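(* Let $d>2$ and let $\theta$ be an antisymmetric real $d\times d$ matrix. For all $V=V^*\in C(\mathbb{T}^d_\theta)$ we have $$\lim_{h\downarrow0}h^dN(\lambda,-h^2\Delta+\rho(V))=\frac{\mathrm{Vol}(S^{d-1})}{d}\,\tau\big((V-\lambda)_-^{\frac{d}{2}}\big),\quad\lambda\in\mathbb{R}.$$
   Context: For a self-adjoint, lower bounded operator $S$ with compact resolvent, $N(\lambda,S)=\mathrm{Tr}(\chi_{(-\infty,\lambda)}(S))$ is the number of eigenvalues of $S$ (with multiplicity) less than $\lambda$. For self-adjoint $x$, $x_-=\frac12(|x|-x)$ is its negative part. The noncommutative torus: $C(\mathbb{T}^d_\theta)$ is the universal $C^*$-algebra generated by unitaries $U_1,\ldots,U_d$ with $U_jU_k=e^{2\pi i\theta_{j,k}}U_kU_j$. Write $U^n=U_1^{n_1}\cdots U_d^{n_d}$ for $n\in\mathbb{Z}^d$. $\tau$ is the tracial state on $C(\mathbb{T}^d_\theta)$ determined by $\tau(U^n)=0$ for $n\neq0$ and $\tau(1)=1$. $L_2(\mathbb{T}^d_\theta)$ is the GNS Hilbert space of $\tau$, in which $\{U^n\}_{n\in\mathbb{Z}^d}$ is an orthonormal basis. $\rho(x)$ denotes the operator on $L_2(\mathbb{T}^d_\theta)$ of left multiplication by $x$. The Laplace operator $\Delta$ is the self-adjoint operator with $\Delta U^n=-|n|^2U^n$, $|n|^2=n_1^2+\cdots+n_d^2$. $\mathrm{Vol}(S^{d-1})$ is the surface area of the unit sphere in $\mathbb{R}^d$. *)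

theory Defs
  imports
    "HOL-Analysis.Analysis"
    "HOL-Algebra.Module"
    "HOL-Computational_Algebra.Polynomial"
begin

section \<open>Complex Hilbert spaces\<close>

text \<open>The inner product is antilinear in the first argument. The inherited real inner product
  is its real part, so that norm, metric and topology are those of the complex Hilbert space.\<close>

class complex_hilbert_space = real_inner + complete_space +
  fixes scaleC :: "complex \<Rightarrow> 'a \<Rightarrow> 'a" (infixr "*\<^sub>C" 75)
    and cinner :: "'a \<Rightarrow> 'a \<Rightarrow> complex"
  assumes scaleC_add_right: "c *\<^sub>C (x + y) = c *\<^sub>C x + c *\<^sub>C y"
    and scaleC_add_left: "(b + c) *\<^sub>C x = b *\<^sub>C x + c *\<^sub>C x"
    and scaleC_scaleC: "b *\<^sub>C c *\<^sub>C x = (b * c) *\<^sub>C x"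
    and scaleR_scaleC: "r *\<^sub>R x = complex_of_real r *\<^sub>C x"
    and cinner_commute: "cinner x y = cnj (cinner y x)"
    and cinner_add_right: "cinner x (y + z) = cinner x y + cinner x z"
    and cinner_scaleC_right: "cinner x (c *\<^sub>C y) = c * cinner x y"
    and inner_eq_Re_cinner: "x \<bullet> y = Re (cinner x y)"

lemma scaleC_one [simp]: "1 *\<^sub>C x = (x :: 'a::complex_hilbert_space)"
  using scaleR_scaleC[of 1 x] by simp

interpretation complex_vector: vector_space "scaleC :: complex \<Rightarrow> 'a \<Rightarrow> 'a::complex_hilbert_space"
  by unfold_locales (simp_all add: scaleC_add_right scaleC_add_left scaleC_scaleC)


section \<open>Unbounded operators and eigenvalue counting\<close>

text \<open>An unbounded operator is represented by its graph.\<close>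

type_synonym 'h operator_graph = "('h \<times> 'h) set"

definition adjoint_graph :: "'h::complex_hilbert_space operator_graph \<Rightarrow> 'h operator_graph" where
  "adjoint_graph S = {(y, z). \<forall>(x, x') \<in> S. cinner y x' = cinner z x}"

definition self_adjoint :: "'h::complex_hilbert_space operator_graph \<Rightarrow> bool" where
  "self_adjoint S \<longleftrightarrow> closure (Domain S) = UNIV \<and> adjoint_graph S = S"

definition eigenspace :: "'h::complex_hilbert_space operator_graph \<Rightarrow> real \<Rightarrow> 'h set" where
  "eigenspace S \<mu> = {x. (x, complex_of_real \<mu> *\<^sub>C x) \<in> S}"

text \<open>The dimension over the complex numbers, with value infinity for an infinite-dimensional
  eigenspace and \<open>0\<close> if \<open>\<mu>\<close> is not an eigenvalue.\<close>

definition multiplicity_of :: "'h::complex_hilbert_space operator_graph \<Rightarrow> real \<Rightarrow> ennreal" where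
  "multiplicity_of S \<mu> =
     (SUP B \<in> {B. finite B \<and> B \<subseteq> eigenspace S \<mu> \<and> complex_vector.independent B}. of_nat (card B))"

text \<open>The number \<open>N(\<lambda>,S)\<close> of eigenvalues less than \<open>l\<close>, counted with multiplicity.\<close>

definition counting_function :: "real \<Rightarrow> 'h::complex_hilbert_space operator_graph \<Rightarrow> ennreal" where
  "counting_function l S = (\<Sum>\<^sub>\<infinity>\<mu>\<in>{..<l}. multiplicity_of S \<mu>)"


section \<open>Unital C*-algebras\<close>

text \<open>C*-algebras are explicit structures rather than a type class, because the universal
  property of the noncommutative torus quantifies over them.\<close>

definition complex_field :: "complex ring" where
  "complex_field = \<lparr>carrier = UNIV, mult = (*), one = 1, zero = 0, add = (+)\<rparr>"

record 'a cstar = "(complex, 'a) module" +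
  adj :: "'a \<Rightarrow> 'a"
  nrm :: "'a \<Rightarrow> real"

locale cstar_algebra = Module.module complex_field A + ring A for A :: "'a cstar" (structure) +
  assumes nontrivial: "\<one> \<noteq> \<zero>"
    and smult_mult_left: "x \<in> carrier A \<Longrightarrow> y \<in> carrier A \<Longrightarrow> (c \<odot> x) \<otimes> y = c \<odot> (x \<otimes> y)"
    and smult_mult_right: "x \<in> carrier A \<Longrightarrow> y \<in> carrier A \<Longrightarrow> x \<otimes> (c \<odot> y) = c \<odot> (x \<otimes> y)"
    and adj_closed: "x \<in> carrier A \<Longrightarrow> adj A x \<in> carrier A"
    and adj_adj: "x \<in> carrier A \<Longrightarrow> adj A (adj A x) = x"
    and adj_add: "x \<in> carrier A \<Longrightarrow> y \<in> carrier A \<Longrightarrow> adj A (x \<oplus> y) = adj A x \<oplus> adj A y"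
    and adj_smult: "x \<in> carrier A \<Longrightarrow> adj A (c \<odot> x) = cnj c \<odot> adj A x"
    and adj_mult: "x \<in> carrier A \<Longrightarrow> y \<in> carrier A \<Longrightarrow> adj A (x \<otimes> y) = adj A y \<otimes> adj A x"
    and nrm_nonneg: "x \<in> carrier A \<Longrightarrow> 0 \<le> nrm A x"
    and nrm_eq_0: "x \<in> carrier A \<Longrightarrow> nrm A x = 0 \<Longrightarrow> x = \<zero>"
    and nrm_add: "x \<in> carrier A \<Longrightarrow> y \<in> carrier A \<Longrightarrow> nrm A (x \<oplus> y) \<le> nrm A x + nrm A y"
    and nrm_smult: "x \<in> carrier A \<Longrightarrow> nrm A (c \<odot> x) = cmod c * nrm A x"
    and nrm_mult: "x \<in> carrier A \<Longrightarrow> y \<in> carrier A \<Longrightarrow> nrm A (x \<otimes> y) \<le> nrm A x * nrm A y"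
    and cstar_identity: "x \<in> carrier A \<Longrightarrow> nrm A (adj A x \<otimes> x) = (nrm A x)\<^sup>2"
    and complete: "(\<And>n::nat. s n \<in> carrier A) \<Longrightarrow>
          (\<forall>e>0. \<exists>M. \<forall>m\<ge>M. \<forall>n\<ge>M. nrm A (s m \<ominus> s n) < e) \<Longrightarrow>
          \<exists>l\<in>carrier A. (\<lambda>n. nrm A (s n \<ominus> l)) \<longlonglongrightarrow> 0"

definition unitary_elt :: "'a cstar \<Rightarrow> 'a \<Rightarrow> bool" where
  "unitary_elt A u \<longleftrightarrow> u \<in> carrier A \<and> adj A u \<otimes>\<^bsub>A\<^esub> u = \<one>\<^bsub>A\<^esub> \<and> u \<otimes>\<^bsub>A\<^esub> adj A u = \<one>\<^bsub>A\<^esub>"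

definition star_hom :: "'a cstar \<Rightarrow> 'a cstar \<Rightarrow> ('a \<Rightarrow> 'a) \<Rightarrow> bool" where
  "star_hom A B \<phi> \<longleftrightarrow> \<phi> \<in> ring_hom A B \<and>
     (\<forall>x\<in>carrier A. \<phi> (adj A x) = adj B (\<phi> x)) \<and>
     (\<forall>c. \<forall>x\<in>carrier A. \<phi> (c \<odot>\<^bsub>A\<^esub> x) = c \<odot>\<^bsub>B\<^esub> \<phi> x)"

definition closed_star_subalgebra :: "'a cstar \<Rightarrow> 'a set \<Rightarrow> bool" where
  "closed_star_subalgebra A S \<longleftrightarrow> S \<subseteq> carrier A \<and> \<one>\<^bsub>A\<^esub> \<in> S \<and>
     (\<forall>x\<in>S. \<forall>y\<in>S. x \<oplus>\<^bsub>A\<^esub> y \<in> S \<and> x \<otimes>\<^bsub>A\<^esub> y \<in> S) \<and>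
     (\<forall>c. \<forall>x\<in>S. c \<odot>\<^bsub>A\<^esub> x \<in> S) \<and> (\<forall>x\<in>S. adj A x \<in> S) \<and>
     (\<forall>s l. (\<forall>n::nat. s n \<in> S) \<longrightarrow> l \<in> carrier A \<longrightarrow>
        (\<lambda>n. nrm A (s n \<ominus>\<^bsub>A\<^esub> l)) \<longlonglongrightarrow> 0 \<longrightarrow> l \<in> S)"


section \<open>Continuous functional calculus for self-adjoint elements\<close>

definition spectrum :: "'a cstar \<Rightarrow> 'a \<Rightarrow> complex set" where
  "spectrum A x = {c. c \<odot>\<^bsub>A\<^esub> \<one>\<^bsub>A\<^esub> \<ominus>\<^bsub>A\<^esub> x \<notin> Units A}"

definition poly_elt :: "'a cstar \<Rightarrow> real poly \<Rightarrow> 'a \<Rightarrow> 'a" where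
  "poly_elt A p x = (\<Oplus>\<^bsub>A\<^esub>i\<in>{..degree p}. complex_of_real (coeff p i) \<odot>\<^bsub>A\<^esub> (x [^]\<^bsub>A\<^esub> i))"

text \<open>For self-adjoint \<open>x\<close> and real-valued \<open>f\<close> continuous on the (real) spectrum of \<open>x\<close>:
  the norm limit of \<open>p n (x)\<close> for real polynomials \<open>p n\<close> converging to \<open>f\<close> uniformly on the
  spectrum. The limit does not depend on the sequence.\<close>

definition cfc :: "'a cstar \<Rightarrow> (real \<Rightarrow> real) \<Rightarrow> 'a \<Rightarrow> 'a" where
  "cfc A f x = (THE y. y \<in> carrier A \<and>
     (\<forall>p :: nat \<Rightarrow> real poly.
        uniform_limit {t. complex_of_real t \<in> spectrum A x} (\<lambda>n. poly (p n)) f sequentially \<longrightarrow>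
        (\<lambda>n. nrm A (poly_elt A (p n) x \<ominus>\<^bsub>A\<^esub> y)) \<longlonglongrightarrow> 0))"

definition neg_part :: "'a cstar \<Rightarrow> 'a \<Rightarrow> 'a" where
  "neg_part A x = (1 / 2) \<odot>\<^bsub>A\<^esub> (cfc A (\<lambda>t. \<bar>t\<bar>) x \<ominus>\<^bsub>A\<^esub> x)"

definition power_elt :: "'a cstar \<Rightarrow> 'a \<Rightarrow> real \<Rightarrow> 'a" where
  "power_elt A x a = cfc A (\<lambda>t. t powr a) x"


section \<open>The noncommutative torus\<close>

text \<open>The index type \<open>'d\<close> plays the role of \<open>{1,\<dots>,d}\<close>; its linear order fixes the order of
  the factors in \<open>U\<^sup>n = U\<^sub>1\<^sup>n\<^sup>1 \<cdots> U\<^sub>d\<^sup>n\<^sup>d\<close>.\<close>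

definition torus_relations ::
  "real^'d^'d \<Rightarrow> 'a cstar \<Rightarrow> ('d::finite \<Rightarrow> 'a) \<Rightarrow> bool" where
  "torus_relations \<theta> A U \<longleftrightarrow> (\<forall>j. unitary_elt A (U j)) \<and>
     (\<forall>j k. U j \<otimes>\<^bsub>A\<^esub> U k = exp (2 * pi * \<i> * \<theta> $ j $ k) \<odot>\<^bsub>A\<^esub> (U k \<otimes>\<^bsub>A\<^esub> U j))"

text \<open>\<open>A\<close> is the universal C*-algebra generated by unitaries \<open>U\<^sub>j\<close> subject to the relations.
  The structures \<open>B\<close> in the universal property have carriers in the same type as \<open>A\<close>. This is
  no restriction: a nonzero complex vector space has at least, and a C*-algebra generated by
  finitely many elements at most, the cardinality of the continuum. So every C*-algebra
  generated by unitaries satisfying the relations has an isomorphic copy in the type \<open>'a\<close>.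
  Uniqueness of \<open>\<phi>\<close> is a consequence of generation.\<close>

definition nc_torus :: "real^'d^'d \<Rightarrow> 'a cstar \<Rightarrow> ('d::finite \<Rightarrow> 'a) \<Rightarrow> bool" where
  "nc_torus \<theta> A U \<longleftrightarrow> cstar_algebra A \<and> torus_relations \<theta> A U \<and>
     (\<forall>S. closed_star_subalgebra A S \<longrightarrow> range U \<subseteq> S \<longrightarrow> S = carrier A) \<and>
     (\<forall>(B :: 'a cstar) W. cstar_algebra B \<longrightarrow> torus_relations \<theta> B W \<longrightarrow>
        (\<exists>\<phi>. star_hom A B \<phi> \<and> (\<forall>j. \<phi> (U j) = W j)))"

definition torus_monomial ::
  "'a cstar \<Rightarrow> ('d::{finite,linorder} \<Rightarrow> 'a) \<Rightarrow> int^'d::_ \<Rightarrow> 'a" where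
  "torus_monomial A U n =
     foldr (\<lambda>j x. (U j [^]\<^bsub>A\<^esub> (n $ j)) \<otimes>\<^bsub>A\<^esub> x) (sorted_list_of_set UNIV) \<one>\<^bsub>A\<^esub>"

definition tracial_state :: "'a cstar \<Rightarrow> ('a \<Rightarrow> complex) \<Rightarrow> bool" where
  "tracial_state A \<tau> \<longleftrightarrow>
     (\<forall>x\<in>carrier A. \<forall>y\<in>carrier A. \<tau> (x \<oplus>\<^bsub>A\<^esub> y) = \<tau> x + \<tau> y) \<and>
     (\<forall>c. \<forall>x\<in>carrier A. \<tau> (c \<odot>\<^bsub>A\<^esub> x) = c * \<tau> x) \<and>
     (\<forall>x\<in>carrier A. Im (\<tau> (adj A x \<otimes>\<^bsub>A\<^esub> x)) = 0 \<and> 0 \<le> Re (\<tau> (adj A x \<otimes>\<^bsub>A\<^esub> x))) \<and>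
     \<tau> \<one>\<^bsub>A\<^esub> = 1 \<and>
     (\<forall>x\<in>carrier A. \<forall>y\<in>carrier A. \<tau> (x \<otimes>\<^bsub>A\<^esub> y) = \<tau> (y \<otimes>\<^bsub>A\<^esub> x))"

definition torus_trace ::
  "'a cstar \<Rightarrow> ('d::{finite,linorder} \<Rightarrow> 'a) \<Rightarrow> ('a \<Rightarrow> complex) \<Rightarrow> bool" where
  "torus_trace A U \<tau> \<longleftrightarrow> tracial_state A \<tau> \<and> (\<forall>n. n \<noteq> 0 \<longrightarrow> \<tau> (torus_monomial A U n) = 0)"

text \<open>The Hilbert space \<open>'h\<close> together with \<open>\<Lambda>\<close> is the GNS space of \<open>\<tau>\<close>; \<open>\<Lambda>\<close> is the canonical
  map of the algebra onto a dense subspace. This determines the pair up to a unique unitary.\<close>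

definition gns_space ::
  "'a cstar \<Rightarrow> ('a \<Rightarrow> complex) \<Rightarrow> ('a \<Rightarrow> 'h::complex_hilbert_space) \<Rightarrow> bool" where
  "gns_space A \<tau> \<Lambda> \<longleftrightarrow>
     (\<forall>x\<in>carrier A. \<forall>y\<in>carrier A. \<Lambda> (x \<oplus>\<^bsub>A\<^esub> y) = \<Lambda> x + \<Lambda> y) \<and>
     (\<forall>c. \<forall>x\<in>carrier A. \<Lambda> (c \<odot>\<^bsub>A\<^esub> x) = c *\<^sub>C \<Lambda> x) \<and>
     (\<forall>x\<in>carrier A. \<forall>y\<in>carrier A. cinner (\<Lambda> x) (\<Lambda> y) = \<tau> (adj A x \<otimes>\<^bsub>A\<^esub> y)) \<and>
     closure (\<Lambda> ` carrier A) = UNIV"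

text \<open>Left multiplication \<open>\<rho>(x)\<close>: the continuous extension of \<open>\<Lambda> y \<mapsto> \<Lambda> (x y)\<close>.\<close>

definition left_mult ::
  "'a cstar \<Rightarrow> ('a \<Rightarrow> 'h::complex_hilbert_space) \<Rightarrow> 'a \<Rightarrow> 'h \<Rightarrow> 'h" where
  "left_mult A \<Lambda> x =
     (THE T. bounded_linear T \<and> (\<forall>y\<in>carrier A. T (\<Lambda> y) = \<Lambda> (x \<otimes>\<^bsub>A\<^esub> y)))"

definition torus_laplacian ::
  "'a cstar \<Rightarrow> ('d::{finite,linorder} \<Rightarrow> 'a) \<Rightarrow> ('a \<Rightarrow> 'h::complex_hilbert_space)
    \<Rightarrow> 'h operator_graph" where
  "torus_laplacian A U \<Lambda> =
     (THE D. self_adjoint D \<and>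
        (\<forall>n. (\<Lambda> (torus_monomial A U n),
              complex_of_int (- (\<Sum>j\<in>UNIV. (n $ j)\<^sup>2)) *\<^sub>C \<Lambda> (torus_monomial A U n)) \<in> D))"

text \<open>\<open>-h\<^sup>2\<Delta> + \<rho>(V)\<close> on the domain of \<open>\<Delta>\<close>.\<close>

definition schroedinger ::
  "'a cstar \<Rightarrow> ('d::{finite,linorder} \<Rightarrow> 'a) \<Rightarrow> ('a \<Rightarrow> 'h::complex_hilbert_space)
    \<Rightarrow> real \<Rightarrow> 'a \<Rightarrow> 'h operator_graph" where
  "schroedinger A U \<Lambda> h V =
     {(x, complex_of_real (- (h\<^sup>2)) *\<^sub>C y + left_mult A \<Lambda> V x) | x y.
        (x, y) \<in> torus_laplacian A U \<Lambda>}"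


section \<open>Surface area\<close>

text \<open>Minkowski content of codimension one, which is the surface area for a compact smooth
  hypersurface.\<close>

definition surface_area :: "'e::euclidean_space set \<Rightarrow> real" where
  "surface_area S =
     Lim (at_right 0) (\<lambda>\<epsilon>. measure lebesgue {x. infdist x S \<le> \<epsilon>} / (2 * \<epsilon>))"

end

theory Submission
  imports Defs "HOL-Analysis.Analysis" "HOL-Computational_Algebra.Fundamental_Theorem_Algebra"
begin

text \<open>
The counting function is computed by the variational principle, without heat kernels or
  pseudodifferential calculus. In the orthonormal basis \<open>U\<^sup>n\<close> the Laplacian is a multiplication
  operator, and \<open>V\<close> is a norm limit of self-adjoint elements \<open>y\<close> whose matrices vanish at distance
  more than some \<open>R\<close> from the diagonal. Cut the momentum lattice into cubes of side \<open>L\<close> and remove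
  from each cube a boundary layer of width \<open>R\<close>. Then \<open>y\<close> does not couple different cubes, the kinetic
  energy is constant up to \<open>o(1)\<close> on each cube as \<open>h \<rightarrow> 0\<close>, and right multiplication by monomials,
  which commutes with left multiplication, makes the compressions of \<open>y\<close> to all cubes unitarily
  equivalent to one matrix with eigenvalues \<open>\<nu> i\<close>. So \<open>h\<^sup>d N\<close> is
  \<open>(volume of the unit ball) * L\<^sup>-\<^sup>d * (\<Sum>i. (l - \<nu> i)\<^sub>+ powr (d / 2))\<close> in the limit \<open>h \<rightarrow> 0\<close>, up to
  the contribution of the boundary layers, which vanishes as \<open>L \<rightarrow> \<infinity>\<close>. Since the trace of a power of
  a compression differs from that of the compression of the power only through the boundary,
  \<open>L\<^sup>-\<^sup>d * (\<Sum>i. p (\<nu> i))\<close> tends to \<open>\<tau> (p y)\<close> for every polynomial \<open>p\<close>, which identifies the limit.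
\<close>

section \<open>Complex Hilbert spaces, orthonormal bases and multiplication operators\<close>

text \<open>\<open>counting_function\<close> adds up multiplicities of eigenvalues and says nothing
  about the rest of the spectrum, so a lower bound has to produce genuine eigenvectors. They are
  obtained one at a time as minimisers of the Rayleigh quotient; the same construction diagonalises
  the compression to a cube. The two bounds treat the boundary layers differently: the lower one
  leaves them out of the trial space, the upper one adds one linear constraint per boundary mode in
  a large momentum cube, outside of which the kinetic energy beats the potential. The number of
  these constraints is of relative size \<open>R / L\<close>. Averages over the eigenvalues can be
  computed directly only for polynomials, so the power of the positive part of \<open>l - v\<close>
  is first approximated by a polynomial \<open>p\<close>. The order of choices matters:
  \<open>p\<close> depends on \<open>l\<close> and on a bound \<open>M\<close> for all norms
  involved; \<open>y\<close> must be so close to \<open>V\<close> that \<open>p y\<close> is close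
  to \<open>p V\<close> as well; then \<open>L\<close> is fixed, and \<open>h\<close> tends to 0
  last. The distance of \<open>y\<close> from \<open>V\<close> shifts \<open>l\<close> by a small
  amount, which continuity absorbs.\<close>

lemma cnj_mult_self: "cnj z * z = (complex_of_real (cmod z))\<^sup>2"
  by (metis complex_norm_square mult.commute of_real_power)

lemma cinner_add_left: "cinner (x + y) z = cinner x z + cinner y (z :: 'a::complex_hilbert_space)"
  by (metis cinner_commute cinner_add_right complex_cnj_add)

lemma cinner_scaleC_left: "cinner (c *\<^sub>C x) y = cnj c * cinner x (y :: 'a::complex_hilbert_space)"
  by (metis cinner_commute cinner_scaleC_right complex_cnj_mult)

lemma cinner_zero_right [simp]: "cinner x (0 :: 'a::complex_hilbert_space) = 0"
  using cinner_add_right[of x 0 0] by simp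

lemma cinner_minus_right: "cinner x (- y) = - cinner x (y :: 'a::complex_hilbert_space)"
  using cinner_add_right[of x y "- y"] by (simp add: eq_neg_iff_add_eq_0 add.commute)

lemma cinner_zero_left [simp]: "cinner 0 (x :: 'a::complex_hilbert_space) = 0"
  using cinner_add_left[of 0 0 x] by simp

lemma cinner_minus_left: "cinner (- x) y = - cinner x (y :: 'a::complex_hilbert_space)"
  using cinner_add_left[of x "- x" y] by (simp add: eq_neg_iff_add_eq_0 add.commute)

lemma cinner_diff_right: "cinner x (y - z) = cinner x y - cinner x (z :: 'a::complex_hilbert_space)"
  using cinner_add_right[of x y "- z"] by (simp add: cinner_minus_right)

lemma cinner_diff_left: "cinner (x - y) z = cinner x z - cinner y (z :: 'a::complex_hilbert_space)"
  using cinner_add_left[of x "- y" z] by (simp add: cinner_minus_left)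

lemma cinner_sum_right: "cinner x (sum f F) = (\<Sum>i\<in>F. cinner x (f i :: 'a::complex_hilbert_space))"
  by (induction F rule: infinite_finite_induct) (auto simp: cinner_add_right)

lemma cinner_sum_left: "cinner (sum f F) x = (\<Sum>i\<in>F. cinner (f i) (x :: 'a::complex_hilbert_space))"
  by (induction F rule: infinite_finite_induct) (auto simp: cinner_add_left)

lemma cinner_self: "cinner x x = complex_of_real ((norm (x :: 'a::complex_hilbert_space))\<^sup>2)"
proof (rule complex_eqI)
  have "Im (cinner x x) = Im (cnj (cinner x x))"
    using cinner_commute[of x x] by simp
  thus "Im (cinner x x) = Im (complex_of_real ((norm x)\<^sup>2))" by simp
  show "Re (cinner x x) = Re (complex_of_real ((norm x)\<^sup>2))"
    by (simp add: inner_eq_Re_cinner[symmetric] dot_square_norm)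
qed

lemma cinner_self_eq_1: "cinner x x = 1 \<Longrightarrow> norm (x :: 'a::complex_hilbert_space) = 1"
proof -
  assume "cinner x x = 1"
  hence "complex_of_real ((norm x)\<^sup>2) = complex_of_real 1" unfolding cinner_self by simp
  hence "(norm x)\<^sup>2 = 1" unfolding of_real_eq_iff .
  thus ?thesis using power2_eq_1_iff[of "norm x"] norm_ge_zero[of x] by linarith
qed

lemma cinner_mult_swap:
  "cinner x y * cinner y x = complex_of_real ((cmod (cinner y (x :: 'a::complex_hilbert_space)))\<^sup>2)"
  using cnj_mult_self[of "cinner y x"] cinner_commute[of x y] by simp

lemma cinner_orthonormal_sum:
  fixes v :: "'i \<Rightarrow> 'a::complex_hilbert_space"
  assumes "finite I" "i \<in> I" "\<And>j. j \<in> I \<Longrightarrow> cinner (v i) (v j) = (if i = j then 1 else 0)"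
  shows "cinner (v i) (\<Sum>j\<in>I. c j *\<^sub>C v j) = c i"
proof -
  have "cinner (v i) (\<Sum>j\<in>I. c j *\<^sub>C v j) = (\<Sum>j\<in>I. if j = i then c i else 0)"
    unfolding cinner_sum_right cinner_scaleC_right using assms(3) by (intro sum.cong refl) auto
  thus ?thesis using assms by simp
qed

lemma norm_scaleC [simp]: "norm (c *\<^sub>C x) = cmod c * norm (x :: 'a::complex_hilbert_space)"
proof -
  have "complex_of_real ((norm (c *\<^sub>C x))\<^sup>2) = complex_of_real ((cmod c * norm x)\<^sup>2)"
    unfolding cinner_self[symmetric] cinner_scaleC_left cinner_scaleC_right
    by (simp add: cinner_self power_mult_distrib complex_norm_square[symmetric] mult_ac)
  hence "(norm (c *\<^sub>C x))\<^sup>2 = (cmod c * norm x)\<^sup>2" unfolding of_real_eq_iff .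
  thus ?thesis by (simp add: power2_eq_iff_nonneg)
qed

lemma cinner_Cauchy_Schwarz: "cmod (cinner x y) \<le> norm x * norm (y :: 'a::complex_hilbert_space)"
proof (cases "cinner x y = 0")
  case False
  \<comment> \<open>\<open>c\<close> is the phase that makes the inner product real and nonnegative,
    so that the real inequality applies to \<open>x\<close> and
    \<open>c *\<^sub>C y\<close>.\<close>
  define c where "c = cnj (cinner x y) / cmod (cinner x y)"
  have "c * cinner x y = complex_of_real ((cmod (cinner x y))\<^sup>2) / cmod (cinner x y)"
    unfolding c_def complex_norm_square by simp
  also have "\<dots> = complex_of_real (cmod (cinner x y))"
    using False by (simp add: power2_eq_square)
  finally have "c * cinner x y = complex_of_real (cmod (cinner x y))" .
  hence "cmod (cinner x y) = x \<bullet> (c *\<^sub>C y)"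
    by (simp add: inner_eq_Re_cinner cinner_scaleC_right)
  also have "\<dots> \<le> norm x * norm (c *\<^sub>C y)" by (rule norm_cauchy_schwarz)
  also have "cmod c = 1" using False by (simp add: c_def norm_divide)
  hence "norm (c *\<^sub>C y) = norm y" by simp
  finally show ?thesis .
qed simp

lemma bounded_bilinear_cinner: "bounded_bilinear (cinner :: 'a::complex_hilbert_space \<Rightarrow> _)"
proof
  show "\<exists>K. \<forall>a b :: 'a. cmod (cinner a b) \<le> norm a * norm b * K"
    by (rule exI[of _ 1]) (simp add: cinner_Cauchy_Schwarz)
qed (simp_all add: cinner_add_left cinner_add_right scaleR_scaleC cinner_scaleC_left
  cinner_scaleC_right scaleR_conv_of_real)

lemma bounded_bilinear_scaleC: "bounded_bilinear (scaleC :: complex \<Rightarrow> 'a::complex_hilbert_space \<Rightarrow> 'a)"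
proof
  show "\<exists>K. \<forall>a (b :: 'a). norm (a *\<^sub>C b) \<le> norm a * norm b * K"
    by (rule exI[of _ 1]) simp
qed (simp_all add: scaleC_add_left scaleC_add_right scaleR_scaleC scaleC_scaleC mult.commute
  scaleR_conv_of_real)

lemmas tendsto_cinner [tendsto_intros] = bounded_bilinear.tendsto[OF bounded_bilinear_cinner]
lemmas tendsto_scaleC [tendsto_intros] = bounded_bilinear.tendsto[OF bounded_bilinear_scaleC]
lemmas continuous_on_cinner [continuous_intros] = bounded_bilinear.continuous_on[OF bounded_bilinear_cinner]
lemmas continuous_on_scaleC [continuous_intros] = bounded_bilinear.continuous_on[OF bounded_bilinear_scaleC]

lemma scaleC_left_commute: "a *\<^sub>C b *\<^sub>C x = b *\<^sub>C a *\<^sub>C (x :: 'a::complex_hilbert_space)"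
  by (simp add: scaleC_scaleC mult.commute)

lemma norm_add_sq: "(norm (x + y))\<^sup>2 = (norm x)\<^sup>2 + (norm y)\<^sup>2 + 2 * Re (cinner x (y :: 'a::complex_hilbert_space))"
  by (simp add: inner_eq_Re_cinner[symmetric] power2_norm_eq_inner inner_add_left inner_add_right inner_commute)

section \<open>Bounded Hermitian operators\<close>

definition complex_linear :: "('a::complex_hilbert_space \<Rightarrow> 'a) \<Rightarrow> bool" where
  "complex_linear T \<longleftrightarrow> (\<forall>x y. T (x + y) = T x + T y) \<and> (\<forall>c x. T (c *\<^sub>C x) = c *\<^sub>C T x)"

definition hermitian_bounded :: "real \<Rightarrow> ('a::complex_hilbert_space \<Rightarrow> 'a) \<Rightarrow> bool" where
  "hermitian_bounded M T \<longleftrightarrow> complex_linear T \<and> (\<forall>x y. cinner (T x) y = cinner x (T y)) \<and>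
     (\<forall>x. norm (T x) \<le> M * norm x)"

lemma complex_linearD:
  assumes "complex_linear T"
  shows "T (x + y) = T x + T y" "T (c *\<^sub>C x) = c *\<^sub>C T x" "T 0 = 0" "T (- x) = - T x"
    "T (x - y) = T x - T y" "T (sum f F) = (\<Sum>i\<in>F. T (f i))"
proof -
  show a: "T (x + y) = T x + T y" and s: "T (c *\<^sub>C x) = c *\<^sub>C T x" for x y c
    using assms by (auto simp: complex_linear_def)
  show z: "T 0 = 0" using a[of 0 0] by simp
  show m: "T (- x) = - T x" for x using a[of x "- x"] z by (simp add: eq_neg_iff_add_eq_0 add.commute)
  show "T (x - y) = T x - T y" using a[of x "- y"] m[of y] by simp
  show "T (sum f F) = (\<Sum>i\<in>F. T (f i))"
    by (induction F rule: infinite_finite_induct) (auto simp: z a)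
qed

lemma hermitian_boundedD:
  assumes "hermitian_bounded M T"
  shows "complex_linear T" "cinner (T x) y = cinner x (T y)" "norm (T x) \<le> M * norm x"
  using assms by (auto simp: hermitian_bounded_def)

lemma hermitian_bounded_bounded_linear:
  assumes "hermitian_bounded M T" shows "bounded_linear T"
proof (rule bounded_linear_intro[of _ M])
  fix x y r
  note d = hermitian_boundedD[OF assms]
  show "T (x + y) = T x + T y" by (rule complex_linearD[OF d(1)])
  show "T (r *\<^sub>R x) = r *\<^sub>R T x" unfolding scaleR_scaleC by (rule complex_linearD[OF d(1)])
  show "norm (T x) \<le> norm x * M" using d(3)[of x] by (simp add: mult.commute)
qed

lemma hermitian_form_bound:
  assumes "hermitian_bounded M T" shows "\<bar>Re (cinner x (T x))\<bar> \<le> M * (norm x)\<^sup>2"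
proof -
  have "\<bar>Re (cinner x (T x))\<bar> \<le> norm x * norm (T x)"
    using abs_Re_le_cmod cinner_Cauchy_Schwarz order_trans by blast
  also have "\<dots> \<le> norm x * (M * norm x)"
    by (intro mult_left_mono hermitian_boundedD[OF assms]) simp
  finally show ?thesis by (simp add: power2_eq_square mult_ac)
qed

section \<open>Orthonormal bases: projections onto finitely many modes and Parseval's
  identity\<close>

locale onb =
  fixes e :: "'n \<Rightarrow> 'h::complex_hilbert_space"
  assumes ortho: "cinner (e m) (e n) = (if m = n then 1 else 0)"
    and total: "closure (complex_vector.span (range e)) = UNIV"
begin

text \<open>For infinite \<open>F\<close> the sum is 0 by convention, so the results that treat
  \<open>proj F\<close> as an orthogonal projection assume \<open>finite F\<close>.\<close>

definition proj :: "'n set \<Rightarrow> 'h \<Rightarrow> 'h" where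
  "proj F x = (\<Sum>n\<in>F. cinner (e n) x *\<^sub>C e n)"

lemma norm_e [simp]: "norm (e n) = 1"
  by (rule cinner_self_eq_1) (simp add: ortho)

lemma coeff_sum: "finite F \<Longrightarrow> cinner (e m) (\<Sum>n\<in>F. a n *\<^sub>C e n) = (if m \<in> F then a m else 0)"
  by (simp add: cinner_sum_right cinner_scaleC_right ortho if_distrib cong: if_cong)

lemma coeff_proj: "finite F \<Longrightarrow> cinner (e m) (proj F x) = (if m \<in> F then cinner (e m) x else 0)"
  unfolding proj_def by (rule coeff_sum)

lemma cinner_proj_left: "cinner (proj F x) y = (\<Sum>n\<in>F. cnj (cinner (e n) x) * cinner (e n) y)"
  by (simp add: proj_def cinner_sum_left cinner_scaleC_left)

lemma cinner_proj_right: "cinner x (proj F y) = (\<Sum>n\<in>F. cnj (cinner (e n) x) * cinner (e n) y)"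
  unfolding proj_def cinner_sum_right cinner_scaleC_right
  by (intro sum.cong refl) (metis cinner_commute mult.commute)

lemma proj_sym: "cinner (proj F x) y = cinner x (proj F y)"
  by (simp add: cinner_proj_left cinner_proj_right)

lemma proj_linear: "complex_linear (proj F)"
  by (auto simp: complex_linear_def proj_def cinner_add_right scaleC_add_left sum.distrib
    cinner_scaleC_right complex_vector.scale_sum_right scaleC_scaleC)

lemma proj_proj: "finite F \<Longrightarrow> proj F (proj F x) = proj F x"
  unfolding proj_def[of F "proj F x"] by (simp add: coeff_proj) (simp add: proj_def)

lemma norm_proj_sq: "finite F \<Longrightarrow> (norm (proj F x))\<^sup>2 = (\<Sum>n\<in>F. (cmod (cinner (e n) x))\<^sup>2)"
proof -
  assume F: "finite F"
  have "complex_of_real ((norm (proj F x))\<^sup>2) = complex_of_real (\<Sum>n\<in>F. (cmod (cinner (e n) x))\<^sup>2)"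
    unfolding cinner_self[symmetric] cinner_proj_left of_real_sum
    by (intro sum.cong refl) (simp add: coeff_proj F cnj_mult_self)
  thus ?thesis unfolding of_real_eq_iff .
qed

lemma pythagoras_proj: "finite F \<Longrightarrow> (norm x)\<^sup>2 = (norm (proj F x))\<^sup>2 + (norm (x - proj F x))\<^sup>2"
proof -
  assume F: "finite F"
  have "cinner (proj F x) (x - proj F x) = 0"
    by (simp add: proj_sym complex_linearD(5)[OF proj_linear] proj_proj F)
  thus ?thesis using norm_add_sq[of "proj F x" "x - proj F x"] by simp
qed

lemma norm_proj_le: "finite F \<Longrightarrow> norm (proj F x) \<le> norm x"
  using pythagoras_proj[of F x] power2_le_imp_le[of "norm (proj F x)" "norm x"] by simp

lemma proj_eq_self: "finite F \<Longrightarrow> y \<in> complex_vector.span (e ` F) \<Longrightarrow> proj F y = y"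
proof -
  assume F: "finite F" and y: "y \<in> complex_vector.span (e ` F)"
  show ?thesis using y
  proof (induction rule: complex_vector.span_induct_alt)
    case base thus ?case by (simp add: proj_def)
  next
    case (step c x y)
    then obtain n where n: "n \<in> F" "x = e n" by auto
    have "proj F (e n) = e n"
    proof -
      have "proj F (e n) = (\<Sum>m\<in>F. if m = n then e n else 0)"
        unfolding proj_def by (intro sum.cong refl) (auto simp: ortho)
      thus ?thesis using n F by simp
    qed
    thus ?case using step n by (simp add: complex_linearD[OF proj_linear])
  qed
qed

lemma span_finite_support:
  "y \<in> complex_vector.span (range e) \<Longrightarrow> \<exists>F. finite F \<and> y \<in> complex_vector.span (e ` F)"
proof (induction rule: complex_vector.span_induct_alt)
  case base show ?case by (rule exI[of _ "{}"]) (simp add: complex_vector.span_zero)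
next
  case (step c x y)
  then obtain F n where F: "finite F" "y \<in> complex_vector.span (e ` F)" "x = e n" by auto
  have "y \<in> complex_vector.span (e ` insert n F)"
    using F(2) complex_vector.span_mono[of "e ` F" "e ` insert n F"] by auto
  moreover have "x \<in> complex_vector.span (e ` insert n F)"
    using F(3) by (intro complex_vector.span_base) simp
  ultimately have "c *\<^sub>C x + y \<in> complex_vector.span (e ` insert n F)"
    by (intro complex_vector.span_add complex_vector.span_scale)
  thus ?case using F(1) by (intro exI[of _ "insert n F"]) simp
qed

text \<open>On the span the projections are eventually the identity, they are contractions, and the
  span is dense. An approximant \<open>y\<close> of \<open>x\<close> costs
  \<open>norm (x - y)\<close> twice, hence the radius \<open>r / 2\<close>.\<close>

lemma tendsto_proj: "((\<lambda>F. proj F x) \<longlongrightarrow> x) (finite_subsets_at_top UNIV)"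
proof (rule tendstoI)
  fix r :: real assume r: "r > 0"
  have "x \<in> closure (complex_vector.span (range e))" using total by simp
  then obtain y where y: "y \<in> complex_vector.span (range e)" "dist y x < r / 2"
    using r unfolding closure_approachable by (metis half_gt_zero)
  obtain F0 where F0: "finite F0" "y \<in> complex_vector.span (e ` F0)"
    using span_finite_support[OF y(1)] by blast
  have "dist (proj F x) x < r" if F: "finite F" "F0 \<subseteq> F" for F
  proof -
    have "y \<in> complex_vector.span (e ` F)"
      using F0(2) complex_vector.span_mono[of "e ` F0" "e ` F"] F by auto
    hence "proj F y = y" using F proj_eq_self by blast
    hence "proj F x - x = proj F (x - y) - (x - y)"
      by (simp add: complex_linearD[OF proj_linear])
    hence "norm (proj F x - x) \<le> norm (proj F (x - y)) + norm (x - y)"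
      by (metis norm_triangle_ineq4)
    also have "\<dots> \<le> 2 * norm (x - y)" using norm_proj_le[OF F(1), of "x - y"] by simp
    finally show ?thesis using y(2) by (simp add: dist_norm norm_minus_commute)
  qed
  thus "\<forall>\<^sub>F F in finite_subsets_at_top UNIV. dist (proj F x) x < r"
    unfolding eventually_finite_subsets_at_top using F0 by auto
qed

lemma parseval: "((\<lambda>n. cnj (cinner (e n) x) * cinner (e n) y) has_sum cinner x y) UNIV"
  unfolding has_sum_def cinner_proj_right[symmetric]
  by (intro tendsto_cinner tendsto_const tendsto_proj)

lemma parseval_norm: "((\<lambda>n. (cmod (cinner (e n) x))\<^sup>2) has_sum (norm x)\<^sup>2) UNIV"
proof -
  have "((\<lambda>F. (norm (proj F x))\<^sup>2) \<longlongrightarrow> (norm x)\<^sup>2) (finite_subsets_at_top UNIV)"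
    by (intro tendsto_intros tendsto_proj)
  moreover have "\<forall>\<^sub>F F in finite_subsets_at_top UNIV.
      (norm (proj F x))\<^sup>2 = (\<Sum>n\<in>F. (cmod (cinner (e n) x))\<^sup>2)"
    unfolding eventually_finite_subsets_at_top using norm_proj_sq by (auto intro!: exI[of _ "{}"])
  ultimately show ?thesis unfolding has_sum_def by (rule Lim_transform_eventually)
qed

lemma coeff_eqI: "(\<And>n. cinner (e n) x = cinner (e n) y) \<Longrightarrow> x = y"
proof -
  assume a: "\<And>n. cinner (e n) x = cinner (e n) y"
  hence "proj F x = proj F y" for F by (simp add: proj_def)
  thus "x = y" using tendsto_proj[of x] tendsto_proj[of y]
    by (intro tendsto_unique[OF finite_subsets_at_top_neq_bot]) simp_all
qed

lemma proj_eqI: "finite F \<Longrightarrow> (\<And>n. n \<notin> F \<Longrightarrow> cinner (e n) x = 0) \<Longrightarrow> proj F x = x"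
  by (rule coeff_eqI) (auto simp: coeff_proj)

text \<open>The maximal multiplication operator by \<open>w\<close> in coordinates. No separate
  domain condition appears: the existence of a vector \<open>y\<close> with the prescribed
  coefficients already expresses square summability.\<close>

definition mgraph :: "('n \<Rightarrow> real) \<Rightarrow> 'h operator_graph" where
  "mgraph w = {(x, y). \<forall>n. cinner (e n) y = complex_of_real (w n) * cinner (e n) x}"

lemma mgraph_symmetric:
  assumes "(x, x') \<in> mgraph w" "(y, y') \<in> mgraph w" shows "cinner y x' = cinner y' x"
proof -
  have "cnj (cinner (e n) y) * cinner (e n) x' = cnj (cinner (e n) y') * cinner (e n) x" for n
    using assms by (simp add: mgraph_def)
  hence "((\<lambda>n. cnj (cinner (e n) y) * cinner (e n) x') has_sum cinner y' x) UNIV"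
    using parseval[of y' x] by simp
  thus ?thesis using parseval[of y x'] has_sum_unique by blast
qed

lemma mgraph_basis: "(e n, complex_of_real (w n) *\<^sub>C e n) \<in> mgraph w"
  by (auto simp: mgraph_def cinner_scaleC_right ortho)

text \<open>Testing the adjoint relation on the basis vectors alone determines the coefficients of
  \<open>z\<close>, so the adjoint is contained in the graph; the other inclusion is symmetry. The
  span of the basis supplies a dense domain.\<close>

lemma self_adjoint_mgraph: "self_adjoint (mgraph w)"
  unfolding self_adjoint_def
proof
  have "complex_vector.span (range e) \<subseteq> Domain (mgraph w)"
  proof
    fix x assume "x \<in> complex_vector.span (range e)"
    thus "x \<in> Domain (mgraph w)"
    proof (induction rule: complex_vector.span_induct_alt)
      case base
      have "(0, 0) \<in> mgraph w" by (simp add: mgraph_def)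
      thus ?case by blast
    next
      case (step c x y)
      then obtain n y' where "x = e n" "(y, y') \<in> mgraph w" by auto
      hence "(c *\<^sub>C x + y, c *\<^sub>C complex_of_real (w n) *\<^sub>C e n + y') \<in> mgraph w"
        using mgraph_basis[of n w]
        by (auto simp: mgraph_def cinner_add_right cinner_scaleC_right algebra_simps)
      thus ?case by blast
    qed
  qed
  thus "closure (Domain (mgraph w)) = UNIV"
    using total closure_mono by blast
  show "adjoint_graph (mgraph w) = mgraph w"
  proof (rule subset_antisym; rule subsetI)
    fix p assume p: "p \<in> adjoint_graph (mgraph w)"
    obtain y z where yz: "p = (y, z)" by force
    have "cinner y (complex_of_real (w n) *\<^sub>C e n) = cinner z (e n)" for n
      using p mgraph_basis[of n w] unfolding yz adjoint_graph_def by auto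
    hence "cinner (e n) z = complex_of_real (w n) * cinner (e n) y" for n
      by (metis cinner_commute cinner_scaleC_right complex_cnj_complex_of_real complex_cnj_mult)
    thus "p \<in> mgraph w" by (auto simp: yz mgraph_def)
  next
    fix p assume "p \<in> mgraph w"
    thus "p \<in> adjoint_graph (mgraph w)"
      unfolding adjoint_graph_def by (cases p) (auto intro: mgraph_symmetric)
  qed
qed

text \<open>A self-adjoint operator has no proper symmetric extension. The basis vectors in
  \<open>D\<close> force \<open>D\<close>, being its own adjoint, into \<open>mgraph w\<close>; the
  symmetric \<open>mgraph w\<close> then lies in the adjoint of \<open>D\<close>. This makes the
  definite description of the Laplacian meaningful.\<close>

lemma self_adjoint_eq_mgraph:
  assumes "self_adjoint D" "\<And>n. (e n, complex_of_real (w n) *\<^sub>C e n) \<in> D"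
  shows "D = mgraph w"
proof
  have D: "adjoint_graph D = D" using assms(1) by (simp add: self_adjoint_def)
  show sub: "D \<subseteq> mgraph w"
  proof
    fix p assume p: "p \<in> D"
    obtain y z where yz: "p = (y, z)" by force
    have "(y, z) \<in> adjoint_graph D" using p D yz by simp
    hence "cinner y (complex_of_real (w n) *\<^sub>C e n) = cinner z (e n)" for n
      using assms(2)[of n] unfolding adjoint_graph_def by auto
    hence "cinner (e n) z = complex_of_real (w n) * cinner (e n) y" for n
      by (metis cinner_commute cinner_scaleC_right complex_cnj_complex_of_real complex_cnj_mult)
    thus "p \<in> mgraph w" by (auto simp: yz mgraph_def)
  qed
  show "mgraph w \<subseteq> D"
  proof
    fix p assume "p \<in> mgraph w"
    hence "p \<in> adjoint_graph D"
      using sub unfolding adjoint_graph_def by (cases p) (auto intro: mgraph_symmetric)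
    thus "p \<in> D" using D by simp
  qed
qed


section \<open>Existence of a ground state\<close>

text \<open>The quadratic form of the multiplication operator, cut off to the modes in
  \<open>F\<close>. Quantifying over all finite \<open>F\<close> replaces the form domain, since for
  nonnegative \<open>w\<close> the full form is the supremum over \<open>F\<close>.\<close>

definition energy :: "('n \<Rightarrow> real) \<Rightarrow> 'n set \<Rightarrow> 'h \<Rightarrow> real" where
  "energy w F x = (\<Sum>n\<in>F. w n * (cmod (cinner (e n) x))\<^sup>2)"

lemma energy_mono_support:
  assumes "\<And>n. 0 \<le> w n" "finite F" "finite G" "proj F x = x"
  shows "energy w G x \<le> energy w F x"
proof -
  have z: "cinner (e n) x = 0" if "n \<notin> F" for n
    using coeff_proj[OF assms(2), of n x] that assms(4) by simp
  have "energy w G x = energy w (G \<inter> F) x"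
    unfolding energy_def by (rule sum.mono_neutral_right) (use assms z in auto)
  also have "\<dots> \<le> energy w F x"
    unfolding energy_def by (rule sum_mono2) (use assms in auto)
  finally show ?thesis .
qed

text \<open>One coordinate is added at a time: the new coefficient ranges over a compact disc, and
  the sum of two compact sets is compact.\<close>

lemma proj_unit_ball_compact:
  "finite F \<Longrightarrow> \<exists>Z. compact Z \<and> (\<forall>x. norm x \<le> 1 \<longrightarrow> proj F x \<in> Z)"
proof (induction F rule: finite_induct)
  case empty
  show ?case by (rule exI[of _ "{0}"]) (simp add: proj_def)
next
  case (insert n F)
  then obtain Z where Z: "compact Z" "\<And>x. norm x \<le> 1 \<Longrightarrow> proj F x \<in> Z" by auto
  let ?C = "(\<lambda>a. a *\<^sub>C e n) ` cball (0::complex) 1"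
  have C: "compact ?C"
    by (intro compact_continuous_image continuous_intros compact_cball)
  have "compact {u + v | u v. u \<in> ?C \<and> v \<in> Z}" by (rule compact_sums[OF C Z(1)])
  moreover have "proj (insert n F) x \<in> {u + v | u v. u \<in> ?C \<and> v \<in> Z}" if x: "norm x \<le> 1" for x
  proof -
    have "cmod (cinner (e n) x) \<le> 1"
      using cinner_Cauchy_Schwarz[of "e n" x] x by simp
    hence "cinner (e n) x *\<^sub>C e n \<in> ?C" by auto
    moreover have "proj (insert n F) x = cinner (e n) x *\<^sub>C e n + proj F x"
      using insert by (simp add: proj_def)
    ultimately show ?thesis using Z(2)[OF x] by blast
  qed
  ultimately show ?case by blast
qed

text \<open>A Rellich argument: bounded energy leaves little norm in the modes with large
  \<open>w\<close>, and only finitely many modes remain. This plays the part of compactness of the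
  resolvent.\<close>

lemma energy_ball_compact:
  assumes w0: "\<And>n. 0 \<le> w n" and wfin: "\<And>c. finite {n. w n \<le> c}"
  shows "compact {x. norm x \<le> 1 \<and> (\<forall>F. finite F \<longrightarrow> energy w F x \<le> C)}" (is "compact ?K")
proof -
  have "closed ?K"
  proof -
    have "?K = {x. norm x \<le> 1} \<inter> (\<Inter>F\<in>{F. finite F}. {x. energy w F x \<le> C})" by auto
    moreover have "closed {x :: 'h. norm x \<le> 1}"
      by (intro closed_Collect_le continuous_intros)
    moreover have "closed {x. energy w F x \<le> C}" for F
      unfolding energy_def by (intro closed_Collect_le continuous_intros)
    ultimately show ?thesis
      by (simp only:) (intro closed_Int closed_INT ballI)
  qed
  moreover have "\<exists>k. finite k \<and> ?K \<subseteq> (\<Union>x\<in>k. ball x r)" if r: "r > 0" for r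
  proof -
    \<comment> \<open>The modes with \<open>w n > c\<close> carry squared norm at most
      \<open>C / c\<close>, and \<open>c\<close> is chosen to bring this below the square of
      \<open>r / 2\<close>. The maximum with 1 keeps \<open>c\<close> positive when \<open>C\<close>
      is negative.\<close>
    define c where "c = max 1 (4 * C / r\<^sup>2 + 1)"
    define F where "F = {n. w n \<le> c}"
    have F: "finite F" unfolding F_def by (rule wfin)
    have c: "c > 0" "C < c * (r / 2)\<^sup>2"
    proof -
      show "c > 0" by (simp add: c_def)
      have "4 * C / r\<^sup>2 < c" by (simp add: c_def)
      thus "C < c * (r / 2)\<^sup>2" using r by (simp add: field_simps power2_eq_square)
    qed
    have tail: "norm (x - proj F x) < r / 2" if x: "x \<in> ?K" for x
    proof -
      have "(norm (proj G (x - proj F x)))\<^sup>2 \<le> C / c" if G: "finite G" for G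
      proof -
        have "(norm (proj G (x - proj F x)))\<^sup>2
            = (\<Sum>n\<in>G. if n \<in> F then 0 else (cmod (cinner (e n) x))\<^sup>2)"
          unfolding norm_proj_sq[OF G] by (intro sum.cong refl) (simp add: cinner_diff_right coeff_proj F)
        also have "\<dots> \<le> (\<Sum>n\<in>G. w n * (cmod (cinner (e n) x))\<^sup>2 / c)"
        proof (intro sum_mono)
          fix n assume "n \<in> G"
          show "(if n \<in> F then 0 else (cmod (cinner (e n) x))\<^sup>2) \<le> w n * (cmod (cinner (e n) x))\<^sup>2 / c"
            using c(1) w0[of n] by (auto simp: F_def field_simps intro!: mult_right_mono)
        qed
        also have "\<dots> = energy w G x / c" by (simp add: energy_def sum_divide_distrib)
        also have "\<dots> \<le> C / c" using x G c(1) by (intro divide_right_mono) auto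
        finally show ?thesis .
      qed
      hence "\<forall>\<^sub>F G in finite_subsets_at_top UNIV. (norm (proj G (x - proj F x)))\<^sup>2 \<le> C / c"
        unfolding eventually_finite_subsets_at_top by (intro exI[of _ "{}"]) auto
      moreover have "((\<lambda>G. (norm (proj G (x - proj F x)))\<^sup>2) \<longlongrightarrow> (norm (x - proj F x))\<^sup>2) (finite_subsets_at_top UNIV)"
        by (intro tendsto_intros tendsto_proj)
      ultimately have "(norm (x - proj F x))\<^sup>2 \<le> C / c"
        using tendsto_upperbound finite_subsets_at_top_neq_bot by blast
      also have "\<dots> < (r / 2)\<^sup>2" using c by (simp add: field_simps)
      finally show ?thesis by (rule power_less_imp_less_base) (use r in simp)
    qed
    obtain Z where Z: "compact Z" "\<And>x. norm x \<le> 1 \<Longrightarrow> proj F x \<in> Z"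
      using proj_unit_ball_compact[OF F] by blast
    obtain k where k: "finite k" "Z \<subseteq> (\<Union>x\<in>k. ball x (r / 2))"
      using Z(1) r unfolding compact_eq_totally_bounded by (meson half_gt_zero)
    have "x \<in> (\<Union>x\<in>k. ball x r)" if x: "x \<in> ?K" for x
    proof -
      obtain z where z: "z \<in> k" "dist z (proj F x) < r / 2" using Z(2)[of x] x k(2) by auto
      have "dist z x \<le> dist z (proj F x) + dist (proj F x) x" by (rule dist_triangle)
      also have "\<dots> < r" using z(2) tail[OF x] by (simp add: dist_norm norm_minus_commute)
      finally show ?thesis using z(1) by auto
    qed
    thus ?thesis using k(1) by blast
  qed
  ultimately show ?thesis
    unfolding compact_eq_totally_bounded by (simp add: complete_eq_closed)
qed

text \<open>The minimiser of the Rayleigh quotient is a limit of a minimising sequence, which stays in a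
  set of bounded energy and hence in a compact set. The Euler-Lagrange equation
  is only tested in the directions \<open>e n\<close>.\<close>

lemma ground_state:
  assumes w0: "\<And>n. 0 \<le> w n" and wfin: "\<And>c. finite {n. w n \<le> c}" and V: "hermitian_bounded M V"
  obtains \<psi> \<mu> where "norm \<psi> = 1" "(\<psi>, complex_of_real \<mu> *\<^sub>C \<psi> - V \<psi>) \<in> mgraph w"
    "\<And>F x. finite F \<Longrightarrow> proj F x = x \<Longrightarrow> \<mu> * (norm x)\<^sup>2 \<le> energy w F x + Re (cinner x (V x))"
proof -
  define q where "q F x = energy w F x + Re (cinner x (V x))" for F x
  define S where "S = {q F x | F x. finite F \<and> proj F x = x \<and> norm x = 1}"
  define \<mu> where "\<mu> = Inf S"
  note VD = hermitian_boundedD[OF V] and Vl = complex_linearD[OF hermitian_boundedD(1)[OF V]]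
  note Vbl = hermitian_bounded_bounded_linear[OF V]
  have e0: "energy w F x \<ge> 0" for F x
    unfolding energy_def by (intro sum_nonneg mult_nonneg_nonneg w0) auto
  have lb: "s \<ge> - M" if s: "s \<in> S" for s
  proof -
    obtain F x where "s = q F x" "norm x = 1" using s unfolding S_def by blast
    thus ?thesis using e0[of F x] hermitian_form_bound[OF V, of x] by (auto simp: q_def)
  qed
  hence bdd: "bdd_below S" by (meson bdd_belowI)
  obtain n0 :: 'n where True by blast
  have pe: "proj {n0} (e n0) = e n0" by (simp add: proj_def ortho)
  have Sne: "S \<noteq> {}"
    using pe unfolding S_def by (auto intro!: exI[of _ "{n0}"] exI[of _ "e n0"])
  have min: "\<mu> * (norm x)\<^sup>2 \<le> q F x" if x: "finite F" "proj F x = x" for F x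
  proof (cases "x = 0")
    case True thus ?thesis using Vl(3) by (simp add: q_def energy_def)
  next
    case False
    define c where "c = complex_of_real (1 / norm x)"
    have "proj F (c *\<^sub>C x) = c *\<^sub>C x" using x(2) by (simp add: complex_linearD[OF proj_linear])
    moreover have "norm (c *\<^sub>C x) = 1" using False by (simp add: c_def norm_divide)
    ultimately have "q F (c *\<^sub>C x) \<in> S" using x(1) unfolding S_def by blast
    hence "\<mu> \<le> q F (c *\<^sub>C x)" unfolding \<mu>_def by (intro cInf_lower bdd)
    also have "q F (c *\<^sub>C x) = q F x / (norm x)\<^sup>2"
      by (simp add: q_def energy_def cinner_scaleC_right cinner_scaleC_left Vl(2) c_def norm_mult
        norm_divide power_divide add_divide_distrib sum_divide_distrib power2_eq_square)
    finally show ?thesis using False by (simp add: field_simps)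
  qed
  have "\<exists>p. finite (fst p) \<and> proj (fst p) (snd p) = snd p \<and> norm (snd p) = 1 \<and>
      q (fst p) (snd p) < \<mu> + 1 / real (Suc j)" for j
  proof -
    have "Inf S < \<mu> + 1 / real (Suc j)" by (simp add: \<mu>_def)
    then obtain s where "s \<in> S" "s < \<mu> + 1 / real (Suc j)" using cInf_lessD[OF Sne] by blast
    thus ?thesis unfolding S_def by auto
  qed
  then obtain p where p: "\<And>j. finite (fst (p j))" "\<And>j. proj (fst (p j)) (snd (p j)) = snd (p j)"
    "\<And>j. norm (snd (p j)) = 1" "\<And>j. q (fst (p j)) (snd (p j)) < \<mu> + 1 / real (Suc j)"
    by metis
  define x where "x j = snd (p j)" for j
  have en: "energy w G (x j) \<le> \<mu> + 1 / real (Suc j) - Re (cinner (x j) (V (x j)))" if "finite G" for G j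
    using energy_mono_support[where w = w, OF w0 p(1)[of j] that p(2)[of j]] p(4)[of j]
    unfolding x_def q_def by linarith
  define K where "K = {x. norm x \<le> 1 \<and> (\<forall>F. finite F \<longrightarrow> energy w F x \<le> \<mu> + 1 + M)}"
  have "x j \<in> K" for j
  proof -
    have "energy w F (x j) \<le> \<mu> + 1 + M" if "finite F" for F
    proof -
      have "1 / real (Suc j) \<le> 1" by simp
      moreover have "\<bar>Re (cinner (x j) (V (x j)))\<bar> \<le> M"
        using hermitian_form_bound[OF V, of "x j"] p(3)[of j] by (simp add: x_def)
      ultimately show ?thesis using en[OF that, of j] by linarith
    qed
    thus ?thesis using p(3)[of j] by (auto simp: K_def x_def)
  qed
  moreover have "compact K" unfolding K_def by (rule energy_ball_compact[OF w0 wfin])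
  ultimately obtain \<psi> r where r: "strict_mono r" "(x \<circ> r) \<longlonglongrightarrow> \<psi>"
    unfolding compact_def by blast
  have xr: "(\<lambda>j. x (r j)) \<longlonglongrightarrow> \<psi>" using r(2) by (simp add: o_def)
  have Vxr: "(\<lambda>j. V (x (r j))) \<longlonglongrightarrow> V \<psi>" by (rule bounded_linear.tendsto[OF Vbl xr])
  have n1: "norm \<psi> = 1"
  proof -
    have "(\<lambda>j. norm (x (r j))) \<longlonglongrightarrow> norm \<psi>" by (intro tendsto_intros xr)
    moreover have "norm (x (r j)) = 1" for j by (simp add: x_def p(3))
    ultimately show ?thesis by (simp add: LIMSEQ_const_iff)
  qed
  \<comment> \<open>On a fixed finite set \<open>energy\<close> is continuous, so the bound passes
    to the limit for each \<open>G\<close> separately; the full energy would only be lower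
    semicontinuous.\<close>
  have E\<psi>: "energy w G \<psi> \<le> \<mu> - Re (cinner \<psi> (V \<psi>))" if G: "finite G" for G
  proof -
    have l1: "(\<lambda>j. energy w G (x (r j))) \<longlonglongrightarrow> energy w G \<psi>"
      unfolding energy_def by (intro tendsto_intros xr)
    have "(\<lambda>j. 1 / real (Suc j)) \<longlonglongrightarrow> 0" using LIMSEQ_inverse_real_of_nat by (simp add: inverse_eq_divide)
    hence "(\<lambda>j. 1 / real (Suc (r j))) \<longlonglongrightarrow> 0"
      using LIMSEQ_subseq_LIMSEQ[OF _ r(1)] by (fastforce simp: o_def)
    hence "(\<lambda>j. \<mu> + 1 / real (Suc (r j)) - Re (cinner (x (r j)) (V (x (r j)))))
        \<longlonglongrightarrow> \<mu> + 0 - Re (cinner \<psi> (V \<psi>))"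
      by (intro tendsto_intros xr Vxr)
    from LIMSEQ_le[OF l1 this] show ?thesis using en[OF G] by auto
  qed
  have EL: "complex_of_real (w n) * cinner (e n) \<psi> + cinner (e n) (V \<psi>) - complex_of_real \<mu> * cinner (e n) \<psi> = 0" for n
  proof -
    define a where "a = cinner (e n) \<psi>"
    define b where "b = cinner (e n) (V \<psi>)"
    define z where "z = complex_of_real (w n) * a + b - complex_of_real \<mu> * a"
    define B where "B = w n + Re (cinner (e n) (V (e n))) - \<mu>"
    \<comment> \<open>The second-order expansion, around \<open>\<psi>\<close> in direction
      \<open>e n\<close>, of the quadratic form minus \<open>\<mu>\<close> times the squared norm.
      Here \<open>z\<close> is the gradient that has to vanish and \<open>B\<close> the
      curvature.\<close>
    have key: "0 \<le> 2 * Re (t * cnj z) + (cmod t)\<^sup>2 * B" for t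
    proof -
      \<comment> \<open>\<open>min\<close> applies to finitely supported vectors only, so
        \<open>\<psi>\<close> is truncated to \<open>G\<close> and the limit over \<open>G\<close>
        is taken afterwards. Among the modes in \<open>G\<close> only \<open>n\<close> has a changed
        coefficient.\<close>
      define y where "y G = proj G \<psi> + t *\<^sub>C e n" for G
      have yl: "(y \<longlongrightarrow> \<psi> + t *\<^sub>C e n) (finite_subsets_at_top UNIV)"
        unfolding y_def by (intro tendsto_intros tendsto_proj)
      have Vyl: "((\<lambda>G. V (y G)) \<longlongrightarrow> V (\<psi> + t *\<^sub>C e n)) (finite_subsets_at_top UNIV)"
        by (rule bounded_linear.tendsto[OF Vbl yl])
      have "\<mu> * (norm (y G))\<^sup>2 \<le> \<mu> - Re (cinner \<psi> (V \<psi>)) + w n * ((cmod (a + t))\<^sup>2 - (cmod a)\<^sup>2)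
          + Re (cinner (y G) (V (y G)))" if G: "finite G" "n \<in> G" for G
      proof -
        have "proj G (t *\<^sub>C e n) = t *\<^sub>C e n"
          by (rule proj_eqI[OF G(1)]) (use G(2) in \<open>auto simp: cinner_scaleC_right ortho\<close>)
        hence py: "proj G (y G) = y G"
          using G(1) by (simp add: y_def complex_linearD[OF proj_linear] proj_proj)
        have cy: "cinner (e m) (y G) = cinner (e m) \<psi> + (if m = n then t else 0)" if "m \<in> G" for m
          using that G by (simp add: y_def cinner_add_right coeff_proj cinner_scaleC_right ortho)
        have "energy w G (y G) = energy w (G - {n}) (y G) + w n * (cmod (a + t))\<^sup>2"
          unfolding energy_def by (subst sum.remove[OF G]) (simp add: cy G a_def)
        also have "energy w (G - {n}) (y G) = energy w (G - {n}) \<psi>"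
          unfolding energy_def by (intro sum.cong refl) (auto simp: cy)
        also have "\<dots> = energy w G \<psi> - w n * (cmod a)\<^sup>2"
          unfolding energy_def a_def by (simp add: sum.remove[OF G])
        finally have "energy w G (y G) \<le> \<mu> - Re (cinner \<psi> (V \<psi>)) + w n * ((cmod (a + t))\<^sup>2 - (cmod a)\<^sup>2)"
          using E\<psi>[OF G(1)] by (simp add: algebra_simps)
        thus ?thesis using min[OF G(1) py] by (simp add: q_def)
      qed
      hence ev: "\<forall>\<^sub>F G in finite_subsets_at_top UNIV. \<mu> * (norm (y G))\<^sup>2 \<le>
          \<mu> - Re (cinner \<psi> (V \<psi>)) + w n * ((cmod (a + t))\<^sup>2 - (cmod a)\<^sup>2) + Re (cinner (y G) (V (y G)))"
        unfolding eventually_finite_subsets_at_top by (intro exI[of _ "{n}"]) auto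
      have "\<mu> * (norm (\<psi> + t *\<^sub>C e n))\<^sup>2 \<le> \<mu> - Re (cinner \<psi> (V \<psi>)) + w n * ((cmod (a + t))\<^sup>2 - (cmod a)\<^sup>2)
          + Re (cinner (\<psi> + t *\<^sub>C e n) (V (\<psi> + t *\<^sub>C e n)))"
        by (rule tendsto_le[OF finite_subsets_at_top_neq_bot _ _ ev])
          (intro tendsto_intros yl Vyl)+
      moreover have "(norm (\<psi> + t *\<^sub>C e n))\<^sup>2 = 1 + (cmod t)\<^sup>2 + 2 * Re (t * cnj a)"
      proof -
        have "cinner \<psi> (e n) = cnj a" unfolding a_def by (rule cinner_commute)
        thus ?thesis by (simp add: norm_add_sq n1 cinner_scaleC_right)
      qed
      moreover have "(cmod (a + t))\<^sup>2 - (cmod a)\<^sup>2 = (cmod t)\<^sup>2 + 2 * Re (t * cnj a)"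
        unfolding cmod_power2 by (simp add: power2_eq_square algebra_simps)
      moreover have "Re (cinner (\<psi> + t *\<^sub>C e n) (V (\<psi> + t *\<^sub>C e n)))
          = Re (cinner \<psi> (V \<psi>)) + (cmod t)\<^sup>2 * Re (cinner (e n) (V (e n))) + 2 * Re (t * cnj b)"
      proof -
        have "cinner \<psi> (V (e n)) = cnj b"
          unfolding b_def by (metis VD(2) cinner_commute)
        hence "cinner (\<psi> + t *\<^sub>C e n) (V (\<psi> + t *\<^sub>C e n))
            = cinner \<psi> (V \<psi>) + t * cnj b + cnj t * b + (cnj t * t) * cinner (e n) (V (e n))"
          by (simp add: Vl cinner_add_left cinner_add_right cinner_scaleC_left cinner_scaleC_right
            b_def algebra_simps)
        thus ?thesis unfolding cmod_power2 by (simp add: power2_eq_square algebra_simps)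
      qed
      ultimately show ?thesis unfolding z_def B_def
        by (simp add: algebra_simps)
    qed
    have "z = 0"
    proof (rule ccontr)
      assume z: "z \<noteq> 0"
      \<comment> \<open>At \<open>t = - s z\<close> the expansion equals
        \<open>s * (cmod z)^2 * (s * B - 2)\<close>, which is negative as soon as
        \<open>s * B < 2\<close>.\<close>
      define s where "s = 1 / (\<bar>B\<bar> + 1)"
      have s: "s > 0" "s * B < 2" by (auto simp: s_def field_simps abs_if)
      have "0 \<le> 2 * Re ((- complex_of_real s * z) * cnj z) + (cmod (- complex_of_real s * z))\<^sup>2 * B" by (rule key)
      also have "\<dots> = s * (cmod z)\<^sup>2 * (s * B - 2)"
        unfolding norm_mult power_mult_distrib cmod_power2 by (simp add: power2_eq_square algebra_simps)
      finally have "0 \<le> s * (cmod z)\<^sup>2 * (s * B - 2)" .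
      moreover have "s * (cmod z)\<^sup>2 > 0" using s z by simp
      ultimately show False using s(2) by (simp add: zero_le_mult_iff)
    qed
    thus ?thesis by (simp add: z_def a_def b_def)
  qed
  have "(\<psi>, complex_of_real \<mu> *\<^sub>C \<psi> - V \<psi>) \<in> mgraph w"
    using EL by (auto simp: mgraph_def cinner_diff_right cinner_scaleC_right algebra_simps)
  thus ?thesis using that[OF n1] min unfolding q_def by blast
qed

end

section \<open>Variational bounds for the counting function\<close>

text \<open>Gaussian elimination: a nontrivial equation \<open>j\<close> is solved for an unknown
  \<open>k\<close> and substituted into the others. This serves as the dimension count in the
  variational arguments.\<close>

lemma underdetermined_system:
  fixes a :: "'j \<Rightarrow> 'i \<Rightarrow> complex"
  assumes "finite J" "finite I" "card J < card I"
  shows "\<exists>c. (\<exists>i\<in>I. c i \<noteq> 0) \<and> (\<forall>j\<in>J. (\<Sum>i\<in>I. a j i * c i) = 0)"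
  using assms
proof (induction J arbitrary: I a rule: finite_induct)
  case empty
  then obtain i where "i \<in> I" by fastforce
  thus ?case by (intro exI[of _ "\<lambda>_. 1"]) auto
next
  case (insert j J)
  show ?case
  proof (cases "\<forall>i\<in>I. a j i = 0")
    case True
    have "card J < card I" using insert by simp
    then obtain c where "\<exists>i\<in>I. c i \<noteq> 0" "\<forall>j\<in>J. (\<Sum>i\<in>I. a j i * c i) = 0"
      using insert.IH[OF insert.prems(1)] by blast
    thus ?thesis using True by (intro exI[of _ c]) auto
  next
    case False
    then obtain k where k: "k \<in> I" "a j k \<noteq> 0" by blast
    define I' where "I' = I - {k}"
    have I': "finite I'" "card J < card I'" "k \<notin> I'" "I = insert k I'"
      using insert k by (auto simp: I'_def)
    obtain c where c: "\<exists>i\<in>I'. c i \<noteq> 0"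
      "\<forall>m\<in>J. (\<Sum>i\<in>I'. (a m i - a m k * a j i / a j k) * c i) = 0"
      using insert.IH[OF I'(1,2), of "\<lambda>m i. a m i - a m k * a j i / a j k"] by blast
    define s where "s = (\<Sum>i\<in>I'. a j i * c i)"
    define d where "d = c(k := - s / a j k)"
    have sum: "(\<Sum>i\<in>I. a m i * d i) = a m k * (- s / a j k) + (\<Sum>i\<in>I'. a m i * c i)" for m
    proof -
      have "(\<Sum>i\<in>I'. a m i * d i) = (\<Sum>i\<in>I'. a m i * c i)"
        using I'(3) by (intro sum.cong) (auto simp: d_def)
      thus ?thesis unfolding I'(4) using I'(1,3) by (simp add: d_def)
    qed
    have "(\<Sum>i\<in>I. a m i * d i) = 0" if m: "m \<in> insert j J" for m
    proof (cases "m = j")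
      case True thus ?thesis using k sum[of j] by (simp add: s_def)
    next
      case False
      hence "0 = (\<Sum>i\<in>I'. (a m i - a m k * a j i / a j k) * c i)" using c(2) m by auto
      also have "\<dots> = (\<Sum>i\<in>I'. a m i * c i) - (\<Sum>i\<in>I'. a m k / a j k * (a j i * c i))"
        by (simp add: algebra_simps sum_subtractf)
      also have "(\<Sum>i\<in>I'. a m k / a j k * (a j i * c i)) = a m k / a j k * s"
        by (simp add: s_def sum_distrib_left)
      finally show ?thesis using sum[of m] by simp
    qed
    moreover have "\<exists>i\<in>I. d i \<noteq> 0"
    proof -
      obtain i where "i \<in> I'" "c i \<noteq> 0" using c(1) by blast
      thus ?thesis using I'(3,4) by (intro bexI[of _ i]) (auto simp: d_def)
    qed
    ultimately show ?thesis by blast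
  qed
qed

context onb
begin

definition pgraph :: "('n \<Rightarrow> real) \<Rightarrow> ('h \<Rightarrow> 'h) \<Rightarrow> 'h operator_graph" where
  "pgraph w V = {(x, y + V x) | x y. (x, y) \<in> mgraph w}"

lemma eigenspace_pgraph:
  "x \<in> eigenspace (pgraph w V) \<mu> \<longleftrightarrow> (x, complex_of_real \<mu> *\<^sub>C x - V x) \<in> mgraph w"
  unfolding eigenspace_def pgraph_def
  by (auto simp: eq_diff_eq[symmetric] intro!: exI[of _ "complex_of_real \<mu> *\<^sub>C x - V x"])

lemma mgraph_add: "(x, x') \<in> mgraph w \<Longrightarrow> (y, y') \<in> mgraph w \<Longrightarrow> (x + y, x' + y') \<in> mgraph w"
  by (simp add: mgraph_def cinner_add_right algebra_simps)

lemma mgraph_scale: "(x, x') \<in> mgraph w \<Longrightarrow> (c *\<^sub>C x, c *\<^sub>C x') \<in> mgraph w"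
  by (simp add: mgraph_def cinner_scaleC_right)

lemma mgraph_sum:
  "(\<And>i. i \<in> I \<Longrightarrow> (x i, y i) \<in> mgraph w) \<Longrightarrow> (sum x I, sum y I) \<in> mgraph w"
proof (induction I rule: infinite_finite_induct)
  case (insert i I) thus ?case by (simp add: mgraph_add)
qed (auto simp: mgraph_def)

lemma eigenspace_sum:
  assumes V: "hermitian_bounded M V" and b: "\<And>b. b \<in> B \<Longrightarrow> b \<in> eigenspace (pgraph w V) \<mu>"
  shows "(\<Sum>b\<in>B. c b *\<^sub>C b) \<in> eigenspace (pgraph w V) \<mu>"
proof -
  note Vl = complex_linearD[OF hermitian_boundedD(1)[OF V]]
  have "((\<Sum>b\<in>B. c b *\<^sub>C b), (\<Sum>b\<in>B. c b *\<^sub>C (complex_of_real \<mu> *\<^sub>C b - V b))) \<in> mgraph w"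
    using b by (intro mgraph_sum mgraph_scale) (simp add: eigenspace_pgraph)
  also have "(\<Sum>b\<in>B. c b *\<^sub>C (complex_of_real \<mu> *\<^sub>C b - V b))
      = complex_of_real \<mu> *\<^sub>C (\<Sum>b\<in>B. c b *\<^sub>C b) - V (\<Sum>b\<in>B. c b *\<^sub>C b)"
    by (simp add: Vl complex_vector.scale_sum_right complex_vector.scale_right_diff_distrib
      sum_subtractf scaleC_scaleC mult.commute)
  finally show ?thesis by (simp add: eigenspace_pgraph)
qed

lemma eigenspace_orthogonal:
  assumes V: "hermitian_bounded M V" and x: "x \<in> eigenspace (pgraph w V) \<mu>"
    and y: "y \<in> eigenspace (pgraph w V) \<nu>" and ne: "\<mu> \<noteq> \<nu>"
  shows "cinner x y = 0"
proof -
  have "cinner x (complex_of_real \<nu> *\<^sub>C y - V y) = cinner (complex_of_real \<mu> *\<^sub>C x - V x) y"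
    using x y by (intro mgraph_symmetric) (auto simp: eigenspace_pgraph)
  hence "complex_of_real (\<nu> - \<mu>) * cinner x y = 0"
    by (simp add: cinner_diff_left cinner_diff_right cinner_scaleC_left cinner_scaleC_right
      hermitian_boundedD(2)[OF V] algebra_simps)
  thus ?thesis using ne by simp
qed

text \<open>More eigenvectors below \<open>l\<close> than constraints would leave a nontrivial
  combination \<open>X\<close> that meets all constraints. Eigenspaces for different eigenvalues are
  orthogonal, so the form of \<open>X\<close> is the sum of
  \<open>\<mu> * (norm (x \<mu>))^2\<close> with all \<open>\<mu> < l\<close>; unless every
  \<open>x \<mu>\<close> vanishes, this contradicts \<open>form\<close>.\<close>

lemma card_eigenvectors_le:
  fixes g :: "'j \<Rightarrow> 'h"
  assumes V: "hermitian_bounded M V" and J: "finite J"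
    and form: "\<And>x y. (x, y) \<in> mgraph w \<Longrightarrow> (\<And>j. j \<in> J \<Longrightarrow> cinner (g j) x = 0) \<Longrightarrow>
        l * (norm x)\<^sup>2 \<le> Re (cinner x (y + V x))"
    and F: "finite F" "F \<subseteq> {..<l}"
    and B: "\<And>\<mu>. \<mu> \<in> F \<Longrightarrow> finite (B \<mu>) \<and> B \<mu> \<subseteq> eigenspace (pgraph w V) \<mu> \<and> complex_vector.independent (B \<mu>)"
  shows "(\<Sum>\<mu>\<in>F. card (B \<mu>)) \<le> card J"
proof (rule ccontr)
  note Vl = complex_linearD[OF hermitian_boundedD(1)[OF V]]
  assume "\<not> ?thesis"
  hence "card J < card (Sigma F B)" using F B by simp
  hence "\<exists>c. (\<exists>i\<in>Sigma F B. c i \<noteq> 0) \<and> (\<forall>j\<in>J. (\<Sum>i\<in>Sigma F B. cinner (g j) (snd i) * c i) = 0)"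
    using F B by (intro underdetermined_system J) auto
  then obtain c where c: "\<exists>i\<in>Sigma F B. c i \<noteq> 0"
    "\<And>j. j \<in> J \<Longrightarrow> (\<Sum>i\<in>Sigma F B. cinner (g j) (snd i) * c i) = 0" by blast
  define x where "x \<mu> = (\<Sum>b\<in>B \<mu>. c (\<mu>, b) *\<^sub>C b)" for \<mu>
  define X where "X = (\<Sum>\<mu>\<in>F. x \<mu>)"
  have xe: "x \<mu> \<in> eigenspace (pgraph w V) \<mu>" if "\<mu> \<in> F" for \<mu>
    unfolding x_def using B[OF that] by (intro eigenspace_sum[OF V]) auto
  have orth: "cinner (x \<mu>) (x \<nu>) = (if \<mu> = \<nu> then complex_of_real ((norm (x \<mu>))\<^sup>2) else 0)"
    if "\<mu> \<in> F" "\<nu> \<in> F" for \<mu> \<nu>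
    using eigenspace_orthogonal[OF V xe[OF that(1)] xe[OF that(2)]] cinner_self[of "x \<mu>"] by auto
  have mg: "(X, \<Sum>\<mu>\<in>F. complex_of_real \<mu> *\<^sub>C x \<mu> - V (x \<mu>)) \<in> mgraph w"
    unfolding X_def using xe by (intro mgraph_sum) (simp add: eigenspace_pgraph)
  have "cinner (g j) X = 0" if j: "j \<in> J" for j
  proof -
    have "cinner (g j) X = (\<Sum>\<mu>\<in>F. \<Sum>b\<in>B \<mu>. cinner (g j) b * c (\<mu>, b))"
      by (simp add: X_def x_def cinner_sum_right cinner_scaleC_right mult.commute)
    also have "\<dots> = (\<Sum>i\<in>Sigma F B. cinner (g j) (snd i) * c i)"
      using F B by (subst sum.Sigma) (auto intro!: sum.cong)
    finally show ?thesis using c(2)[OF j] by simp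
  qed
  from form[OF mg this]
  have "l * (norm X)\<^sup>2 \<le> Re (cinner X (\<Sum>\<mu>\<in>F. complex_of_real \<mu> *\<^sub>C x \<mu>))"
    by (simp add: X_def Vl sum_subtractf)
  also have "cinner X (\<Sum>\<mu>\<in>F. complex_of_real \<mu> *\<^sub>C x \<mu>)
      = (\<Sum>\<mu>\<in>F. \<Sum>\<nu>\<in>F. if \<nu> = \<mu> then complex_of_real (\<mu> * (norm (x \<mu>))\<^sup>2) else 0)"
    unfolding X_def cinner_sum_left cinner_sum_right cinner_scaleC_right
    by (intro sum.cong refl) (auto simp: orth F(1))
  also have "\<dots> = complex_of_real (\<Sum>\<mu>\<in>F. \<mu> * (norm (x \<mu>))\<^sup>2)"
    using F by simp
  finally have 1: "l * (norm X)\<^sup>2 \<le> (\<Sum>\<mu>\<in>F. \<mu> * (norm (x \<mu>))\<^sup>2)" by simp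
  have "complex_of_real ((norm X)\<^sup>2) = (\<Sum>\<mu>\<in>F. \<Sum>\<nu>\<in>F. if \<nu> = \<mu> then complex_of_real ((norm (x \<mu>))\<^sup>2) else 0)"
    unfolding cinner_self[symmetric] X_def cinner_sum_left cinner_sum_right
    by (intro sum.cong refl) (auto simp: orth cinner_self)
  also have "\<dots> = complex_of_real (\<Sum>\<mu>\<in>F. (norm (x \<mu>))\<^sup>2)"
    using F by simp
  finally have "(norm X)\<^sup>2 = (\<Sum>\<mu>\<in>F. (norm (x \<mu>))\<^sup>2)" unfolding of_real_eq_iff .
  with 1 have 2: "(\<Sum>\<mu>\<in>F. (l - \<mu>) * (norm (x \<mu>))\<^sup>2) \<le> 0"
    by (simp add: sum_distrib_left left_diff_distrib sum_subtractf)
  have "(l - \<mu>) * (norm (x \<mu>))\<^sup>2 = 0" if "\<mu> \<in> F" for \<mu>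
  proof -
    have nn: "0 \<le> (l - \<mu>) * (norm (x \<mu>))\<^sup>2" if "\<mu> \<in> F" for \<mu>
      using that F by (intro mult_nonneg_nonneg) (auto simp: less_imp_le subset_iff)
    hence "(\<Sum>\<mu>\<in>F. (l - \<mu>) * (norm (x \<mu>))\<^sup>2) = 0" using 2 by (intro antisym sum_nonneg)
    moreover have "(\<Sum>\<mu>\<in>F. (l - \<mu>) * (norm (x \<mu>))\<^sup>2) = 0 \<longleftrightarrow> (\<forall>\<mu>\<in>F. (l - \<mu>) * (norm (x \<mu>))\<^sup>2 = 0)"
      by (rule sum_nonneg_eq_0_iff[OF F(1) nn])
    ultimately show ?thesis using that by simp
  qed
  hence x0: "x \<mu> = 0" if "\<mu> \<in> F" for \<mu> using that F by fastforce
  obtain \<mu> b where mb: "\<mu> \<in> F" "b \<in> B \<mu>" "c (\<mu>, b) \<noteq> 0" using c(1) by auto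
  have "c (\<mu>, b) = 0"
    using complex_vector.independentD[of "B \<mu>" "B \<mu>" "\<lambda>b. c (\<mu>, b)" b] B[OF mb(1)] mb x0[OF mb(1)]
    by (auto simp: x_def)
  thus False using mb by simp
qed

lemma counting_function_le:
  fixes g :: "'j \<Rightarrow> 'h"
  assumes V: "hermitian_bounded M V" and J: "finite J"
    and form: "\<And>x y. (x, y) \<in> mgraph w \<Longrightarrow> (\<And>j. j \<in> J \<Longrightarrow> cinner (g j) x = 0) \<Longrightarrow>
        l * (norm x)\<^sup>2 \<le> Re (cinner x (y + V x))"
  shows "counting_function l (pgraph w V) \<le> of_nat (card J)"
proof -
  define P where "P \<mu> = {B. finite B \<and> B \<subseteq> eigenspace (pgraph w V) \<mu> \<and> complex_vector.independent B}" for \<mu>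
  \<comment> \<open>The cardinalities are bounded by \<open>card J\<close>, so the supremum in
    \<open>multiplicity_of\<close> is attained and each multiplicity can be replaced by an actual
    independent set.\<close>
  have att: "\<exists>B\<in>P \<mu>. multiplicity_of (pgraph w V) \<mu> = of_nat (card B)" if \<mu>: "\<mu> < l" for \<mu>
  proof -
    have bnd: "card B \<le> card J" if B: "B \<in> P \<mu>" for B
    proof -
      have "(\<Sum>\<nu>\<in>{\<mu>}. card B) \<le> card J"
      proof (rule card_eigenvectors_le[OF V J])
        fix x y assume "(x, y) \<in> mgraph w" "\<And>j. j \<in> J \<Longrightarrow> cinner (g j) x = 0"
        thus "l * (norm x)\<^sup>2 \<le> Re (cinner x (y + V x))" by (rule form)
      qed (use B \<mu> in \<open>auto simp: P_def\<close>)
      thus ?thesis by simp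
    qed
    have fin: "finite (card ` P \<mu>)" by (rule finite_subset[of _ "{..card J}"]) (use bnd in auto)
    have "{} \<in> P \<mu>" by (simp add: P_def complex_vector.independent_empty)
    hence ne: "card ` P \<mu> \<noteq> {}" by blast
    obtain B where B: "B \<in> P \<mu>" "card B = Max (card ` P \<mu>)" using Max_in[OF fin ne] by auto
    have "multiplicity_of (pgraph w V) \<mu> = of_nat (card B)"
      unfolding multiplicity_of_def P_def[symmetric]
    proof (rule antisym)
      show "(SUP B\<in>P \<mu>. of_nat (card B)) \<le> (of_nat (card B) :: ennreal)"
        using fin B by (intro SUP_least) simp
      show "(of_nat (card B) :: ennreal) \<le> (SUP B\<in>P \<mu>. of_nat (card B))"
        by (rule SUP_upper[OF B(1)])
    qed
    thus ?thesis using B(1) by blast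
  qed
  then obtain B where B: "\<And>\<mu>. \<mu> < l \<Longrightarrow> B \<mu> \<in> P \<mu>"
    "\<And>\<mu>. \<mu> < l \<Longrightarrow> multiplicity_of (pgraph w V) \<mu> = of_nat (card (B \<mu>))" by metis
  have "(\<Sum>\<mu>\<in>F. multiplicity_of (pgraph w V) \<mu>) \<le> of_nat (card J)"
    if F: "finite F" "F \<subseteq> {..<l}" for F
  proof -
    have "(\<Sum>\<mu>\<in>F. multiplicity_of (pgraph w V) \<mu>) = (\<Sum>\<mu>\<in>F. of_nat (card (B \<mu>)))"
      using F B(2) by (intro sum.cong) auto
    also have "\<dots> = of_nat (\<Sum>\<mu>\<in>F. card (B \<mu>))" by simp
    also have "\<dots> \<le> of_nat (card J)"
    proof (intro of_nat_mono, rule card_eigenvectors_le[OF V J _ F])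
      fix x y assume "(x, y) \<in> mgraph w" "\<And>j. j \<in> J \<Longrightarrow> cinner (g j) x = 0"
      thus "l * (norm x)\<^sup>2 \<le> Re (cinner x (y + V x))" by (rule form)
    next
      fix \<mu> assume "\<mu> \<in> F"
      hence "B \<mu> \<in> P \<mu>" using F B(1) by auto
      thus "finite (B \<mu>) \<and> B \<mu> \<subseteq> eigenspace (pgraph w V) \<mu> \<and> complex_vector.independent (B \<mu>)"
        by (simp add: P_def)
    qed
    finally show ?thesis .
  qed
  thus ?thesis unfolding counting_function_def
    by (intro infsum_le_finite_sums nonneg_summable_on_complete) auto
qed

text \<open>Adding a large multiple of the projection onto the eigenvectors found so far to the potential
  forces the next ground state to be orthogonal to them.\<close>

lemma next_eigenvector:
  fixes f :: "'j \<Rightarrow> 'h"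
  assumes w: "\<And>n. 0 \<le> w n" "\<And>c. finite {n. w n \<le> c}" and V: "hermitian_bounded M V"
    and J: "finite J" and F: "finite F" "\<And>j. j \<in> J \<Longrightarrow> proj F (f j) = f j"
    and form: "\<And>c x. (\<exists>j\<in>J. c j \<noteq> 0) \<Longrightarrow> x = (\<Sum>j\<in>J. c j *\<^sub>C f j) \<Longrightarrow>
        energy w F x + Re (cinner x (V x)) < l * (norm x)\<^sup>2"
    and I: "finite I" "card I < card J"
    and \<epsilon>: "\<And>i. i \<in> I \<Longrightarrow> \<epsilon> i \<in> eigenspace (pgraph w V) (\<nu> i)"
    and orth: "\<And>i j. i \<in> I \<Longrightarrow> j \<in> I \<Longrightarrow> cinner (\<epsilon> i) (\<epsilon> j) = (if i = j then 1 else 0)"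
  shows "\<exists>\<psi> \<mu>. norm \<psi> = 1 \<and> \<mu> < l \<and> \<psi> \<in> eigenspace (pgraph w V) \<mu> \<and> (\<forall>i\<in>I. cinner (\<epsilon> i) \<psi> = 0)"
proof -
  note VD = hermitian_boundedD[OF V] and Vl = complex_linearD[OF hermitian_boundedD(1)[OF V]]
  \<comment> \<open>\<open>K\<close> is large enough to lift every eigenvalue found so far to at
    least \<open>l\<close>, above the next ground state energy.\<close>
  define K where "K = (\<Sum>i\<in>I. \<bar>l - \<nu> i\<bar>)"
  have K: "l \<le> \<nu> i + K" "K \<ge> 0" if "i \<in> I" for i
    using member_le_sum[of i I "\<lambda>i. \<bar>l - \<nu> i\<bar>"] I that by (auto simp: K_def)
  define Q where "Q x = (\<Sum>i\<in>I. cinner (\<epsilon> i) x *\<^sub>C \<epsilon> i)" for x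
  define V' where "V' x = V x + complex_of_real K *\<^sub>C Q x" for x
  have K0: "K \<ge> 0" by (simp add: K_def sum_nonneg)
  have Ql: "complex_linear Q"
    by (auto simp: complex_linear_def Q_def cinner_add_right scaleC_add_left sum.distrib
      cinner_scaleC_right complex_vector.scale_sum_right scaleC_scaleC)
  have Qs: "cinner (Q x) y = cinner x (Q y)" for x y
  proof -
    have "cinner x (\<epsilon> i) = cnj (cinner (\<epsilon> i) x)" for i by (rule cinner_commute)
    thus ?thesis by (simp add: Q_def cinner_sum_left cinner_sum_right cinner_scaleC_left cinner_scaleC_right mult.commute)
  qed
  have Qb: "norm (Q x) \<le> (\<Sum>i\<in>I. (norm (\<epsilon> i))\<^sup>2) * norm x" for x
  proof -
    have "norm (Q x) \<le> (\<Sum>i\<in>I. cmod (cinner (\<epsilon> i) x) * norm (\<epsilon> i))"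
      unfolding Q_def by (rule order_trans[OF norm_sum]) simp
    also have "\<dots> \<le> (\<Sum>i\<in>I. (norm (\<epsilon> i) * norm x) * norm (\<epsilon> i))"
      by (intro sum_mono mult_right_mono cinner_Cauchy_Schwarz) simp
    finally show ?thesis unfolding sum_distrib_right power2_eq_square by (simp add: mult_ac)
  qed
  have V': "hermitian_bounded (M + K * (\<Sum>i\<in>I. (norm (\<epsilon> i))\<^sup>2)) V'"
    unfolding hermitian_bounded_def
  proof (intro conjI allI)
    show "complex_linear V'"
      by (simp add: complex_linear_def V'_def Vl complex_linearD[OF Ql] scaleC_add_right scaleC_left_commute)
    show "cinner (V' x) y = cinner x (V' y)" for x y
      by (simp add: V'_def cinner_add_left cinner_add_right cinner_scaleC_left cinner_scaleC_right VD(2) Qs)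
    show "norm (V' x) \<le> (M + K * (\<Sum>i\<in>I. (norm (\<epsilon> i))\<^sup>2)) * norm x" for x
    proof -
      have "norm (V' x) \<le> norm (V x) + K * norm (Q x)"
        unfolding V'_def using norm_triangle_ineq[of "V x" "complex_of_real K *\<^sub>C Q x"] K0 by simp
      also have "\<dots> \<le> M * norm x + K * ((\<Sum>i\<in>I. (norm (\<epsilon> i))\<^sup>2) * norm x)"
        by (intro add_mono VD(3) mult_left_mono Qb K0)
      finally show ?thesis by (simp add: algebra_simps)
    qed
  qed
  obtain \<psi> \<mu> where gs: "norm \<psi> = 1" "(\<psi>, complex_of_real \<mu> *\<^sub>C \<psi> - V' \<psi>) \<in> mgraph w"
    "\<And>F x. finite F \<Longrightarrow> proj F x = x \<Longrightarrow> \<mu> * (norm x)\<^sup>2 \<le> energy w F x + Re (cinner x (V' x))"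
    by (rule ground_state[OF w V']) blast
  \<comment> \<open>The trial space has more dimensions than there are old eigenvectors, so it
    contains a vector orthogonal to all of them. There \<open>V'\<close> agrees with
    \<open>V\<close>, which forces \<open>\<mu> < l\<close>.\<close>
  obtain c where c: "\<exists>j\<in>J. c j \<noteq> 0" "\<And>i. i \<in> I \<Longrightarrow> (\<Sum>j\<in>J. cinner (\<epsilon> i) (f j) * c j) = 0"
    using underdetermined_system[OF I(1) J I(2), of "\<lambda>i j. cinner (\<epsilon> i) (f j)"] by blast
  define x where "x = (\<Sum>j\<in>J. c j *\<^sub>C f j)"
  have xe: "cinner (\<epsilon> i) x = 0" if "i \<in> I" for i
    using c(2)[OF that] by (simp add: x_def cinner_sum_right cinner_scaleC_right mult.commute)
  have "V' x = V x" by (simp add: V'_def Q_def xe)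
  moreover have "proj F x = x" using F by (simp add: x_def complex_linearD[OF proj_linear])
  ultimately have "\<mu> * (norm x)\<^sup>2 < l * (norm x)\<^sup>2"
    using gs(3)[OF F(1), of x] form[OF c(1) x_def] by simp
  hence \<mu>: "\<mu> < l" by (metis mult_right_mono not_less zero_le_power2)
  define s where "s i = cinner (\<epsilon> i) \<psi>" for i
  \<comment> \<open>In the perturbed operator \<open>\<epsilon> i\<close> is an eigenvector for
    \<open>\<nu> i + K \<ge> l\<close>, while \<open>\<psi>\<close> belongs to
    \<open>\<mu> < l\<close>; different eigenvalues make them orthogonal.\<close>
  have s0: "s i = 0" if i: "i \<in> I" for i
  proof -
    have "cinner (\<epsilon> i) (Q \<psi>) = s i"
      unfolding Q_def s_def using I i orth by (intro cinner_orthonormal_sum) auto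
    hence "cinner (\<epsilon> i) (V' \<psi>) = cinner (\<epsilon> i) (V \<psi>) + complex_of_real K * s i"
      using I i by (simp add: V'_def cinner_add_right cinner_scaleC_right)
    moreover have "cinner (\<epsilon> i) (complex_of_real \<mu> *\<^sub>C \<psi> - V' \<psi>)
        = cinner (complex_of_real (\<nu> i) *\<^sub>C \<epsilon> i - V (\<epsilon> i)) \<psi>"
      using gs(2) \<epsilon>[OF i] by (intro mgraph_symmetric) (auto simp: eigenspace_pgraph)
    ultimately have "complex_of_real (\<mu> - \<nu> i - K) * s i = 0"
      by (simp add: cinner_diff_left cinner_diff_right cinner_scaleC_left cinner_scaleC_right VD(2)
        s_def algebra_simps)
    moreover have "complex_of_real (\<mu> - \<nu> i - K) \<noteq> 0"
      unfolding of_real_eq_0_iff using K(1)[OF i] \<mu> by linarith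
    ultimately show ?thesis by (metis mult_eq_0_iff)
  qed
  have "V' \<psi> = V \<psi>" using s0 by (simp add: V'_def Q_def s_def)
  thus ?thesis using gs \<mu> s0
    by (intro exI[of _ \<psi>] exI[of _ \<mu>]) (auto simp: eigenspace_pgraph s_def)
qed

lemma ex_orthonormal_eigenvectors:
  fixes f :: "'j \<Rightarrow> 'h"
  assumes w: "\<And>n. 0 \<le> w n" "\<And>c. finite {n. w n \<le> c}" and V: "hermitian_bounded M V"
    and J: "finite J" and F: "finite F" "\<And>j. j \<in> J \<Longrightarrow> proj F (f j) = f j"
    and form: "\<And>c x. (\<exists>j\<in>J. c j \<noteq> 0) \<Longrightarrow> x = (\<Sum>j\<in>J. c j *\<^sub>C f j) \<Longrightarrow>
        energy w F x + Re (cinner x (V x)) < l * (norm x)\<^sup>2"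
  shows "\<exists>\<epsilon> \<nu>. (\<forall>i<card J. \<nu> i < l \<and> \<epsilon> i \<in> eigenspace (pgraph w V) (\<nu> i)) \<and>
      (\<forall>i<card J. \<forall>j<card J. cinner (\<epsilon> i) (\<epsilon> j) = (if i = j then 1 else 0))"
proof -
  have "\<exists>\<epsilon> \<nu>. (\<forall>i<k. \<nu> i < l \<and> \<epsilon> i \<in> eigenspace (pgraph w V) (\<nu> i)) \<and>
      (\<forall>i<k. \<forall>j<k. cinner (\<epsilon> i) (\<epsilon> j) = (if i = j then 1 else 0))" if "k \<le> card J" for k :: nat
    using that
  proof (induction k)
    case (Suc k)
    then obtain \<epsilon> \<nu> where en: "\<And>i. i < k \<Longrightarrow> \<nu> i < l \<and> \<epsilon> i \<in> eigenspace (pgraph w V) (\<nu> i)"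
      "\<And>i j. i < k \<Longrightarrow> j < k \<Longrightarrow> cinner (\<epsilon> i) (\<epsilon> j) = (if i = j then 1 else 0)" by auto
    have "\<exists>\<psi> \<mu>. norm \<psi> = 1 \<and> \<mu> < l \<and> \<psi> \<in> eigenspace (pgraph w V) \<mu> \<and> (\<forall>i\<in>{..<k}. cinner (\<epsilon> i) \<psi> = 0)"
    proof (rule next_eigenvector[OF w V J F, where \<nu> = \<nu> and l = l])
      fix c x assume "\<exists>j\<in>J. c j \<noteq> 0" "x = (\<Sum>j\<in>J. c j *\<^sub>C f j)"
      thus "energy w F x + Re (cinner x (V x)) < l * (norm x)\<^sup>2" by (rule form)
    qed (use en Suc.prems in auto)
    then obtain \<psi> \<mu> where p: "norm \<psi> = 1" "\<mu> < l" "\<psi> \<in> eigenspace (pgraph w V) \<mu>"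
      "\<And>i. i < k \<Longrightarrow> cinner (\<epsilon> i) \<psi> = 0" by auto
    have p': "cinner \<psi> (\<epsilon> i) = 0" if "i < k" for i
      using p(4)[OF that] by (metis cinner_commute complex_cnj_zero)
    have "cinner \<psi> \<psi> = 1" using p(1) by (simp add: cinner_self)
    hence ob: "cinner ((\<epsilon>(k := \<psi>)) i) ((\<epsilon>(k := \<psi>)) j) = (if i = j then 1 else 0)"
      if "i < Suc k" "j < Suc k" for i j
      using en(2)[of i j] p(4)[of i] p'[of j] that by (cases "i = k"; cases "j = k") simp_all
    have eb: "(\<nu>(k := \<mu>)) i < l \<and> (\<epsilon>(k := \<psi>)) i \<in> eigenspace (pgraph w V) ((\<nu>(k := \<mu>)) i)"
      if "i < Suc k" for i
      using en(1)[of i] p(2,3) that by (cases "i = k") simp_all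
    show ?case
    proof (rule exI[of _ "\<epsilon>(k := \<psi>)"], rule exI[of _ "\<nu>(k := \<mu>)"], rule conjI; rule allI; rule impI)
      show "(\<nu>(k := \<mu>)) i < l \<and> (\<epsilon>(k := \<psi>)) i \<in> eigenspace (pgraph w V) ((\<nu>(k := \<mu>)) i)"
        if "i < Suc k" for i by (rule eb[OF that])
      show "\<forall>j<Suc k. cinner ((\<epsilon>(k := \<psi>)) i) ((\<epsilon>(k := \<psi>)) j) = (if i = j then 1 else 0)"
        if "i < Suc k" for i using ob[OF that] by blast
    qed
  qed simp
  from this[OF order_refl] show ?thesis .
qed

text \<open>The lower half of the min-max principle. The orthonormal eigenvectors constructed before
  only have to be grouped by eigenvalue; each group is an independent set, as counted by
  \<open>multiplicity_of\<close>.\<close>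

lemma ge_counting_function:
  fixes f :: "'j \<Rightarrow> 'h"
  assumes w: "\<And>n. 0 \<le> w n" "\<And>c. finite {n. w n \<le> c}" and V: "hermitian_bounded M V"
    and J: "finite J" and F: "finite F" "\<And>j. j \<in> J \<Longrightarrow> proj F (f j) = f j"
    and form: "\<And>c x. (\<exists>j\<in>J. c j \<noteq> 0) \<Longrightarrow> x = (\<Sum>j\<in>J. c j *\<^sub>C f j) \<Longrightarrow>
        energy w F x + Re (cinner x (V x)) < l * (norm x)\<^sup>2"
  shows "of_nat (card J) \<le> counting_function l (pgraph w V)"
proof -
  obtain \<epsilon> \<nu> where en: "\<And>i. i < card J \<Longrightarrow> \<nu> i < l \<and> \<epsilon> i \<in> eigenspace (pgraph w V) (\<nu> i)"
      "\<And>i j. i < card J \<Longrightarrow> j < card J \<Longrightarrow> cinner (\<epsilon> i) (\<epsilon> j) = (if i = j then 1 else 0)"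
  proof -
    have "\<exists>\<epsilon> \<nu>. (\<forall>i<card J. \<nu> i < l \<and> \<epsilon> i \<in> eigenspace (pgraph w V) (\<nu> i)) \<and>
      (\<forall>i<card J. \<forall>j<card J. cinner (\<epsilon> i) (\<epsilon> j) = (if i = j then 1 else 0))"
      by (rule ex_orthonormal_eigenvectors[OF w V J F(1)]) (erule F(2), erule (1) form)
    thus thesis using that by metis
  qed
  define I where "I = {..<card J}"
  define B where "B \<mu> = \<epsilon> ` {i\<in>I. \<nu> i = \<mu>}" for \<mu>
  have inj: "inj_on \<epsilon> I"
  proof (rule inj_onI)
    fix i j assume ij: "i \<in> I" "j \<in> I" "\<epsilon> i = \<epsilon> j"
    show "i = j" using en(2)[of i i] en(2)[of i j] ij by (auto simp: I_def split: if_splits)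
  qed
  have mult: "of_nat (card {i\<in>I. \<nu> i = \<mu>}) \<le> multiplicity_of (pgraph w V) \<mu>" for \<mu>
  proof -
    have "complex_vector.independent (B \<mu>)"
    proof -
      have "u v = 0" if v: "v \<in> B \<mu>" and s: "(\<Sum>v\<in>B \<mu>. u v *\<^sub>C v) = 0" for u v
      proof -
        obtain i where i: "i \<in> I" "v = \<epsilon> i" using v by (auto simp: B_def)
        have "0 = cinner v (\<Sum>v\<in>B \<mu>. u v *\<^sub>C v)" using s by simp
        also have "\<dots> = (\<Sum>x\<in>B \<mu>. if x = v then u v else 0)"
          unfolding cinner_sum_right cinner_scaleC_right
          using i by (intro sum.cong refl) (auto simp: B_def I_def en(2) split: if_splits)
        also have "\<dots> = u v" using v by (simp add: B_def I_def)
        finally show ?thesis by simp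
      qed
      thus ?thesis
        using complex_vector.dependent_finite[of "B \<mu>"] by (auto simp: B_def I_def)
    qed
    moreover have "card (B \<mu>) = card {i\<in>I. \<nu> i = \<mu>}"
      unfolding B_def by (intro card_image inj_on_subset[OF inj]) auto
    moreover have "finite (B \<mu>)" "B \<mu> \<subseteq> eigenspace (pgraph w V) \<mu>"
      using en(1) by (auto simp: B_def I_def)
    ultimately show ?thesis unfolding multiplicity_of_def by (intro SUP_upper2[of "B \<mu>"]) auto
  qed
  have "card J = (\<Sum>\<mu>\<in>\<nu> ` I. card {i\<in>I. \<nu> i = \<mu>})"
    using sum.image_gen[of I "\<lambda>_. 1 :: nat" \<nu>] by (simp add: I_def)
  hence "of_nat (card J) = (\<Sum>\<mu>\<in>\<nu> ` I. of_nat (card {i\<in>I. \<nu> i = \<mu>}) :: ennreal)" by (metis of_nat_sum)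
  also have "\<dots> \<le> (\<Sum>\<mu>\<in>\<nu> ` I. multiplicity_of (pgraph w V) \<mu>)" by (intro sum_mono mult)
  also have "\<dots> \<le> counting_function l (pgraph w V)"
    unfolding counting_function_def
    by (subst nonneg_infsum_complete) (use en(1) in \<open>auto simp: I_def intro!: SUP_upper\<close>)
  finally show ?thesis .
qed


text \<open>The finite-dimensional spectral theorem, drawn from the variational construction: the
  compression of \<open>Y\<close> to the modes in \<open>Q\<close> is embedded into an operator on
  the whole space by a penalty outside \<open>Q\<close>.\<close>

lemma eigenbasis_compression:
  fixes w :: "'n \<Rightarrow> real"
  assumes w0: "\<And>n. 0 \<le> w n" "\<And>c. finite {n. w n \<le> c}" and Y: "hermitian_bounded M Y" and Q: "finite Q"
  obtains \<psi> \<nu> where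
    "\<And>i j. i < card Q \<Longrightarrow> j < card Q \<Longrightarrow> cinner (\<psi> i) (\<psi> j) = (if i = j then 1 else 0)"
    "\<And>i. i < card Q \<Longrightarrow> proj Q (\<psi> i) = \<psi> i"
    "\<And>i. i < card Q \<Longrightarrow> proj Q (Y (\<psi> i)) = complex_of_real (\<nu> i) *\<^sub>C \<psi> i"
    "\<And>i. i < card Q \<Longrightarrow> \<bar>\<nu> i\<bar> \<le> M"
    "\<And>x. proj Q x = x \<Longrightarrow> x = (\<Sum>i<card Q. cinner (\<psi> i) x *\<^sub>C \<psi> i)"
proof -
  note YD = hermitian_boundedD[OF Y] and Yl = complex_linearD[OF hermitian_boundedD(1)[OF Y]]
  note pl = complex_linearD[OF proj_linear]
  define m where "m = card Q"
  define V where "V x = proj Q (Y (proj Q x))" for x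
  \<comment> \<open>The weight is zero on \<open>Q\<close> and at least \<open>M + 1\<close>
    elsewhere, so eigenvectors below \<open>M + 1\<close> live on \<open>Q\<close> and belong to the
    compression alone. The summand \<open>w n\<close> keeps the sublevel sets finite.\<close>
  define u where "u n = (if n \<in> Q then 0 else w n + (M + 1))" for n
  obtain n0 :: 'n where True by blast
  have M0: "0 \<le> M" using YD(3)[of "e n0"] norm_ge_zero[of "Y (e n0)"] by (simp del: norm_ge_zero)
  have u: "0 \<le> u n" "finite {n. u n \<le> c}" for n c
  proof -
    show "0 \<le> u n" using w0(1)[of n] M0 by (simp add: u_def)
    have "{n. u n \<le> c} \<subseteq> Q \<union> {n. w n \<le> c}" using M0 by (auto simp: u_def)
    thus "finite {n. u n \<le> c}" using Q w0(2) finite_subset by blast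
  qed
  have V: "hermitian_bounded M V"
    unfolding hermitian_bounded_def
  proof (intro conjI allI)
    show "complex_linear V" by (simp add: complex_linear_def V_def pl Yl)
    show "cinner (V x) y = cinner x (V y)" for x y by (simp add: V_def proj_sym YD(2))
    show "norm (V x) \<le> M * norm x" for x
    proof -
      have "norm (V x) \<le> norm (Y (proj Q x))" unfolding V_def by (rule norm_proj_le[OF Q])
      also have "\<dots> \<le> M * norm (proj Q x)" by (rule YD(3))
      also have "\<dots> \<le> M * norm x" by (intro mult_left_mono norm_proj_le Q M0)
      finally show ?thesis .
    qed
  qed
  have pe: "proj Q (e j) = e j" if "j \<in> Q" for j
    by (rule proj_eqI[OF Q]) (use that in \<open>auto simp: ortho\<close>)
  have form: "energy u Q x + Re (cinner x (V x)) < (M + 1) * (norm x)\<^sup>2"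
    if c: "\<exists>j\<in>Q. c j \<noteq> 0" "x = (\<Sum>j\<in>Q. c j *\<^sub>C e j)" for c x
  proof -
    obtain j where j: "j \<in> Q" "c j \<noteq> 0" using c by blast
    have "cinner (e j) x = c j" unfolding c(2) using j Q by (simp add: coeff_sum)
    hence "x \<noteq> 0" using j by auto
    hence "M * (norm x)\<^sup>2 < (M + 1) * (norm x)\<^sup>2" by simp
    moreover have "energy u Q x = 0" by (simp add: energy_def u_def)
    ultimately show ?thesis using hermitian_form_bound[OF V, of x] by simp
  qed
  obtain \<psi> \<nu> where en: "\<And>i. i < m \<Longrightarrow> \<nu> i < M + 1 \<and> \<psi> i \<in> eigenspace (pgraph u V) (\<nu> i)"
      "\<And>i j. i < m \<Longrightarrow> j < m \<Longrightarrow> cinner (\<psi> i) (\<psi> j) = (if i = j then 1 else 0)"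
  proof -
    have "\<exists>\<epsilon> \<nu>. (\<forall>i<card Q. \<nu> i < M + 1 \<and> \<epsilon> i \<in> eigenspace (pgraph u V) (\<nu> i)) \<and>
      (\<forall>i<card Q. \<forall>j<card Q. cinner (\<epsilon> i) (\<epsilon> j) = (if i = j then 1 else 0))"
      by (rule ex_orthonormal_eigenvectors[OF u V Q Q]) (erule pe, erule (1) form)
    thus thesis using that unfolding m_def by metis
  qed
  have co: "complex_of_real (u n) * cinner (e n) (\<psi> i)
      = complex_of_real (\<nu> i) * cinner (e n) (\<psi> i) - cinner (e n) (V (\<psi> i))" if "i < m" for i n
    using en(1)[OF that] by (simp add: eigenspace_pgraph mgraph_def cinner_diff_right cinner_scaleC_right)
  have p\<psi>: "proj Q (\<psi> i) = \<psi> i" if i: "i < m" for i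
  proof (rule proj_eqI[OF Q])
    fix n assume n: "n \<notin> Q"
    hence "complex_of_real (u n - \<nu> i) * cinner (e n) (\<psi> i) = 0"
      using co[OF i, of n] by (simp add: V_def coeff_proj Q algebra_simps)
    moreover have "complex_of_real (u n - \<nu> i) \<noteq> 0"
      unfolding of_real_eq_0_iff using en(1)[OF i] n w0(1)[of n] by (auto simp: u_def)
    ultimately show "cinner (e n) (\<psi> i) = 0" by (metis mult_eq_0_iff)
  qed
  have ev: "proj Q (Y (\<psi> i)) = complex_of_real (\<nu> i) *\<^sub>C \<psi> i" if i: "i < m" for i
  proof (rule coeff_eqI)
    fix n
    show "cinner (e n) (proj Q (Y (\<psi> i))) = cinner (e n) (complex_of_real (\<nu> i) *\<^sub>C \<psi> i)"
    proof (cases "n \<in> Q")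
      case True
      thus ?thesis using co[OF i, of n] p\<psi>[OF i] by (simp add: V_def u_def cinner_scaleC_right)
    next
      case False
      have "cinner (e n) (\<psi> i) = 0" using coeff_proj[OF Q, of n "\<psi> i"] p\<psi>[OF i] False by simp
      thus ?thesis using False by (simp add: coeff_proj Q cinner_scaleC_right)
    qed
  qed
  have n\<psi>: "norm (\<psi> i) = 1" if i: "i < m" for i
    by (rule cinner_self_eq_1) (simp add: en(2) i)
  have b\<nu>: "\<bar>\<nu> i\<bar> \<le> M" if i: "i < m" for i
  proof -
    have "cinner (\<psi> i) (Y (\<psi> i)) = cinner (\<psi> i) (proj Q (Y (\<psi> i)))"
      using p\<psi>[OF i] by (metis proj_sym)
    also have "\<dots> = complex_of_real (\<nu> i)" using en(2)[OF i i] by (simp add: ev[OF i] cinner_scaleC_right)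
    finally show ?thesis using hermitian_form_bound[OF Y, of "\<psi> i"] n\<psi>[OF i] by simp
  qed
  \<comment> \<open>A nonzero remainder \<open>r\<close> would be one more vector orthogonal to all
    \<open>\<psi> i\<close>. These \<open>m + 1\<close> vectors have only \<open>m\<close>
    coordinates and hence satisfy a linear relation, whose coefficients vanish by
    orthogonality.\<close>
  have sp: "x = (\<Sum>i<m. cinner (\<psi> i) x *\<^sub>C \<psi> i)" if x: "proj Q x = x" for x
  proof (rule ccontr)
    assume ne: "x \<noteq> (\<Sum>i<m. cinner (\<psi> i) x *\<^sub>C \<psi> i)"
    define r where "r = x - (\<Sum>i<m. cinner (\<psi> i) x *\<^sub>C \<psi> i)"
    have r0: "r \<noteq> 0" using ne by (simp add: r_def)
    have or: "cinner (\<psi> i) r = 0" if i: "i < m" for i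
    proof -
      have "cinner (\<psi> i) (\<Sum>j<m. cinner (\<psi> j) x *\<^sub>C \<psi> j) = cinner (\<psi> i) x"
        using i en(2) by (intro cinner_orthonormal_sum) auto
      thus ?thesis using i by (simp add: r_def cinner_diff_right)
    qed
    have pr: "proj Q r = r" using x p\<psi> by (simp add: r_def pl)
    define v where "v i = (if i < m then \<psi> i else r)" for i
    have "card Q < card {..m}" by (simp add: m_def)
    then obtain c where c: "\<exists>i\<in>{..m}. c i \<noteq> 0" "\<forall>n\<in>Q. (\<Sum>i\<in>{..m}. cinner (e n) (v i) * c i) = 0"
      using underdetermined_system[OF Q, of "{..m}" "\<lambda>n i. cinner (e n) (v i)"] by auto
    define z where "z = (\<Sum>i\<le>m. c i *\<^sub>C v i)"
    have pv: "proj Q (v i) = v i" for i using p\<psi> pr by (simp add: v_def)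
    have "z = 0"
    proof (rule coeff_eqI)
      fix n
      have "proj Q z = z" by (simp add: z_def pl pv)
      moreover have "n \<in> Q \<Longrightarrow> cinner (e n) z = 0"
        using c(2) by (simp add: z_def cinner_sum_right cinner_scaleC_right mult.commute)
      ultimately show "cinner (e n) z = cinner (e n) 0"
        using coeff_proj[OF Q, of n z] by (cases "n \<in> Q") auto
    qed
    have or': "cinner r (\<psi> i) = 0" if "i < m" for i using or[OF that] by (metis cinner_commute complex_cnj_zero)
    have orv: "cinner (v i) (v j) = 0" if "i \<le> m" "j \<le> m" "i \<noteq> j" for i j
      using that by (auto simp: v_def or or' en(2))
    have "c i = 0" if i: "i \<le> m" for i
    proof -
      have "0 = cinner (v i) z" using \<open>z = 0\<close> by simp
      also have "\<dots> = (\<Sum>j\<le>m. if j = i then c i * cinner (v i) (v i) else 0)"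
        unfolding z_def cinner_sum_right cinner_scaleC_right
        using i by (intro sum.cong refl) (auto simp: orv)
      also have "\<dots> = c i * cinner (v i) (v i)" using i by simp
      finally have "c i * cinner (v i) (v i) = 0" by simp
      moreover have "v i \<noteq> 0" using r0 n\<psi>[of i] by (cases "i < m") (auto simp: v_def)
      ultimately show ?thesis by (simp add: cinner_self)
    qed
    thus False using c(1) by auto
  qed
  show ?thesis
    by (rule that[of \<psi> \<nu>]) (use en p\<psi> ev b\<nu> sp in \<open>simp_all add: m_def\<close>)
qed

end

section \<open>Finite range operators and boxes in momentum space\<close>

lemma bij_betw_vec_box:
  "bij_betw vec_lambda (PiE UNIV (\<lambda>_. S)) {n :: 'a^'d::finite. \<forall>j. n $ j \<in> S}"
  by (rule bij_betw_byWitness[where f' = vec_nth]) (auto simp: PiE_def)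

lemma card_vec_box: "card {n :: 'a^'d::finite. \<forall>j. n $ j \<in> S} = card S ^ CARD('d)"
  using bij_betw_same_card[OF bij_betw_vec_box[of S, where 'd = 'd]] by (simp add: card_PiE)

lemma finite_vec_box: "finite S \<Longrightarrow> finite {n :: 'a^'d::finite. \<forall>j. n $ j \<in> S}"
  using bij_betw_finite[OF bij_betw_vec_box[of S, where 'd = 'd]] by (simp add: finite_PiE)

definition real_vec :: "int^'d \<Rightarrow> real^'d::finite" where
  "real_vec n = (\<chi> j. real_of_int (n $ j))"

text \<open>The eigenvalue of \<open>-h^2 \<Delta>\<close> at momentum \<open>n\<close>.\<close>

definition kinetic :: "real \<Rightarrow> int^'d::finite \<Rightarrow> real" where
  "kinetic h n = (h * norm (real_vec n))\<^sup>2"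

lemma norm_real_vec: "(norm (real_vec n))\<^sup>2 = (\<Sum>j\<in>UNIV. (real_of_int (n $ j))\<^sup>2)"
  by (simp add: norm_vec_def L2_set_def real_vec_def sum_nonneg)

lemma component_le_norm_real_vec: "\<bar>real_of_int (n $ j)\<bar> \<le> norm (real_vec n)"
  using component_le_norm_cart[of "real_vec n" j] by (simp add: real_vec_def)

lemma finite_real_vec_ball: "finite {n. norm (real_vec n) \<le> r}"
proof -
  have "{n. norm (real_vec n) \<le> r} \<subseteq> {n. \<forall>j. n $ j \<in> {-\<lceil>r\<rceil>..\<lceil>r\<rceil>}}"
  proof (rule subsetI)
    fix n assume n: "n \<in> {n. norm (real_vec n) \<le> r}"
    have "n $ j \<in> {-\<lceil>r\<rceil>..\<lceil>r\<rceil>}" for j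
    proof -
      have "\<bar>real_of_int (n $ j)\<bar> \<le> r" using component_le_norm_real_vec[of n j] n by simp
      also have "r \<le> real_of_int \<lceil>r\<rceil>" by (rule le_of_int_ceiling)
      finally show ?thesis by (simp add: abs_le_iff minus_le_iff)
    qed
    thus "n \<in> {n. \<forall>j. n $ j \<in> {-\<lceil>r\<rceil>..\<lceil>r\<rceil>}}" by simp
  qed
  thus ?thesis using finite_vec_box[of "{-\<lceil>r\<rceil>..\<lceil>r\<rceil>}"] finite_subset by blast
qed

lemma kinetic_finite: "h > 0 \<Longrightarrow> finite {n. kinetic h n \<le> c}"
proof -
  assume h: "h > 0"
  have "{n. kinetic h n \<le> c} \<subseteq> {n. norm (real_vec n) \<le> sqrt c / h}"
  proof (rule subsetI)
    fix n assume "n \<in> {n. kinetic h n \<le> c}"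
    hence "(h * norm (real_vec n))\<^sup>2 \<le> c" by (simp add: kinetic_def)
    hence "h * norm (real_vec n) \<le> sqrt c" by (rule real_le_rsqrt)
    thus "n \<in> {n. norm (real_vec n) \<le> sqrt c / h}" using h by (simp add: field_simps)
  qed
  thus ?thesis using finite_real_vec_ball finite_subset by blast
qed

lemma norm_real_vec_box:
  fixes n :: "int^'d::finite"
  assumes "\<And>j. 0 \<le> n $ j \<and> n $ j < L"
  shows "norm (real_vec n) \<le> real_of_int L * sqrt CARD('d)"
proof -
  have L: "0 \<le> L" using assms by (meson less_le_not_le linorder_linear order_trans)
  have "(norm (real_vec n))\<^sup>2 \<le> (\<Sum>j\<in>(UNIV::'d set). (real_of_int L)\<^sup>2)"
    unfolding norm_real_vec by (intro sum_mono power_mono) (use assms in \<open>auto simp: less_imp_le\<close>)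
  also have "\<dots> = (real_of_int L * sqrt CARD('d))\<^sup>2" by (simp add: power_mult_distrib)
  finally show ?thesis by (rule power2_le_imp_le) (use L in simp)
qed

text \<open>An abstraction of left multiplication by a self-adjoint element. The phases
  \<open>u\<close> describe right multiplication by the monomial with exponent \<open>k\<close>,
  which sends \<open>e n\<close> to \<open>u k n *\<^sub>C e (n + k)\<close>;
  \<open>covariant\<close> expresses that this map is unitary and commutes with left
  multiplication.\<close>

locale finite_range = onb e for e :: "int^'d::finite \<Rightarrow> 'h::complex_hilbert_space" +
  fixes Y :: "'h \<Rightarrow> 'h" and M :: real and R :: int and u :: "int^'d \<Rightarrow> int^'d \<Rightarrow> complex"
  assumes Y: "hermitian_bounded M Y" and R: "0 \<le> R"
    and range: "R < \<bar>n $ j - m $ j\<bar> \<Longrightarrow> cinner (e n) (Y (e m)) = 0"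
    and phase: "cmod (u k n) = 1"
    and covariant: "cinner (u k n *\<^sub>C e (n + k)) (Y (u k m *\<^sub>C e (m + k))) = cinner (e n) (Y (e m))"
begin

lemmas Y_linear = complex_linearD[OF hermitian_boundedD(1)[OF Y]]
lemmas Y_sym = hermitian_boundedD(2)[OF Y]

lemma M_nonneg: "0 \<le> M"
  using hermitian_boundedD(3)[OF Y, of "e 0"] norm_ge_zero[of "Y (e 0)"] by (simp del: norm_ge_zero)

text \<open>Since \<open>z\<close> may have infinitely many modes, the vanishing of all relevant
  matrix elements is summed up by Parseval's identity for \<open>Y (e n)\<close> and
  \<open>z\<close>.\<close>

lemma decoupled:
  assumes A: "finite A" "proj A x = x"
    and z: "\<And>m n. cinner (e m) z \<noteq> 0 \<Longrightarrow> n \<in> A \<Longrightarrow> cinner (e n) (Y (e m)) = 0"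
  shows "cinner x (Y z) = 0" "cinner z (Y x) = 0"
proof -
  have 0: "cinner (e n) (Y z) = 0" if n: "n \<in> A" for n
  proof -
    have "cnj (cinner (e m) (Y (e n))) * cinner (e m) z = 0" for m
      using z[of m n] n by (metis Y_sym cinner_commute complex_cnj_zero mult_eq_0_iff)
    hence "(\<lambda>m. cnj (cinner (e m) (Y (e n))) * cinner (e m) z) = (\<lambda>_. 0)" by (rule ext)
    hence "((\<lambda>_ :: int^'d. 0) has_sum cinner (Y (e n)) z) UNIV" using parseval[of "Y (e n)" z] by (simp only:)
    hence "cinner (Y (e n)) z = 0" by (rule has_sum_unique) (rule has_sum_0, simp)
    thus ?thesis by (simp add: Y_sym)
  qed
  have "cinner (proj A x) (Y z) = 0" unfolding cinner_proj_left using 0 by simp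
  thus *: "cinner x (Y z) = 0" using A by simp
  show "cinner z (Y x) = 0" using * by (metis Y_sym cinner_commute complex_cnj_zero)
qed

end

text \<open>\<open>core k\<close> is the half-open cube of side \<open>L\<close> with corner
  \<open>L * k\<close>, stripped of a layer of width \<open>R\<close> at each face. For
  \<open>L \<le> 2 * R\<close> the cores are empty; later \<open>L\<close> is large. The eigenbasis
  is given on \<open>core 0\<close> only and transported to the other cores.\<close>

locale box_eigenbasis = finite_range e Y M R u
  for e :: "int^'d::finite \<Rightarrow> 'h::complex_hilbert_space" and Y M R u +
  fixes L :: int and core :: "int^'d \<Rightarrow> (int^'d) set" and \<psi> :: "nat \<Rightarrow> 'h" and \<nu> :: "nat \<Rightarrow> real"
  assumes L: "0 < L"
    and core_def: "core = (\<lambda>k. {n. \<forall>j. L * k $ j + R \<le> n $ j \<and> n $ j < L * k $ j + L - R})"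
    and \<psi>_ortho: "i < card (core 0) \<Longrightarrow> j < card (core 0) \<Longrightarrow> cinner (\<psi> i) (\<psi> j) = (if i = j then 1 else 0)"
    and \<psi>_support: "i < card (core 0) \<Longrightarrow> proj (core 0) (\<psi> i) = \<psi> i"
    and \<psi>_eigen: "i < card (core 0) \<Longrightarrow> proj (core 0) (Y (\<psi> i)) = complex_of_real (\<nu> i) *\<^sub>C \<psi> i"
    and \<psi>_complete: "proj (core 0) x = x \<Longrightarrow> x = (\<Sum>i<card (core 0). cinner (\<psi> i) x *\<^sub>C \<psi> i)"
begin

definition shift :: "int^'d \<Rightarrow> int^'d" where "shift k = (\<chi> j. L * k $ j)"

definition f :: "int^'d \<Rightarrow> int^'d \<Rightarrow> 'h" where "f k n = u (shift k) n *\<^sub>C e (n + shift k)"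

text \<open>In the torus \<open>f k n\<close> is \<open>e n\<close> multiplied from the right by a
  monomial. \<open>lift k\<close> is the resulting unitary from the modes in \<open>core 0\<close>
  onto those in \<open>core k\<close>, extended by zero, and \<open>restrict k\<close> is its
  adjoint.\<close>

definition lift :: "int^'d \<Rightarrow> 'h \<Rightarrow> 'h" where
  "lift k x = (\<Sum>n\<in>core 0. cinner (e n) x *\<^sub>C f k n)"

definition restrict :: "int^'d \<Rightarrow> 'h \<Rightarrow> 'h" where
  "restrict k x = (\<Sum>n\<in>core 0. cinner (f k n) x *\<^sub>C e n)"

lemma core_shift: "bij_betw (\<lambda>n. n + shift k) (core 0) (core k)"
  by (rule bij_betw_byWitness[where f' = "\<lambda>n. n - shift k"]) (auto simp: core_def shift_def le_diff_eq diff_less_eq algebra_simps)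

lemma card_core: "card (core k) = nat (L - 2 * R) ^ CARD('d)"
proof -
  have "core 0 = {n. \<forall>j. n $ j \<in> {R..<L - R}}" by (auto simp: core_def)
  hence "card (core 0) = nat (L - R - R) ^ CARD('d)"
    by (simp only: card_vec_box card_atLeastLessThan_int)
  also have "L - R - R = L - 2 * R" by simp
  finally have "card (core 0) = nat (L - 2 * R) ^ CARD('d)" .
  thus ?thesis using bij_betw_same_card[OF core_shift] by simp
qed

lemma finite_core [simp]: "finite (core k)"
proof -
  have "core 0 = {n. \<forall>j. n $ j \<in> {R..<L - R}}" by (auto simp: core_def)
  moreover have "finite {n :: int^'d. \<forall>j. n $ j \<in> {R..<L - R}}" by (rule finite_vec_box) simp
  ultimately have "finite (core 0)" by (simp only:)
  thus ?thesis using bij_betw_finite[OF core_shift] by simp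
qed

text \<open>The purpose of the removed layer: a step of length \<open>R\<close> from the core stays
  inside the same cube of side \<open>L\<close>. The cube containing \<open>m\<close> is found by
  coordinatewise division.\<close>

lemma core_neighbour:
  assumes "n \<in> core k" "\<And>j. \<bar>m $ j - n $ j\<bar> \<le> R" shows "(\<chi> j. m $ j div L) = k"
proof -
  have "m $ j div L = k $ j" for j
  proof (rule int_div_pos_eq[of _ _ _ "m $ j - L * k $ j"])
    have "L * k $ j + R \<le> n $ j \<and> n $ j < L * k $ j + L - R" using assms(1) by (simp add: core_def)
    thus "m $ j = L * k $ j + (m $ j - L * k $ j)" "0 \<le> m $ j - L * k $ j" "m $ j - L * k $ j < L"
      using assms(2)[of j] by auto
  qed
  thus ?thesis by (simp add: vec_eq_iff)
qed

lemma core_box: "n \<in> core k \<Longrightarrow> (\<chi> j. n $ j div L) = k"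
  using core_neighbour[of n k n] R by simp

lemma core_decoupled:
  "n \<in> core k \<Longrightarrow> (\<chi> j. m $ j div L) \<noteq> k \<Longrightarrow> cinner (e n) (Y (e m)) = 0"
  using core_neighbour[of n k m] range[of n _ m] by (metis abs_minus_commute not_le)

lemma core_disjoint: "n \<in> core k \<Longrightarrow> n \<in> core k' \<Longrightarrow> k = k'"
  using core_box by blast

lemma phase_mult: "cnj (u k n) * u k n = 1" "u k n * cnj (u k n) = 1"
  using cnj_mult_self[of "u k n"] by (simp_all add: phase mult.commute)

lemma f_ortho: "cinner (f k n) (f k m) = (if n = m then 1 else 0)"
  by (simp add: f_def cinner_scaleC_left cinner_scaleC_right ortho phase_mult)

lemma f_Y: "cinner (f k n) (Y (f k m)) = cinner (e n) (Y (e m))"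
  unfolding f_def by (rule covariant)

lemma lift_inner: "cinner (lift k x) (lift k y) = cinner (proj (core 0) x) y"
proof -
  have "cinner (lift k x) (lift k y)
      = (\<Sum>m\<in>core 0. cinner (e m) y * (\<Sum>n\<in>core 0. if n = m then cnj (cinner (e n) x) else 0))"
    unfolding lift_def cinner_sum_left cinner_sum_right cinner_scaleC_left cinner_scaleC_right f_ortho
    by (intro sum.cong refl arg_cong2[of _ _ _ _ "(*)"]) auto
  thus ?thesis by (simp add: cinner_proj_left mult.commute)
qed

lemma norm_lift: "proj (core 0) x = x \<Longrightarrow> norm (lift k x) = norm x"
proof -
  assume "proj (core 0) x = x"
  hence "complex_of_real ((norm (lift k x))\<^sup>2) = complex_of_real ((norm x)\<^sup>2)"
    unfolding cinner_self[symmetric] lift_inner by simp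
  hence "(norm (lift k x))\<^sup>2 = (norm x)\<^sup>2" unfolding of_real_eq_iff .
  thus ?thesis by (simp add: power2_eq_iff_nonneg)
qed

lemma lift_Y:
  assumes "proj (core 0) x = x" "proj (core 0) y = y"
  shows "cinner (lift k x) (Y (lift k y)) = cinner x (Y y)"
proof -
  have "cinner (lift k x) (Y (lift k y))
      = (\<Sum>m\<in>core 0. \<Sum>n\<in>core 0. cnj (cinner (e m) x) * (cinner (e n) y * cinner (e m) (Y (e n))))"
    unfolding lift_def Y_linear cinner_sum_left cinner_sum_right cinner_scaleC_left cinner_scaleC_right f_Y
    by (subst sum.swap) (simp add: sum_distrib_left mult_ac)
  also have "\<dots> = cinner (proj (core 0) x) (Y (proj (core 0) y))"
    unfolding proj_def Y_linear cinner_sum_left cinner_sum_right cinner_scaleC_left cinner_scaleC_right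
    by (subst sum.swap) (simp add: sum_distrib_left mult_ac)
  finally show ?thesis using assms by simp
qed

lemma lift_support: "proj (core k) (lift k x) = lift k x"
proof (rule proj_eqI)
  fix n assume n: "n \<notin> core k"
  have "n \<noteq> m + shift k" if "m \<in> core 0" for m
    using n that core_shift[of k] by (auto simp: bij_betw_def)
  thus "cinner (e n) (lift k x) = 0"
    by (auto simp: lift_def f_def cinner_sum_right cinner_scaleC_right ortho intro!: sum.neutral)
qed simp

lemma lift_sum: "lift k (\<Sum>i\<in>I. c i *\<^sub>C x i) = (\<Sum>i\<in>I. c i *\<^sub>C lift k (x i))"
  unfolding lift_def cinner_sum_right cinner_scaleC_right complex_vector.scale_sum_left
    complex_vector.scale_sum_right scaleC_scaleC
  by (rule sum.swap)

lemma restrict_support: "proj (core 0) (restrict k x) = restrict k x"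
  by (rule proj_eqI) (simp_all add: restrict_def coeff_sum)

lemma lift_restrict: "lift k (restrict k x) = proj (core k) x"
proof -
  have "lift k (restrict k x) = (\<Sum>n\<in>core 0. cinner (f k n) x *\<^sub>C f k n)"
    unfolding lift_def by (intro sum.cong refl) (simp add: restrict_def coeff_sum)
  also have "\<dots> = (\<Sum>n\<in>core 0. cinner (e (n + shift k)) x *\<^sub>C e (n + shift k))"
  proof (intro sum.cong refl)
    fix n
    have "cinner (f k n) x *\<^sub>C f k n = (cnj (u (shift k) n) * u (shift k) n) *\<^sub>C cinner (e (n + shift k)) x *\<^sub>C e (n + shift k)"
      by (simp add: f_def cinner_scaleC_left scaleC_scaleC mult_ac)
    thus "cinner (f k n) x *\<^sub>C f k n = cinner (e (n + shift k)) x *\<^sub>C e (n + shift k)"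
      by (simp add: phase_mult)
  qed
  also have "\<dots> = proj (core k) x"
    unfolding proj_def by (rule sum.reindex_bij_betw[OF core_shift])
  finally show ?thesis .
qed

lemma restrict_inner: "cinner y (restrict k x) = cinner (lift k y) x"
  unfolding restrict_def lift_def cinner_sum_right cinner_sum_left cinner_scaleC_left cinner_scaleC_right
  by (intro sum.cong refl) (metis cinner_commute mult.commute)

lemma compression_form:
  assumes y: "proj (core 0) y = y"
  shows "cinner y (Y y) = complex_of_real (\<Sum>i<card (core 0). \<nu> i * (cmod (cinner (\<psi> i) y))\<^sup>2)"
    and "(norm y)\<^sup>2 = (\<Sum>i<card (core 0). (cmod (cinner (\<psi> i) y))\<^sup>2)"
proof -
  let ?m = "card (core 0)"
  have "cinner y (Y y) = cinner y (proj (core 0) (Y y))" using y by (metis proj_sym)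
  also have "\<dots> = cinner y (proj (core 0) (Y (\<Sum>i<?m. cinner (\<psi> i) y *\<^sub>C \<psi> i)))"
    using \<psi>_complete[OF y] by simp
  also have "\<dots> = cinner y (\<Sum>i<?m. cinner (\<psi> i) y *\<^sub>C complex_of_real (\<nu> i) *\<^sub>C \<psi> i)"
    unfolding Y_linear complex_linearD[OF proj_linear]
    by (intro arg_cong[of _ _ "cinner y"] sum.cong refl) (simp add: \<psi>_eigen)
  also have "\<dots> = (\<Sum>i<?m. complex_of_real (\<nu> i) * (cinner y (\<psi> i) * cinner (\<psi> i) y))"
    by (simp add: cinner_sum_right cinner_scaleC_right mult_ac)
  also have "\<dots> = complex_of_real (\<Sum>i<?m. \<nu> i * (cmod (cinner (\<psi> i) y))\<^sup>2)" by (simp add: cinner_mult_swap)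
  finally show "cinner y (Y y) = complex_of_real (\<Sum>i<?m. \<nu> i * (cmod (cinner (\<psi> i) y))\<^sup>2)" .
  have "complex_of_real ((norm y)\<^sup>2) = cinner y (\<Sum>i<?m. cinner (\<psi> i) y *\<^sub>C \<psi> i)"
    unfolding cinner_self[symmetric] using \<psi>_complete[OF y] by simp
  also have "\<dots> = (\<Sum>i<?m. cinner y (\<psi> i) * cinner (\<psi> i) y)"
    by (simp add: cinner_sum_right cinner_scaleC_right mult_ac)
  also have "\<dots> = complex_of_real (\<Sum>i<?m. (cmod (cinner (\<psi> i) y))\<^sup>2)" by (simp add: cinner_mult_swap)
  finally show "(norm y)\<^sup>2 = (\<Sum>i<?m. (cmod (cinner (\<psi> i) y))\<^sup>2)" unfolding of_real_eq_iff .
qed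

text \<open>Every momentum in cube \<open>k\<close> differs from the corner \<open>L * k\<close> by
  at most \<open>L * sqrt d\<close>. The maximum with 0 keeps the lower bound valid for cubes near
  the origin, where the difference would be negative and its square meaningless.\<close>

lemma kinetic_core:
  assumes "n \<in> core k" "0 < h"
  shows "kinetic h n \<le> (h * L * (norm (real_vec k) + sqrt CARD('d)))\<^sup>2"
    and "(h * L * max 0 (norm (real_vec k) - sqrt CARD('d)))\<^sup>2 \<le> kinetic h n"
proof -
  define r where "r = n - shift k"
  have "0 \<le> r $ j \<and> r $ j < L" for j
  proof -
    have "L * k $ j + R \<le> n $ j \<and> n $ j < L * k $ j + L - R" using assms(1) by (simp add: core_def)
    thus ?thesis using R by (simp add: r_def shift_def)
  qed
  hence r: "norm (real_vec r) \<le> L * sqrt CARD('d)" by (rule norm_real_vec_box)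
  have n: "real_vec n = real_of_int L *\<^sub>R real_vec k + real_vec r"
    by (simp add: real_vec_def r_def shift_def vec_eq_iff)
  have nk: "norm (real_of_int L *\<^sub>R real_vec k) = L * norm (real_vec k)" using L by simp
  have aL: "\<bar>real_of_int L\<bar> = L" using L by simp
  have "norm (real_vec n) \<le> L * norm (real_vec k) + L * sqrt CARD('d)"
    using norm_triangle_ineq[of "real_of_int L *\<^sub>R real_vec k" "real_vec r"] r nk n aL by simp
  hence "h * norm (real_vec n) \<le> h * L * (norm (real_vec k) + sqrt CARD('d))"
    using mult_left_mono[of "norm (real_vec n)" "L * norm (real_vec k) + L * sqrt CARD('d)" h] assms(2)
    by (simp add: algebra_simps)
  thus "kinetic h n \<le> (h * L * (norm (real_vec k) + sqrt CARD('d)))\<^sup>2"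
    unfolding kinetic_def using assms(2) by (intro power_mono) auto
  have "L * norm (real_vec k) - L * sqrt CARD('d) \<le> norm (real_vec n)"
    using norm_diff_ineq[of "real_of_int L *\<^sub>R real_vec k" "real_vec r"] r nk n aL by simp
  hence "L * max 0 (norm (real_vec k) - sqrt CARD('d)) \<le> norm (real_vec n)"
    by (auto simp: max_def algebra_simps)
  hence "h * L * max 0 (norm (real_vec k) - sqrt CARD('d)) \<le> h * norm (real_vec n)"
    using assms(2) by (simp add: mult.assoc)
  thus "(h * L * max 0 (norm (real_vec k) - sqrt CARD('d)))\<^sup>2 \<le> kinetic h n"
    unfolding kinetic_def using assms(2) L by (intro power_mono) auto
qed


lemma lift_support_coeff: "n \<notin> core k \<Longrightarrow> proj (core k) x = x \<Longrightarrow> cinner (e n) x = 0"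
  using coeff_proj[OF finite_core, of n k x] by simp

lemma blocks_orthogonal:
  assumes "proj (core k) x = x" "proj (core k') x' = x'" "k \<noteq> k'"
  shows "cinner x x' = 0"
proof -
  have "cinner (e n) x' = 0" if "n \<in> core k" for n
    using lift_support_coeff[of n k' x'] core_disjoint[OF that, of k'] assms(2,3) by blast
  hence "cinner (proj (core k) x) x' = 0"
    unfolding cinner_proj_left by (intro sum.neutral) simp
  thus ?thesis using assms(1) by simp
qed

lemma blocks_decoupled:
  assumes "proj (core k) x = x" "proj (core k') x' = x'" "k \<noteq> k'"
  shows "cinner x (Y x') = 0"
proof (rule decoupled(1)[OF finite_core assms(1)])
  fix m n assume m: "cinner (e m) x' \<noteq> 0" and n: "n \<in> core k"
  have "m \<in> core k'" using lift_support_coeff[of m k' x'] assms(2) m by blast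
  hence "(\<chi> j. m $ j div L) = k'" by (rule core_box)
  thus "cinner (e n) (Y (e m)) = 0" using core_decoupled[OF n, of m] assms(3) by simp
qed

lemma block_sums:
  assumes K: "finite K" and x: "\<And>k. k \<in> K \<Longrightarrow> proj (core k) (x k) = x k"
  shows "(norm (sum x K))\<^sup>2 = (\<Sum>k\<in>K. (norm (x k))\<^sup>2)"
    and "cinner (sum x K) (Y (sum x K)) = (\<Sum>k\<in>K. cinner (x k) (Y (x k)))"
proof -
  have "complex_of_real ((norm (sum x K))\<^sup>2) = (\<Sum>k'\<in>K. \<Sum>k\<in>K. if k' = k then cinner (x k) (x k) else 0)"
    unfolding cinner_self[symmetric] cinner_sum_left cinner_sum_right
    by (subst sum.swap) (intro sum.cong refl, auto intro!: blocks_orthogonal x)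
  also have "\<dots> = complex_of_real (\<Sum>k\<in>K. (norm (x k))\<^sup>2)" using K by (subst sum.swap) (simp add: cinner_self)
  finally show "(norm (sum x K))\<^sup>2 = (\<Sum>k\<in>K. (norm (x k))\<^sup>2)" unfolding of_real_eq_iff .
  have "cinner (sum x K) (Y (sum x K)) = (\<Sum>k'\<in>K. \<Sum>k\<in>K. if k' = k then cinner (x k) (Y (x k)) else 0)"
    unfolding Y_linear cinner_sum_left cinner_sum_right
    by (subst sum.swap) (intro sum.cong refl, auto intro!: blocks_decoupled x)
  also have "\<dots> = (\<Sum>k\<in>K. cinner (x k) (Y (x k)))" using K by (subst sum.swap) simp
  finally show "cinner (sum x K) (Y (sum x K)) = (\<Sum>k\<in>K. cinner (x k) (Y (x k)))" .
qed

lemma coeff_block_sum: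
  assumes K: "finite K" and x: "\<And>k. k \<in> K \<Longrightarrow> proj (core k) (x k) = x k" and k: "k \<in> K" "n \<in> core k"
  shows "cinner (e n) (sum x K) = cinner (e n) (x k)"
proof -
  have "cinner (e n) (sum x K) = (\<Sum>k'\<in>K. if k' = k then cinner (e n) (x k) else 0)"
    unfolding cinner_sum_right
  proof (intro sum.cong refl)
    fix k' assume k': "k' \<in> K"
    show "cinner (e n) (x k') = (if k' = k then cinner (e n) (x k) else 0)"
      using lift_support_coeff[OF _ x[OF k'], of n] core_disjoint[OF k(2), of k'] by auto
  qed
  thus ?thesis using K k by simp
qed

text \<open>The trial space is spanned by the vectors \<open>lift k (\<psi> i)\<close> with
  \<open>\<nu> i + T k < l - \<epsilon>\<close>, where \<open>T k\<close> bounds the kinetic energy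
  on cube \<open>k\<close>; solving for \<open>norm (real_vec k)\<close> gives the radius in the
  statement. If \<open>\<nu> i \<ge> l - \<epsilon>\<close>, the maximum makes this radius negative
  and the set empty.\<close>

lemma ge_counting_blocks:
  fixes h l \<epsilon> N :: real and V :: "'h \<Rightarrow> 'h"
  assumes V: "hermitian_bounded N V" and h: "0 < h"
    and close: "\<And>x. Re (cinner x (V x)) \<le> Re (cinner x (Y x)) + \<epsilon> * (norm x)\<^sup>2"
  shows "of_nat (\<Sum>i<card (core 0). card {k :: int^'d. norm (real_vec k) <
      sqrt (max 0 (l - \<epsilon> - \<nu> i)) / (h * L) - sqrt CARD('d)}) \<le> counting_function l (pgraph (kinetic h) V)"
proof -
  let ?m = "card (core 0)"
  define A where "A i = {k :: int^'d. norm (real_vec k) < sqrt (max 0 (l - \<epsilon> - \<nu> i)) / (h * L) - sqrt CARD('d)}" for i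
  define J where "J = Sigma {..<?m} A"
  define T where "T k = (h * L * (norm (real_vec k) + sqrt CARD('d)))\<^sup>2" for k :: "int^'d"
  define K where "K = snd ` J"
  define F where "F = (\<Union>k\<in>K. core k)"
  have fA: "finite (A i)" for i
    unfolding A_def by (rule finite_subset[OF _ finite_real_vec_ball]) (auto intro: less_imp_le)
  have J: "finite J" "card J = (\<Sum>i<?m. card (A i))" using fA by (simp_all add: J_def)
  have K: "finite K" and F: "finite F" using J by (simp_all add: K_def F_def)
  have TA: "\<nu> i + T k < l - \<epsilon>" if "k \<in> A i" for i k
  proof -
    have hL: "0 < h * L" using h L by simp
    have "norm (real_vec k) + sqrt CARD('d) < sqrt (max 0 (l - \<epsilon> - \<nu> i)) / (h * L)"
      using that by (simp add: A_def)
    hence "h * L * (norm (real_vec k) + sqrt CARD('d)) < sqrt (max 0 (l - \<epsilon> - \<nu> i))"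
      using hL by (simp add: field_simps)
    hence "T k < (sqrt (max 0 (l - \<epsilon> - \<nu> i)))\<^sup>2"
      unfolding T_def using h L by (intro power_strict_mono) auto
    hence "T k < max 0 (l - \<epsilon> - \<nu> i)" by simp
    moreover have "0 \<le> T k" by (simp add: T_def)
    ultimately show ?thesis by (auto simp: max_def split: if_splits)
  qed
  have "of_nat (card J) \<le> counting_function l (pgraph (kinetic h) V)"
  proof (rule ge_counting_function[where w = "kinetic h" and f = "\<lambda>p. lift (snd p) (\<psi> (fst p))", OF _ kinetic_finite[OF h] V J(1) F])
    show "0 \<le> kinetic h n" for n :: "int^'d" by (simp add: kinetic_def)
    show "proj F (lift (snd p) (\<psi> (fst p))) = lift (snd p) (\<psi> (fst p))" if p: "p \<in> J" for p
    proof (rule proj_eqI[OF F])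
      fix n assume "n \<notin> F"
      hence "n \<notin> core (snd p)" using p by (auto simp: F_def K_def)
      thus "cinner (e n) (lift (snd p) (\<psi> (fst p))) = 0" by (rule lift_support_coeff[OF _ lift_support])
    qed
  next
    fix c x assume c: "\<exists>p\<in>J. c p \<noteq> 0" and x: "x = (\<Sum>p\<in>J. c p *\<^sub>C lift (snd p) (\<psi> (fst p)))"
    \<comment> \<open>Extension of \<open>c\<close> by zero from \<open>J\<close> to a full
      rectangle of pairs, which allows the sum to be regrouped cube by cube.\<close>
    define d where "d i k = (if (i, k) \<in> J then c (i, k) else 0)" for i k
    define y where "y k = (\<Sum>i<?m. d i k *\<^sub>C \<psi> i)" for k
    define X where "X k = lift k (y k)" for k
    have "x = (\<Sum>p\<in>{..<?m} \<times> K. d (fst p) (snd p) *\<^sub>C lift (snd p) (\<psi> (fst p)))"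
      unfolding x using K
      by (intro sum.mono_neutral_cong_left) (auto simp: d_def J_def K_def image_iff)
    also have "\<dots> = (\<Sum>k\<in>K. \<Sum>i<?m. d i k *\<^sub>C lift k (\<psi> i))"
      by (subst sum.swap) (simp add: sum.cartesian_product case_prod_beta)
    finally have xX: "x = sum X K" by (simp add: X_def y_def lift_sum)
    have Xs: "proj (core k) (X k) = X k" for k by (simp add: X_def lift_support)
    have ys: "proj (core 0) (y k) = y k" for k
      unfolding y_def complex_linearD[OF proj_linear] by (intro sum.cong refl) (simp add: \<psi>_support)
    have co: "cinner (\<psi> i) (y k) = d i k" if i: "i < ?m" for i k
      unfolding y_def using i \<psi>_ortho by (intro cinner_orthonormal_sum) auto
    have n2: "(norm x)\<^sup>2 = (\<Sum>k\<in>K. \<Sum>i<?m. (cmod (d i k))\<^sup>2)"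
      unfolding xX block_sums(1)[OF K Xs] X_def norm_lift[OF ys] compression_form(2)[OF ys]
      by (intro sum.cong refl) (simp add: co)
    have "cinner x (Y x) = (\<Sum>k\<in>K. complex_of_real (\<Sum>i<?m. \<nu> i * (cmod (d i k))\<^sup>2))"
      unfolding xX block_sums(2)[OF K Xs] X_def lift_Y[OF ys ys] compression_form(1)[OF ys]
      by (intro sum.cong refl arg_cong[of _ _ complex_of_real]) (simp add: co)
    hence Yf: "Re (cinner x (Y x)) = (\<Sum>k\<in>K. \<Sum>i<?m. \<nu> i * (cmod (d i k))\<^sup>2)" by simp
    have "energy (kinetic h) F x = (\<Sum>k\<in>K. \<Sum>n\<in>core k. kinetic h n * (cmod (cinner (e n) x))\<^sup>2)"
      unfolding energy_def F_def using K core_disjoint by (intro sum.UNION_disjoint) auto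
    also have "\<dots> \<le> (\<Sum>k\<in>K. \<Sum>n\<in>core k. T k * (cmod (cinner (e n) (X k)))\<^sup>2)"
      using kinetic_core(1)[OF _ h]
      by (intro sum_mono mult_mono) (auto simp: T_def xX coeff_block_sum[OF K Xs])
    also have "\<dots> = (\<Sum>k\<in>K. T k * (norm (X k))\<^sup>2)"
      by (intro sum.cong refl) (simp add: sum_distrib_left[symmetric] norm_proj_sq[OF finite_core, symmetric] Xs)
    also have "\<dots> = (\<Sum>k\<in>K. \<Sum>i<?m. T k * (cmod (d i k))\<^sup>2)"
      unfolding X_def norm_lift[OF ys] compression_form(2)[OF ys]
      by (intro sum.cong refl) (simp add: co sum_distrib_left)
    finally have en: "energy (kinetic h) F x \<le> (\<Sum>k\<in>K. \<Sum>i<?m. T k * (cmod (d i k))\<^sup>2)" .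
    have "0 < (\<Sum>k\<in>K. \<Sum>i<?m. (l - \<epsilon> - \<nu> i - T k) * (cmod (d i k))\<^sup>2)"
    proof -
      have nn: "0 \<le> (l - \<epsilon> - \<nu> i - T k) * (cmod (d i k))\<^sup>2" for i k
        using TA[of k i] by (auto simp: d_def J_def intro!: mult_nonneg_nonneg)
      obtain i k where ik: "(i, k) \<in> J" "c (i, k) \<noteq> 0" using c by auto
      have "0 < (l - \<epsilon> - \<nu> i - T k) * (cmod (d i k))\<^sup>2"
        using TA[of k i] ik by (auto simp: d_def J_def intro!: mult_pos_pos)
      moreover have "i < ?m" "k \<in> K" using ik by (auto simp: J_def K_def image_iff)
      ultimately show ?thesis
        by (intro sum_pos2[OF K, of k] sum_pos2[of _ i] sum_nonneg nn) auto
    qed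
    moreover have "(\<Sum>k\<in>K. \<Sum>i<?m. (l - \<epsilon> - \<nu> i - T k) * (cmod (d i k))\<^sup>2) =
        (l - \<epsilon>) * (norm x)\<^sup>2 - Re (cinner x (Y x)) - (\<Sum>k\<in>K. \<Sum>i<?m. T k * (cmod (d i k))\<^sup>2)"
      unfolding n2 Yf by (simp add: algebra_simps sum_subtractf sum.distrib sum_distrib_left)
    ultimately have "(\<Sum>k\<in>K. \<Sum>i<?m. T k * (cmod (d i k))\<^sup>2) + Re (cinner x (Y x)) < (l - \<epsilon>) * (norm x)\<^sup>2"
      by linarith
    thus "energy (kinetic h) F x + Re (cinner x (V x)) < l * (norm x)\<^sup>2"
      using en close[of x] by (simp add: algebra_simps)
  qed
  thus ?thesis unfolding J(2) A_def .
qed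

lemma le_div_iff: "c \<le> a div L \<longleftrightarrow> c * L \<le> a"
proof
  have a: "a = a div L * L + a mod L" "0 \<le> a mod L" "a mod L < L" using L by simp_all
  show "c * L \<le> a" if "c \<le> a div L"
    using mult_right_mono[OF that, of L] L a by linarith
  show "c \<le> a div L" if "c * L \<le> a"
  proof (rule ccontr)
    assume "\<not> c \<le> a div L"
    hence "a div L + 1 \<le> c" by simp
    hence "(a div L + 1) * L \<le> c * L" using L by (intro mult_right_mono) auto
    thus False using that a by (simp add: distrib_right)
  qed
qed

text \<open>Cores and boundary modes together fill the cube of side \<open>(2 * K + 1) * L\<close>.
  The count is stated as a sum to stay clear of truncated subtraction.\<close>

lemma card_boundary:
  fixes K :: int
  assumes K: "0 \<le> K"
  defines "B \<equiv> {n :: int^'d. (\<forall>j. n $ j div L \<in> {-K..K}) \<and> n \<notin> core (\<chi> j. n $ j div L)}"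
  shows "finite B"
    and "card B + nat (2 * K + 1) ^ CARD('d) * nat (L - 2 * R) ^ CARD('d) = nat ((2 * K + 1) * L) ^ CARD('d)"
proof -
  define S where "S = {k :: int^'d. \<forall>j. k $ j \<in> {-K..K}}"
  have "card S = card {-K..K} ^ CARD('d)" unfolding S_def by (rule card_vec_box)
  also have "card {-K..K} = nat (2 * K + 1)" using K by simp
  finally have Sc: "card S = nat (2 * K + 1) ^ CARD('d)" .
  have S: "finite S" unfolding S_def by (rule finite_vec_box) simp
  define D where "D = {n :: int^'d. \<forall>j. n $ j \<in> {- K * L..<(K + 1) * L}}"
  have "card D = card {- K * L..<(K + 1) * L} ^ CARD('d)" unfolding D_def by (rule card_vec_box)
  also have "card {- K * L..<(K + 1) * L} = nat ((2 * K + 1) * L)" by (simp add: algebra_simps)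
  finally have Dc: "card D = nat ((2 * K + 1) * L) ^ CARD('d)" .
  have D: "finite D" unfolding D_def by (rule finite_vec_box) simp
  have div: "a div L \<in> {-K..K} \<longleftrightarrow> a \<in> {- K * L..<(K + 1) * L}" for a :: int
    using le_div_iff[of "-K" a] le_div_iff[of "K + 1" a] by auto
  define U where "U = (\<Union>k\<in>S. core k)"
  have U: "finite U" using S by (simp add: U_def)
  have "card U = (\<Sum>k\<in>S. card (core k))"
    unfolding U_def using S core_disjoint by (intro card_UN_disjoint) auto
  hence Uc: "card U = nat (2 * K + 1) ^ CARD('d) * nat (L - 2 * R) ^ CARD('d)"
    by (simp add: card_core Sc)
  have UD: "U \<subseteq> D"
  proof
    fix n assume "n \<in> U"
    then obtain k where k: "k \<in> S" "n \<in> core k" by (auto simp: U_def)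
    have "n $ j div L = k $ j" for j using core_box[OF k(2)] by (metis vec_lambda_beta)
    hence "n $ j div L \<in> {-K..K}" for j using k(1) by (simp add: S_def)
    thus "n \<in> D" unfolding div by (simp add: D_def)
  qed
  have "B = D - U"
  proof (rule subset_antisym; rule subsetI)
    fix n assume n: "n \<in> B"
    have "n \<notin> U"
    proof
      assume "n \<in> U"
      then obtain k where "n \<in> core k" by (auto simp: U_def)
      moreover from this have "(\<chi> j. n $ j div L) = k" by (rule core_box)
      ultimately show False using n by (simp add: B_def)
    qed
    moreover have "\<forall>j. n $ j div L \<in> {-K..K}" using n by (simp add: B_def)
    hence "n \<in> D" unfolding div D_def by simp
    ultimately show "n \<in> D - U" by simp
  next
    fix n assume n: "n \<in> D - U"
    have "\<forall>j. n $ j \<in> {- K * L..<(K + 1) * L}" using n by (simp add: D_def)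
    hence "\<forall>j. n $ j div L \<in> {-K..K}" unfolding div .
    moreover from this have "(\<chi> j. n $ j div L) \<in> S" by (simp add: S_def)
    hence "n \<notin> core (\<chi> j. n $ j div L)" using n unfolding U_def by blast
    ultimately show "n \<in> B" unfolding B_def by blast
  qed
  thus "finite B" using D by simp
  have "card B + card U = card D"
    using card_Diff_subset[OF U UD] card_mono[OF D UD] \<open>B = D - U\<close> by simp
  thus "card B + nat (2 * K + 1) ^ CARD('d) * nat (L - 2 * R) ^ CARD('d) = nat ((2 * K + 1) * L) ^ CARD('d)"
    by (simp add: Uc Dc)
qed

text \<open>The constraints are orthogonality to the low block states and to all boundary modes in
  the large cube. A vector that meets them splits into core parts, where
  \<open>\<nu> i + T k \<ge> l + \<epsilon>\<close>, and a part outside the large cube, where the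
  kinetic energy is at least \<open>l + \<epsilon> + M\<close> and \<open>Y\<close> cannot take the
  form below \<open>l + \<epsilon>\<close>. \<open>Y\<close> couples no two of these parts.\<close>

lemma counting_le_blocks:
  fixes h l \<epsilon> N :: real and V :: "'h \<Rightarrow> 'h" and K :: int
  assumes V: "hermitian_bounded N V" and h: "0 < h" and K: "0 \<le> K" "l + \<epsilon> + M \<le> (h * (K * L))\<^sup>2"
    and close: "\<And>x. Re (cinner x (Y x)) - \<epsilon> * (norm x)\<^sup>2 \<le> Re (cinner x (V x))"
  shows "counting_function l (pgraph (kinetic h) V) \<le> of_nat ((\<Sum>i<card (core 0). card {k :: int^'d. norm (real_vec k) <
      sqrt (max 0 (l + \<epsilon> - \<nu> i)) / (h * L) + sqrt CARD('d)})
      + (nat ((2 * K + 1) * L) ^ CARD('d) - nat (2 * K + 1) ^ CARD('d) * nat (L - 2 * R) ^ CARD('d)))"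
proof -
  let ?m = "card (core 0)"
  define A where "A i = {k :: int^'d. norm (real_vec k) < sqrt (max 0 (l + \<epsilon> - \<nu> i)) / (h * L) + sqrt CARD('d)}" for i
  define B where "B = {n :: int^'d. (\<forall>j. n $ j div L \<in> {-K..K}) \<and> n \<notin> core (\<chi> j. n $ j div L)}"
  define J where "J = Sigma {..<?m} A <+> B"
  define g where "g p = (case p of Inl q \<Rightarrow> lift (snd q) (\<psi> (fst q)) | Inr n \<Rightarrow> e n)" for p
  define S where "S = {k :: int^'d. \<forall>j. k $ j \<in> {-K..K}}"
  define T where "T k = (h * L * max 0 (norm (real_vec k) - sqrt CARD('d)))\<^sup>2" for k :: "int^'d"
  have S: "finite S" unfolding S_def by (rule finite_vec_box) simp
  have B: "finite B" "card B + nat (2 * K + 1) ^ CARD('d) * nat (L - 2 * R) ^ CARD('d) = nat ((2 * K + 1) * L) ^ CARD('d)"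
    unfolding B_def by (rule card_boundary[OF K(1)])+
  have fA: "finite (A i)" for i
    unfolding A_def by (rule finite_subset[OF _ finite_real_vec_ball]) (auto intro: less_imp_le)
  have J: "finite J" "card J = (\<Sum>i<?m. card (A i)) + card B"
    using fA B by (simp_all add: J_def card_Plus)
  have TA: "l + \<epsilon> \<le> \<nu> i + T k" if "k \<notin> A i" for i k
  proof -
    have hL: "0 < h * L" using h L by simp
    have "sqrt (max 0 (l + \<epsilon> - \<nu> i)) / (h * L) \<le> norm (real_vec k) - sqrt CARD('d)"
      using that by (simp add: A_def)
    hence "sqrt (max 0 (l + \<epsilon> - \<nu> i)) \<le> (norm (real_vec k) - sqrt CARD('d)) * (h * L)"
      by (simp only: pos_divide_le_eq[OF hL])
    also have "\<dots> = h * L * (norm (real_vec k) - sqrt CARD('d))" by simp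
    also have "\<dots> \<le> h * L * max 0 (norm (real_vec k) - sqrt CARD('d))"
      using hL by (intro mult_left_mono) auto
    finally have "(sqrt (max 0 (l + \<epsilon> - \<nu> i)))\<^sup>2 \<le> T k"
      unfolding T_def by (intro power_mono) auto
    thus ?thesis by simp
  qed
  have "counting_function l (pgraph (kinetic h) V) \<le> of_nat (card J)"
  proof (rule counting_function_le[where g = g, OF V J(1)])
    fix x y assume xy: "(x, y) \<in> mgraph (kinetic h)" and gx: "\<And>p. p \<in> J \<Longrightarrow> cinner (g p) x = 0"
    have yn: "cinner (e n) y = complex_of_real (kinetic h n) * cinner (e n) x" for n
      using xy by (simp add: mgraph_def)
    define X where "X k = proj (core k) x" for k
    define z where "z = x - sum X S"
    have Xs: "proj (core k) (X k) = X k" for k by (simp add: X_def proj_proj)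
    have bx: "cinner (e n) x = 0" if "n \<in> B" for n
      using gx[of "Inr n"] that by (auto simp: J_def g_def)
    have pA: "cinner (lift k (\<psi> i)) x = 0" if "i < ?m" "k \<in> A i" for i k
      using gx[of "Inl (i, k)"] that by (auto simp: J_def g_def)
    \<comment> \<open>\<open>z\<close> has no modes in the large cube: its core modes have been
      subtracted, and on its boundary modes \<open>x\<close> itself vanishes by the
      constraints.\<close>
    have far: "(\<chi> j. n $ j div L) \<notin> S \<and> cinner (e n) z = cinner (e n) x" if n: "cinner (e n) z \<noteq> 0" for n
    proof -
      have "(\<chi> j. n $ j div L) \<notin> S"
      proof
        assume kS: "(\<chi> j. n $ j div L) \<in> S"
        show False
        proof (cases "n \<in> core (\<chi> j. n $ j div L)")
          case True
          have "cinner (e n) (sum X S) = cinner (e n) (X (\<chi> j. n $ j div L))"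
            by (rule coeff_block_sum[OF S Xs kS True])
          also have "\<dots> = cinner (e n) x" using True by (simp add: X_def coeff_proj)
          finally show False using n by (simp add: z_def cinner_diff_right)
        next
          case False
          hence "n \<in> B" using kS by (simp add: B_def S_def)
          moreover have "cinner (e n) (X k) = 0" for k
          proof (rule lift_support_coeff[OF _ Xs])
            show "n \<notin> core k" using False core_box[of n k] by auto
          qed
          ultimately show False using n bx by (simp add: z_def cinner_diff_right cinner_sum_right)
        qed
      qed
      moreover from this have "cinner (e n) (X k) = 0" if "k \<in> S" for k
        using core_box[of n k] that by (intro lift_support_coeff[OF _ Xs]) auto
      ultimately show ?thesis by (simp add: z_def cinner_diff_right cinner_sum_right)
    qed
    have xz: "x = sum X S + z" by (simp add: z_def)
    have orth: "cinner (X k) z = 0" if k: "k \<in> S" for k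
    proof -
      have "cinner (e n) z = 0" if "n \<in> core k" for n
        using far[of n] core_box[OF that] k by auto
      hence "cinner (proj (core k) (X k)) z = 0" unfolding cinner_proj_left by simp
      thus ?thesis by (simp add: Xs)
    qed
    have dec: "cinner (X k) (Y z) = 0" "cinner z (Y (X k)) = 0" if k: "k \<in> S" for k
    proof -
      have d: "cinner (e n) (Y (e m)) = 0" if "cinner (e m) z \<noteq> 0" "n \<in> core k" for m n
        using core_decoupled[OF that(2), of m] far[OF that(1)] k by auto
      show "cinner (X k) (Y z) = 0" "cinner z (Y (X k)) = 0"
        by (rule decoupled[OF finite_core Xs]; erule (1) d)+
    qed
    have n2: "(norm x)\<^sup>2 = (\<Sum>k\<in>S. (norm (X k))\<^sup>2) + (norm z)\<^sup>2"
      unfolding xz norm_add_sq block_sums(1)[OF S Xs] cinner_sum_left by (simp add: orth)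
    have Yf: "cinner x (Y x) = (\<Sum>k\<in>S. cinner (X k) (Y (X k))) + cinner z (Y z)"
      unfolding xz Y_linear cinner_add_left cinner_add_right block_sums(2)[OF S Xs, unfolded Y_linear]
      by (simp add: cinner_sum_left cinner_sum_right dec)
    have Xy: "T k * (norm (X k))\<^sup>2 \<le> Re (cinner (X k) y)" for k
    proof -
      have "T k * (norm (X k))\<^sup>2 = (\<Sum>n\<in>core k. T k * (cmod (cinner (e n) x))\<^sup>2)"
        unfolding X_def norm_proj_sq[OF finite_core] sum_distrib_left ..
      also have "\<dots> \<le> (\<Sum>n\<in>core k. kinetic h n * (cmod (cinner (e n) x))\<^sup>2)"
        using kinetic_core(2)[OF _ h] by (intro sum_mono mult_right_mono) (auto simp: T_def)
      also have "\<dots> = Re (cinner (X k) y)"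
      proof -
        have "cinner (X k) y = (\<Sum>n\<in>core k. complex_of_real (kinetic h n) * (cnj (cinner (e n) x) * cinner (e n) x))"
          unfolding X_def cinner_proj_left by (simp add: yn mult_ac)
        also have "\<dots> = complex_of_real (\<Sum>n\<in>core k. kinetic h n * (cmod (cinner (e n) x))\<^sup>2)"
          by (simp add: cnj_mult_self)
        finally show ?thesis by simp
      qed
      finally show ?thesis .
    qed
    have zy: "(l + \<epsilon> + M) * (norm z)\<^sup>2 \<le> Re (cinner z y)"
    proof (rule has_sum_mono)
      show "((\<lambda>n. (l + \<epsilon> + M) * (cmod (cinner (e n) z))\<^sup>2) has_sum (l + \<epsilon> + M) * (norm z)\<^sup>2) UNIV"
        by (intro has_sum_cmult_right parseval_norm)
      show "((\<lambda>n. Re (cnj (cinner (e n) z) * cinner (e n) y)) has_sum Re (cinner z y)) UNIV"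
        by (intro has_sum_Re parseval)
      fix n
      show "(l + \<epsilon> + M) * (cmod (cinner (e n) z))\<^sup>2 \<le> Re (cnj (cinner (e n) z) * cinner (e n) y)"
      proof (cases "cinner (e n) z = 0")
        case False
        from far[OF this] obtain j where j: "n $ j div L \<notin> {-K..K}"
          and zx: "cinner (e n) z = cinner (e n) x" by (auto simp: S_def)
        \<comment> \<open>The cube index is a floor: below \<open>-K\<close> it gives
          \<open>n $ j < - K * L\<close>, above \<open>K\<close> it gives
          \<open>n $ j \<ge> (K + 1) * L\<close>.\<close>
        have "K * L \<le> \<bar>n $ j\<bar>"
          using j le_div_iff[of "-K" "n $ j"] le_div_iff[of "K + 1" "n $ j"] L
          by (auto simp: distrib_right not_le)
        hence "real_of_int (K * L) \<le> norm (real_vec n)"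
          using component_le_norm_real_vec[of n j] by (metis of_int_abs of_int_le_iff order_trans)
        hence "(h * (K * L))\<^sup>2 \<le> kinetic h n"
          unfolding kinetic_def using h K(1) L by (intro power_mono) auto
        hence "l + \<epsilon> + M \<le> kinetic h n" using K(2) by simp
        hence "(l + \<epsilon> + M) * (cmod (cinner (e n) z))\<^sup>2 \<le> kinetic h n * (cmod (cinner (e n) z))\<^sup>2"
          by (rule mult_right_mono) simp
        also have "complex_of_real (kinetic h n * (cmod (cinner (e n) z))\<^sup>2) = cnj (cinner (e n) z) * cinner (e n) y"
          unfolding yn zx by (simp add: cnj_mult_self[symmetric] mult_ac)
        hence "kinetic h n * (cmod (cinner (e n) z))\<^sup>2 = Re (cnj (cinner (e n) z) * cinner (e n) y)"
          by (metis Re_complex_of_real)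
        finally show ?thesis .
      qed simp
    qed
    have Xk: "(l + \<epsilon>) * (norm (X k))\<^sup>2 \<le> Re (cinner (X k) (Y (X k))) + T k * (norm (X k))\<^sup>2" for k
    proof -
      define a where "a i = (cmod (cinner (\<psi> i) (restrict k x)))\<^sup>2" for i
      have Xl: "X k = lift k (restrict k x)" by (simp add: X_def lift_restrict)
      have n: "(norm (X k))\<^sup>2 = (\<Sum>i<?m. a i)"
        unfolding Xl norm_lift[OF restrict_support] compression_form(2)[OF restrict_support] a_def ..
      have yf: "Re (cinner (X k) (Y (X k))) = (\<Sum>i<?m. \<nu> i * a i)"
        unfolding Xl lift_Y[OF restrict_support restrict_support] compression_form(1)[OF restrict_support] a_def by simp
      have "(\<Sum>i<?m. (l + \<epsilon>) * a i) \<le> (\<Sum>i<?m. (\<nu> i + T k) * a i)"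
      proof (rule sum_mono)
        fix i assume i: "i \<in> {..<?m}"
        show "(l + \<epsilon>) * a i \<le> (\<nu> i + T k) * a i"
        proof (cases "k \<in> A i")
          case True
          hence "a i = 0" using pA[of i k] i by (simp add: a_def restrict_inner)
          thus ?thesis by simp
        next
          case False
          thus ?thesis using TA by (intro mult_right_mono) (auto simp: a_def)
        qed
      qed
      thus ?thesis unfolding n yf by (simp add: sum_distrib_left sum.distrib distrib_right)
    qed
    have "(l + \<epsilon>) * (norm x)\<^sup>2 \<le> Re (cinner x y) + Re (cinner x (Y x))"
    proof -
      have "(l + \<epsilon>) * (norm x)\<^sup>2 = (\<Sum>k\<in>S. (l + \<epsilon>) * (norm (X k))\<^sup>2) + (l + \<epsilon>) * (norm z)\<^sup>2"
        unfolding n2 by (simp add: distrib_left sum_distrib_left)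
      also have "\<dots> \<le> (\<Sum>k\<in>S. Re (cinner (X k) (Y (X k))) + Re (cinner (X k) y)) + (l + \<epsilon>) * (norm z)\<^sup>2"
        using Xk Xy by (intro add_right_mono sum_mono) (meson add_left_mono order_trans)
      also have "(l + \<epsilon>) * (norm z)\<^sup>2 \<le> Re (cinner z y) + Re (cinner z (Y z))"
        using zy hermitian_form_bound[OF Y, of z] by (simp add: distrib_right abs_le_iff)
      finally have "(l + \<epsilon>) * (norm x)\<^sup>2 \<le> (\<Sum>k\<in>S. Re (cinner (X k) (Y (X k))) + Re (cinner (X k) y))
          + (Re (cinner z y) + Re (cinner z (Y z)))" by simp
      moreover have "cinner x y = (\<Sum>k\<in>S. cinner (X k) y) + cinner z y"
        using xz by (metis cinner_add_left cinner_sum_left)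
      ultimately show ?thesis unfolding Yf by (simp add: sum.distrib)
    qed
    thus "l * (norm x)\<^sup>2 \<le> Re (cinner x (y + V x))"
      using close[of x] by (simp add: cinner_add_right distrib_right)
  qed
  also have "card J = (\<Sum>i<?m. card (A i)) + (nat ((2 * K + 1) * L) ^ CARD('d) - nat (2 * K + 1) ^ CARD('d) * nat (L - 2 * R) ^ CARD('d))"
    using J(2) B(2) by simp
  finally show ?thesis unfolding A_def .
qed

end

section \<open>Lattice points in balls\<close>

lemma measure_cube:
  fixes k :: "int^'d::finite"
  defines "C \<equiv> {x :: real^'d. \<forall>j. \<lfloor>x $ j\<rfloor> = k $ j}"
  shows "C \<in> sets lborel" "emeasure lborel C = 1"
proof -
  have "C = (\<Inter>j. {x. real_of_int (k $ j) \<le> x $ j} \<inter> {x. x $ j < real_of_int (k $ j) + 1})"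
    unfolding C_def by (auto simp: floor_eq_iff)
  also have "\<dots> \<in> sets borel"
    by (intro sets.countable_INT'' sets.Int borel_closed borel_open closed_Collect_le open_Collect_less
      continuous_intros) (auto intro: countable_finite)
  finally show C: "C \<in> sets lborel" by simp
  define a where "a = real_vec k"
  define b :: "real^'d" where "b = (\<chi> j. real_of_int (k $ j) + 1)"
  have ab: "cbox a b \<noteq> {}" by (auto simp: interval_ne_empty_cart a_def b_def real_vec_def)
  have "measure lborel (cbox a b) = 1"
    by (subst content_cbox_cart[OF ab]) (simp add: a_def b_def real_vec_def)
  hence c: "emeasure lborel (cbox a b) = 1"
    using emeasure_eq_ennreal_measure[of lborel "cbox a b"] emeasure_lborel_cbox_finite[of a b]
    by (simp add: less_top)
  moreover have "emeasure lborel (box a b) = 1"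
    using c by (simp only: emeasure_lborel_box_eq emeasure_lborel_cbox_eq)
  moreover have "C \<subseteq> cbox a b" "box a b \<subseteq> C"
    by (auto simp: C_def a_def b_def real_vec_def mem_box_cart floor_eq_iff less_imp_le intro: less_imp_le)
  ultimately show "emeasure lborel C = 1"
    using C by (metis antisym emeasure_mono sets_lborel cbox_borel)
qed

text \<open>The half-open unit cubes based at lattice points tile space, so \<open>card N\<close> is
  the volume of a union of cubes. Points of a cube are closer than \<open>D\<close> to its base
  point, which places the union between the balls of radius \<open>r - D\<close> and
  \<open>r + D\<close>; the maximum covers negative radii.\<close>

lemma lattice_points_ball:
  fixes r :: real
  defines "D \<equiv> sqrt CARD('d)"
  defines "N \<equiv> {k :: int^'d::finite. norm (real_vec k) < r}"
  shows "finite N"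
    and "unit_ball_vol CARD('d) * max 0 (r - D) ^ CARD('d) \<le> real (card N)"
    and "real (card N) \<le> unit_ball_vol CARD('d) * max 0 (r + D) ^ CARD('d)"
proof -
  define C where "C k = {x :: real^'d. \<forall>j. \<lfloor>x $ j\<rfloor> = k $ j}" for k :: "int^'d"
  show N: "finite N"
    unfolding N_def by (rule finite_subset[OF _ finite_real_vec_ball[of r]]) auto
  define P where "P = (\<Union>k\<in>N. C k)"
  have C: "C k \<in> sets lborel" "emeasure lborel (C k) = 1" for k
    unfolding C_def by (rule measure_cube)+
  have Ps: "P \<in> sets lborel" unfolding P_def using C N by (intro sets.finite_UN) auto
  have Pm: "emeasure lborel P = of_nat (card N)"
  proof -
    have "emeasure lborel P = (\<Sum>k\<in>N. emeasure lborel (C k))"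
      unfolding P_def
      by (intro sum_emeasure[symmetric] N) (use C in \<open>auto simp: disjoint_family_on_def C_def vec_eq_iff\<close>)
    thus ?thesis by (simp add: C)
  qed
  have diff: "norm (x - real_vec k) < D" if "x \<in> C k" for x k
  proof -
    have "(norm (x - real_vec k))\<^sup>2 = (\<Sum>j\<in>UNIV. (x $ j - \<lfloor>x $ j\<rfloor>)\<^sup>2)"
      using that by (simp add: norm_vec_def L2_set_def sum_nonneg C_def real_vec_def)
    also have "\<dots> < (\<Sum>j\<in>(UNIV::'d set). 1)"
    proof (rule sum_strict_mono)
      fix j
      have "0 \<le> x $ j - \<lfloor>x $ j\<rfloor>" "x $ j - \<lfloor>x $ j\<rfloor> < 1" by linarith+
      thus "(x $ j - \<lfloor>x $ j\<rfloor>)\<^sup>2 < 1" by (simp add: abs_square_less_1)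
    qed auto
    also have "\<dots> = D\<^sup>2" by (simp add: D_def)
    finally show ?thesis by (rule power_less_imp_less_base) (simp add: D_def)
  qed
  have "ball 0 (r - D) \<subseteq> P"
  proof
    fix x :: "real^'d" assume x: "x \<in> ball 0 (r - D)"
    define k :: "int^'d" where "k = (\<chi> j. \<lfloor>x $ j\<rfloor>)"
    have xk: "x \<in> C k" by (simp add: C_def k_def)
    have "norm (real_vec k) \<le> norm x + norm (x - real_vec k)"
      using norm_triangle_ineq4[of x "x - real_vec k"] by simp
    hence "k \<in> N" using diff[OF xk] x by (simp add: N_def)
    thus "x \<in> P" using xk by (auto simp: P_def)
  qed
  hence "emeasure lborel (ball (0::real^'d) (r - D)) \<le> of_nat (card N)"
    unfolding Pm[symmetric] by (intro emeasure_mono Ps)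
  thus "unit_ball_vol CARD('d) * max 0 (r - D) ^ CARD('d) \<le> real (card N)"
  proof (cases "0 \<le> r - D")
    case True
    with \<open>emeasure lborel (ball (0::real^'d) (r - D)) \<le> of_nat (card N)\<close> show ?thesis
      by (simp add: emeasure_ball max_def ennreal_of_nat_eq_real_of_nat)
  qed (simp add: max_def zero_power)
  have "P \<subseteq> ball 0 (r + D)"
  proof
    fix x assume "x \<in> P"
    then obtain k where k: "k \<in> N" "x \<in> C k" by (auto simp: P_def)
    have "norm x \<le> norm (real_vec k) + norm (x - real_vec k)"
      using norm_triangle_ineq[of "real_vec k" "x - real_vec k"] by simp
    thus "x \<in> ball 0 (r + D)" using diff[OF k(2)] k(1) by (simp add: N_def)
  qed
  hence le: "of_nat (card N) \<le> emeasure lborel (ball (0::real^'d) (r + D))"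
    unfolding Pm[symmetric] by (intro emeasure_mono) auto
  show "real (card N) \<le> unit_ball_vol CARD('d) * max 0 (r + D) ^ CARD('d)"
  proof (cases "0 \<le> r + D")
    case True
    with le show ?thesis
      by (simp add: emeasure_ball max_def ennreal_of_nat_eq_real_of_nat)
  next
    case False
    hence "N = {}" by (auto simp: N_def D_def not_less) (smt (verit) norm_ge_zero real_sqrt_ge_zero of_nat_0_le_iff)
    thus ?thesis by simp
  qed
qed

text \<open>After scaling by \<open>h\<close>, both the shift \<open>a\<close> and the cube diagonal
  become of order \<open>h\<close> and disappear from the limit.\<close>

lemma tendsto_lattice_points:
  fixes s a L :: real
  assumes s: "0 \<le> s" and L: "0 < L"
  shows "((\<lambda>h. h ^ CARD('d) * real (card {k :: int^'d::finite. norm (real_vec k) < s / (h * L) + a}))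
    \<longlongrightarrow> unit_ball_vol CARD('d) * (s / L) ^ CARD('d)) (at_right 0)"
proof (rule tendsto_sandwich)
  let ?D = "sqrt (real CARD('d))" and ?N = "\<lambda>h. {k :: int^'d::finite. norm (real_vec k) < s / (h * L) + a}"
  have m: "h ^ CARD('d) * (unit_ball_vol CARD('d) * max 0 (s / (h * L) + b) ^ CARD('d))
      = unit_ball_vol CARD('d) * max 0 (s / L + h * b) ^ CARD('d)" if "h > 0" for h b
  proof -
    have "h * max 0 (s / (h * L) + b) = max 0 (s / L + h * b)"
      using that by (simp add: max_mult_distrib_left distrib_left)
    thus ?thesis by (metis (no_types, lifting) mult.left_commute power_mult_distrib)
  qed
  have ev: "\<forall>\<^sub>F h :: real in at_right 0. h > 0" by (simp add: eventually_at_right_less)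
  show "\<forall>\<^sub>F h in at_right 0. unit_ball_vol CARD('d) * max 0 (s / L + h * (a - ?D)) ^ CARD('d)
      \<le> h ^ CARD('d) * real (card (?N h))"
    using ev
  proof eventually_elim
    case (elim h)
    have "h ^ CARD('d) * (unit_ball_vol CARD('d) * max 0 (s / (h * L) + (a - ?D)) ^ CARD('d)) \<le> h ^ CARD('d) * real (card (?N h))"
      using lattice_points_ball(2)[where r = "s / (h * L) + a" and 'd = 'd] elim
      by (intro mult_left_mono) (simp_all add: algebra_simps)
    thus ?case unfolding m[OF elim] .
  qed
  show "\<forall>\<^sub>F h in at_right 0. h ^ CARD('d) * real (card (?N h))
      \<le> unit_ball_vol CARD('d) * max 0 (s / L + h * (a + ?D)) ^ CARD('d)"
    using ev
  proof eventually_elim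
    case (elim h)
    have "h ^ CARD('d) * real (card (?N h)) \<le> h ^ CARD('d) * (unit_ball_vol CARD('d) * max 0 (s / (h * L) + (a + ?D)) ^ CARD('d))"
      using lattice_points_ball(3)[where r = "s / (h * L) + a" and 'd = 'd] elim
      by (intro mult_left_mono) (simp_all add: algebra_simps)
    thus ?case unfolding m[OF elim] .
  qed
  have lim: "((\<lambda>h. unit_ball_vol CARD('d) * max 0 (s / L + h * b) ^ CARD('d)) \<longlongrightarrow> unit_ball_vol CARD('d) * (s / L) ^ CARD('d)) (at_right 0)" for b
  proof -
    have "((\<lambda>h. unit_ball_vol CARD('d) * max 0 (s / L + h * b) ^ CARD('d)) \<longlongrightarrow>
        unit_ball_vol CARD('d) * max 0 (s / L + 0 * b) ^ CARD('d)) (at_right 0)"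
      by (intro tendsto_intros)
    thus ?thesis using s L by simp
  qed
  show "((\<lambda>h. unit_ball_vol CARD('d) * max 0 (s / L + h * (a - ?D)) ^ CARD('d)) \<longlongrightarrow> unit_ball_vol CARD('d) * (s / L) ^ CARD('d)) (at_right 0)"
    by (rule lim)
  show "((\<lambda>h. unit_ball_vol CARD('d) * max 0 (s / L + h * (a + ?D)) ^ CARD('d)) \<longlongrightarrow> unit_ball_vol CARD('d) * (s / L) ^ CARD('d)) (at_right 0)"
    by (rule lim)
qed

text \<open>The tube around the sphere is a spherical shell, so its Minkowski content is the volume
  of the unit ball times the symmetric difference quotient of \<open>t ^ d\<close> at 1.\<close>

lemma surface_area_sphere:
  "surface_area (sphere (0 :: 'e::euclidean_space) 1) = DIM('e) * unit_ball_vol DIM('e)"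
proof -
  let ?d = "DIM('e)"
  have inf: "infdist x (sphere 0 1) = \<bar>norm x - 1\<bar>" for x :: 'e
  proof (rule antisym)
    \<comment> \<open>The radial projection of \<open>x\<close> realises the distance; at the origin
      any unit vector does.\<close>
    show "infdist x (sphere 0 1) \<le> \<bar>norm x - 1\<bar>"
    proof (cases "x = 0")
      case True
      obtain b :: 'e where "b \<in> Basis" using nonempty_Basis by blast
      hence "infdist x (sphere 0 1) \<le> dist x b" by (intro infdist_le) simp
      thus ?thesis using True \<open>b \<in> Basis\<close> by simp
    next
      case False
      have "infdist x (sphere 0 1) \<le> dist x (x /\<^sub>R norm x)"
        using False by (intro infdist_le) simp
      also have "x - x /\<^sub>R norm x = (1 - 1 / norm x) *\<^sub>R x" by (simp add: algebra_simps inverse_eq_divide)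
      hence "dist x (x /\<^sub>R norm x) = \<bar>1 - 1 / norm x\<bar> * norm x" by (simp add: dist_norm)
      also have "\<dots> = \<bar>(1 - 1 / norm x) * norm x\<bar>" by (simp add: abs_mult)
      also have "(1 - 1 / norm x) * norm x = norm x - 1" using False by (simp add: field_simps)
      finally show ?thesis .
    qed
    obtain b :: 'e where "b \<in> Basis" using nonempty_Basis by blast
    hence "sphere (0::'e) 1 \<noteq> {}" by (metis dist_0_norm empty_iff mem_sphere norm_Basis)
    thus "\<bar>norm x - 1\<bar> \<le> infdist x (sphere 0 1)"
      unfolding infdist_def
      by (auto intro!: cINF_greatest simp: dist_norm) (metis norm_triangle_ineq3)
  qed
  have vol: "measure lebesgue {x :: 'e. infdist x (sphere 0 1) \<le> \<epsilon>} / (2 * \<epsilon>)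
      = unit_ball_vol ?d * (((1 + \<epsilon>) ^ ?d - 1) / \<epsilon> + ((1 - \<epsilon>) ^ ?d - 1) / (- \<epsilon>)) / 2"
    if e: "0 < \<epsilon>" "\<epsilon> < 1" for \<epsilon>
  proof -
    have eq: "{x :: 'e. infdist x (sphere 0 1) \<le> \<epsilon>} = cball 0 (1 + \<epsilon>) - ball 0 (1 - \<epsilon>)"
      using e by (auto simp: inf abs_le_iff)
    have "measure lebesgue (cball (0::'e) (1 + \<epsilon>) - ball 0 (1 - \<epsilon>)) =
        measure lebesgue (cball (0::'e) (1 + \<epsilon>)) - measure lebesgue (ball (0::'e) (1 - \<epsilon>))"
    proof (rule measure_Diff)
      show "emeasure lebesgue (cball (0::'e) (1 + \<epsilon>)) \<noteq> \<infinity>"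
        using emeasure_lborel_cball_finite[of "0::'e" "1 + \<epsilon>"] by (simp add: less_top[symmetric])
    qed (use e in auto)
    also have "\<dots> = unit_ball_vol ?d * (1 + \<epsilon>) ^ ?d - unit_ball_vol ?d * (1 - \<epsilon>) ^ ?d"
      using e content_cball[of "1 + \<epsilon>" "0::'e"] content_ball[of "1 - \<epsilon>" "0::'e"] by simp
    finally show ?thesis unfolding eq using e by (simp add: field_simps)
  qed
  have der: "((\<lambda>\<epsilon>. ((1 + \<epsilon>) ^ ?d - 1) / \<epsilon>) \<longlongrightarrow> real ?d) (at (0::real))"
  proof -
    have "((\<lambda>t::real. t ^ ?d) has_real_derivative real ?d * 1 ^ (?d - 1)) (at 1)"
      by (auto intro!: derivative_eq_intros)
    thus ?thesis unfolding DERIV_def by simp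
  qed
  have d1: "((\<lambda>\<epsilon>. ((1 + \<epsilon>) ^ ?d - 1) / \<epsilon>) \<longlongrightarrow> real ?d) (at_right (0::real))"
    by (rule tendsto_mono[OF at_le der]) simp
  have d2: "((\<lambda>\<epsilon>. ((1 + - \<epsilon>) ^ ?d - 1) / (- \<epsilon>)) \<longlongrightarrow> real ?d) (at_right (0::real))"
  proof (rule filterlim_compose[OF der])
    have "((\<lambda>\<epsilon>. - \<epsilon>) \<longlongrightarrow> - 0) (at_right (0::real))" by (intro tendsto_intros)
    thus "filterlim uminus (at 0) (at_right (0::real))"
      by (auto simp: filterlim_at eventually_at_filter)
  qed
  have "((\<lambda>\<epsilon>. unit_ball_vol ?d * (((1 + \<epsilon>) ^ ?d - 1) / \<epsilon> + ((1 - \<epsilon>) ^ ?d - 1) / (- \<epsilon>)) / 2)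
      \<longlongrightarrow> unit_ball_vol ?d * (real ?d + real ?d) / 2) (at_right 0)"
    using d1 d2 by (intro tendsto_intros) simp_all
  moreover have "\<forall>\<^sub>F \<epsilon> in at_right 0. unit_ball_vol ?d * (((1 + \<epsilon>) ^ ?d - 1) / \<epsilon> + ((1 - \<epsilon>) ^ ?d - 1) / (- \<epsilon>)) / 2
      = measure lebesgue {x :: 'e. infdist x (sphere 0 1) \<le> \<epsilon>} / (2 * \<epsilon>)"
  proof -
    have "\<forall>\<^sub>F \<epsilon> in at_right 0. \<epsilon> \<in> {0<..<1 :: real}" by (rule eventually_at_right_real) simp
    thus ?thesis by eventually_elim (use vol in auto)
  qed
  ultimately have "((\<lambda>\<epsilon>. measure lebesgue {x :: 'e. infdist x (sphere 0 1) \<le> \<epsilon>} / (2 * \<epsilon>))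
      \<longlongrightarrow> unit_ball_vol ?d * (real ?d + real ?d) / 2) (at_right 0)"
    by (rule Lim_transform_eventually)
  thus ?thesis unfolding surface_area_def by (subst tendsto_Lim) (auto simp: mult.commute)
qed

section \<open>Szego limit and semiclassical bounds\<close>

context box_eigenbasis
begin

lemma eigenvalue_bound: "i < card (core 0) \<Longrightarrow> \<bar>\<nu> i\<bar> \<le> M"
proof -
  assume i: "i < card (core 0)"
  have n: "norm (\<psi> i) = 1" by (rule cinner_self_eq_1) (simp add: \<psi>_ortho i)
  have "cinner (\<psi> i) (Y (\<psi> i)) = cinner (\<psi> i) (proj (core 0) (Y (\<psi> i)))"
    using \<psi>_support[OF i] by (metis proj_sym)
  also have "\<dots> = complex_of_real (\<nu> i)" using \<psi>_ortho[OF i i] by (simp add: \<psi>_eigen[OF i] cinner_scaleC_right)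
  finally show ?thesis using hermitian_form_bound[OF Y, of "\<psi> i"] n by simp
qed

definition compress :: "'h \<Rightarrow> 'h" where "compress x = proj (core 0) (Y x)"

lemma e_support: "n \<in> core 0 \<Longrightarrow> proj (core 0) (e n) = e n"
  by (rule proj_eqI) (auto simp: ortho)

lemma compress_power:
  assumes "n \<in> core 0"
  shows "(compress ^^ p) (e n) = (\<Sum>i<card (core 0). complex_of_real (\<nu> i ^ p) *\<^sub>C cinner (\<psi> i) (e n) *\<^sub>C \<psi> i)"
proof (induction p)
  case 0
  show ?case using \<psi>_complete[OF e_support[OF assms]] by simp
next
  case (Suc p)
  have "(compress ^^ Suc p) (e n)
      = (\<Sum>i<card (core 0). complex_of_real (\<nu> i ^ p) *\<^sub>C cinner (\<psi> i) (e n) *\<^sub>C proj (core 0) (Y (\<psi> i)))"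
    by (simp add: Suc.IH compress_def Y_linear complex_linearD[OF proj_linear])
  also have "\<dots> = (\<Sum>i<card (core 0). complex_of_real (\<nu> i ^ Suc p) *\<^sub>C cinner (\<psi> i) (e n) *\<^sub>C \<psi> i)"
    by (intro sum.cong refl) (simp add: \<psi>_eigen scaleC_scaleC mult_ac)
  finally show ?case .
qed

lemma compress_power_diagonal:
  assumes "n \<in> core 0"
  shows "Re (cinner (e n) ((compress ^^ p) (e n))) = (\<Sum>i<card (core 0). \<nu> i ^ p * (cmod (cinner (\<psi> i) (e n)))\<^sup>2)"
proof -
  have "cinner (e n) ((compress ^^ p) (e n))
      = (\<Sum>i<card (core 0). complex_of_real (\<nu> i ^ p) * (cinner (e n) (\<psi> i) * cinner (\<psi> i) (e n)))"
    unfolding compress_power[OF assms] cinner_sum_right cinner_scaleC_right by (simp add: mult_ac)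
  also have "\<dots> = complex_of_real (\<Sum>i<card (core 0). \<nu> i ^ p * (cmod (cinner (\<psi> i) (e n)))\<^sup>2)"
    by (simp add: cinner_mult_swap)
  finally show ?thesis by simp
qed

text \<open>Both sides are the trace of a power of the compression, once in the basis
  \<open>e\<close> and once in the eigenbasis \<open>\<psi>\<close>.\<close>

lemma trace_compress_power:
  "(\<Sum>n\<in>core 0. Re (cinner (e n) ((compress ^^ p) (e n)))) = (\<Sum>i<card (core 0). \<nu> i ^ p)"
proof -
  have one: "(\<Sum>n\<in>core 0. (cmod (cinner (\<psi> i) (e n)))\<^sup>2) = 1" if i: "i < card (core 0)" for i
  proof -
    have "cmod (cinner (\<psi> i) (e n)) = cmod (cinner (e n) (\<psi> i))" for n
      by (metis cinner_commute complex_mod_cnj)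
    hence "(\<Sum>n\<in>core 0. (cmod (cinner (\<psi> i) (e n)))\<^sup>2) = (norm (\<psi> i))\<^sup>2"
      using norm_proj_sq[OF finite_core, of 0 "\<psi> i"] \<psi>_support[OF i] by simp
    moreover have "norm (\<psi> i) = 1" by (rule cinner_self_eq_1) (simp add: \<psi>_ortho i)
    ultimately show ?thesis by simp
  qed
  have "(\<Sum>n\<in>core 0. Re (cinner (e n) ((compress ^^ p) (e n))))
      = (\<Sum>n\<in>core 0. \<Sum>i<card (core 0). \<nu> i ^ p * (cmod (cinner (\<psi> i) (e n)))\<^sup>2)"
    by (intro sum.cong refl compress_power_diagonal)
  also have "\<dots> = (\<Sum>i<card (core 0). \<nu> i ^ p * (\<Sum>n\<in>core 0. (cmod (cinner (\<psi> i) (e n)))\<^sup>2))"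
    by (subst sum.swap) (simp add: sum_distrib_left)
  also have "\<dots> = (\<Sum>i<card (core 0). \<nu> i ^ p)"
    by (intro sum.cong refl) (simp add: one)
  finally show ?thesis .
qed

lemma Y_support:
  assumes x: "\<And>m. cinner (e m) x \<noteq> 0 \<Longrightarrow> \<forall>j. \<bar>m $ j - n $ j\<bar> \<le> a" and m: "cinner (e m) (Y x) \<noteq> 0"
  shows "\<forall>j. \<bar>m $ j - n $ j\<bar> \<le> a + R"
proof (rule ccontr)
  assume "\<not> ?thesis"
  then obtain j where j: "a + R < \<bar>m $ j - n $ j\<bar>" by (auto simp: not_le)
  have "cinner (e m) (Y (e k)) = 0" if "cinner (e k) x \<noteq> 0" for k
  proof (rule range[where j = j])
    have "\<bar>k $ j - n $ j\<bar> \<le> a" using x[OF that] by blast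
    thus "R < \<bar>m $ j - k $ j\<bar>" using j by arith
  qed
  hence "cinner (e m) (Y x) = 0"
    by (intro decoupled(1)[of "{m}" "e m" x]) (auto simp: proj_def ortho)
  thus False using m by simp
qed

text \<open>Each application of \<open>Y\<close> moves every coordinate of a momentum by at most
  \<open>R\<close>. Starting at distance \<open>p * R\<close> from the faces of the core,
  \<open>p\<close> applications do not leave it, so the projections have nothing to cut off.\<close>

lemma compress_power_interior:
  assumes n: "\<forall>j. R + int p * R \<le> n $ j \<and> n $ j < L - R - int p * R"
  shows "(compress ^^ p) (e n) = (Y ^^ p) (e n)"
proof -
  have "(compress ^^ q) (e n) = (Y ^^ q) (e n) \<and>
      (\<forall>m. cinner (e m) ((Y ^^ q) (e n)) \<noteq> 0 \<longrightarrow> (\<forall>j. \<bar>m $ j - n $ j\<bar> \<le> int q * R))" if "q \<le> p" for q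
    using that
  proof (induction q)
    case 0
    show ?case by (simp add: ortho)
  next
    case (Suc q)
    have s: "\<forall>j. \<bar>m $ j - n $ j\<bar> \<le> int (Suc q) * R" if "cinner (e m) ((Y ^^ Suc q) (e n)) \<noteq> 0" for m
      using Y_support[of "(Y ^^ q) (e n)" n "int q * R" m] Suc that by (simp add: algebra_simps)
    have "proj (core 0) ((Y ^^ Suc q) (e n)) = (Y ^^ Suc q) (e n)"
    proof (rule proj_eqI[OF finite_core], rule ccontr)
      fix m assume m: "m \<notin> core 0" "cinner (e m) ((Y ^^ Suc q) (e n)) \<noteq> 0"
      have "int (Suc q) * R \<le> int p * R" using Suc.prems R by (intro mult_right_mono) auto
      hence "R \<le> m $ j \<and> m $ j < L - R" for j using s[OF m(2)] n by (smt (verit))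
      thus False using m(1) by (simp add: core_def)
    qed
    moreover have "(compress ^^ Suc q) (e n) = proj (core 0) ((Y ^^ Suc q) (e n))"
    proof -
      have "(compress ^^ q) (e n) = (Y ^^ q) (e n)" using Suc by simp
      thus ?thesis by (simp add: compress_def[of "(Y ^^ q) (e n)"])
    qed
    ultimately show ?case using s by auto
  qed
  thus ?thesis by blast
qed

text \<open>On the inner cube \<open>D\<close> the diagonal entries of the compressed power are
  exactly \<open>t\<close>. The remaining points of the cube of side \<open>L\<close> enter with at
  most \<open>M ^ p\<close> each, once through the trace and once through \<open>L ^ d * t\<close>;
  hence the factor 2.\<close>

lemma moment_estimate:
  fixes t :: real
  assumes t: "\<And>n. Re (cinner (e n) ((Y ^^ p) (e n))) = t"
    and Lp: "2 * R + 2 * int p * R \<le> L"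
  shows "\<bar>(\<Sum>i<card (core 0). \<nu> i ^ p) - L ^ CARD('d) * t\<bar>
    \<le> 2 * M ^ p * (L ^ CARD('d) - (L - (2 * R + 2 * int p * R)) ^ CARD('d))"
proof -
  define a where "a n = Re (cinner (e n) ((compress ^^ p) (e n)))" for n
  define D where "D = {n :: int^'d. \<forall>j. n $ j \<in> {R + int p * R..<L - R - int p * R}}"
  have "card D = card {R + int p * R..<L - R - int p * R} ^ CARD('d)" unfolding D_def by (rule card_vec_box)
  also have "card {R + int p * R..<L - R - int p * R} = nat (L - (2 * R + 2 * int p * R))" by (simp add: algebra_simps)
  finally have Dc: "real (card D) = (L - (2 * R + 2 * int p * R)) ^ CARD('d)" using Lp by simp
  have D: "finite D" unfolding D_def by (rule finite_vec_box) simp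
  have pR: "0 \<le> int p * R" using R by simp
  have DC: "D \<subseteq> core 0"
  proof
    fix n assume "n \<in> D"
    hence "R + int p * R \<le> n $ j \<and> n $ j < L - R - int p * R" for j by (simp add: D_def)
    hence "R \<le> n $ j \<and> n $ j < L - R" for j using pR by (smt (verit))
    thus "n \<in> core 0" by (simp add: core_def)
  qed
  have aD: "a n = t" if "n \<in> D" for n
    using that compress_power_interior[of p n] t by (simp add: a_def D_def)
  have nub: "\<bar>\<nu> i ^ p\<bar> \<le> M ^ p" if "i < card (core 0)" for i
    using power_mono[OF eigenvalue_bound[OF that]] by (simp add: power_abs)
  have ab: "\<bar>a n\<bar> \<le> M ^ p" if n: "n \<in> core 0" for n
  proof -
    have "\<bar>a n\<bar> \<le> (\<Sum>i<card (core 0). \<bar>\<nu> i ^ p * (cmod (cinner (\<psi> i) (e n)))\<^sup>2\<bar>)"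
      unfolding a_def compress_power_diagonal[OF n] by (rule sum_abs)
    also have "\<dots> \<le> (\<Sum>i<card (core 0). M ^ p * (cmod (cinner (\<psi> i) (e n)))\<^sup>2)"
      using nub by (intro sum_mono) (auto simp: abs_mult intro!: mult_right_mono)
    also have "\<dots> = M ^ p * (norm (e n))\<^sup>2"
      unfolding compression_form(2)[OF e_support[OF n]] by (simp add: sum_distrib_left)
    finally show ?thesis by simp
  qed
  have tb: "\<bar>t\<bar> \<le> M ^ p"
  proof -
    have "norm ((Y ^^ p) (e 0)) \<le> M ^ p"
    proof (induction p)
      case (Suc p)
      have "norm (Y ((Y ^^ p) (e 0))) \<le> M * norm ((Y ^^ p) (e 0))" by (rule hermitian_boundedD(3)[OF Y])
      also have "\<dots> \<le> M * M ^ p" by (intro mult_left_mono Suc M_nonneg)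
      finally show ?case by simp
    qed simp
    moreover have "\<bar>t\<bar> \<le> norm (e 0) * norm ((Y ^^ p) (e 0))"
      unfolding t[of 0, symmetric] using abs_Re_le_cmod cinner_Cauchy_Schwarz order_trans by blast
    ultimately show ?thesis by simp
  qed
  have cc: "real (card (core 0)) \<le> L ^ CARD('d)"
  proof -
    have "2 * R \<le> L" using Lp pR by linarith
    hence "real (card (core 0)) = real_of_int (L - 2 * R) ^ CARD('d)" by (simp add: card_core)
    also have "\<dots> \<le> real_of_int L ^ CARD('d)" using R \<open>2 * R \<le> L\<close> by (intro power_mono) auto
    finally show ?thesis by simp
  qed
  have "(\<Sum>i<card (core 0). \<nu> i ^ p) = (\<Sum>n\<in>core 0. a n)" by (simp add: a_def trace_compress_power)
  also have "\<dots> = (\<Sum>n\<in>core 0 - D. a n) + (\<Sum>n\<in>D. a n)"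
    by (rule sum.subset_diff[OF DC finite_core])
  also have "(\<Sum>n\<in>D. a n) = card D * t" by (simp add: aD)
  finally have "(\<Sum>i<card (core 0). \<nu> i ^ p) - L ^ CARD('d) * t
      = (\<Sum>n\<in>core 0 - D. a n) - (L ^ CARD('d) - card D) * t" by (simp add: algebra_simps)
  hence "\<bar>(\<Sum>i<card (core 0). \<nu> i ^ p) - L ^ CARD('d) * t\<bar>
      \<le> \<bar>\<Sum>n\<in>core 0 - D. a n\<bar> + \<bar>(L ^ CARD('d) - card D) * t\<bar>" by (simp only: abs_triangle_ineq4)
  also have "\<bar>\<Sum>n\<in>core 0 - D. a n\<bar> \<le> (\<Sum>n\<in>core 0 - D. M ^ p)"
    using ab by (intro order_trans[OF sum_abs] sum_mono) auto
  also have "(\<Sum>n\<in>core 0 - D. M ^ p) = (real (card (core 0)) - real (card D)) * M ^ p"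
    using card_Diff_subset[OF D DC] card_mono[OF finite_core DC] by (simp add: of_nat_diff)
  also have "\<dots> \<le> (L ^ CARD('d) - card D) * M ^ p"
    using cc M_nonneg by (intro mult_right_mono) auto
  also have "\<bar>(L ^ CARD('d) - card D) * t\<bar> = (L ^ CARD('d) - card D) * \<bar>t\<bar>"
    using cc card_mono[OF finite_core DC] by (simp add: abs_mult)
  also have "\<dots> \<le> (L ^ CARD('d) - card D) * M ^ p"
    using cc card_mono[OF finite_core DC] tb by (intro mult_left_mono) auto
  finally show ?thesis by (simp add: Dc)
qed

end

context finite_range
begin

lemma ex_box_eigenbasis:
  assumes "0 < L"
  shows "\<exists>core \<psi> \<nu>. box_eigenbasis e Y M R u L core \<psi> \<nu>"
proof -
  define core where "core k = {n :: int^'d. \<forall>j. L * k $ j + R \<le> n $ j \<and> n $ j < L * k $ j + L - R}" for k :: "int^'d"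
  have "core 0 = {n. \<forall>j. n $ j \<in> {R..<L - R}}" by (auto simp: core_def)
  moreover have "finite {n :: int^'d. \<forall>j. n $ j \<in> {R..<L - R}}" by (rule finite_vec_box) simp
  ultimately have Q: "finite (core 0)" by (simp only:)
  \<comment> \<open>\<open>kinetic 1\<close> is just a convenient nonnegative weight with finite
    sublevel sets.\<close>
  have k0: "0 \<le> kinetic 1 n" for n :: "int^'d" by (simp add: kinetic_def)
  obtain \<psi> \<nu> where
    "\<And>i j. i < card (core 0) \<Longrightarrow> j < card (core 0) \<Longrightarrow> cinner (\<psi> i) (\<psi> j) = (if i = j then 1 else 0)"
    "\<And>i. i < card (core 0) \<Longrightarrow> proj (core 0) (\<psi> i) = \<psi> i"
    "\<And>i. i < card (core 0) \<Longrightarrow> proj (core 0) (Y (\<psi> i)) = complex_of_real (\<nu> i) *\<^sub>C \<psi> i"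
    "\<And>x. proj (core 0) x = x \<Longrightarrow> x = (\<Sum>i<card (core 0). cinner (\<psi> i) x *\<^sub>C \<psi> i)"
    by (rule eigenbasis_compression[OF k0 kinetic_finite Y Q]) auto
  hence "box_eigenbasis e Y M R u L core \<psi> \<nu>"
    using assms by unfold_locales (auto simp: core_def fun_eq_iff)
  thus ?thesis by blast
qed

text \<open>By linearity only powers matter, and for these the error is proportional to the volume
  fraction \<open>1 - (1 - c / L) ^ d\<close> of a layer of fixed width. The bound is uniform over
  all eigenbases, so \<open>L\<close> can be fixed before one is chosen.\<close>

lemma polynomial_szego:
  assumes t: "\<And>n q. Re (cinner (e n) ((Y ^^ q) (e n))) = t q" and \<eta>: "0 < \<eta>"
  shows "\<forall>\<^sub>F L in sequentially. \<forall>core \<psi> \<nu>. box_eigenbasis e Y M R u (int L) core \<psi> \<nu> \<longrightarrow>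
    \<bar>(\<Sum>i<card (core 0). poly p (\<nu> i)) / real L ^ CARD('d) - (\<Sum>q\<le>degree p. coeff p q * t q)\<bar> \<le> \<eta>"
proof -
  let ?c = "\<lambda>q. real_of_int (2 * R + 2 * int q * R)"
  let ?b = "\<lambda>L. \<Sum>q\<le>degree p. \<bar>coeff p q\<bar> * (2 * M ^ q * (1 - (1 - ?c q / real L) ^ CARD('d)))"
  have "?b \<longlonglongrightarrow> (\<Sum>q\<le>degree p. \<bar>coeff p q\<bar> * (2 * M ^ q * (1 - (1 - 0) ^ CARD('d))))"
    by (intro tendsto_intros lim_const_over_n)
  hence "?b \<longlonglongrightarrow> 0" by simp
  hence "\<forall>\<^sub>F L in sequentially. ?b L < \<eta>" using \<eta> by (rule order_tendstoD(2))
  moreover have "\<forall>\<^sub>F L in sequentially. nat (2 * R + 2 * int (degree p) * R) + 1 \<le> L"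
    by (rule eventually_ge_at_top)
  ultimately show ?thesis
  proof eventually_elim
    case (elim L)
    show ?case
    proof (intro allI impI)
      fix core \<psi> \<nu> assume "box_eigenbasis e Y M R u (int L) core \<psi> \<nu>"
      then interpret B: box_eigenbasis e Y M R u "int L" core \<psi> \<nu> .
      have L0: "0 < real L" using elim(2) by simp
      have est: "\<bar>(\<Sum>i<card (core 0). \<nu> i ^ q) / real L ^ CARD('d) - t q\<bar>
          \<le> 2 * M ^ q * (1 - (1 - ?c q / real L) ^ CARD('d))" if q: "q \<le> degree p" for q
      proof -
        have "int q * R \<le> int (degree p) * R" using q R by (intro mult_right_mono) auto
        hence "2 * R + 2 * int q * R \<le> int L" using elim(2) by (simp add: nat_le_iff)
        from B.moment_estimate[OF t this]
        have m: "\<bar>(\<Sum>i<card (core 0). \<nu> i ^ q) - real L ^ CARD('d) * t q\<bar>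
          \<le> 2 * M ^ q * (real L ^ CARD('d) - (real L - ?c q) ^ CARD('d))" by simp
        have "\<bar>(\<Sum>i<card (core 0). \<nu> i ^ q) / real L ^ CARD('d) - t q\<bar>
            = \<bar>(\<Sum>i<card (core 0). \<nu> i ^ q) - real L ^ CARD('d) * t q\<bar> / real L ^ CARD('d)"
        proof -
          have "(\<Sum>i<card (core 0). \<nu> i ^ q) / real L ^ CARD('d) - t q
              = ((\<Sum>i<card (core 0). \<nu> i ^ q) - real L ^ CARD('d) * t q) / real L ^ CARD('d)"
            using L0 by (simp add: diff_divide_distrib)
          thus ?thesis using L0 by (simp add: abs_divide)
        qed
        also have "\<dots> \<le> 2 * M ^ q * (real L ^ CARD('d) - (real L - ?c q) ^ CARD('d)) / real L ^ CARD('d)"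
          using L0 by (intro divide_right_mono m) simp
        also have "\<dots> = 2 * M ^ q * (1 - ((real L - ?c q) / real L) ^ CARD('d))"
          using L0 by (simp add: power_divide field_simps)
        also have "(real L - ?c q) / real L = 1 - ?c q / real L" using L0 by (simp add: diff_divide_distrib)
        finally show ?thesis .
      qed
      have "(\<Sum>i<card (core 0). poly p (\<nu> i)) / real L ^ CARD('d) - (\<Sum>q\<le>degree p. coeff p q * t q)
          = (\<Sum>q\<le>degree p. coeff p q * ((\<Sum>i<card (core 0). \<nu> i ^ q) / real L ^ CARD('d) - t q))"
        unfolding poly_altdef by (subst sum.swap)
          (simp add: sum_distrib_left[symmetric] sum_divide_distrib[where A = "{..degree p}"]
            right_diff_distrib sum_subtractf)
      also have "\<bar>\<dots>\<bar> \<le> ?b L"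
      proof (intro order_trans[OF sum_abs] sum_mono)
        fix q assume "q \<in> {..degree p}"
        thus "\<bar>coeff p q * ((\<Sum>i<card (core 0). \<nu> i ^ q) / real L ^ CARD('d) - t q)\<bar>
            \<le> \<bar>coeff p q\<bar> * (2 * M ^ q * (1 - (1 - ?c q / real L) ^ CARD('d)))"
          unfolding abs_mult by (intro mult_left_mono est) simp_all
      qed
      finally show "\<bar>(\<Sum>i<card (core 0). poly p (\<nu> i)) / real L ^ CARD('d) - (\<Sum>q\<le>degree p. coeff p q * t q)\<bar> \<le> \<eta>"
        using elim(1) by simp
    qed
  qed
qed

text \<open>The expression \<open>sqrt (max 0 s) ^ d\<close> is the positive part of
  \<open>s\<close> to the power \<open>d / 2\<close>. It is dominated by a polynomial because
  eigenvalue averages are under control for polynomials. Once \<open>L\<close> is fixed, only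
  finitely many eigenvalues are involved as \<open>h\<close> tends to 0.\<close>

lemma counting_upper:
  fixes l \<epsilon> \<delta> \<eta> N :: real and V :: "'h \<Rightarrow> 'h"
  assumes t: "\<And>n q. Re (cinner (e n) ((Y ^^ q) (e n))) = t q" and \<eta>: "0 < \<eta>" and \<delta>: "0 \<le> \<delta>"
    and V: "hermitian_bounded N V"
    and close: "\<And>x. Re (cinner x (Y x)) - \<epsilon> * (norm x)\<^sup>2 \<le> Re (cinner x (V x))"
    and dom: "\<And>v. \<bar>v\<bar> \<le> M \<Longrightarrow> sqrt (max 0 (l + \<epsilon> - v)) ^ CARD('d) \<le> poly p v + \<delta>"
  shows "\<forall>\<^sub>F h in at_right 0. ennreal (h ^ CARD('d)) * counting_function l (pgraph (kinetic h) V)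
    \<le> ennreal (unit_ball_vol CARD('d) * ((\<Sum>q\<le>degree p. coeff p q * t q) + \<delta>) + \<eta>)"
proof -
  define \<omega> where "\<omega> = unit_ball_vol (real CARD('d))"
  define P where "P = (\<Sum>q\<le>degree p. coeff p q * t q)"
  \<comment> \<open>Momenta with \<open>h * norm (real_vec n) \<ge> S\<close> have kinetic energy at
    least \<open>l + \<epsilon> + M\<close>, so \<open>S / h\<close> fixes the size of the large
    cube.\<close>
  define S where "S = sqrt (max 0 (l + \<epsilon> + M))"
  \<comment> \<open>A quarter of \<open>\<eta>\<close> is allowed for the polynomial average and
    another quarter for the boundary layers; the rest is slack for the limit in
    \<open>h\<close>.\<close>
  define \<eta>1 where "\<eta>1 = \<eta> / (4 * (\<omega> + 1))"
  have \<omega>: "0 \<le> \<omega>" by (simp add: \<omega>_def)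
  have \<eta>1: "0 < \<eta>1" "\<omega> * \<eta>1 \<le> \<eta> / 4" using \<eta> \<omega> by (simp_all add: \<eta>1_def field_simps)
  have S0: "0 \<le> S" by (simp add: S_def)
  have "(\<lambda>L. (2 * S) ^ CARD('d) * (1 - (1 - real_of_int (2 * R) / real L) ^ CARD('d))) \<longlonglongrightarrow>
      (2 * S) ^ CARD('d) * (1 - (1 - 0) ^ CARD('d))"
    by (intro tendsto_intros lim_const_over_n)
  hence "(\<lambda>L. (2 * S) ^ CARD('d) * (1 - (1 - real_of_int (2 * R) / real L) ^ CARD('d))) \<longlonglongrightarrow> 0" by simp
  hence "\<forall>\<^sub>F L in sequentially. (2 * S) ^ CARD('d) * (1 - (1 - real_of_int (2 * R) / real L) ^ CARD('d)) < \<eta> / 4"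
    using \<eta> by (intro order_tendstoD(2)) auto
  moreover note polynomial_szego[OF t \<eta>1(1), of p]
  moreover have "\<forall>\<^sub>F L in sequentially. nat (2 * R) + 1 \<le> L" by (rule eventually_ge_at_top)
  ultimately have "\<forall>\<^sub>F L in sequentially. (2 * S) ^ CARD('d) * (1 - (1 - real_of_int (2 * R) / real L) ^ CARD('d)) < \<eta> / 4 \<and>
      (\<forall>core \<psi> \<nu>. box_eigenbasis e Y M R u (int L) core \<psi> \<nu> \<longrightarrow>
        \<bar>(\<Sum>i<card (core 0). poly p (\<nu> i)) / real L ^ CARD('d) - P\<bar> \<le> \<eta>1) \<and> nat (2 * R) + 1 \<le> L"
    unfolding P_def by eventually_elim blast
  then obtain L :: nat where L: "(2 * S) ^ CARD('d) * (1 - (1 - real_of_int (2 * R) / real L) ^ CARD('d)) < \<eta> / 4"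
    "\<And>core \<psi> \<nu>. box_eigenbasis e Y M R u (int L) core \<psi> \<nu> \<Longrightarrow>
        \<bar>(\<Sum>i<card (core 0). poly p (\<nu> i)) / real L ^ CARD('d) - P\<bar> \<le> \<eta>1" "nat (2 * R) + 1 \<le> L"
    using eventually_happens'[OF sequentially_bot] by blast
  have L0: "0 < real L" "2 * R \<le> int L" "0 < int L" using L(3) by auto
  obtain core \<psi> \<nu> where B: "box_eigenbasis e Y M R u (int L) core \<psi> \<nu>"
    using ex_box_eigenbasis[OF L0(3)] by blast
  interpret B: box_eigenbasis e Y M R u "int L" core \<psi> \<nu> by (rule B)
  let ?m = "card (core 0)"
  define s where "s i = sqrt (max 0 (l + \<epsilon> - \<nu> i))" for i
  define cnt where "cnt i h = card {k :: int^'d. norm (real_vec k) < s i / (h * L) + sqrt CARD('d)}" for i and h :: real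
  \<comment> \<open>\<open>G h\<close> bounds \<open>h ^ d\<close> times the number of boundary
    modes: \<open>K\<close> is \<open>S / (h * L)\<close> rounded up, so
    \<open>h * (2 * K + 1)\<close> is at most \<open>2 * S / L + 3 * h\<close>.\<close>
  define G where "G h = (2 * S / L + 3 * h) ^ CARD('d) * (real L ^ CARD('d) - (real L - 2 * R) ^ CARD('d))" for h :: real
  have lim1: "((\<lambda>h. \<Sum>i<?m. h ^ CARD('d) * real (cnt i h)) \<longlongrightarrow> (\<Sum>i<?m. \<omega> * (s i / L) ^ CARD('d))) (at_right 0)"
    unfolding cnt_def \<omega>_def by (intro tendsto_sum tendsto_lattice_points L0) (simp add: s_def)
  have "(G \<longlongrightarrow> (2 * S / L + 3 * 0) ^ CARD('d) * (real L ^ CARD('d) - (real L - 2 * R) ^ CARD('d))) (at_right 0)"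
    unfolding G_def by (intro tendsto_intros)
  also have "(2 * S / L + 3 * 0) ^ CARD('d) * (real L ^ CARD('d) - (real L - 2 * R) ^ CARD('d))
      = (2 * S) ^ CARD('d) * (1 - ((real L - 2 * R) / L) ^ CARD('d))"
    using L0 by (simp add: power_divide field_simps)
  also have "(real L - 2 * R) / L = 1 - real_of_int (2 * R) / real L" using L0 by (simp add: diff_divide_distrib)
  finally have lim2: "(G \<longlongrightarrow> (2 * S) ^ CARD('d) * (1 - (1 - real_of_int (2 * R) / real L) ^ CARD('d))) (at_right 0)" .
  have cc: "real ?m \<le> real L ^ CARD('d)"
    unfolding B.card_core using L0 R by (simp add: of_nat_power)
  have "(\<Sum>i<?m. \<omega> * (s i / L) ^ CARD('d)) = \<omega> * ((\<Sum>i<?m. s i ^ CARD('d)) / real L ^ CARD('d))"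
    by (simp add: sum_distrib_left sum_divide_distrib power_divide)
  also have "\<dots> \<le> \<omega> * ((\<Sum>i<?m. poly p (\<nu> i) + \<delta>) / real L ^ CARD('d))"
    unfolding s_def
    by (intro mult_left_mono divide_right_mono sum_mono dom B.eigenvalue_bound \<omega>) auto
  also have "\<dots> = \<omega> * ((\<Sum>i<?m. poly p (\<nu> i)) / real L ^ CARD('d) + ?m * \<delta> / real L ^ CARD('d))"
    by (simp add: sum.distrib add_divide_distrib)
  also have "\<dots> \<le> \<omega> * ((P + \<eta>1) + \<delta>)"
  proof (intro mult_left_mono add_mono \<omega>)
    show "(\<Sum>i<?m. poly p (\<nu> i)) / real L ^ CARD('d) \<le> P + \<eta>1" using L(2)[OF B] by (simp add: abs_le_iff)
    show "?m * \<delta> / real L ^ CARD('d) \<le> \<delta>" using cc \<delta> L0 mult_right_mono[OF cc \<delta>] by (simp add: field_simps)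
  qed
  also have "\<dots> = \<omega> * (P + \<delta>) + \<omega> * \<eta>1" by (simp add: algebra_simps)
  finally have le: "(\<Sum>i<?m. \<omega> * (s i / L) ^ CARD('d)) \<le> \<omega> * (P + \<delta>) + \<eta> / 4" using \<eta>1 by linarith
  have "\<forall>\<^sub>F h in at_right 0. (\<Sum>i<?m. h ^ CARD('d) * real (cnt i h)) + G h < \<omega> * (P + \<delta>) + \<eta>"
    by (rule order_tendstoD(2)[OF tendsto_add[OF lim1 lim2]]) (use le L(1) \<eta> in linarith)
  moreover have "\<forall>\<^sub>F h :: real in at_right 0. h > 0" by (simp add: eventually_at_right_less)
  ultimately show ?thesis
  proof eventually_elim
    case (elim h)
    define K where "K = \<lceil>S / (h * L)\<rceil>"
    define b where "b = nat ((2 * K + 1) * int L) ^ CARD('d) - nat (2 * K + 1) ^ CARD('d) * nat (int L - 2 * R) ^ CARD('d)"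
    have "0 \<le> S / (h * L)" using S0 elim(2) L0 by (intro divide_nonneg_nonneg) auto
    hence K0: "0 \<le> K" unfolding K_def by linarith
    have "S / (h * L) \<le> K" by (simp add: K_def)
    hence "S \<le> h * (K * L)" using elim(2) L0 by (simp add: field_simps)
    hence "S\<^sup>2 \<le> (h * (K * L))\<^sup>2" using S0 by (intro power_mono)
    hence K2: "l + \<epsilon> + M \<le> (h * real_of_int (K * int L))\<^sup>2" by (simp add: S_def)
    have N: "counting_function l (pgraph (kinetic h) V) \<le> of_nat ((\<Sum>i<?m. cnt i h) + b)"
      using B.counting_le_blocks[OF V elim(2) K0 K2 close] unfolding b_def cnt_def s_def by simp
    have bG: "h ^ CARD('d) * real b \<le> G h"
    proof -
      have "nat (2 * K + 1) ^ CARD('d) * nat (int L - 2 * R) ^ CARD('d) \<le> nat ((2 * K + 1) * int L) ^ CARD('d)"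
        unfolding power_mult_distrib[symmetric] using K0 R L0
        by (intro power_mono) (simp_all add: nat_mult_distrib[symmetric] nat_mono mult_left_mono)
      hence "real b = (real_of_int (2 * K + 1) * L) ^ CARD('d) - real_of_int (2 * K + 1) ^ CARD('d) * (real L - 2 * R) ^ CARD('d)"
        unfolding b_def using K0 L0 by (simp add: of_nat_diff)
      hence "h ^ CARD('d) * real b = (h * real_of_int (2 * K + 1)) ^ CARD('d) * (real L ^ CARD('d) - (real L - 2 * R) ^ CARD('d))"
        by (simp only: power_mult_distrib right_diff_distrib mult.assoc)
      also have "\<dots> \<le> (2 * S / L + 3 * h) ^ CARD('d) * (real L ^ CARD('d) - (real L - 2 * R) ^ CARD('d))"
      proof (intro mult_right_mono power_mono)
        have "real_of_int K \<le> S / (h * L) + 1" unfolding K_def by linarith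
        hence "h * real_of_int (2 * K + 1) \<le> h * (2 * (S / (h * L)) + 3)" using elim(2) by (intro mult_left_mono) auto
        also have "\<dots> = 2 * S / L + 3 * h" using elim(2) by (simp add: field_simps)
        finally show "h * real_of_int (2 * K + 1) \<le> 2 * S / L + 3 * h" .
        show "0 \<le> h * real_of_int (2 * K + 1)" using elim(2) K0 by simp
        have "(real L - 2 * R) ^ CARD('d) \<le> real L ^ CARD('d)" using L0 R by (intro power_mono) auto
        thus "0 \<le> real L ^ CARD('d) - (real L - 2 * R) ^ CARD('d)" by simp
      qed
      finally show ?thesis by (simp add: G_def)
    qed
    have "ennreal (h ^ CARD('d)) * counting_function l (pgraph (kinetic h) V) \<le> ennreal (h ^ CARD('d)) * of_nat ((\<Sum>i<?m. cnt i h) + b)"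
      by (intro mult_left_mono N) simp
    also have "\<dots> = ennreal (h ^ CARD('d) * real ((\<Sum>i<?m. cnt i h) + b))"
      by (subst ennreal_of_nat_eq_real_of_nat) (rule ennreal_mult[symmetric], use elim(2) in \<open>auto intro!: add_nonneg_nonneg sum_nonneg\<close>)
    also have "\<dots> \<le> ennreal (\<omega> * (P + \<delta>) + \<eta>)"
      using elim(1) bG by (intro ennreal_leI) (simp add: sum_distrib_left algebra_simps)
    finally show ?case unfolding \<omega>_def P_def .
  qed
qed

text \<open>The loss from discarding the boundary modes is already contained in the average over the
  \<open>card (core 0)\<close> eigenvalues. If the real number on the left is negative,
  \<open>ennreal\<close> turns it into 0 and the bound is trivial.\<close>

lemma counting_lower:
  fixes l \<epsilon> \<delta> \<eta> N :: real and V :: "'h \<Rightarrow> 'h"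
  assumes t: "\<And>n q. Re (cinner (e n) ((Y ^^ q) (e n))) = t q" and \<eta>: "0 < \<eta>" and \<delta>: "0 \<le> \<delta>"
    and V: "hermitian_bounded N V"
    and close: "\<And>x. Re (cinner x (V x)) \<le> Re (cinner x (Y x)) + \<epsilon> * (norm x)\<^sup>2"
    and dom: "\<And>v. \<bar>v\<bar> \<le> M \<Longrightarrow> poly p v - \<delta> \<le> sqrt (max 0 (l - \<epsilon> - v)) ^ CARD('d)"
  shows "\<forall>\<^sub>F h in at_right 0. ennreal (unit_ball_vol CARD('d) * ((\<Sum>q\<le>degree p. coeff p q * t q) - \<delta>) - \<eta>)
    \<le> ennreal (h ^ CARD('d)) * counting_function l (pgraph (kinetic h) V)"
proof -
  define \<omega> where "\<omega> = unit_ball_vol (real CARD('d))"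
  define P where "P = (\<Sum>q\<le>degree p. coeff p q * t q)"
  define \<eta>1 where "\<eta>1 = \<eta> / (4 * (\<omega> + 1))"
  have \<omega>: "0 \<le> \<omega>" by (simp add: \<omega>_def)
  have \<eta>1: "0 < \<eta>1" "\<omega> * \<eta>1 \<le> \<eta> / 4" using \<eta> \<omega> by (simp_all add: \<eta>1_def field_simps)
  note polynomial_szego[OF t \<eta>1(1), of p]
  moreover have "\<forall>\<^sub>F L in sequentially. nat (2 * R) + 1 \<le> L" by (rule eventually_ge_at_top)
  ultimately have "\<forall>\<^sub>F L in sequentially.
      (\<forall>core \<psi> \<nu>. box_eigenbasis e Y M R u (int L) core \<psi> \<nu> \<longrightarrow>
        \<bar>(\<Sum>i<card (core 0). poly p (\<nu> i)) / real L ^ CARD('d) - P\<bar> \<le> \<eta>1) \<and> nat (2 * R) + 1 \<le> L"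
    unfolding P_def by eventually_elim blast
  then obtain L :: nat where L:
    "\<And>core \<psi> \<nu>. box_eigenbasis e Y M R u (int L) core \<psi> \<nu> \<Longrightarrow>
        \<bar>(\<Sum>i<card (core 0). poly p (\<nu> i)) / real L ^ CARD('d) - P\<bar> \<le> \<eta>1" "nat (2 * R) + 1 \<le> L"
    using eventually_happens'[OF sequentially_bot] by blast
  have L0: "0 < real L" "2 * R \<le> int L" "0 < int L" using L(2) by auto
  obtain core \<psi> \<nu> where B: "box_eigenbasis e Y M R u (int L) core \<psi> \<nu>"
    using ex_box_eigenbasis[OF L0(3)] by blast
  interpret B: box_eigenbasis e Y M R u "int L" core \<psi> \<nu> by (rule B)
  let ?m = "card (core 0)"
  define s where "s i = sqrt (max 0 (l - \<epsilon> - \<nu> i))" for i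
  define cnt where "cnt i h = card {k :: int^'d. norm (real_vec k) < s i / (h * L) + (- sqrt CARD('d))}" for i and h :: real
  have lim1: "((\<lambda>h. \<Sum>i<?m. h ^ CARD('d) * real (cnt i h)) \<longlongrightarrow> (\<Sum>i<?m. \<omega> * (s i / L) ^ CARD('d))) (at_right 0)"
    unfolding cnt_def \<omega>_def by (intro tendsto_sum tendsto_lattice_points L0) (simp add: s_def)
  have cc: "real ?m \<le> real L ^ CARD('d)"
    unfolding B.card_core using L0 R by (simp add: of_nat_power)
  have "\<omega> * (P - \<delta>) - \<omega> * \<eta>1 = \<omega> * ((P - \<eta>1) - \<delta>)" by (simp add: algebra_simps)
  also have "\<dots> \<le> \<omega> * ((\<Sum>i<?m. poly p (\<nu> i)) / real L ^ CARD('d) - ?m * \<delta> / real L ^ CARD('d))"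
  proof (intro mult_left_mono diff_mono \<omega>)
    show "P - \<eta>1 \<le> (\<Sum>i<?m. poly p (\<nu> i)) / real L ^ CARD('d)" using L(1)[OF B] by (simp add: abs_le_iff)
    show "?m * \<delta> / real L ^ CARD('d) \<le> \<delta>" using cc \<delta> L0 mult_right_mono[OF cc \<delta>] by (simp add: field_simps)
  qed
  also have "\<dots> = \<omega> * ((\<Sum>i<?m. poly p (\<nu> i) - \<delta>) / real L ^ CARD('d))"
    by (simp add: sum_subtractf diff_divide_distrib)
  also have "\<dots> \<le> \<omega> * ((\<Sum>i<?m. s i ^ CARD('d)) / real L ^ CARD('d))"
    unfolding s_def
    by (intro mult_left_mono divide_right_mono sum_mono dom B.eigenvalue_bound \<omega>) auto
  also have "\<dots> = (\<Sum>i<?m. \<omega> * (s i / L) ^ CARD('d))"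
    by (simp add: sum_distrib_left sum_divide_distrib power_divide)
  finally have le: "\<omega> * (P - \<delta>) - \<eta> / 4 \<le> (\<Sum>i<?m. \<omega> * (s i / L) ^ CARD('d))" using \<eta>1 by linarith
  have "\<forall>\<^sub>F h in at_right 0. \<omega> * (P - \<delta>) - \<eta> < (\<Sum>i<?m. h ^ CARD('d) * real (cnt i h))"
    by (rule order_tendstoD(1)[OF lim1]) (use le \<eta> in linarith)
  moreover have "\<forall>\<^sub>F h :: real in at_right 0. h > 0" by (simp add: eventually_at_right_less)
  ultimately show ?thesis
  proof eventually_elim
    case (elim h)
    have N: "of_nat (\<Sum>i<?m. cnt i h) \<le> counting_function l (pgraph (kinetic h) V)"
      using B.ge_counting_blocks[OF V elim(2) close] unfolding cnt_def s_def by simp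
    have "ennreal (\<omega> * (P - \<delta>) - \<eta>) \<le> ennreal (h ^ CARD('d) * real (\<Sum>i<?m. cnt i h))"
      using elim(1) by (intro ennreal_leI) (simp add: sum_distrib_left)
    also have "\<dots> = ennreal (h ^ CARD('d)) * of_nat (\<Sum>i<?m. cnt i h)"
      by (subst ennreal_of_nat_eq_real_of_nat) (rule ennreal_mult, use elim(2) in \<open>auto intro: sum_nonneg\<close>)
    also have "\<dots> \<le> ennreal (h ^ CARD('d)) * counting_function l (pgraph (kinetic h) V)"
      by (intro mult_left_mono N) simp
    finally show ?case unfolding \<omega>_def P_def .
  qed
qed

end

section \<open>Functional calculus in C*-algebras\<close>

lemma inverse_Suc_tendsto_0: "(\<lambda>n. 1 / real (Suc n)) \<longlonglongrightarrow> 0"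
  using LIMSEQ_inverse_real_of_nat by (simp add: inverse_eq_divide)

context cstar_algebra
begin

lemma smult_closed' [simp, intro]: "x \<in> carrier A \<Longrightarrow> c \<odot> x \<in> carrier A"
  using smult_closed[of c x] by (simp add: complex_field_def)

lemma smult_add_left: "x \<in> carrier A \<Longrightarrow> (a + b) \<odot> x = a \<odot> x \<oplus> b \<odot> x"
  using smult_l_distr[of a b x] by (simp add: complex_field_def)

lemma smult_add_right: "x \<in> carrier A \<Longrightarrow> y \<in> carrier A \<Longrightarrow> a \<odot> (x \<oplus> y) = a \<odot> x \<oplus> a \<odot> y"
  using smult_r_distr[of a x y] by (simp add: complex_field_def)

lemma smult_smult: "x \<in> carrier A \<Longrightarrow> a \<odot> (b \<odot> x) = (a * b) \<odot> x"
  using smult_assoc1[of a b x] by (simp add: complex_field_def)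

lemma smult_1 [simp]: "x \<in> carrier A \<Longrightarrow> 1 \<odot> x = x"
  using smult_one[of x] by (simp add: complex_field_def)

lemma smult_0 [simp]: "x \<in> carrier A \<Longrightarrow> 0 \<odot> x = \<zero>"
  using smult_add_left[of x 0 0] by (metis add.r_cancel_one' add_0 smult_closed')

lemma smult_neg: "x \<in> carrier A \<Longrightarrow> (- a) \<odot> x = \<ominus> (a \<odot> x)"
proof -
  assume x: "x \<in> carrier A"
  have "a \<odot> x \<oplus> (- a) \<odot> x = \<zero>" using smult_add_left[OF x, of a "- a"] x by simp
  hence "(- a) \<odot> x \<oplus> a \<odot> x = \<zero>" using x a_comm[of "a \<odot> x" "(- a) \<odot> x"] by simp
  thus ?thesis using x minus_equality[of "(- a) \<odot> x" "a \<odot> x"] by simp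
qed

lemma smult_zero [simp]: "c \<odot> \<zero> = \<zero>"
  using smult_smult[of \<zero> c 0] by (metis mult_zero_right smult_0 zero_closed)

lemma smult_minus: "x \<in> carrier A \<Longrightarrow> a \<odot> (\<ominus> x) = \<ominus> (a \<odot> x)"
  using smult_neg[of x 1] smult_neg[of x a] smult_smult[of x a "-1"] by simp

lemma smult_diff: "x \<in> carrier A \<Longrightarrow> y \<in> carrier A \<Longrightarrow> a \<odot> (x \<ominus> y) = a \<odot> x \<ominus> a \<odot> y"
  by (simp add: minus_eq smult_add_right smult_minus)

lemmas adj_closed' [simp, intro] = adj_closed

lemma adj_one [simp]: "adj A \<one> = \<one>"
  by (metis adj_adj adj_closed adj_mult l_one one_closed)

lemma adj_zero [simp]: "adj A \<zero> = \<zero>"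
  using adj_smult[of \<zero> 0] by simp

lemma adj_neg: "x \<in> carrier A \<Longrightarrow> adj A (\<ominus> x) = \<ominus> adj A x"
  using adj_smult[of x "-1"] smult_neg[of x 1] smult_neg[of "adj A x" 1] by simp

lemma adj_diff: "x \<in> carrier A \<Longrightarrow> y \<in> carrier A \<Longrightarrow> adj A (x \<ominus> y) = adj A x \<ominus> adj A y"
  by (simp add: minus_eq adj_add adj_neg)

lemma nrm_zero [simp]: "nrm A \<zero> = 0"
  using nrm_smult[of \<zero> 0] by simp

lemma nrm_neg [simp]: "x \<in> carrier A \<Longrightarrow> nrm A (\<ominus> x) = nrm A x"
  using nrm_smult[of x "-1"] smult_neg[of x 1] by simp

lemma nrm_diff: "x \<in> carrier A \<Longrightarrow> y \<in> carrier A \<Longrightarrow> nrm A (x \<ominus> y) \<le> nrm A x + nrm A y"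
  using nrm_add[of x "\<ominus> y"] by (simp add: minus_eq)

lemma minus_swap: "x \<in> carrier A \<Longrightarrow> y \<in> carrier A \<Longrightarrow> \<ominus> (x \<ominus> y) = y \<ominus> x"
  by (simp add: minus_eq minus_add a_comm)

lemma nrm_minus_commute: "x \<in> carrier A \<Longrightarrow> y \<in> carrier A \<Longrightarrow> nrm A (x \<ominus> y) = nrm A (y \<ominus> x)"
  using nrm_neg[of "x \<ominus> y"] minus_swap[of x y] by simp

lemma minus_add_minus: "x \<in> carrier A \<Longrightarrow> y \<in> carrier A \<Longrightarrow> z \<in> carrier A \<Longrightarrow> (x \<ominus> y) \<oplus> (y \<ominus> z) = x \<ominus> z"
  by (simp add: minus_eq a_assoc l_neg r_neg1)

lemma minus_add_cancel: "x \<in> carrier A \<Longrightarrow> y \<in> carrier A \<Longrightarrow> (x \<ominus> y) \<oplus> y = x"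
  by (simp add: minus_eq a_assoc l_neg)

lemma nrm_triangle: "x \<in> carrier A \<Longrightarrow> y \<in> carrier A \<Longrightarrow> z \<in> carrier A \<Longrightarrow>
    nrm A (x \<ominus> z) \<le> nrm A (x \<ominus> y) + nrm A (y \<ominus> z)"
  using nrm_add[of "x \<ominus> y" "y \<ominus> z"] by (simp add: minus_add_minus)

lemma nrm_minus_eq_0: "x \<in> carrier A \<Longrightarrow> y \<in> carrier A \<Longrightarrow> nrm A (x \<ominus> y) = 0 \<Longrightarrow> x = y"
  using nrm_eq_0[of "x \<ominus> y"] by (metis add.inv_comm add.inv_unique' a_inv_closed minus_closed minus_eq minus_minus l_neg minus_equality)

lemma nrm_one [simp]: "nrm A \<one> = 1"
proof -
  have "nrm A \<one> = (nrm A \<one>)\<^sup>2" using cstar_identity[of \<one>] by simp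
  moreover have "nrm A \<one> \<noteq> 0" using nrm_eq_0[of \<one>] nontrivial by auto
  ultimately show ?thesis by (simp add: power2_eq_square)
qed

lemma nrm_adj [simp]: "x \<in> carrier A \<Longrightarrow> nrm A (adj A x) = nrm A x"
proof -
  have le: "nrm A x \<le> nrm A (adj A x)" if x: "x \<in> carrier A" for x
  proof (cases "nrm A x = 0")
    case False
    have "nrm A x * nrm A x \<le> nrm A (adj A x) * nrm A x"
      using nrm_mult[of "adj A x" x] cstar_identity[OF x] x by (simp add: power2_eq_square)
    thus ?thesis using False nrm_nonneg[OF x] by simp
  qed (use x nrm_nonneg in simp)
  show "x \<in> carrier A \<Longrightarrow> nrm A (adj A x) = nrm A x"
    using le[of x] le[of "adj A x"] by (simp add: adj_adj)
qed

section \<open>Norm convergence in the algebra\<close>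

definition converges :: "(nat \<Rightarrow> 'a) \<Rightarrow> 'a \<Rightarrow> bool" where
  "converges s l \<longleftrightarrow> (\<forall>n. s n \<in> carrier A) \<and> l \<in> carrier A \<and> (\<lambda>n. nrm A (s n \<ominus> l)) \<longlonglongrightarrow> 0"

lemma convergesI:
  assumes "\<And>n. s n \<in> carrier A" "l \<in> carrier A" "\<And>n. nrm A (s n \<ominus> l) \<le> g n" "g \<longlonglongrightarrow> 0"
  shows "converges s l"
proof -
  have "(\<lambda>n. nrm A (s n \<ominus> l)) \<longlonglongrightarrow> 0"
    by (rule tendsto_sandwich[of "\<lambda>_. 0" _ sequentially g])
      (use assms in \<open>simp_all add: nrm_nonneg\<close>)
  thus ?thesis using assms(1,2) by (simp add: converges_def)
qed

lemma converges_const: "x \<in> carrier A \<Longrightarrow> converges (\<lambda>_. x) x"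
  by (simp add: converges_def r_neg minus_eq)

lemma converges_unique: "converges s l \<Longrightarrow> converges s l' \<Longrightarrow> l = l'"
proof -
  assume a: "converges s l" "converges s l'"
  hence c: "s n \<in> carrier A" "l \<in> carrier A" "l' \<in> carrier A" for n by (auto simp: converges_def)
  have "(\<lambda>n. nrm A (s n \<ominus> l) + nrm A (s n \<ominus> l')) \<longlonglongrightarrow> 0 + 0"
    using a by (intro tendsto_add) (auto simp: converges_def)
  moreover have "nrm A (l \<ominus> l') \<le> nrm A (s n \<ominus> l) + nrm A (s n \<ominus> l')" for n
    using nrm_triangle[of l "s n" l'] nrm_minus_commute[of l "s n"] c by simp
  ultimately have "nrm A (l \<ominus> l') \<le> 0 + 0" by (intro LIMSEQ_le_const) auto
  thus "l = l'" using c nrm_nonneg[of "l \<ominus> l'"] by (intro nrm_minus_eq_0) auto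
qed

lemma converges_add: "converges s l \<Longrightarrow> converges s' l' \<Longrightarrow> converges (\<lambda>n. s n \<oplus> s' n) (l \<oplus> l')"
proof -
  assume a: "converges s l" "converges s' l'"
  hence c: "s n \<in> carrier A" "l \<in> carrier A" "s' n \<in> carrier A" "l' \<in> carrier A" for n by (auto simp: converges_def)
  have "(\<lambda>n. nrm A (s n \<ominus> l) + nrm A (s' n \<ominus> l')) \<longlonglongrightarrow> 0 + 0"
    using a by (intro tendsto_add) (auto simp: converges_def)
  moreover have "(s n \<oplus> s' n) \<ominus> (l \<oplus> l') = (s n \<ominus> l) \<oplus> (s' n \<ominus> l')" for n
    using c by (simp add: minus_eq minus_add a_ac)
  ultimately show ?thesis using c
    by (intro convergesI[where g = "\<lambda>n. nrm A (s n \<ominus> l) + nrm A (s' n \<ominus> l')"]) (auto intro: nrm_add)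
qed

lemma converges_smult: "converges s l \<Longrightarrow> converges (\<lambda>n. c \<odot> s n) (c \<odot> l)"
proof -
  assume a: "converges s l"
  hence c: "s n \<in> carrier A" "l \<in> carrier A" for n by (auto simp: converges_def)
  have "(\<lambda>n. cmod c * nrm A (s n \<ominus> l)) \<longlonglongrightarrow> cmod c * 0"
    using a by (intro tendsto_mult tendsto_const) (auto simp: converges_def)
  thus ?thesis using c
    by (intro convergesI[where g = "\<lambda>n. cmod c * nrm A (s n \<ominus> l)"]) (auto simp: smult_diff[symmetric] nrm_smult)
qed

lemma converges_diff: "converges s l \<Longrightarrow> converges s' l' \<Longrightarrow> converges (\<lambda>n. s n \<ominus> s' n) (l \<ominus> l')"
  using converges_add[of s l "\<lambda>n. (-1) \<odot> s' n" "(-1) \<odot> l'"] converges_smult[of s' l' "-1"]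
  by (simp add: minus_eq smult_neg converges_def)

lemma converges_adj: "converges s l \<Longrightarrow> converges (\<lambda>n. adj A (s n)) (adj A l)"
  by (auto simp: converges_def adj_diff[symmetric])

lemma converges_nrm:
  assumes a: "converges s l" shows "(\<lambda>n. nrm A (s n)) \<longlonglongrightarrow> nrm A l"
proof -
  have c: "s n \<in> carrier A" "l \<in> carrier A" for n using a by (auto simp: converges_def)
  have "\<bar>nrm A (s n) - nrm A l\<bar> \<le> nrm A (s n \<ominus> l)" for n
  proof -
    have "nrm A (s n) \<le> nrm A (s n \<ominus> l) + nrm A l"
      using nrm_add[of "s n \<ominus> l" l] c by (simp add: minus_add_cancel)
    moreover have "nrm A l \<le> nrm A (l \<ominus> s n) + nrm A (s n)"
      using nrm_add[of "l \<ominus> s n" "s n"] c by (simp add: minus_add_cancel)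
    moreover have "nrm A (l \<ominus> s n) = nrm A (s n \<ominus> l)" by (rule nrm_minus_commute[OF c(2,1)])
    ultimately show ?thesis by linarith
  qed
  note b = this
  have "(\<lambda>n. \<bar>nrm A (s n) - nrm A l\<bar>) \<longlonglongrightarrow> 0"
    by (rule tendsto_sandwich[of "\<lambda>_. 0" _ sequentially "\<lambda>n. nrm A (s n \<ominus> l)"])
      (use a b in \<open>simp_all add: converges_def\<close>)
  thus ?thesis by (rule LIM_zero_cancel[OF tendsto_rabs_zero_cancel])
qed

lemma nrm_mult_diff:
  assumes "x \<in> carrier A" "y \<in> carrier A" "x' \<in> carrier A" "y' \<in> carrier A"
  shows "nrm A (x \<otimes> y \<ominus> x' \<otimes> y') \<le> nrm A x * nrm A (y \<ominus> y') + nrm A (x \<ominus> x') * nrm A y'"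
proof -
  have "x \<otimes> y \<ominus> x' \<otimes> y' = x \<otimes> (y \<ominus> y') \<oplus> (x \<ominus> x') \<otimes> y'"
    using assms by (simp add: minus_eq l_distr r_distr l_minus r_minus a_assoc r_neg1)
  thus ?thesis
    using nrm_add[of "x \<otimes> (y \<ominus> y')" "(x \<ominus> x') \<otimes> y'"] nrm_mult[of x "y \<ominus> y'"]
      nrm_mult[of "x \<ominus> x'" y'] assms by simp
qed

lemma converges_mult: "converges s l \<Longrightarrow> converges s' l' \<Longrightarrow> converges (\<lambda>n. s n \<otimes> s' n) (l \<otimes> l')"
proof -
  assume a: "converges s l" "converges s' l'"
  hence c: "s n \<in> carrier A" "l \<in> carrier A" "s' n \<in> carrier A" "l' \<in> carrier A" for n by (auto simp: converges_def)
  have "(\<lambda>n. nrm A (s n) * nrm A (s' n \<ominus> l') + nrm A (s n \<ominus> l) * nrm A l') \<longlonglongrightarrow> nrm A l * 0 + 0 * nrm A l'"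
    using a by (intro tendsto_add tendsto_mult converges_nrm tendsto_const) (auto simp: converges_def)
  thus ?thesis using c
    by (intro convergesI[where g = "\<lambda>n. nrm A (s n) * nrm A (s' n \<ominus> l') + nrm A (s n \<ominus> l) * nrm A l'"])
      (auto intro: nrm_mult_diff)
qed

lemma converges_closed: "converges s l \<Longrightarrow> s n \<in> carrier A" "converges s l \<Longrightarrow> l \<in> carrier A"
  by (simp_all add: converges_def)

lemma converges_Suc: "converges s l \<Longrightarrow> converges (\<lambda>n. s (Suc n)) l"
  unfolding converges_def using LIMSEQ_Suc[of "\<lambda>n. nrm A (s n \<ominus> l)"] by simp

section \<open>Invertibility and the spectral radius of self-adjoint elements\<close>

lemma UnitsI: "x \<in> carrier A \<Longrightarrow> y \<in> carrier A \<Longrightarrow> x \<otimes> y = \<one> \<Longrightarrow> y \<otimes> x = \<one> \<Longrightarrow> x \<in> Units A"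
  by (auto simp: Units_def)

text \<open>The Neumann series is constructed as a fixed point iteration for \<open>s = 1 + x s\<close>.\<close>

lemma neumann:
  assumes x: "x \<in> carrier A" and n: "nrm A x < 1"
  shows "\<one> \<ominus> x \<in> Units A"
proof -
  define q where "q = nrm A x"
  have q: "0 \<le> q" "q < 1" using n nrm_nonneg[OF x] by (simp_all add: q_def)
  define s where "s = rec_nat \<zero> (\<lambda>_ y. \<one> \<oplus> x \<otimes> y)"
  have s0: "s 0 = \<zero>" and sS: "s (Suc k) = \<one> \<oplus> x \<otimes> s k" for k by (simp_all add: s_def)
  have sc: "s k \<in> carrier A" for k by (induction k) (simp_all add: s0 sS x)
  have comm: "x \<otimes> s k = s k \<otimes> x" for k
  proof (induction k)
    case (Suc k)
    have "x \<otimes> s (Suc k) = x \<oplus> x \<otimes> (x \<otimes> s k)" using x sc by (simp add: sS r_distr)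
    also have "x \<otimes> (x \<otimes> s k) = (x \<otimes> s k) \<otimes> x" by (metis Suc m_assoc x sc)
    also have "x \<oplus> (x \<otimes> s k) \<otimes> x = s (Suc k) \<otimes> x" using x sc by (simp add: sS l_distr)
    finally show ?case .
  qed (simp add: s0 x)
  have bnd: "nrm A (s k) \<le> 1 / (1 - q)" for k
  proof (induction k)
    case 0 thus ?case using q by (simp add: s0)
  next
    case (Suc k)
    have "nrm A (s (Suc k)) \<le> 1 + nrm A (x \<otimes> s k)" using nrm_add[of \<one> "x \<otimes> s k"] x sc by (simp add: sS)
    also have "\<dots> \<le> 1 + q * nrm A (s k)" using nrm_mult[OF x sc] by (simp add: q_def)
    also have "\<dots> \<le> 1 + q * (1 / (1 - q))" using Suc q by (intro add_left_mono mult_left_mono)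
    also have "\<dots> = 1 / (1 - q)" using q by (simp add: field_simps)
    finally show ?case .
  qed
  \<comment> \<open>The recursion is affine, so differences are multiplied by \<open>x\<close> in
    each step; the starting difference \<open>s k - s 0\<close> is bounded by the limit of the
    geometric series.\<close>
  have cau: "nrm A (s (m + k) \<ominus> s m) \<le> q ^ m * (1 / (1 - q))" for m k
  proof (induction m)
    case 0 thus ?case using bnd sc by (simp add: s0 minus_eq)
  next
    case (Suc m)
    have "s (Suc m + k) \<ominus> s (Suc m) = x \<otimes> (s (m + k) \<ominus> s m)"
    proof -
      have "s (Suc m + k) \<ominus> s (Suc m) = (\<one> \<oplus> x \<otimes> s (m + k)) \<oplus> (\<ominus> \<one> \<oplus> \<ominus> (x \<otimes> s m))"
        using x sc by (simp add: sS minus_eq minus_add)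
      also have "\<dots> = x \<otimes> s (m + k) \<oplus> \<ominus> (x \<otimes> s m)"
        using x sc by (simp add: a_ac r_neg1 r_neg2)
      finally show ?thesis using x sc by (simp add: minus_eq r_distr r_minus)
    qed
    hence "nrm A (s (Suc m + k) \<ominus> s (Suc m)) \<le> q * nrm A (s (m + k) \<ominus> s m)"
      using nrm_mult[OF x, of "s (m + k) \<ominus> s m"] sc by (simp add: q_def)
    also have "\<dots> \<le> q * (q ^ m * (1 / (1 - q)))" using Suc q by (intro mult_left_mono)
    finally show ?case by simp
  qed
  have "\<forall>r>0. \<exists>M. \<forall>m\<ge>M. \<forall>n\<ge>M. nrm A (s m \<ominus> s n) < r"
  proof (intro allI impI)
    fix r :: real assume r: "r > 0"
    have "(\<lambda>m. q ^ m * (1 / (1 - q))) \<longlonglongrightarrow> 0 * (1 / (1 - q))"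
      using q by (intro tendsto_mult tendsto_const LIMSEQ_realpow_zero)
    hence "\<forall>\<^sub>F m in sequentially. q ^ m * (1 / (1 - q)) < r" using r by (intro order_tendstoD(2)) auto
    then obtain M where M: "\<And>m. m \<ge> M \<Longrightarrow> q ^ m * (1 / (1 - q)) < r" by (auto simp: eventually_sequentially)
    have "nrm A (s m \<ominus> s n) < r" if "n \<le> m" "n \<ge> M" for m n
      using cau[of n "m - n"] M[OF that(2)] that by simp
    hence "nrm A (s m \<ominus> s n) < r" if "m \<ge> M" "n \<ge> M" for m n
      using that nrm_minus_commute[OF sc sc] by (metis nle_le)
    thus "\<exists>M. \<forall>m\<ge>M. \<forall>n\<ge>M. nrm A (s m \<ominus> s n) < r" by blast
  qed
  then obtain l where l: "l \<in> carrier A" "(\<lambda>n. nrm A (s n \<ominus> l)) \<longlonglongrightarrow> 0"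
    using complete[of s] sc by blast
  have sl: "converges s l" using l sc by (simp add: converges_def)
  have xs: "converges (\<lambda>n. x \<otimes> s n) (x \<otimes> l)" by (intro converges_mult converges_const x sl)
  have sx: "converges (\<lambda>n. s n \<otimes> x) (l \<otimes> x)" by (intro converges_mult converges_const x sl)
  have "converges (\<lambda>n. \<one> \<oplus> x \<otimes> s n) (\<one> \<oplus> x \<otimes> l)" by (intro converges_add converges_const xs) simp
  hence fp: "l = \<one> \<oplus> x \<otimes> l" unfolding sS[symmetric] by (rule converges_unique[OF converges_Suc[OF sl]])
  have lx: "x \<otimes> l = l \<otimes> x" using xs unfolding comm by (rule converges_unique[OF _ sx])
  have "l \<ominus> x \<otimes> l = (\<one> \<oplus> x \<otimes> l) \<ominus> x \<otimes> l" by (rule arg_cong[OF fp])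
  also have "\<dots> = \<one>" using l x by (simp add: minus_eq a_assoc r_neg)
  finally have "l \<ominus> x \<otimes> l = \<one>" .
  hence "(\<one> \<ominus> x) \<otimes> l = \<one>" "l \<otimes> (\<one> \<ominus> x) = \<one>"
    using l x by (simp_all add: minus_eq l_distr r_distr l_minus r_minus lx)
  thus ?thesis using l x by (intro UnitsI[of _ l]) auto
qed

lemma Units_smult: "x \<in> Units A \<Longrightarrow> c \<noteq> 0 \<Longrightarrow> c \<odot> x \<in> Units A"
proof -
  assume x: "x \<in> Units A" and c: "c \<noteq> 0"
  then obtain y where y: "x \<in> carrier A" "y \<in> carrier A" "x \<otimes> y = \<one>" "y \<otimes> x = \<one>" by (auto simp: Units_def)
  show ?thesis
    by (rule UnitsI[of _ "(1 / c) \<odot> y"]) (use y c in \<open>simp_all add: smult_mult_left smult_mult_right smult_smult\<close>)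
qed

lemma Units_shift:
  assumes "x \<in> carrier A" "nrm A x < cmod c"
  shows "x \<ominus> c \<odot> \<one> \<in> Units A" "c \<odot> \<one> \<ominus> x \<in> Units A"
proof -
  have c: "c \<noteq> 0" using assms nrm_nonneg[of x] by auto
  have "\<one> \<ominus> (1 / c) \<odot> x \<in> Units A"
    using assms c by (intro neumann) (simp_all add: nrm_smult norm_divide field_simps)
  note u = Units_smult[OF this c] Units_smult[OF this, of "- c"]
  have e: "c \<odot> (\<one> \<ominus> (1 / c) \<odot> x) = c \<odot> \<one> \<ominus> x"
    using assms(1) c by (simp add: smult_diff smult_smult)
  show "c \<odot> \<one> \<ominus> x \<in> Units A" using u(1) e by simp
  have "(- c) \<odot> (\<one> \<ominus> (1 / c) \<odot> x) = x \<ominus> c \<odot> \<one>"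
    using assms(1) by (simp add: smult_neg e minus_swap)
  thus "x \<ominus> c \<odot> \<one> \<in> Units A" using u(2) c by simp
qed

text \<open>Self-adjoint elements have real spectrum: adding \<open>i s\<close> to both
  \<open>w\<close> and \<open>i t\<close> does not change their difference, but for suitable
  \<open>s\<close> the shifted element \<open>z\<close> has norm less than \<open>|t + s|\<close>,
  and the Neumann series applies.\<close>

lemma Units_not_real:
  assumes w: "w \<in> carrier A" "adj A w = w" and t: "t \<noteq> 0"
  shows "w \<ominus> (\<i> * complex_of_real t) \<odot> \<one> \<in> Units A"
proof -
  \<comment> \<open>This makes \<open>2 * t * s\<close> equal to the squared norm of
    \<open>w\<close>, so the square of \<open>t + s\<close> exceeds the bound for the squared norm
    of \<open>z\<close> by exactly the square of \<open>t\<close>.\<close>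
  define s where "s = (nrm A w)\<^sup>2 / (2 * t)"
  define z where "z = w \<oplus> (\<i> * complex_of_real s) \<odot> \<one>"
  have z: "z \<in> carrier A" using w by (simp add: z_def)
  have "adj A z = w \<ominus> (\<i> * complex_of_real s) \<odot> \<one>"
    using w by (simp add: z_def adj_add adj_smult minus_eq smult_neg)
  moreover have e: "\<i> * complex_of_real s * (\<i> * complex_of_real s) = - (complex_of_real s * complex_of_real s)"
    by (simp add: algebra_simps)
  ultimately have "adj A z \<otimes> z = w \<otimes> w \<oplus> complex_of_real (s\<^sup>2) \<odot> \<one>"
    using w by (simp add: z_def minus_eq l_distr r_distr l_minus r_minus smult_mult_left smult_mult_right
      smult_smult smult_neg[symmetric] smult_add_right a_ac)
      (simp add: a_assoc[symmetric] smult_add_left[symmetric] power2_eq_square e)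
  hence "(nrm A z)\<^sup>2 \<le> nrm A (w \<otimes> w) + s\<^sup>2"
    using cstar_identity[OF z] nrm_add[of "w \<otimes> w" "complex_of_real (s\<^sup>2) \<odot> \<one>"] w
    by (simp add: nrm_smult norm_power)
  also have "nrm A (w \<otimes> w) = (nrm A w)\<^sup>2" using cstar_identity[OF w(1)] w by simp
  also have "(nrm A w)\<^sup>2 + s\<^sup>2 < (t + s)\<^sup>2"
    using t by (simp add: s_def power2_sum)
  finally have "nrm A z < \<bar>t + s\<bar>" by (metis abs_ge_zero power2_abs power_less_imp_less_base)
  hence "nrm A z < cmod (\<i> * complex_of_real (t + s))" by (simp add: norm_mult del: of_real_add)
  from Units_shift(1)[OF z this] show ?thesis
    using w by (simp add: z_def minus_eq distrib_left smult_add_left minus_add a_assoc)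
      (simp add: smult_neg[symmetric] smult_add_left[symmetric] a_assoc[symmetric] w a_ac)
qed

lemma cancel_simps:
  assumes "x \<in> carrier A" "y \<in> carrier A" "y' \<in> carrier A" "z \<in> carrier A"
  shows "x \<oplus> (y \<oplus> \<ominus> x) = y" "x \<oplus> (y \<oplus> (\<ominus> x \<oplus> z)) = y \<oplus> z"
    "x \<oplus> (y \<oplus> (y' \<oplus> \<ominus> x)) = y \<oplus> y'" "x \<oplus> (y \<oplus> (y' \<oplus> (\<ominus> x \<oplus> z))) = y \<oplus> (y' \<oplus> z)"
    "\<ominus> x \<oplus> (y \<oplus> x) = y" "\<ominus> x \<oplus> (y \<oplus> (x \<oplus> z)) = y \<oplus> z"
    "\<ominus> x \<oplus> (y \<oplus> (y' \<oplus> x)) = y \<oplus> y'" "\<ominus> x \<oplus> (y \<oplus> (y' \<oplus> (x \<oplus> z))) = y \<oplus> (y' \<oplus> z)"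
proof -
  have *: "x \<oplus> (y \<oplus> (\<ominus> x \<oplus> z)) = y \<oplus> z" if "x \<in> carrier A" "y \<in> carrier A" "z \<in> carrier A" for x y z
    using a_lcomm[of x y "\<ominus> x \<oplus> z"] that by (simp add: r_neg2)
  have **: "\<ominus> x \<oplus> (y \<oplus> (x \<oplus> z)) = y \<oplus> z" if "x \<in> carrier A" "y \<in> carrier A" "z \<in> carrier A" for x y z
    using a_lcomm[of "\<ominus> x" y "x \<oplus> z"] that by (simp add: r_neg1)
  show "x \<oplus> (y \<oplus> \<ominus> x) = y" using *[of x y \<zero>] assms by simp
  show "x \<oplus> (y \<oplus> (\<ominus> x \<oplus> z)) = y \<oplus> z" using *[of x y z] assms by simp
  show "x \<oplus> (y \<oplus> (y' \<oplus> \<ominus> x)) = y \<oplus> y'" using *[of x "y \<oplus> y'" \<zero>] assms by (simp add: a_assoc)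
  show "x \<oplus> (y \<oplus> (y' \<oplus> (\<ominus> x \<oplus> z))) = y \<oplus> (y' \<oplus> z)" using *[of x "y \<oplus> y'" z] assms by (simp add: a_assoc)
  show "\<ominus> x \<oplus> (y \<oplus> x) = y" using **[of x y \<zero>] assms by simp
  show "\<ominus> x \<oplus> (y \<oplus> (x \<oplus> z)) = y \<oplus> z" using **[of x y z] assms by simp
  show "\<ominus> x \<oplus> (y \<oplus> (y' \<oplus> x)) = y \<oplus> y'" using **[of x "y \<oplus> y'" \<zero>] assms by (simp add: a_assoc)
  show "\<ominus> x \<oplus> (y \<oplus> (y' \<oplus> (x \<oplus> z))) = y \<oplus> (y' \<oplus> z)" using **[of x "y \<oplus> y'" z] assms by (simp add: a_assoc)
qed

lemma Units_inverse: "x \<in> Units A \<Longrightarrow> \<exists>y\<in>carrier A. x \<otimes> y = \<one> \<and> y \<otimes> x = \<one>"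
  by (auto simp: Units_def)

text \<open>With the Cayley transform \<open>u = (w - i)(w + i)\<^sup>-\<^sup>1\<close>, which is unitary, one has
  \<open>u\<^sup>* - u = 4 i w (1 + w\<^sup>2)\<^sup>-\<^sup>1\<close>.\<close>

lemma cayley_bound:
  assumes w: "w \<in> carrier A" "adj A w = w" "nrm A w \<le> 1"
  shows "\<exists>g\<in>carrier A. (\<one> \<oplus> w \<otimes> w) \<otimes> g = \<one> \<and> g \<otimes> (\<one> \<oplus> w \<otimes> w) = \<one> \<and> nrm A (w \<otimes> w \<otimes> g) \<le> 1 / 2"
proof -
  define P where "P = w \<oplus> \<i> \<odot> \<one>"
  define N where "N = w \<ominus> \<i> \<odot> \<one>"
  have c: "P \<in> carrier A" "N \<in> carrier A" using w by (simp_all add: P_def N_def)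
  have "N \<in> Units A" using Units_not_real[OF w(1,2), of 1] by (simp add: N_def)
  then obtain b where b: "b \<in> carrier A" "N \<otimes> b = \<one>" "b \<otimes> N = \<one>" using Units_inverse by blast
  have "P \<in> Units A" using Units_not_real[OF w(1,2), of "-1"] w by (simp add: P_def minus_eq smult_neg)
  then obtain a where a: "a \<in> carrier A" "P \<otimes> a = \<one>" "a \<otimes> P = \<one>" using Units_inverse by blast
  have PN: "P \<otimes> N = \<one> \<oplus> w \<otimes> w" "N \<otimes> P = \<one> \<oplus> w \<otimes> w"
    using w by (simp_all add: P_def N_def minus_eq l_distr r_distr l_minus r_minus smult_mult_left
      smult_mult_right smult_smult smult_neg smult_add_right smult_minus minus_add a_ac r_neg r_neg1 r_neg2 cancel_simps)
  have Na: "N = P \<ominus> (2 * \<i>) \<odot> \<one>" "P = N \<oplus> (2 * \<i>) \<odot> \<one>"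
  proof -
    have "(2 * \<i>) \<odot> \<one> = \<i> \<odot> \<one> \<oplus> \<i> \<odot> \<one>" using smult_add_left[of \<one> \<i> \<i>] by simp
    thus "N = P \<ominus> (2 * \<i>) \<odot> \<one>" "P = N \<oplus> (2 * \<i>) \<odot> \<one>"
      using w by (simp_all add: N_def P_def minus_eq minus_add a_ac r_neg r_neg1 r_neg2)
  qed
  have adjP: "adj A P = N" using w by (simp add: P_def N_def adj_add adj_smult smult_neg minus_eq)
  have adjN: "adj A N = P" using adjP c by (metis adj_adj)
  have adja: "adj A a = b"
  proof -
    have "adj A a \<otimes> N = \<one>" using a c adj_mult[of P a] adjP by simp
    thus ?thesis using m_assoc[of "adj A a" N b] a b c by simp
  qed
  \<comment> \<open>The Cayley transform. It is isometric because \<open>b\<close>, the inverse of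
    \<open>N\<close>, is the adjoint of \<open>a\<close>, and because \<open>P\<close> and
    \<open>N\<close> commute.\<close>
  define U where "U = N \<otimes> a"
  have Uc: "U \<in> carrier A" using a c by (simp add: U_def)
  have adjU: "adj A U = b \<otimes> P" using a c by (simp add: U_def adj_mult adja adjN)
  have "adj A U \<otimes> U = b \<otimes> (P \<otimes> N) \<otimes> a" using a b c unfolding adjU by (simp add: U_def m_assoc)
  also have "\<dots> = (b \<otimes> N) \<otimes> (P \<otimes> a)" using a b c PN by (metis m_assoc m_closed)
  also have "\<dots> = \<one>" using a b by simp
  finally have "(nrm A U)\<^sup>2 = 1" using cstar_identity[OF Uc] by simp
  hence nU: "nrm A U = 1" using nrm_nonneg[OF Uc] by (simp add: power2_eq_1_iff)
  have "U = \<one> \<ominus> (2 * \<i>) \<odot> a"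
    using a c by (simp add: U_def Na(1) minus_eq l_distr l_minus smult_mult_left)
  moreover have "adj A U = \<one> \<oplus> (2 * \<i>) \<odot> b"
    using b c unfolding adjU Na(2) by (simp add: r_distr smult_mult_right)
  ultimately have "adj A U \<ominus> U = (2 * \<i>) \<odot> (a \<oplus> b)"
    using a b by (simp add: minus_eq minus_add smult_add_right a_ac r_neg1 r_neg2)
  hence "2 * nrm A (a \<oplus> b) = nrm A (adj A U \<ominus> U)" using a b by (simp add: nrm_smult norm_mult)
  also have "\<dots> \<le> 2" using nrm_diff[of "adj A U" U] Uc nU by simp
  finally have ab: "nrm A (a \<oplus> b) \<le> 1" by simp
  have NP: "N \<oplus> P = 2 \<odot> w"
    using w smult_add_left[of w 1 1] by (simp add: N_def P_def minus_eq a_ac r_neg r_neg1 r_neg2)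
  \<comment> \<open>Inserting \<open>N b = 1\<close> and \<open>P a = 1\<close> in this form and
    using \<open>N + P = 2 w\<close> turns the bound on \<open>a + b\<close> into one on
    \<open>b w a\<close>, which is \<open>w\<close> times the inverse of
    \<open>1 + w\<^sup>2\<close>.\<close>
  have "a \<oplus> b = b \<otimes> (N \<oplus> P) \<otimes> a"
  proof -
    have "b \<otimes> (N \<oplus> P) \<otimes> a = (b \<otimes> N) \<otimes> a \<oplus> b \<otimes> (P \<otimes> a)" using a b c by (simp add: l_distr r_distr m_assoc)
    thus ?thesis using a b by simp
  qed
  also have "\<dots> = 2 \<odot> (b \<otimes> w \<otimes> a)" using a b w by (simp add: NP smult_mult_left smult_mult_right)
  finally have bwa: "nrm A (b \<otimes> w \<otimes> a) \<le> 1 / 2" using ab a b w by (simp add: nrm_smult)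
  have wN: "w \<otimes> N = N \<otimes> w" using w
    by (simp add: N_def minus_eq l_distr r_distr l_minus r_minus smult_mult_left smult_mult_right)
  have wb: "b \<otimes> w = w \<otimes> b"
  proof -
    have "b \<otimes> w = b \<otimes> (w \<otimes> N) \<otimes> b" using b w c by (simp add: m_assoc)
    also have "\<dots> = b \<otimes> (N \<otimes> (w \<otimes> b))" unfolding wN using b w c by (simp add: m_assoc)
    also have "\<dots> = (b \<otimes> N) \<otimes> (w \<otimes> b)" by (rule m_assoc[symmetric]) (use b w c in auto)
    finally show ?thesis using b w by simp
  qed
  show ?thesis
  proof (intro bexI[of _ "b \<otimes> a"] conjI)
    show "b \<otimes> a \<in> carrier A" using a b by simp
    have "N \<otimes> (b \<otimes> a) = a" using a b c m_assoc[of N b a] by simp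
    hence "(P \<otimes> N) \<otimes> (b \<otimes> a) = \<one>" using a b c by (simp add: m_assoc)
    thus "(\<one> \<oplus> w \<otimes> w) \<otimes> (b \<otimes> a) = \<one>" by (simp add: PN)
    have "a \<otimes> (P \<otimes> N) = N" using a b c m_assoc[of a P N] by simp
    hence "(b \<otimes> a) \<otimes> (P \<otimes> N) = \<one>" using a b c by (simp add: m_assoc)
    thus "(b \<otimes> a) \<otimes> (\<one> \<oplus> w \<otimes> w) = \<one>" by (simp add: PN)
    have "w \<otimes> w \<otimes> (b \<otimes> a) = w \<otimes> ((w \<otimes> b) \<otimes> a)" using a b w by (simp add: m_assoc)
    also have "\<dots> = w \<otimes> (b \<otimes> w \<otimes> a)" by (simp add: wb)
    finally have "nrm A (w \<otimes> w \<otimes> (b \<otimes> a)) \<le> nrm A w * nrm A (b \<otimes> w \<otimes> a)"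
      using nrm_mult[of w "b \<otimes> w \<otimes> a"] a b w by simp
    also have "\<dots> \<le> 1 * (1 / 2)" using bwa w nrm_nonneg a b by (intro mult_mono) auto
    finally show "nrm A (w \<otimes> w \<otimes> (b \<otimes> a)) \<le> 1 / 2" by simp
  qed
qed

lemma one_minus_sq: "z \<in> carrier A \<Longrightarrow> \<one> \<ominus> z \<otimes> z = (\<one> \<ominus> z) \<otimes> (\<one> \<oplus> z)"
  using minus_add_minus[of \<one> z "z \<otimes> z"] by (simp add: minus_eq l_distr r_distr l_minus)

text \<open>If \<open>1 - y\<^sup>2\<close> were invertible, then so would be \<open>1 - z\<close> for all \<open>z = y\<^sup>2, y\<^sup>4, y\<^sup>8, \<dots>\<close>.
  Since \<open>z\<^sup>2 (1 - z\<^sup>2)\<^sup>-\<^sup>1\<close> is the product of \<open>z (1 - z)\<^sup>-\<^sup>1\<close> and \<open>z (1 + z)\<^sup>-\<^sup>1\<close>, the elements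
  \<open>z (1 - z)\<^sup>-\<^sup>1\<close> would tend to 0 along this sequence, and hence so would \<open>z\<close>.\<close>

lemma one_minus_sq_not_unit:
  assumes y: "y \<in> carrier A" "adj A y = y" "nrm A y = 1"
  shows "\<one> \<ominus> y \<otimes> y \<notin> Units A"
proof
  assume u: "\<one> \<ominus> y \<otimes> y \<in> Units A"
  define q where "q = rec_nat y (\<lambda>_ x. x \<otimes> x)"
  have q0: "q 0 = y" and qS: "q (Suc n) = q n \<otimes> q n" for n by (simp_all add: q_def)
  have q: "q n \<in> carrier A \<and> adj A (q n) = q n \<and> nrm A (q n) = 1" for n
  proof (induction n)
    case (Suc n)
    thus ?case using cstar_identity[of "q n"] by (simp add: qS adj_mult)
  qed (simp add: q0 y)
  obtain v where v: "v \<in> carrier A" "(\<one> \<ominus> y \<otimes> y) \<otimes> v = \<one>" "v \<otimes> (\<one> \<ominus> y \<otimes> y) = \<one>"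
    using Units_inverse[OF u] by blast
  define C where "C = nrm A (y \<otimes> y \<otimes> v)"
  have claim: "\<exists>v\<in>carrier A. (\<one> \<ominus> q (Suc n)) \<otimes> v = \<one> \<and> v \<otimes> (\<one> \<ominus> q (Suc n)) = \<one>
      \<and> nrm A (q (Suc n) \<otimes> v) \<le> C / 2 ^ n" for n
  proof (induction n)
    case 0
    show ?case using v by (intro bexI[of _ v]) (simp_all add: qS q0 C_def)
  next
    case (Suc n)
    define z where "z = q (Suc n)"
    have z: "z \<in> carrier A" using q by (simp add: z_def)
    obtain v where v: "v \<in> carrier A" "(\<one> \<ominus> z) \<otimes> v = \<one>" "v \<otimes> (\<one> \<ominus> z) = \<one>"
      "nrm A (z \<otimes> v) \<le> C / 2 ^ n" using Suc unfolding z_def by blast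
    \<comment> \<open>\<open>z\<close> is the square of the self-adjoint element \<open>q n\<close>
      of norm 1, so \<open>cayley_bound\<close> supplies the factor \<open>1 / 2\<close> that drives
      the induction.\<close>
    obtain g where g: "g \<in> carrier A" "(\<one> \<oplus> z) \<otimes> g = \<one>" "g \<otimes> (\<one> \<oplus> z) = \<one>" "nrm A (z \<otimes> g) \<le> 1 / 2"
      using cayley_bound[of "q n"] q[of n] by (auto simp: z_def qS)
    have gz: "z \<otimes> g = g \<otimes> z"
    proof -
      have "g \<oplus> z \<otimes> g = g \<oplus> g \<otimes> z" using g(2,3) g(1) z by (simp add: l_distr r_distr)
      thus ?thesis using g z by simp
    qed
    have qz: "q (Suc (Suc n)) = z \<otimes> z" by (simp add: qS[of "Suc n"] z_def)
    have o1: "(\<one> \<ominus> z \<otimes> z) \<otimes> (g \<otimes> v) = \<one>"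
    proof -
      have "(\<one> \<oplus> z) \<otimes> (g \<otimes> v) = v" using g v z m_assoc[of "\<one> \<oplus> z" g v] by simp
      thus ?thesis using g v z unfolding one_minus_sq[OF z] by (simp add: m_assoc)
    qed
    have o2: "(g \<otimes> v) \<otimes> (\<one> \<ominus> z \<otimes> z) = \<one>"
    proof -
      have "v \<otimes> ((\<one> \<ominus> z) \<otimes> (\<one> \<oplus> z)) = \<one> \<oplus> z"
        using v z m_assoc[of v "\<one> \<ominus> z" "\<one> \<oplus> z"] by simp
      thus ?thesis using g v z unfolding one_minus_sq[OF z] by (simp add: m_assoc)
    qed
    have "z \<otimes> z \<otimes> (g \<otimes> v) = z \<otimes> ((z \<otimes> g) \<otimes> v)" using g v z by (simp add: m_assoc)
    also have "\<dots> = z \<otimes> ((g \<otimes> z) \<otimes> v)" by (simp only: gz)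
    also have "\<dots> = (z \<otimes> g) \<otimes> (z \<otimes> v)" using g v z by (simp add: m_assoc)
    finally have "z \<otimes> z \<otimes> (g \<otimes> v) = (z \<otimes> g) \<otimes> (z \<otimes> v)" .
    hence "nrm A (z \<otimes> z \<otimes> (g \<otimes> v)) \<le> nrm A (z \<otimes> g) * nrm A (z \<otimes> v)"
      using nrm_mult[of "z \<otimes> g" "z \<otimes> v"] g v z by simp
    also have "\<dots> \<le> (1 / 2) * (C / 2 ^ n)" using g v z nrm_nonneg by (intro mult_mono) auto
    finally have "nrm A (z \<otimes> z \<otimes> (g \<otimes> v)) \<le> C / 2 ^ Suc n" by simp
    thus ?case using g v o1 o2 unfolding qz by (intro bexI[of _ "g \<otimes> v"]) auto
  qed
  have bound: "1 \<le> C / 2 ^ n * 2" for n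
  proof -
    define z where "z = q (Suc n)"
    have z: "z \<in> carrier A" "nrm A z = 1" using q by (simp_all add: z_def)
    obtain v where v: "v \<in> carrier A" "v \<otimes> (\<one> \<ominus> z) = \<one>" "nrm A (z \<otimes> v) \<le> C / 2 ^ n"
      using claim[of n] unfolding z_def by blast
    \<comment> \<open>The element \<open>z\<close> has norm 1, but this factorisation bounds its
      norm by \<open>2 * C / 2 ^ n\<close>.\<close>
    have "z = (z \<otimes> v) \<otimes> (\<one> \<ominus> z)" using z v by (simp add: m_assoc)
    hence "1 \<le> nrm A (z \<otimes> v) * nrm A (\<one> \<ominus> z)"
      using nrm_mult[of "z \<otimes> v" "\<one> \<ominus> z"] z v by simp
    also have "\<dots> \<le> C / 2 ^ n * 2"
      using v z nrm_diff[of \<one> z] nrm_nonneg[of "z \<otimes> v"] nrm_nonneg[of "\<one> \<ominus> z"] by (intro mult_mono) auto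
    finally show ?thesis .
  qed
  obtain n where "2 * C < 2 ^ n" using real_arch_pow[of 2 "2 * C"] by auto
  thus False using bound[of n] by (simp add: field_simps)
qed

text \<open>After normalisation \<open>1 - y\<^sup>2 = (1 - y)(1 + y)\<close> is not invertible, so
  1 or -1 lies in the spectrum of \<open>y\<close>. For self-adjoint elements this replaces the
  spectral radius formula.\<close>

lemma norm_in_spectrum:
  assumes x: "x \<in> carrier A" "adj A x = x"
  shows "\<exists>s::real. \<bar>s\<bar> = nrm A x \<and> complex_of_real s \<odot> \<one> \<ominus> x \<notin> Units A"
proof (cases "nrm A x = 0")
  case True
  hence x0: "x = \<zero>" using nrm_eq_0 x by blast
  have "\<zero> \<notin> Units A"
  proof
    assume "\<zero> \<in> Units A"
    then obtain y where "y \<in> carrier A" "\<zero> \<otimes> y = \<one>" using Units_inverse by blast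
    thus False using nontrivial by simp
  qed
  thus ?thesis using x0 by (intro exI[of _ 0]) (simp add: minus_eq)
next
  case False
  define r where "r = nrm A x"
  have r: "r > 0" using False nrm_nonneg[OF x(1)] by (simp add: r_def)
  define y where "y = complex_of_real (1 / r) \<odot> x"
  have y: "y \<in> carrier A" "adj A y = y" "nrm A y = 1"
    using x r by (simp_all add: y_def adj_smult nrm_smult norm_divide r_def)
  have xy: "x = complex_of_real r \<odot> y" using x r by (simp add: y_def smult_smult)
  have nu: "\<not> (\<one> \<ominus> y \<in> Units A \<and> \<one> \<oplus> y \<in> Units A)"
    using one_minus_sq_not_unit[OF y] one_minus_sq[OF y(1)] Units_m_closed by metis
  have rc: "complex_of_real r \<noteq> 0" "complex_of_real (1 / r) \<noteq> 0" using r by auto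
  show ?thesis
  proof (cases "complex_of_real r \<odot> \<one> \<ominus> x \<in> Units A")
    case True
    have "complex_of_real (1 / r) \<odot> (complex_of_real r \<odot> \<one> \<ominus> x) = \<one> \<ominus> y"
      using x r by (simp add: smult_diff smult_smult y_def)
    hence "\<one> \<ominus> y \<in> Units A" using Units_smult[OF True rc(2)] by simp
    hence n: "\<one> \<oplus> y \<notin> Units A" using nu by blast
    have "complex_of_real (- r) \<odot> \<one> \<ominus> x \<notin> Units A"
    proof
      assume a: "complex_of_real (- r) \<odot> \<one> \<ominus> x \<in> Units A"
      have "(- complex_of_real (1 / r)) \<odot> (complex_of_real (- r) \<odot> \<one> \<ominus> x) = \<one> \<oplus> y"
      proof -
        have "(- complex_of_real (1 / r)) \<odot> (complex_of_real (- r) \<odot> \<one> \<ominus> x) = \<one> \<ominus> (- complex_of_real (1 / r)) \<odot> x"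
          using x r by (simp add: smult_diff smult_smult)
        thus ?thesis using x by (simp add: y_def smult_neg minus_eq)
      qed
      thus False using Units_smult[OF a, of "- complex_of_real (1 / r)"] rc n by simp
    qed
    thus ?thesis using r by (intro exI[of _ "- r"]) (simp add: r_def)
  next
    case False
    thus ?thesis using r by (intro exI[of _ r]) (simp add: r_def)
  qed
qed

text \<open>Evaluation in Horner form with complex coefficients. Factorisation into linear terms
  needs complex roots, whereas \<open>poly_elt\<close> accepts real polynomials only.\<close>

definition peval :: "complex poly \<Rightarrow> 'a \<Rightarrow> 'a" where
  "peval p x = fold_coeffs (\<lambda>a y. a \<odot> \<one> \<oplus> x \<otimes> y) p \<zero>"

lemma peval_0 [simp]: "peval 0 x = \<zero>"
  by (simp add: peval_def)

lemma peval_pCons: "x \<in> carrier A \<Longrightarrow> peval (pCons a p) x = a \<odot> \<one> \<oplus> x \<otimes> peval p x"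
  by (cases "p = 0"; cases "a = 0") (simp_all add: peval_def)

lemma peval_closed [simp]: "x \<in> carrier A \<Longrightarrow> peval p x \<in> carrier A"
  by (induction p) (simp_all add: peval_pCons)

lemma peval_add: "x \<in> carrier A \<Longrightarrow> peval (p + q) x = peval p x \<oplus> peval q x"
  by (induction p q rule: poly_induct2) (simp_all add: peval_pCons smult_add_left r_distr a_ac)

lemma peval_smult: "x \<in> carrier A \<Longrightarrow> peval (Polynomial.smult c p) x = c \<odot> peval p x"
  by (induction p) (simp_all add: peval_pCons smult_add_right smult_smult smult_mult_right)

lemma peval_mult: "x \<in> carrier A \<Longrightarrow> peval (p * q) x = peval p x \<otimes> peval q x"
  by (induction p) (simp_all add: peval_pCons peval_add peval_smult l_distr m_assoc smult_mult_left)

text \<open>A complex polynomial splits into linear factors, and a product of invertible elements is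
  invertible. Read contrapositively, this is half of the spectral mapping theorem.\<close>

lemma peval_Units:
  assumes x: "x \<in> carrier A"
  shows "p \<noteq> 0 \<Longrightarrow> (\<And>c. poly p c = 0 \<Longrightarrow> c \<odot> \<one> \<ominus> x \<in> Units A) \<Longrightarrow> peval p x \<in> Units A"
proof (induction "degree p" arbitrary: p rule: less_induct)
  case less
  show ?case
  proof (cases "degree p = 0")
    case True
    then obtain a where a: "p = [:a:]" by (rule degree_eq_zeroE)
    hence "a \<noteq> 0" using less.prems by simp
    thus ?thesis using x Units_smult[of \<one> a] by (simp add: a peval_pCons)
  next
    case False
    hence "\<not> constant (poly p)" by (simp add: constant_degree)
    then obtain c where c: "poly p c = 0" using fundamental_theorem_of_algebra by blast
    then obtain q where q: "p = [:- c, 1:] * q" by (auto simp: poly_eq_0_iff_dvd)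
    have "q \<noteq> 0" using q less.prems by auto
    have "degree p = Suc (degree q)" using \<open>q \<noteq> 0\<close> unfolding q by (subst degree_mult_eq) auto
    hence "peval q x \<in> Units A" using less.prems(2) \<open>q \<noteq> 0\<close> by (intro less.hyps) (auto simp: q)
    moreover have "peval [:- c, 1:] x \<in> Units A"
    proof -
      have "peval [:- c, 1:] x = (-1) \<odot> (c \<odot> \<one> \<ominus> x)"
        using x by (simp add: peval_pCons smult_neg smult_diff minus_swap minus_eq minus_add a_comm)
      thus ?thesis using Units_smult[OF less.prems(2)[OF c], of "-1"] by simp
    qed
    ultimately show ?thesis unfolding q peval_mult[OF x] by (intro Units_m_closed)
  qed
qed

lemma poly_elt_0 [simp]: "x \<in> carrier A \<Longrightarrow> poly_elt A 0 x = \<zero>"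
  by (simp add: poly_elt_def)

lemma poly_elt_pCons:
  assumes x: "x \<in> carrier A"
  shows "poly_elt A (pCons a p) x = complex_of_real a \<odot> \<one> \<oplus> x \<otimes> poly_elt A p x"
proof (cases "p = 0")
  case True
  thus ?thesis using x by (simp add: poly_elt_def)
next
  case False
  have "poly_elt A (pCons a p) x
      = (\<Oplus>i\<in>{..Suc (degree p)}. complex_of_real (coeff (pCons a p) i) \<odot> (x [^] i))"
    using False by (simp add: poly_elt_def)
  also have "\<dots> = (\<Oplus>i\<in>{..degree p}. complex_of_real (coeff (pCons a p) (Suc i)) \<odot> (x [^] Suc i))
      \<oplus> complex_of_real (coeff (pCons a p) 0) \<odot> (x [^] (0::nat))"
    using x by (intro finsum_Suc2) auto
  also have "(\<Oplus>i\<in>{..degree p}. complex_of_real (coeff (pCons a p) (Suc i)) \<odot> (x [^] Suc i))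
      = (\<Oplus>i\<in>{..degree p}. x \<otimes> (complex_of_real (coeff p i) \<odot> (x [^] i)))"
  proof (rule finsum_cong')
    fix i
    have "x [^] Suc i = x \<otimes> x [^] i" by (rule nat_pow_Suc2[OF x])
    thus "complex_of_real (coeff (pCons a p) (Suc i)) \<odot> (x [^] Suc i) = x \<otimes> (complex_of_real (coeff p i) \<odot> (x [^] i))"
      using x by (simp only: smult_mult_right coeff_pCons_Suc nat_pow_closed)
  qed (use x in auto)
  also have "\<dots> = x \<otimes> poly_elt A p x"
    unfolding poly_elt_def using x by (intro finsum_rdistr[symmetric]) auto
  finally show ?thesis using x by (simp add: a_comm poly_elt_def)
qed

lemma poly_elt_closed [simp]: "x \<in> carrier A \<Longrightarrow> poly_elt A p x \<in> carrier A"
  by (induction p) (simp_all add: poly_elt_pCons)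

lemma poly_elt_peval: "x \<in> carrier A \<Longrightarrow> poly_elt A p x = peval (map_poly complex_of_real p) x"
  by (induction p) (simp_all add: poly_elt_pCons peval_pCons map_poly_pCons)

lemma poly_elt_add: "x \<in> carrier A \<Longrightarrow> poly_elt A (p + q) x = poly_elt A p x \<oplus> poly_elt A q x"
  by (induction p q rule: poly_induct2) (simp_all add: poly_elt_pCons smult_add_left r_distr a_ac)

lemma poly_elt_smult: "x \<in> carrier A \<Longrightarrow> poly_elt A (Polynomial.smult c p) x = complex_of_real c \<odot> poly_elt A p x"
  by (induction p) (simp_all add: poly_elt_pCons smult_add_right smult_smult smult_mult_right)

lemma poly_elt_diff: "x \<in> carrier A \<Longrightarrow> poly_elt A (p - q) x = poly_elt A p x \<ominus> poly_elt A q x"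
  using poly_elt_add[of x p "Polynomial.smult (-1) q"] poly_elt_smult[of x "-1" q]
  by (simp add: smult_neg minus_eq)

lemma poly_elt_mult: "x \<in> carrier A \<Longrightarrow> poly_elt A (p * q) x = poly_elt A p x \<otimes> poly_elt A q x"
  by (induction p) (simp_all add: poly_elt_pCons poly_elt_add poly_elt_smult l_distr m_assoc smult_mult_left)

lemma poly_elt_pcompose: "x \<in> carrier A \<Longrightarrow> poly_elt A (pcompose q p) x = poly_elt A q (poly_elt A p x)"
  by (induction q) (simp_all add: pcompose_pCons poly_elt_pCons poly_elt_add poly_elt_mult)

lemma poly_elt_commute: "x \<in> carrier A \<Longrightarrow> poly_elt A p x \<otimes> x = x \<otimes> poly_elt A p x"
  by (induction p) (simp_all add: poly_elt_pCons l_distr r_distr m_assoc smult_mult_left smult_mult_right)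

lemma adj_poly_elt: "x \<in> carrier A \<Longrightarrow> adj A x = x \<Longrightarrow> adj A (poly_elt A p x) = poly_elt A p x"
  by (induction p) (simp_all add: poly_elt_pCons adj_add adj_smult adj_mult poly_elt_commute)

lemma converges_poly_elt: "converges s l \<Longrightarrow> converges (\<lambda>n. poly_elt A p (s n)) (poly_elt A p l)"
proof (induction p)
  case 0
  thus ?case by (simp add: converges_closed converges_const)
next
  case (pCons a p)
  thus ?case
    by (simp add: poly_elt_pCons converges_closed) (intro converges_add converges_const converges_mult; simp)
qed

lemma poly_map_poly_of_real: "poly (map_poly complex_of_real q) (complex_of_real t) = complex_of_real (poly q t)"
  by (induction q) (simp_all add: map_poly_pCons)

text \<open>The norm of the self-adjoint element \<open>y\<close> is attained as \<open>|s|\<close>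
  at a point \<open>s\<close> of its spectrum. By \<open>peval_Units\<close> the polynomial
  \<open>s - p\<close> has a root in the spectrum of \<open>x\<close>, and this root is real by
  \<open>Units_not_real\<close>.\<close>

lemma norm_poly_elt_le:
  assumes x: "x \<in> carrier A" "adj A x = x"
    and B: "\<And>t. complex_of_real t \<in> spectrum A x \<Longrightarrow> \<bar>poly p t\<bar> \<le> B"
  shows "nrm A (poly_elt A p x) \<le> B"
proof -
  define y where "y = poly_elt A p x"
  have y: "y \<in> carrier A" "adj A y = y" using x adj_poly_elt by (simp_all add: y_def)
  obtain s :: real where s: "\<bar>s\<bar> = nrm A y" "complex_of_real s \<odot> \<one> \<ominus> y \<notin> Units A"
    using norm_in_spectrum[OF y] by blast
  define r where "r = map_poly complex_of_real ([:s:] - p)"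
  have pr: "poly r (complex_of_real t) = complex_of_real (s - poly p t)" for t
    unfolding r_def poly_map_poly_of_real by simp
  have "\<exists>t. complex_of_real t \<in> spectrum A x \<and> poly p t = s"
  \<comment> \<open>A vanishing polynomial yields no root, but then \<open>p\<close> is the constant
    \<open>s\<close> and any real point of the spectrum of \<open>x\<close> will do;
    \<open>norm_in_spectrum\<close> provides one.\<close>
  proof (cases "[:s:] - p = 0")
    case True
    obtain t :: real where "complex_of_real t \<odot> \<one> \<ominus> x \<notin> Units A" using norm_in_spectrum[OF x] by blast
    moreover have "p = [:s:]" using True by simp
    ultimately show ?thesis by (intro exI[of _ t]) (simp add: spectrum_def)
  next
    case False
    hence "r \<noteq> 0" by (simp add: r_def map_poly_eq_0_iff)
    have "peval r x = complex_of_real s \<odot> \<one> \<ominus> y"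
      using x by (simp add: r_def poly_elt_peval[symmetric] poly_elt_diff poly_elt_pCons y_def)
    then obtain c where c: "poly r c = 0" "c \<odot> \<one> \<ominus> x \<notin> Units A"
      using peval_Units[OF x(1) \<open>r \<noteq> 0\<close>] s(2) by metis
    have "Im c = 0"
    proof (rule ccontr)
      assume im: "Im c \<noteq> 0"
      define w where "w = x \<ominus> complex_of_real (Re c) \<odot> \<one>"
      have w: "w \<in> carrier A" "adj A w = w" using x by (simp_all add: w_def adj_diff adj_smult)
      have "(complex_of_real (Re c) + \<i> * complex_of_real (Im c)) \<odot> \<one>
          = complex_of_real (Re c) \<odot> \<one> \<oplus> (\<i> * complex_of_real (Im c)) \<odot> \<one>"
        by (rule smult_add_left) simp
      hence "c \<odot> \<one> = complex_of_real (Re c) \<odot> \<one> \<oplus> (\<i> * complex_of_real (Im c)) \<odot> \<one>"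
        by (simp only: complex_eq[symmetric])
      hence "(-1) \<odot> (w \<ominus> (\<i> * complex_of_real (Im c)) \<odot> \<one>) = c \<odot> \<one> \<ominus> x"
        using x by (simp add: w_def smult_neg minus_eq minus_add a_ac)
      thus False using Units_smult[OF Units_not_real[OF w im], of "-1"] c(2) by simp
    qed
    hence ct: "c = complex_of_real (Re c)" by (simp add: complex_eq_iff)
    have "poly p (Re c) = s" using c(1) pr[of "Re c"] ct by simp
    moreover have "complex_of_real (Re c) \<in> spectrum A x" using c(2) ct by (simp add: spectrum_def)
    ultimately show ?thesis by blast
  qed
  then obtain t where "complex_of_real t \<in> spectrum A x" "poly p t = s" by blast
  thus ?thesis using B[of t] s(1) by (simp add: y_def)
qed

section \<open>Nonnegative spectrum and the continuous functional calculus\<close>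

lemma real_spectrum_le_norm:
  "x \<in> carrier A \<Longrightarrow> complex_of_real t \<in> spectrum A x \<Longrightarrow> \<bar>t\<bar> \<le> nrm A x"
  using Units_shift(2)[of x "complex_of_real t"] by (auto simp: spectrum_def not_less[symmetric])

text \<open>The norm bound confines the spectrum of \<open>b\<close> to the disc of radius
  \<open>c\<close> around \<open>c\<close>. The condition stands in for positivity because it passes
  to norm limits.\<close>

lemma real_spectrum_nonneg:
  assumes b: "b \<in> carrier A" "nrm A (complex_of_real c \<odot> \<one> \<ominus> b) \<le> c" and t: "complex_of_real t \<in> spectrum A b"
  shows "0 \<le> t"
proof (rule ccontr)
  assume "\<not> 0 \<le> t"
  hence "nrm A (complex_of_real c \<odot> \<one> \<ominus> b) < cmod (complex_of_real (c - t))"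
    using b nrm_nonneg[of "complex_of_real c \<odot> \<one> \<ominus> b"] by (simp del: of_real_diff)
  hence "(complex_of_real c \<odot> \<one> \<ominus> b) \<ominus> complex_of_real (c - t) \<odot> \<one> \<in> Units A"
    using b by (intro Units_shift(1)) auto
  also have "complex_of_real (c - t) \<odot> \<one> = complex_of_real c \<odot> \<one> \<ominus> complex_of_real t \<odot> \<one>"
    using smult_add_left[of \<one> "complex_of_real c" "- complex_of_real t"] by (simp add: smult_neg minus_eq)
  also have "(complex_of_real c \<odot> \<one> \<ominus> b) \<ominus> (complex_of_real c \<odot> \<one> \<ominus> complex_of_real t \<odot> \<one>) = complex_of_real t \<odot> \<one> \<ominus> b"
    using b by (simp add: minus_eq minus_add a_ac r_neg1 r_neg2 cancel_simps)
  finally show False using t by (simp add: spectrum_def)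
qed

lemma weierstrass_poly:
  fixes f :: "real \<Rightarrow> real"
  assumes "compact S" "continuous_on S f" "0 < r"
  shows "\<exists>p :: real poly. \<forall>t\<in>S. \<bar>poly p t - f t\<bar> < r"
proof -
  obtain g where g: "real_polynomial_function g" "\<And>t. t \<in> S \<Longrightarrow> \<bar>f t - g t\<bar> < r"
    using Stone_Weierstrass_real_polynomial_function[OF assms] by auto
  obtain a n where an: "g = (\<lambda>t. \<Sum>i\<le>n. a i * t ^ i)"
    using g(1) unfolding real_polynomial_function_iff_sum by blast
  have "poly (\<Sum>i\<le>n. monom (a i) i) t = g t" for t
    by (simp add: poly_sum poly_monom an)
  thus ?thesis using g(2) by (intro exI[of _ "\<Sum>i\<le>n. monom (a i) i"]) (auto simp: abs_minus_commute)
qed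

lemma cfc_approx:
  assumes x: "x \<in> carrier A" "adj A x = x" and S: "compact S" "continuous_on S f"
    and sp: "\<And>t. complex_of_real t \<in> spectrum A x \<Longrightarrow> t \<in> S"
  shows "cfc A f x \<in> carrier A" "adj A (cfc A f x) = cfc A f x"
    "\<And>p B. (\<And>t. t \<in> S \<Longrightarrow> \<bar>poly p t - f t\<bar> \<le> B) \<Longrightarrow> nrm A (poly_elt A p x \<ominus> cfc A f x) \<le> B"
proof -
  let ?\<sigma> = "{t. complex_of_real t \<in> spectrum A x}"
  have "\<exists>p :: real poly. \<forall>t\<in>S. \<bar>poly p t - f t\<bar> < 1 / real (Suc n)" for n
    by (rule weierstrass_poly[OF S]) simp
  then obtain P :: "nat \<Rightarrow> real poly" where P: "\<And>n t. t \<in> S \<Longrightarrow> \<bar>poly (P n) t - f t\<bar> < 1 / real (Suc n)" by metis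
  have close: "nrm A (poly_elt A p x \<ominus> poly_elt A (P n) x) \<le> B + 1 / real (Suc n)"
    if B: "\<And>t. t \<in> ?\<sigma> \<Longrightarrow> \<bar>poly p t - f t\<bar> \<le> B" for p B n
    unfolding poly_elt_diff[OF x(1), symmetric]
  proof (rule norm_poly_elt_le[OF x])
    fix t assume t: "complex_of_real t \<in> spectrum A x"
    have "\<bar>poly (P n) t - f t\<bar> < 1 / real (Suc n)" by (rule P[OF sp[OF t]])
    moreover have "\<bar>poly p t - f t\<bar> \<le> B" using B t by simp
    ultimately show "\<bar>poly (p - P n) t\<bar> \<le> B + 1 / real (Suc n)"
      unfolding poly_diff by linarith
  qed
  have "\<forall>r>0. \<exists>M. \<forall>m\<ge>M. \<forall>n\<ge>M. nrm A (poly_elt A (P m) x \<ominus> poly_elt A (P n) x) < r"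
  proof (intro allI impI)
    fix r :: real assume r: "r > 0"
    have "\<forall>\<^sub>F n in sequentially. 1 / real (Suc n) < r / 2" using r by (intro order_tendstoD(2)[OF inverse_Suc_tendsto_0]) simp
    then obtain M where M: "\<And>n. n \<ge> M \<Longrightarrow> 1 / real (Suc n) < r / 2" by (auto simp: eventually_sequentially)
    have "nrm A (poly_elt A (P m) x \<ominus> poly_elt A (P n) x) < r" if mn: "m \<ge> M" "n \<ge> M" for m n
    proof -
      have "nrm A (poly_elt A (P m) x \<ominus> poly_elt A (P n) x) \<le> 1 / real (Suc m) + 1 / real (Suc n)"
        by (rule close) (use P sp in \<open>auto intro: less_imp_le\<close>)
      thus ?thesis using M[OF mn(1)] M[OF mn(2)] by linarith
    qed
    thus "\<exists>M. \<forall>m\<ge>M. \<forall>n\<ge>M. nrm A (poly_elt A (P m) x \<ominus> poly_elt A (P n) x) < r" by blast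
  qed
  then obtain y where y: "y \<in> carrier A" "(\<lambda>n. nrm A (poly_elt A (P n) x \<ominus> y)) \<longlonglongrightarrow> 0"
    using complete[of "\<lambda>n. poly_elt A (P n) x"] x by auto
  have Py: "converges (\<lambda>n. poly_elt A (P n) x) y" using y x by (simp add: converges_def)
  have bound: "nrm A (poly_elt A p x \<ominus> y) \<le> B" if B: "\<And>t. t \<in> ?\<sigma> \<Longrightarrow> \<bar>poly p t - f t\<bar> \<le> B" for p B
  proof -
    have l: "(\<lambda>n. nrm A (poly_elt A p x \<ominus> poly_elt A (P n) x)) \<longlonglongrightarrow> nrm A (poly_elt A p x \<ominus> y)"
      using x by (intro converges_nrm converges_diff converges_const Py) simp
    have "(\<lambda>n. B + 1 / real (Suc n)) \<longlonglongrightarrow> B + 0" by (intro tendsto_intros inverse_Suc_tendsto_0)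
    from LIMSEQ_le[OF l this] show ?thesis using close[OF B] by auto
  qed
  have uniq: "(\<lambda>n. nrm A (poly_elt A (p n) x \<ominus> y)) \<longlonglongrightarrow> 0"
    if u: "uniform_limit ?\<sigma> (\<lambda>n. poly (p n)) f sequentially" for p
  proof (rule LIMSEQ_I)
    fix r :: real assume r: "r > 0"
    have "\<forall>\<^sub>F n in sequentially. \<forall>t\<in>?\<sigma>. dist (poly (p n) t) (f t) < r / 2"
      using u r unfolding uniform_limit_iff by (meson half_gt_zero)
    then obtain M where M: "\<And>n t. n \<ge> M \<Longrightarrow> t \<in> ?\<sigma> \<Longrightarrow> dist (poly (p n) t) (f t) < r / 2"
      unfolding eventually_sequentially by blast
    have "nrm A (poly_elt A (p n) x \<ominus> y) \<le> r / 2" if "n \<ge> M" for n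
      by (rule bound) (use M[OF that] in \<open>auto simp: dist_real_def intro: less_imp_le\<close>)
    hence "norm (nrm A (poly_elt A (p n) x \<ominus> y) - 0) < r" if "n \<ge> M" for n
      using that r nrm_nonneg[of "poly_elt A (p n) x \<ominus> y"] x y by fastforce
    thus "\<exists>no. \<forall>n\<ge>no. norm (nrm A (poly_elt A (p n) x \<ominus> y) - 0) < r" by blast
  qed
  have "cfc A f x = y"
    unfolding cfc_def
  proof (rule the_equality)
    show "y \<in> carrier A \<and> (\<forall>p :: nat \<Rightarrow> real poly. uniform_limit ?\<sigma> (\<lambda>n. poly (p n)) f sequentially \<longrightarrow>
        (\<lambda>n. nrm A (poly_elt A (p n) x \<ominus> y)) \<longlonglongrightarrow> 0)" using y uniq by blast
    fix y' assume y': "y' \<in> carrier A \<and> (\<forall>p :: nat \<Rightarrow> real poly. uniform_limit ?\<sigma> (\<lambda>n. poly (p n)) f sequentially \<longrightarrow>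
        (\<lambda>n. nrm A (poly_elt A (p n) x \<ominus> y')) \<longlonglongrightarrow> 0)"
    have "uniform_limit ?\<sigma> (\<lambda>n. poly (P n)) f sequentially"
      unfolding uniform_limit_iff
    proof (intro allI impI)
      fix r :: real assume "r > 0"
      hence "\<forall>\<^sub>F n in sequentially. 1 / real (Suc n) < r" by (intro order_tendstoD(2)[OF inverse_Suc_tendsto_0])
      thus "\<forall>\<^sub>F n in sequentially. \<forall>t\<in>?\<sigma>. dist (poly (P n) t) (f t) < r"
      proof eventually_elim
        case (elim n)
        show ?case
        proof
          fix t assume "t \<in> ?\<sigma>"
          hence "\<bar>poly (P n) t - f t\<bar> < 1 / real (Suc n)" by (intro P sp) simp
          thus "dist (poly (P n) t) (f t) < r" using elim unfolding dist_real_def by linarith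
        qed
      qed
    qed
    hence "converges (\<lambda>n. poly_elt A (P n) x) y'" using y' x by (simp add: converges_def)
    thus "y' = y" using Py by (rule converges_unique)
  qed
  note eq = this
  show "cfc A f x \<in> carrier A" by (simp add: eq y)
  have "converges (\<lambda>n. poly_elt A (P n) x) (adj A y)" using converges_adj[OF Py] adj_poly_elt x by simp
  thus "adj A (cfc A f x) = cfc A f x" unfolding eq by (rule converges_unique[OF _ Py])
  show "nrm A (poly_elt A p x \<ominus> cfc A f x) \<le> B" if "\<And>t. t \<in> S \<Longrightarrow> \<bar>poly p t - f t\<bar> \<le> B" for p B
    unfolding eq by (rule bound) (use that sp in auto)
qed

text \<open>The third assumption encodes positivity and puts the real spectrum into the interval
  from 0 to \<open>nrm A b\<close>. Square roots enter through the boundedness of left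
  multiplication.\<close>

lemma ex_sqrt:
  assumes b: "b \<in> carrier A" "adj A b = b" "nrm A (complex_of_real c \<odot> \<one> \<ominus> b) \<le> c"
  shows "\<exists>y\<in>carrier A. adj A y = y \<and> y \<otimes> y = b"
proof -
  define S where "S = {0..nrm A b}"
  have S: "compact S" "continuous_on S sqrt" by (auto simp: S_def intro: continuous_intros)
  have sp: "t \<in> S" if "complex_of_real t \<in> spectrum A b" for t
    using real_spectrum_nonneg[OF b(1,3) that] real_spectrum_le_norm[OF b(1) that] by (auto simp: S_def)
  define y where "y = cfc A sqrt b"
  note cf = cfc_approx[OF b(1,2) S sp, folded y_def]
  have "\<exists>p :: real poly. \<forall>t\<in>S. \<bar>poly p t - sqrt t\<bar> < 1 / real (Suc n)" for n
    by (rule weierstrass_poly[OF S]) simp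
  then obtain P :: "nat \<Rightarrow> real poly" where P: "\<And>n t. t \<in> S \<Longrightarrow> \<bar>poly (P n) t - sqrt t\<bar> < 1 / real (Suc n)" by metis
  have "converges (\<lambda>n. poly_elt A (P n) b) y"
  proof (rule convergesI[OF _ cf(1) _ inverse_Suc_tendsto_0])
    show "nrm A (poly_elt A (P n) b \<ominus> y) \<le> 1 / real (Suc n)" for n
      by (rule cf(3)) (use P in \<open>auto intro: less_imp_le\<close>)
  qed (use b in auto)
  hence c1: "converges (\<lambda>n. poly_elt A (P n) b \<otimes> poly_elt A (P n) b) (y \<otimes> y)" by (intro converges_mult)
  have "nrm A (poly_elt A (P n) b \<otimes> poly_elt A (P n) b \<ominus> b) \<le> 1 / real (Suc n) * (2 * sqrt (nrm A b) + 1)" for n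
  proof -
    have "poly_elt A (P n) b \<otimes> poly_elt A (P n) b \<ominus> b = poly_elt A (P n * P n - [:0, 1:]) b"
      using b by (simp add: poly_elt_diff poly_elt_mult poly_elt_pCons)
    moreover have "nrm A (poly_elt A (P n * P n - [:0, 1:]) b) \<le> 1 / real (Suc n) * (2 * sqrt (nrm A b) + 1)"
    proof (rule norm_poly_elt_le[OF b(1,2)])
      fix t assume "complex_of_real t \<in> spectrum A b"
      hence tS: "t \<in> S" by (rule sp)
      define d where "d = poly (P n) t - sqrt t"
      have d: "\<bar>d\<bar> \<le> 1 / real (Suc n)" using P[OF tS, of n] by (simp add: d_def)
      have t0: "0 \<le> t" "sqrt t \<le> sqrt (nrm A b)" using tS by (auto simp: S_def)
      \<comment> \<open>With \<open>poly (P n) t = sqrt t + d\<close> the square exceeds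
        \<open>t\<close> by \<open>d * (2 * sqrt t + d)\<close>.\<close>
      have "poly (P n * P n - [:0, 1:]) t = d * (2 * sqrt t + d)"
        using t0 by (simp add: d_def algebra_simps)
      also have "\<bar>\<dots>\<bar> = \<bar>d\<bar> * \<bar>2 * sqrt t + d\<bar>" by (rule abs_mult)
      also have "\<dots> \<le> 1 / real (Suc n) * (2 * sqrt (nrm A b) + 1)"
      proof (rule mult_mono[OF d])
        have "1 / real (Suc n) \<le> 1" by simp
        hence "\<bar>d\<bar> \<le> 1" using d by linarith
        moreover have "0 \<le> sqrt t" using t0 by simp
        ultimately show "\<bar>2 * sqrt t + d\<bar> \<le> 2 * sqrt (nrm A b) + 1" using t0 by linarith
      qed auto
      finally show "\<bar>poly (P n * P n - [:0, 1:]) t\<bar> \<le> 1 / real (Suc n) * (2 * sqrt (nrm A b) + 1)" .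
    qed
    ultimately show ?thesis by simp
  qed
  moreover have "(\<lambda>n. 1 / real (Suc n) * (2 * sqrt (nrm A b) + 1)) \<longlonglongrightarrow> 0 * (2 * sqrt (nrm A b) + 1)"
    by (intro tendsto_mult inverse_Suc_tendsto_0 tendsto_const)
  ultimately have "converges (\<lambda>n. poly_elt A (P n) b \<otimes> poly_elt A (P n) b) b"
    using b by (intro convergesI[where g = "\<lambda>n. 1 / real (Suc n) * (2 * sqrt (nrm A b) + 1)"]) auto
  hence "y \<otimes> y = b" using c1 converges_unique by blast
  thus ?thesis using cf(1,2) by blast
qed

text \<open>The power of the negative part is a functional calculus of a functional calculus. The
  lemma merges the two into one function of \<open>x\<close>, passing through compositions of
  polynomials, where \<open>poly_elt_pcompose\<close> is available.\<close>

lemma power_neg_part_approx: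
  assumes x: "x \<in> carrier A" "adj A x = x" "nrm A x \<le> M" and a: "0 < a"
    and B: "\<And>t. t \<in> {-M..M} \<Longrightarrow> \<bar>poly p t - max 0 (- t) powr a\<bar> \<le> B"
  shows "power_elt A (neg_part A x) a \<in> carrier A"
    and "nrm A (poly_elt A p x \<ominus> power_elt A (neg_part A x) a) \<le> B"
proof -
  define S where "S = {-M..M}"
  have S: "compact S" "continuous_on S (\<lambda>t::real. \<bar>t\<bar>)" "continuous_on S (\<lambda>t::real. max 0 (- t))"
    by (auto simp: S_def intro!: continuous_intros)
  have spx: "t \<in> S" if "complex_of_real t \<in> spectrum A x" for t
    using real_spectrum_le_norm[OF x(1) that] x(3) by (auto simp: S_def abs_le_iff)
  note cx = cfc_approx[OF x(1,2) S(1,2) spx]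
  define y where "y = neg_part A x"
  have y_eq: "y = (1 / 2) \<odot> (cfc A (\<lambda>t. \<bar>t\<bar>) x \<ominus> x)" by (simp add: y_def neg_part_def)
  have y: "y \<in> carrier A" "adj A y = y"
    using cx(1,2) x by (simp_all add: y_eq adj_smult adj_diff)
  have appr: "nrm A (poly_elt A q x \<ominus> y) \<le> \<beta>" if q: "\<And>t. t \<in> S \<Longrightarrow> \<bar>poly q t - max 0 (- t)\<bar> \<le> \<beta>" for q \<beta>
  proof -
    let ?c = "cfc A (\<lambda>t. \<bar>t\<bar>) x"
    have "nrm A (poly_elt A (Polynomial.smult 2 q + [:0, 1:]) x \<ominus> ?c) \<le> 2 * \<beta>"
    proof (rule cx(3))
      fix t assume "t \<in> S"
      from q[OF this] show "\<bar>poly (Polynomial.smult 2 q + [:0, 1:]) t - \<bar>t\<bar>\<bar> \<le> 2 * \<beta>"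
        by (cases "0 \<le> t") (auto simp: abs_le_iff max_def split: if_splits)
    qed
    moreover have "poly_elt A q x \<ominus> y = (1 / 2) \<odot> (poly_elt A (Polynomial.smult 2 q + [:0, 1:]) x \<ominus> ?c)"
      using x cx(1) by (simp add: y_eq poly_elt_add poly_elt_smult poly_elt_pCons smult_diff smult_add_right smult_smult)
        (simp add: minus_eq minus_add a_ac)
    ultimately show ?thesis using x cx(1) by (simp add: nrm_smult)
  qed
  have "\<exists>p :: real poly. \<forall>t\<in>S. \<bar>poly p t - max 0 (- t)\<bar> < 1 / real (Suc n)" for n
    by (rule weierstrass_poly[OF S(1,3)]) simp
  then obtain P :: "nat \<Rightarrow> real poly" where P: "\<And>n t. t \<in> S \<Longrightarrow> \<bar>poly (P n) t - max 0 (- t)\<bar> < 1 / real (Suc n)" by metis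
  have Py: "converges (\<lambda>n. poly_elt A (P n) x) y"
  proof (rule convergesI[OF _ y(1) _ inverse_Suc_tendsto_0])
    show "nrm A (poly_elt A (P n) x \<ominus> y) \<le> 1 / real (Suc n)" for n
      by (rule appr) (use P in \<open>auto intro: less_imp_le\<close>)
  qed (use x in auto)
  \<comment> \<open>On \<open>[-M, M]\<close> the polynomials \<open>P n\<close> take values between
    about 0 and \<open>M\<close>, so \<open>M - P n\<close> has norm at most about \<open>M\<close>.
    In the limit this is the positivity criterion for \<open>y\<close>, whose real spectrum is thus
    in the range where the power is continuous.\<close>
  have "nrm A (complex_of_real M \<odot> \<one> \<ominus> poly_elt A (P n) x) \<le> M + 1 / real (Suc n)" for n
  proof -
    have "complex_of_real M \<odot> \<one> \<ominus> poly_elt A (P n) x = poly_elt A ([:M:] - P n) x"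
      using x by (simp add: poly_elt_diff poly_elt_pCons)
    also have "nrm A \<dots> \<le> M + 1 / real (Suc n)"
    proof (rule norm_poly_elt_le[OF x(1,2)])
      fix t assume "complex_of_real t \<in> spectrum A x"
      hence "t \<in> S" by (rule spx)
      thus "\<bar>poly ([:M:] - P n) t\<bar> \<le> M + 1 / real (Suc n)"
        using P[of t n] by (auto simp: S_def abs_less_iff abs_le_iff max_def split: if_splits)
    qed
    finally show ?thesis .
  qed
  moreover have "(\<lambda>n. nrm A (complex_of_real M \<odot> \<one> \<ominus> poly_elt A (P n) x)) \<longlonglongrightarrow> nrm A (complex_of_real M \<odot> \<one> \<ominus> y)"
    by (intro converges_nrm converges_diff converges_const Py) simp
  moreover have "(\<lambda>n. M + 1 / real (Suc n)) \<longlonglongrightarrow> M + 0" by (intro tendsto_intros inverse_Suc_tendsto_0)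
  ultimately have My: "nrm A (complex_of_real M \<odot> \<one> \<ominus> y) \<le> M"
    using LIMSEQ_le[of "\<lambda>n. nrm A (complex_of_real M \<odot> \<one> \<ominus> poly_elt A (P n) x)"] by fastforce
  define S2 where "S2 = {0..nrm A y}"
  have S2: "compact S2" "continuous_on S2 (\<lambda>t. t powr a)"
    by (simp add: S2_def)
      (intro continuous_on_powr' continuous_on_id continuous_on_const, use a in \<open>auto simp: S2_def\<close>)
  have spy: "t \<in> S2" if "complex_of_real t \<in> spectrum A y" for t
    using real_spectrum_nonneg[OF y(1) My that] real_spectrum_le_norm[OF y(1) that] by (auto simp: S2_def)
  define z where "z = power_elt A y a"
  note cz = cfc_approx[OF y S2 spy, folded power_elt_def z_def]
  \<comment> \<open>The values of \<open>P n\<close> may be slightly negative, so the power is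
    extended by 0. \<open>S3\<close> contains these values for \<open>t\<close> in \<open>S\<close>,
    which are within 1 of \<open>[0, M]\<close>, as well as the real spectrum of
    \<open>y\<close>.\<close>
  define g where "g s = max 0 s powr a" for s
  define S3 where "S3 = {-1..max (nrm A y) (M + 1)}"
  have S3: "compact S3" "continuous_on S3 g"
    unfolding g_def[abs_def]
    by (simp add: S3_def) (intro continuous_on_powr' continuous_intros, use a in auto)
  have ucont: "uniformly_continuous_on S3 g" by (rule compact_uniformly_continuous[OF S3(2,1)])
  have key: "nrm A (poly_elt A p x \<ominus> z) \<le> B + \<kappa>'" if k': "0 < \<kappa>'" for \<kappa>'
  proof -
    define \<kappa> where "\<kappa> = \<kappa>' / 3"
    have \<kappa>: "\<kappa> > 0" using k' by (simp add: \<kappa>_def)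
    obtain q where q: "\<And>s. s \<in> S3 \<Longrightarrow> \<bar>poly q s - g s\<bar> < \<kappa>" using weierstrass_poly[OF S3 \<kappa>] by blast
    have qz: "nrm A (poly_elt A q y \<ominus> z) \<le> \<kappa>"
    proof (rule cz(3))
      fix t assume "t \<in> S2"
      hence "t \<in> S3" "g t = t powr a" by (auto simp: S2_def S3_def g_def max_def)
      thus "\<bar>poly q t - t powr a\<bar> \<le> \<kappa>" using q[of t] by simp
    qed
    obtain \<delta> where \<delta>: "\<delta> > 0" "\<And>s s'. s \<in> S3 \<Longrightarrow> s' \<in> S3 \<Longrightarrow> dist s' s < \<delta> \<Longrightarrow> dist (g s') (g s) < \<kappa>"
      using ucont \<kappa> unfolding uniformly_continuous_on_def by metis
    have "\<forall>\<^sub>F n in sequentially. 1 / real (Suc n) < \<delta>" using \<delta>(1) by (intro order_tendstoD(2)[OF inverse_Suc_tendsto_0])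
    hence "\<forall>\<^sub>F n in sequentially. nrm A (poly_elt A p x \<ominus> poly_elt A q (poly_elt A (P n) x)) \<le> B + 2 * \<kappa>"
    proof eventually_elim
      case (elim n)
      have "poly_elt A p x \<ominus> poly_elt A q (poly_elt A (P n) x) = poly_elt A (p - pcompose q (P n)) x"
        using x by (simp add: poly_elt_diff poly_elt_pcompose)
      also have "nrm A \<dots> \<le> B + 2 * \<kappa>"
      proof (rule norm_poly_elt_le[OF x(1,2)])
        fix t assume "complex_of_real t \<in> spectrum A x"
        hence t: "t \<in> S" by (rule spx)
        define s where "s = poly (P n) t"
        define s' where "s' = max 0 (- t)"
        have ss: "\<bar>s - s'\<bar> < 1 / real (Suc n)" using P[OF t] by (simp add: s_def s'_def)
        moreover have "1 / real (Suc n) \<le> 1" by simp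
        ultimately have "\<bar>s - s'\<bar> < 1" by linarith
        moreover have "0 \<le> s'" "s' \<le> M" using t by (auto simp: s'_def S_def)
        ultimately have S3s: "s \<in> S3" "s' \<in> S3" by (auto simp: S3_def)
        have "\<bar>g s - g s'\<bar> < \<kappa>" using \<delta>(2)[OF S3s(2,1)] ss elim by (simp add: dist_real_def)
        moreover have "\<bar>poly q s - g s\<bar> < \<kappa>" by (rule q[OF S3s(1)])
        moreover have "g s' = max 0 (- t) powr a" by (simp add: g_def s'_def)
        moreover have "\<bar>poly p t - max 0 (- t) powr a\<bar> \<le> B" using B t by (simp add: S_def)
        ultimately have "\<bar>poly p t - poly q s\<bar> \<le> B + 2 * \<kappa>" by linarith
        thus "\<bar>poly (p - pcompose q (P n)) t\<bar> \<le> B + 2 * \<kappa>" by (simp add: poly_pcompose s_def)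
      qed
      finally show ?case .
    qed
    moreover have "(\<lambda>n. nrm A (poly_elt A p x \<ominus> poly_elt A q (poly_elt A (P n) x))) \<longlonglongrightarrow> nrm A (poly_elt A p x \<ominus> poly_elt A q y)"
      using x by (intro converges_nrm converges_diff converges_const converges_poly_elt Py) simp
    ultimately have "nrm A (poly_elt A p x \<ominus> poly_elt A q y) \<le> B + 2 * \<kappa>"
      using tendsto_upperbound[OF _ _ sequentially_bot] by blast
    moreover have "nrm A (poly_elt A p x \<ominus> z) \<le> nrm A (poly_elt A p x \<ominus> poly_elt A q y) + nrm A (poly_elt A q y \<ominus> z)"
      using x y cz(1) by (intro nrm_triangle) auto
    ultimately show ?thesis using qz by (simp add: \<kappa>_def)
  qed
  show "power_elt A (neg_part A x) a \<in> carrier A" using cz(1) by (simp add: z_def y_def)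
  show "nrm A (poly_elt A p x \<ominus> power_elt A (neg_part A x) a) \<le> B"
    using field_le_epsilon[OF key] by (simp add: z_def y_def)
qed

end

section \<open>The GNS representation of the noncommutative torus\<close>

locale gns_rep = cstar_algebra A for A :: "'a cstar" (structure) +
  fixes \<tau> :: "'a \<Rightarrow> complex" and \<Lambda> :: "'a \<Rightarrow> 'h::complex_hilbert_space"
  assumes tracial: "tracial_state A \<tau>" and gns: "gns_space A \<tau> \<Lambda>"
begin

lemma tr_add: "x \<in> carrier A \<Longrightarrow> y \<in> carrier A \<Longrightarrow> \<tau> (x \<oplus> y) = \<tau> x + \<tau> y"
  and tr_smult: "x \<in> carrier A \<Longrightarrow> \<tau> (c \<odot> x) = c * \<tau> x"
  and tr_one: "\<tau> \<one> = 1"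
  and tr_commute: "x \<in> carrier A \<Longrightarrow> y \<in> carrier A \<Longrightarrow> \<tau> (x \<otimes> y) = \<tau> (y \<otimes> x)"
  and tr_positive: "x \<in> carrier A \<Longrightarrow> 0 \<le> Re (\<tau> (adj A x \<otimes> x))"
  using tracial by (auto simp: tracial_state_def)

lemma gns_add: "x \<in> carrier A \<Longrightarrow> y \<in> carrier A \<Longrightarrow> \<Lambda> (x \<oplus> y) = \<Lambda> x + \<Lambda> y"
  and gns_smult: "x \<in> carrier A \<Longrightarrow> \<Lambda> (c \<odot> x) = c *\<^sub>C \<Lambda> x"
  and gns_inner: "x \<in> carrier A \<Longrightarrow> y \<in> carrier A \<Longrightarrow> cinner (\<Lambda> x) (\<Lambda> y) = \<tau> (adj A x \<otimes> y)"
  and gns_dense: "closure (\<Lambda> ` carrier A) = UNIV"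
  using gns by (auto simp: gns_space_def)

lemma scaleC_minus1: "(-1) *\<^sub>C x = - (x :: 'h)"
  using scaleR_scaleC[of "-1" x] by simp

lemma tr_diff: "x \<in> carrier A \<Longrightarrow> y \<in> carrier A \<Longrightarrow> \<tau> (x \<ominus> y) = \<tau> x - \<tau> y"
  using tr_add[of x "(-1) \<odot> y"] tr_smult[of y "-1"] by (simp add: smult_neg minus_eq)

lemma gns_diff: "x \<in> carrier A \<Longrightarrow> y \<in> carrier A \<Longrightarrow> \<Lambda> (x \<ominus> y) = \<Lambda> x - \<Lambda> y"
  using gns_add[of x "(-1) \<odot> y"] gns_smult[of y "-1"] by (simp add: smult_neg minus_eq scaleC_minus1)

lemma norm_gns: "x \<in> carrier A \<Longrightarrow> (norm (\<Lambda> x))\<^sup>2 = Re (\<tau> (adj A x \<otimes> x))"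
  by (simp only: gns_inner[symmetric] cinner_self Re_complex_of_real)

lemma dense_induct:
  assumes "closed {u. P u}" "\<And>y. y \<in> carrier A \<Longrightarrow> P (\<Lambda> y)" shows "P u"
proof -
  have "closure (\<Lambda> ` carrier A) \<subseteq> {u. P u}"
    by (rule closure_minimal) (use assms in auto)
  thus ?thesis using gns_dense by auto
qed

text \<open>The element \<open>c - x\<^sup>* x\<close> with \<open>c\<close> the squared norm of
  \<open>x\<close> is positive and has a self-adjoint square root \<open>s\<close>. Positivity of
  the trace on \<open>s y\<close> is the squared inequality.\<close>

lemma norm_gns_mult_le:
  assumes x: "x \<in> carrier A" and y: "y \<in> carrier A"
  shows "norm (\<Lambda> (x \<otimes> y)) \<le> nrm A x * norm (\<Lambda> y)"
proof -
  define c where "c = (nrm A x)\<^sup>2"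
  define b where "b = complex_of_real c \<odot> \<one> \<ominus> adj A x \<otimes> x"
  have b: "b \<in> carrier A" "adj A b = b" using x by (simp_all add: b_def adj_diff adj_smult adj_mult adj_adj)
  have "complex_of_real c \<odot> \<one> \<ominus> b = adj A x \<otimes> x"
    using x by (simp add: b_def minus_eq minus_add a_ac r_neg r_neg1 r_neg2 cancel_simps)
  hence "nrm A (complex_of_real c \<odot> \<one> \<ominus> b) \<le> c" using cstar_identity[OF x] by (simp add: c_def)
  then obtain s where s: "s \<in> carrier A" "adj A s = s" "s \<otimes> s = b" using ex_sqrt[OF b] by blast
  have "adj A (s \<otimes> y) \<otimes> (s \<otimes> y) = adj A y \<otimes> (b \<otimes> y)"
    using s y by (simp add: adj_mult m_assoc s(3)[symmetric])
  also have "b \<otimes> y = complex_of_real c \<odot> y \<ominus> adj A x \<otimes> (x \<otimes> y)"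
    using x y by (simp add: b_def minus_eq l_distr l_minus smult_mult_left m_assoc)
  also have "adj A y \<otimes> \<dots> = complex_of_real c \<odot> (adj A y \<otimes> y) \<ominus> adj A (x \<otimes> y) \<otimes> (x \<otimes> y)"
    using x y by (simp add: minus_eq r_distr r_minus smult_mult_right adj_mult m_assoc)
  finally have "Re (\<tau> (adj A (s \<otimes> y) \<otimes> (s \<otimes> y))) = c * (norm (\<Lambda> y))\<^sup>2 - (norm (\<Lambda> (x \<otimes> y)))\<^sup>2"
    using x y by (simp add: tr_diff tr_smult norm_gns)
  hence "(norm (\<Lambda> (x \<otimes> y)))\<^sup>2 \<le> (nrm A x * norm (\<Lambda> y))\<^sup>2"
    using tr_positive[of "s \<otimes> y"] s y by (simp add: c_def power_mult_distrib)
  thus ?thesis by (rule power2_le_imp_le) (simp add: x nrm_nonneg)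
qed

lemma norm_gns_le: "x \<in> carrier A \<Longrightarrow> norm (\<Lambda> x) \<le> nrm A x"
proof -
  assume x: "x \<in> carrier A"
  have "norm (\<Lambda> \<one>) = 1" by (rule cinner_self_eq_1) (simp add: gns_inner tr_one)
  thus ?thesis using norm_gns_mult_le[of x \<one>] x by simp
qed

lemma tr_bound: "x \<in> carrier A \<Longrightarrow> cmod (\<tau> x) \<le> nrm A x"
  using cinner_Cauchy_Schwarz[of "\<Lambda> \<one>" "\<Lambda> x"] gns_inner[of \<one> x] norm_gns_le[of x] norm_gns_le[of \<one>]
    mult_mono[of "norm (\<Lambda> \<one>)" 1 "norm (\<Lambda> x)" "nrm A x"] by simp

text \<open>A vector may have several preimages under \<open>\<Lambda>\<close>. \<open>g\<close>
  picks one of them, and \<open>lip\<close> shows that the choice does not affect the result; it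
  also permits the extension to the closure. Linearity is inherited by density, one argument at a
  time.\<close>

lemma ex_left_mult:
  assumes x: "x \<in> carrier A"
  shows "\<exists>T. bounded_linear T \<and> (\<forall>y\<in>carrier A. T (\<Lambda> y) = \<Lambda> (x \<otimes> y)) \<and> (\<forall>u. norm (T u) \<le> nrm A x * norm u)"
proof -
  define D where "D = \<Lambda> ` carrier A"
  define g where "g v = \<Lambda> (x \<otimes> (SOME y. y \<in> carrier A \<and> \<Lambda> y = v))" for v
  have lip: "norm (\<Lambda> (x \<otimes> y) - \<Lambda> (x \<otimes> y')) \<le> nrm A x * norm (\<Lambda> y - \<Lambda> y')"
    if "y \<in> carrier A" "y' \<in> carrier A" for y y'
  proof -
    have "\<Lambda> (x \<otimes> y) - \<Lambda> (x \<otimes> y') = \<Lambda> (x \<otimes> (y \<ominus> y'))"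
      using that x by (simp add: gns_diff[symmetric] minus_eq r_distr r_minus)
    thus ?thesis using norm_gns_mult_le[OF x, of "y \<ominus> y'"] that by (simp add: gns_diff)
  qed
  have g: "g (\<Lambda> y) = \<Lambda> (x \<otimes> y)" if y: "y \<in> carrier A" for y
  proof -
    define y' where "y' = (SOME z. z \<in> carrier A \<and> \<Lambda> z = \<Lambda> y)"
    have "y' \<in> carrier A \<and> \<Lambda> y' = \<Lambda> y" unfolding y'_def by (rule someI) (use y in blast)
    hence "norm (\<Lambda> (x \<otimes> y') - \<Lambda> (x \<otimes> y)) \<le> 0" using lip[of y' y] y by simp
    thus ?thesis by (simp add: g_def y'_def)
  qed
  have "uniformly_continuous_on D g"
    unfolding uniformly_continuous_on_def
  proof (intro allI impI)
    fix r :: real assume r: "0 < r"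
    have n1: "0 < nrm A x + 1" using nrm_nonneg[OF x] by simp
    show "\<exists>d>0. \<forall>u\<in>D. \<forall>v\<in>D. dist v u < d \<longrightarrow> dist (g v) (g u) < r"
    proof (intro exI[of _ "r / (nrm A x + 1)"] conjI ballI impI)
      show "0 < r / (nrm A x + 1)" using r n1 by simp
      fix u v assume uv: "u \<in> D" "v \<in> D" "dist v u < r / (nrm A x + 1)"
      obtain y y' where y: "y \<in> carrier A" "y' \<in> carrier A" "u = \<Lambda> y" "v = \<Lambda> y'" using uv by (auto simp: D_def)
      have "dist (g v) (g u) \<le> nrm A x * dist v u" using lip[OF y(2,1)] y by (simp add: g dist_norm)
      also have "\<dots> \<le> (nrm A x + 1) * dist v u" by (intro mult_right_mono) auto
      also have "\<dots> < r" using uv(3) n1 by (simp add: field_simps)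
      finally show "dist (g v) (g u) < r" .
    qed
  qed
  then obtain T where T: "uniformly_continuous_on (closure D) T" "\<And>u. u \<in> D \<Longrightarrow> g u = T u"
    by (rule uniformly_continuous_on_extension_on_closure) blast
  have cT: "continuous_on UNIV T"
    using uniformly_continuous_imp_continuous[OF T(1)] gns_dense by (simp add: D_def)
  have TL: "T (\<Lambda> y) = \<Lambda> (x \<otimes> y)" if "y \<in> carrier A" for y
    using T(2)[of "\<Lambda> y"] g[OF that] that by (simp add: D_def)
  have cT': "continuous_on UNIV (\<lambda>u. T (h u))" if "continuous_on UNIV h" for h :: "'h \<Rightarrow> 'h"
    using continuous_on_compose2[OF cT that] by simp
  have add1: "T (\<Lambda> y + v) = T (\<Lambda> y) + T v" if y: "y \<in> carrier A" for y v
  proof (rule dense_induct[of "\<lambda>v. T (\<Lambda> y + v) = T (\<Lambda> y) + T v"])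
    show "closed {v. T (\<Lambda> y + v) = T (\<Lambda> y) + T v}"
      by (intro closed_Collect_eq cT' continuous_intros)
    fix z assume z: "z \<in> carrier A"
    show "T (\<Lambda> y + \<Lambda> z) = T (\<Lambda> y) + T (\<Lambda> z)"
      using x y z TL[of "y \<oplus> z"] by (simp add: gns_add TL r_distr)
  qed
  have add: "T (u + v) = T u + T v" for u v
  proof (rule dense_induct[of "\<lambda>u. T (u + v) = T u + T v"])
    show "closed {u. T (u + v) = T u + T v}"
      by (intro closed_Collect_eq cT' continuous_intros)
  qed (rule add1)
  have bnd: "norm (T u) \<le> nrm A x * norm u" for u
  proof (rule dense_induct[of "\<lambda>u. norm (T u) \<le> nrm A x * norm u"])
    show "closed {u. norm (T u) \<le> nrm A x * norm u}"
      by (intro closed_Collect_le cT' continuous_intros)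
    show "norm (T (\<Lambda> y)) \<le> nrm A x * norm (\<Lambda> y)" if "y \<in> carrier A" for y
      using norm_gns_mult_le[OF x that] TL[OF that] by simp
  qed
  have scale: "T (r *\<^sub>R u) = r *\<^sub>R T u" for r u
  proof (rule dense_induct[of "\<lambda>u. T (r *\<^sub>R u) = r *\<^sub>R T u"])
    show "closed {u. T (r *\<^sub>R u) = r *\<^sub>R T u}"
      by (intro closed_Collect_eq cT' continuous_intros)
    show "T (r *\<^sub>R \<Lambda> y) = r *\<^sub>R T (\<Lambda> y)" if "y \<in> carrier A" for y
      using x that TL[of "complex_of_real r \<odot> y"] by (simp add: TL scaleR_scaleC gns_smult smult_mult_right)
  qed
  have "bounded_linear T"
    by (rule bounded_linear_intro[OF add scale, of "nrm A x"]) (metis bnd mult.commute)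
  thus ?thesis using TL bnd by blast
qed

lemma bounded_linear_eqI:
  assumes "bounded_linear S" "bounded_linear T" "\<And>y. y \<in> carrier A \<Longrightarrow> S (\<Lambda> y) = T (\<Lambda> y)"
  shows "S = (T :: 'h \<Rightarrow> 'h)"
proof
  fix u
  show "S u = T u"
    by (rule dense_induct[of "\<lambda>u. S u = T u"])
      (use assms in \<open>auto intro!: closed_Collect_eq linear_continuous_on\<close>)
qed

abbreviation L :: "'a \<Rightarrow> 'h \<Rightarrow> 'h" where "L \<equiv> left_mult A \<Lambda>"

lemma left_mult:
  assumes x: "x \<in> carrier A"
  shows "bounded_linear (L x)" "\<And>y. y \<in> carrier A \<Longrightarrow> L x (\<Lambda> y) = \<Lambda> (x \<otimes> y)" "norm (L x u) \<le> nrm A x * norm u"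
proof -
  obtain T where T: "bounded_linear T" "\<forall>y\<in>carrier A. T (\<Lambda> y) = \<Lambda> (x \<otimes> y)" "\<forall>u. norm (T u) \<le> nrm A x * norm u"
    using ex_left_mult[OF x] by blast
  have "L x = T"
    unfolding left_mult_def
  proof (rule the_equality)
    show "bounded_linear T \<and> (\<forall>y\<in>carrier A. T (\<Lambda> y) = \<Lambda> (x \<otimes> y))" using T by blast
    show "S = T" if "bounded_linear S \<and> (\<forall>y\<in>carrier A. S (\<Lambda> y) = \<Lambda> (x \<otimes> y))" for S
      by (rule bounded_linear_eqI) (use that T in auto)
  qed
  thus "bounded_linear (L x)" "\<And>y. y \<in> carrier A \<Longrightarrow> L x (\<Lambda> y) = \<Lambda> (x \<otimes> y)" "norm (L x u) \<le> nrm A x * norm u"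
    using T by auto
qed

lemma left_mult_add: "x \<in> carrier A \<Longrightarrow> y \<in> carrier A \<Longrightarrow> L (x \<oplus> y) u = L x u + L y u"
proof -
  assume xy: "x \<in> carrier A" "y \<in> carrier A"
  have "L (x \<oplus> y) = (\<lambda>u. L x u + L y u)"
    by (rule bounded_linear_eqI) (use xy in \<open>auto intro!: bounded_linear_add left_mult(1) simp: left_mult(2) l_distr gns_add\<close>)
  thus ?thesis by simp
qed

lemma left_mult_mult: "x \<in> carrier A \<Longrightarrow> y \<in> carrier A \<Longrightarrow> L (x \<otimes> y) u = L x (L y u)"
proof -
  assume xy: "x \<in> carrier A" "y \<in> carrier A"
  have "L (x \<otimes> y) = (\<lambda>u. L x (L y u))"
    by (rule bounded_linear_eqI) (use xy in \<open>auto intro!: bounded_linear_compose[OF left_mult(1) left_mult(1)] left_mult(1) simp: left_mult(2) m_assoc\<close>)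
  thus ?thesis by simp
qed

lemma bounded_linear_scaleC: "bounded_linear S \<Longrightarrow> bounded_linear (\<lambda>u. c *\<^sub>C (S u :: 'h))"
  using bounded_linear_compose[OF bounded_bilinear.bounded_linear_right[OF bounded_bilinear_scaleC]] by blast

lemma left_mult_smult: "x \<in> carrier A \<Longrightarrow> L (c \<odot> x) u = c *\<^sub>C L x u"
proof -
  assume x: "x \<in> carrier A"
  have "L (c \<odot> x) = (\<lambda>u. c *\<^sub>C L x u)"
    by (rule bounded_linear_eqI) (use x in \<open>auto intro!: bounded_linear_scaleC left_mult(1) simp: left_mult(2) smult_mult_left gns_smult\<close>)
  thus ?thesis by simp
qed

lemma left_mult_scaleC: "x \<in> carrier A \<Longrightarrow> L x (c *\<^sub>C u) = c *\<^sub>C L x u"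
proof -
  assume x: "x \<in> carrier A"
  have b: "bounded_linear (\<lambda>u. L x (c *\<^sub>C u))"
    by (rule bounded_linear_compose[OF left_mult(1)[OF x]])
      (rule bounded_bilinear.bounded_linear_right[OF bounded_bilinear_scaleC])
  have "(\<lambda>u. L x (c *\<^sub>C u)) = (\<lambda>u. c *\<^sub>C L x u)"
  proof (rule bounded_linear_eqI[OF b bounded_linear_scaleC[OF left_mult(1)[OF x]]])
    fix y assume y: "y \<in> carrier A"
    have "L x (c *\<^sub>C \<Lambda> y) = \<Lambda> (x \<otimes> (c \<odot> y))" using x y by (simp add: gns_smult[symmetric] left_mult(2))
    thus "L x (c *\<^sub>C \<Lambda> y) = c *\<^sub>C L x (\<Lambda> y)" using x y by (simp add: smult_mult_right gns_smult left_mult(2))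
  qed
  thus ?thesis by meson
qed

lemma left_mult_complex_linear: "x \<in> carrier A \<Longrightarrow> complex_linear (L x)"
  by (simp add: complex_linear_def left_mult_scaleC linear_add[OF bounded_linear.linear[OF left_mult(1)]])

lemma left_mult_adj:
  assumes x: "x \<in> carrier A" shows "cinner (L x u) v = cinner u (L (adj A x) v)"
proof -
  have cL: "continuous_on UNIV (L y)" if "y \<in> carrier A" for y
    using left_mult(1)[OF that] by (rule linear_continuous_on)
  have 1: "cinner (L x (\<Lambda> y)) v = cinner (\<Lambda> y) (L (adj A x) v)" if y: "y \<in> carrier A" for y v
  proof (rule dense_induct[of "\<lambda>v. cinner (L x (\<Lambda> y)) v = cinner (\<Lambda> y) (L (adj A x) v)"])
    show "closed {v. cinner (L x (\<Lambda> y)) v = cinner (\<Lambda> y) (L (adj A x) v)}"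
      by (intro closed_Collect_eq continuous_intros cL) (simp add: x)
    fix z assume z: "z \<in> carrier A"
    show "cinner (L x (\<Lambda> y)) (\<Lambda> z) = cinner (\<Lambda> y) (L (adj A x) (\<Lambda> z))"
      using x y z by (simp add: left_mult(2) gns_inner adj_mult m_assoc)
  qed
  show ?thesis
  proof (rule dense_induct[of "\<lambda>u. cinner (L x u) v = cinner u (L (adj A x) v)"])
    show "closed {u. cinner (L x u) v = cinner u (L (adj A x) v)}"
      by (intro closed_Collect_eq continuous_intros cL) (simp add: x)
  qed (rule 1)
qed

lemma left_mult_hermitian:
  "x \<in> carrier A \<Longrightarrow> adj A x = x \<Longrightarrow> nrm A x \<le> M \<Longrightarrow> hermitian_bounded M (L x)"
  unfolding hermitian_bounded_def
  using left_mult_complex_linear[of x] left_mult_adj[of x] left_mult(3)[of x]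
  by (auto intro: order_trans[OF left_mult(3) mult_right_mono])

lemma left_mult_funpow: "x \<in> carrier A \<Longrightarrow> z \<in> carrier A \<Longrightarrow> (L x ^^ q) (\<Lambda> z) = \<Lambda> (x [^] q \<otimes> z)"
proof (induction q)
  case (Suc q)
  thus ?case
    by (simp add: left_mult(2) m_assoc[symmetric] nat_pow_Suc2[of x q, symmetric] del: nat_pow_Suc)
qed simp

lemma tr_finsum: "finite F \<Longrightarrow> (\<And>i. i \<in> F \<Longrightarrow> f i \<in> carrier A) \<Longrightarrow> \<tau> (\<Oplus>i\<in>F. f i) = (\<Sum>i\<in>F. \<tau> (f i))"
proof (induction F rule: finite_induct)
  case empty
  show ?case using tr_smult[of \<zero> 0] by simp
next
  case (insert i F)
  thus ?case by (simp add: tr_add finsum_closed Pi_def)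
qed

lemma tr_poly_elt:
  "x \<in> carrier A \<Longrightarrow> Re (\<tau> (poly_elt A p x)) = (\<Sum>q\<le>degree p. coeff p q * Re (\<tau> (x [^] q)))"
  by (simp add: poly_elt_def tr_finsum tr_smult)

end

locale torus_rep = gns_rep A \<tau> \<Lambda>
  for A :: "'a cstar" (structure) and \<tau> and \<Lambda> :: "'a \<Rightarrow> 'h::complex_hilbert_space" +
  fixes \<theta> :: "real^'d::_^'d::{finite,linorder}" and U :: "'d \<Rightarrow> 'a"
  assumes torus: "nc_torus \<theta> A U" and trace: "torus_trace A U \<tau>"
begin

text \<open>Equality up to a phase. Products of monomials agree with monomials up to phases
  depending on \<open>\<theta>\<close>, and working modulo phases avoids computing this
  cocycle.\<close>

definition sim :: "'a \<Rightarrow> 'a \<Rightarrow> bool" (infix "\<approx>" 50) where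
  "x \<approx> y \<longleftrightarrow> (\<exists>c. cmod c = 1 \<and> x = c \<odot> y)"

lemma simI: "cmod c = 1 \<Longrightarrow> x = c \<odot> y \<Longrightarrow> x \<approx> y"
  by (auto simp: sim_def)

lemma sim_refl: "x \<in> carrier A \<Longrightarrow> x \<approx> x"
  by (rule simI[of 1]) simp_all

lemma sim_sym: "y \<in> carrier A \<Longrightarrow> x \<approx> y \<Longrightarrow> y \<approx> x"
proof -
  assume y: "y \<in> carrier A" and "x \<approx> y"
  then obtain c where c: "cmod c = 1" "x = c \<odot> y" by (auto simp: sim_def)
  hence "c \<noteq> 0" by auto
  thus ?thesis using c y by (intro simI[of "1 / c"]) (simp_all add: smult_smult norm_divide)
qed

lemma sim_trans [trans]: "z \<in> carrier A \<Longrightarrow> x \<approx> y \<Longrightarrow> y \<approx> z \<Longrightarrow> x \<approx> z"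
  unfolding sim_def by (metis mult_1 norm_mult smult_smult)

lemma sim_mult_left: "x' \<in> carrier A \<Longrightarrow> y \<in> carrier A \<Longrightarrow> x \<approx> x' \<Longrightarrow> x \<otimes> y \<approx> x' \<otimes> y"
  by (auto simp: sim_def smult_mult_left)

lemma sim_mult_right: "x \<in> carrier A \<Longrightarrow> y' \<in> carrier A \<Longrightarrow> y \<approx> y' \<Longrightarrow> x \<otimes> y \<approx> x \<otimes> y'"
  by (auto simp: sim_def smult_mult_right)

section \<open>Monomials in the generators\<close>

lemma unitary_U: "unitary_elt A (U j)"
  and U_commute: "U j \<otimes> U k \<approx> U k \<otimes> U j"
proof -
  have t: "torus_relations \<theta> A U" using torus by (simp add: nc_torus_def)
  show "unitary_elt A (U j)" using t by (simp add: torus_relations_def)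
  have "U j \<otimes> U k = exp (2 * pi * \<i> * \<theta> $ j $ k) \<odot> (U k \<otimes> U j)" using t unfolding torus_relations_def by blast
  moreover have "cmod (exp (2 * pi * \<i> * \<theta> $ j $ k)) = 1" by (simp add: norm_exp_eq_Re)
  ultimately show "U j \<otimes> U k \<approx> U k \<otimes> U j" by (intro simI)
qed

lemma unitary_closed: "unitary_elt A u \<Longrightarrow> u \<in> carrier A"
  by (simp add: unitary_elt_def)

lemma unitary_adj: "unitary_elt A u \<Longrightarrow> unitary_elt A (adj A u)"
  by (simp add: unitary_elt_def adj_adj)

lemma unitary_one: "unitary_elt A \<one>"
  by (simp add: unitary_elt_def)

lemma unitary_mult: "unitary_elt A u \<Longrightarrow> unitary_elt A v \<Longrightarrow> unitary_elt A (u \<otimes> v)"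
proof -
  assume a: "unitary_elt A u" "unitary_elt A v"
  hence c: "u \<in> carrier A" "v \<in> carrier A" "adj A u \<otimes> u = \<one>" "u \<otimes> adj A u = \<one>"
    "adj A v \<otimes> v = \<one>" "v \<otimes> adj A v = \<one>" by (auto simp: unitary_elt_def)
  have "adj A u \<otimes> (u \<otimes> v) = v" using m_assoc[of "adj A u" u v] c by simp
  moreover have "v \<otimes> (adj A v \<otimes> adj A u) = adj A u" using m_assoc[of v "adj A v" "adj A u"] c by simp
  ultimately show ?thesis using c by (simp add: unitary_elt_def adj_mult m_assoc)
qed

lemma commute_mult:
  assumes "x \<in> carrier A" "y \<in> carrier A" "z \<in> carrier A" "x \<otimes> y \<approx> y \<otimes> x" "x \<otimes> z \<approx> z \<otimes> x"
  shows "x \<otimes> (y \<otimes> z) \<approx> (y \<otimes> z) \<otimes> x"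
proof -
  have "x \<otimes> (y \<otimes> z) = (x \<otimes> y) \<otimes> z" using assms by (simp add: m_assoc)
  also have "\<dots> \<approx> (y \<otimes> x) \<otimes> z" using assms by (intro sim_mult_left) auto
  also have "(y \<otimes> x) \<otimes> z = y \<otimes> (x \<otimes> z)" using assms by (simp add: m_assoc)
  finally have 1: "x \<otimes> (y \<otimes> z) \<approx> y \<otimes> (x \<otimes> z)" .
  have "y \<otimes> (x \<otimes> z) \<approx> y \<otimes> (z \<otimes> x)" using assms by (intro sim_mult_right) auto
  hence 2: "y \<otimes> (x \<otimes> z) \<approx> (y \<otimes> z) \<otimes> x" using assms(1-3) by (simp add: m_assoc)
  show ?thesis by (rule sim_trans[OF _ 1 2]) (use assms in auto)
qed

lemma commute_sym: "x \<in> carrier A \<Longrightarrow> y \<in> carrier A \<Longrightarrow> x \<otimes> y \<approx> y \<otimes> x \<Longrightarrow> y \<otimes> x \<approx> x \<otimes> y"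
  by (rule sim_sym) auto

lemma commute_adj:
  assumes x: "x \<in> carrier A" and u: "unitary_elt A u" and c: "x \<otimes> u \<approx> u \<otimes> x"
  shows "x \<otimes> adj A u \<approx> adj A u \<otimes> x"
proof -
  have uc: "u \<in> carrier A" "adj A u \<otimes> u = \<one>" "u \<otimes> adj A u = \<one>" using u by (auto simp: unitary_elt_def)
  have "x \<otimes> (u \<otimes> adj A u) = x" using uc x by simp
  hence "adj A u \<otimes> (x \<otimes> u) \<otimes> adj A u = adj A u \<otimes> x" using uc x by (simp add: m_assoc)
  moreover have "adj A u \<otimes> (u \<otimes> x) = x" using m_assoc[of "adj A u" u x] uc x by simp
  moreover have "adj A u \<otimes> (x \<otimes> u) \<otimes> adj A u \<approx> adj A u \<otimes> (u \<otimes> x) \<otimes> adj A u"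
    using x uc c by (intro sim_mult_left sim_mult_right) auto
  ultimately have "adj A u \<otimes> x \<approx> x \<otimes> adj A u" by simp
  thus ?thesis by (rule sim_sym[rotated]) (use x uc in auto)
qed

definition pw :: "'d \<Rightarrow> int \<Rightarrow> 'a" where "pw j z = U j [^] z"

lemma pw_nat: "pw j (int k) = U j [^] k"
  by (simp add: pw_def int_pow_int)

lemma Uc: "U j \<in> carrier A" "adj A (U j) \<otimes> U j = \<one>" "U j \<otimes> adj A (U j) = \<one>"
  using unitary_U[of j] by (auto simp: unitary_elt_def)

lemma unitary_nat_pow: "unitary_elt A (U j [^] (k::nat))"
  by (induction k) (simp_all add: unitary_one unitary_mult unitary_U)

lemma pw_neg: "pw j (- int k) = adj A (U j [^] k)"
proof -
  have u: "U j [^] k \<in> carrier A" "adj A (U j [^] k) \<otimes> (U j [^] k) = \<one>" "(U j [^] k) \<otimes> adj A (U j [^] k) = \<one>"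
    using unitary_nat_pow[of j k] by (auto simp: unitary_elt_def)
  show ?thesis
  proof (cases "k = 0")
    case True thus ?thesis by (simp add: pw_def int_pow_def2)
  next
    case False
    hence "pw j (- int k) = inv (U j [^] k)" by (simp add: pw_def int_pow_def2)
    thus ?thesis using u by (simp add: inv_char)
  qed
qed

lemma unitary_pw: "unitary_elt A (pw j z)"
  by (cases z rule: int_cases2) (simp_all add: pw_nat pw_neg unitary_nat_pow unitary_adj)

lemma pw_closed [simp]: "pw j z \<in> carrier A"
  using unitary_pw by (rule unitary_closed)

lemma pw_Suc: "pw j (z + 1) = pw j z \<otimes> U j"
proof (cases "0 \<le> z")
  case True
  then obtain k where k: "z = int k" using nonneg_int_cases by blast
  have "z + 1 = int (Suc k)" using k by simp
  thus ?thesis using k by (simp only: pw_nat nat_pow_Suc)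
next
  case False
  define k where "k = nat (- z - 1)"
  have z: "z = - int (Suc k)" "z + 1 = - int k" using False by (auto simp: k_def)
  have v: "U j [^] k \<in> carrier A" using Uc by simp
  have "U j [^] Suc k = U j \<otimes> U j [^] k" by (rule nat_pow_Suc2[OF Uc(1)])
  hence "pw j z = adj A (U j [^] k) \<otimes> adj A (U j)" unfolding z(1) pw_neg using v Uc by (simp only: adj_mult)
  hence "pw j z \<otimes> U j = adj A (U j [^] k)" using v Uc by (simp add: m_assoc)
  thus ?thesis unfolding z(2) pw_neg by simp
qed

lemma pw_pred: "pw j (z - 1) = pw j z \<otimes> adj A (U j)"
  using pw_Suc[of j "z - 1"] Uc by (simp add: m_assoc)

lemma pw_add: "pw j (a + b) = pw j a \<otimes> pw j b"
proof (induction b rule: int_induct[where k = 0])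
  case base
  have "pw j 0 = \<one>" using pw_nat[of j 0] by simp
  thus ?case by simp
next
  case (step1 b)
  thus ?case using pw_Suc[of j "a + b"] pw_Suc[of j b] Uc by (simp add: m_assoc add.assoc)
next
  case (step2 b)
  have ab: "a + (b - 1) = (a + b) - 1" by simp
  show ?case unfolding ab pw_pred using step2 Uc by (simp add: m_assoc)
qed

lemma commute_pw: "x \<in> carrier A \<Longrightarrow> x \<otimes> U j \<approx> U j \<otimes> x \<Longrightarrow> x \<otimes> pw j z \<approx> pw j z \<otimes> x"
proof (induction z rule: int_induct[where k = 0])
  case base
  have "pw j 0 = \<one>" using pw_nat[of j 0] by simp
  thus ?case using base by (simp add: sim_refl)
next
  case (step1 z)
  thus ?case using commute_mult[of x "pw j z" "U j"] Uc by (simp add: pw_Suc)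
next
  case (step2 z)
  thus ?case using commute_mult[of x "pw j z" "adj A (U j)"] commute_adj[OF _ unitary_U] Uc by (simp add: pw_pred)
qed

lemma pw_commute: "pw j a \<otimes> pw k b \<approx> pw k b \<otimes> pw j a"
proof (rule commute_pw)
  have "U k \<otimes> pw j a \<approx> pw j a \<otimes> U k" by (rule commute_pw[OF Uc(1) U_commute])
  thus "pw j a \<otimes> U k \<approx> U k \<otimes> pw j a" by (rule commute_sym[rotated 2]) (use Uc in auto)
qed simp

text \<open>The monomial with its factors taken along an arbitrary list, which makes induction over
  the factors possible; the sorted list of all indices gives the monomial itself.\<close>

definition word :: "'d list \<Rightarrow> int^'d::_ \<Rightarrow> 'a" where
  "word js n = foldr (\<lambda>j x. pw j (n $ j) \<otimes> x) js \<one>"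

lemma word_simps: "word [] n = \<one>" "word (j # js) n = pw j (n $ j) \<otimes> word js n"
  by (simp_all add: word_def)

lemma unitary_word: "unitary_elt A (word js n)"
  by (induction js) (simp_all add: word_simps unitary_one unitary_mult unitary_pw)

lemma word_closed [simp]: "word js n \<in> carrier A"
  using unitary_word by (rule unitary_closed)

lemma word_pw_commute: "word js n \<otimes> pw k b \<approx> pw k b \<otimes> word js n"
proof (induction js)
  case Nil thus ?case by (simp add: word_simps sim_refl)
next
  case (Cons j js)
  have "pw k b \<otimes> word (j # js) n \<approx> word (j # js) n \<otimes> pw k b"
    unfolding word_simps
    by (rule commute_mult[OF _ _ _ pw_commute commute_sym[OF _ _ Cons]]) auto
  thus ?case by (rule commute_sym[rotated 2]) auto
qed

text \<open>The head of the second word is moved past the tail of the first at the price of a phase,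
  after which powers of the same generator are adjacent.\<close>

lemma word_mult: "word js n \<otimes> word js m \<approx> word js (n + m)"
proof (induction js)
  case Nil thus ?case by (simp add: word_simps sim_refl)
next
  case (Cons j js)
  let ?p = "pw j (n $ j)" and ?q = "pw j (m $ j)" and ?v = "word js n" and ?w = "word js m"
  have "(?p \<otimes> ?v) \<otimes> (?q \<otimes> ?w) = ?p \<otimes> ((?v \<otimes> ?q) \<otimes> ?w)" by (simp add: m_assoc)
  also have "\<dots> \<approx> ?p \<otimes> ((?q \<otimes> ?v) \<otimes> ?w)" by (intro sim_mult_right sim_mult_left word_pw_commute) auto
  also have "?p \<otimes> ((?q \<otimes> ?v) \<otimes> ?w) = (?p \<otimes> ?q) \<otimes> (?v \<otimes> ?w)" by (simp add: m_assoc)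
  finally have 1: "(?p \<otimes> ?v) \<otimes> (?q \<otimes> ?w) \<approx> (?p \<otimes> ?q) \<otimes> (?v \<otimes> ?w)" .
  have 2: "(?p \<otimes> ?q) \<otimes> (?v \<otimes> ?w) \<approx> (?p \<otimes> ?q) \<otimes> word js (n + m)"
    by (intro sim_mult_right Cons) auto
  have "(?p \<otimes> ?v) \<otimes> (?q \<otimes> ?w) \<approx> (?p \<otimes> ?q) \<otimes> word js (n + m)"
    by (rule sim_trans[OF _ 1 2]) auto
  thus ?case by (simp add: word_simps pw_add)
qed

definition mon :: "int^'d::_ \<Rightarrow> 'a" where "mon n = torus_monomial A U n"

lemma mon_word: "mon n = word (sorted_list_of_set UNIV) n"
  by (simp add: mon_def torus_monomial_def word_def pw_def)

lemma unitary_mon: "unitary_elt A (mon n)" and mon_closed [simp]: "mon n \<in> carrier A"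
  and mon_mult: "mon n \<otimes> mon m \<approx> mon (n + m)"
  by (simp_all add: mon_word unitary_word word_mult)

lemma mon_adj_mult: "adj A (mon n) \<otimes> mon n = \<one>" "mon n \<otimes> adj A (mon n) = \<one>"
  using unitary_mon[of n] by (auto simp: unitary_elt_def)

lemma mon_0: "mon 0 = \<one>"
proof -
  have "pw j 0 = \<one>" for j using pw_nat[of j 0] by simp
  hence "word js 0 = \<one>" for js by (induction js) (simp_all add: word_simps)
  thus ?thesis by (simp add: mon_word)
qed

lemma mon_axis: "mon (axis j 1) = U j"
proof -
  have p0: "pw k 0 = \<one>" for k using pw_nat[of k 0] by simp
  have p1: "pw j 1 = U j" using pw_nat[of j 1] Uc by simp
  have n: "j \<notin> set js \<Longrightarrow> word js (axis j 1) = \<one>" for js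
    by (induction js) (auto simp: word_simps axis_def p0)
  have "distinct js \<Longrightarrow> j \<in> set js \<Longrightarrow> word js (axis j 1) = U j" for js
  proof (induction js)
    case (Cons k js)
    show ?case
    proof (cases "k = j")
      case True
      thus ?thesis using Cons.prems n Uc by (simp add: word_simps p1)
    next
      case False
      have "axis j (1::int) $ k = 0" using False by (simp add: axis_def)
      thus ?thesis using Cons False Uc by (simp add: word_simps p0)
    qed
  qed simp
  thus ?thesis by (simp add: mon_word)
qed

lemma adj_mon: "adj A (mon n) \<approx> mon (- n)"
proof -
  have "adj A (mon n) \<otimes> (mon n \<otimes> mon (- n)) = mon (- n)"
    using m_assoc[of "adj A (mon n)" "mon n" "mon (- n)"] mon_adj_mult[of n] by simp
  moreover have "mon n \<otimes> mon (- n) \<approx> \<one>" using mon_mult[of n "- n"] by (simp add: mon_0)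
  hence "adj A (mon n) \<otimes> (mon n \<otimes> mon (- n)) \<approx> adj A (mon n) \<otimes> \<one>" by (intro sim_mult_right) auto
  ultimately have "mon (- n) \<approx> adj A (mon n)" by simp
  thus ?thesis by (rule sim_sym[rotated]) auto
qed

lemma tr_mon: "n \<noteq> 0 \<Longrightarrow> \<tau> (mon n) = 0"
  using trace by (simp add: torus_trace_def mon_def)

definition e :: "int^'d::_ \<Rightarrow> 'h" where "e n = \<Lambda> (mon n)"

text \<open>Up to a phase the adjoint of one monomial times another is the monomial of the
  difference of exponents, on which the trace vanishes unless the difference is 0.\<close>

lemma e_ortho: "cinner (e m) (e n) = (if m = n then 1 else 0)"
proof (cases "m = n")
  case True
  thus ?thesis by (simp add: e_def gns_inner mon_adj_mult tr_one)
next
  case False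
  have 1: "adj A (mon m) \<otimes> mon n \<approx> mon (- m) \<otimes> mon n" by (intro sim_mult_left adj_mon) auto
  have "adj A (mon m) \<otimes> mon n \<approx> mon (- m + n)" by (rule sim_trans[OF _ 1 mon_mult]) simp
  moreover have "\<tau> (mon (- m + n)) = 0" using False by (intro tr_mon) simp
  ultimately show ?thesis using False by (auto simp: sim_def e_def gns_inner tr_smult)
qed

lemma gns_sim: "x \<approx> y \<Longrightarrow> y \<in> carrier A \<Longrightarrow> \<exists>c. cmod c = 1 \<and> \<Lambda> x = c *\<^sub>C \<Lambda> y"
  by (auto simp: sim_def gns_smult)

definition window :: "int \<Rightarrow> int^'d::_ \<Rightarrow> 'h set" where
  "window R m = complex_vector.span (e ` {k. \<forall>j. \<bar>k $ j - m $ j\<bar> \<le> R})"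

text \<open>Phrased by membership in a span instead of vanishing coefficients: totality of
  \<open>e\<close> is not yet known and is itself deduced from the density of such elements.\<close>

definition range_le :: "int \<Rightarrow> 'a \<Rightarrow> bool" where
  "range_le R x \<longleftrightarrow> x \<in> carrier A \<and> (\<forall>m. L x (e m) \<in> window R m)"

text \<open>The condition is imposed on the adjoint as well, to obtain a class of elements closed
  under \<open>adj\<close>.\<close>

definition finite_range_elt :: "'a \<Rightarrow> bool" where
  "finite_range_elt x \<longleftrightarrow> (\<exists>R\<ge>0. range_le R x \<and> range_le R (adj A x))"

lemma window_mono: "R \<le> R' \<Longrightarrow> window R m \<subseteq> window R' m"
  unfolding window_def by (intro complex_vector.span_mono image_mono) (auto intro: order_trans)

lemma range_le_mono: "range_le R x \<Longrightarrow> R \<le> R' \<Longrightarrow> range_le R' x"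
  unfolding range_le_def using window_mono by blast

lemma range_le_add: "range_le R x \<Longrightarrow> range_le R y \<Longrightarrow> range_le R (x \<oplus> y)"
  by (auto simp: range_le_def left_mult_add window_def intro: complex_vector.span_add)

lemma range_le_smult: "range_le R x \<Longrightarrow> range_le R (c \<odot> x)"
  by (auto simp: range_le_def left_mult_smult window_def intro: complex_vector.span_scale)

lemma range_le_window:
  assumes x: "range_le R x" and u: "u \<in> window R' m" shows "L x u \<in> window (R + R') m"
proof -
  have xc: "x \<in> carrier A" using x by (simp add: range_le_def)
  note l = complex_linearD[OF left_mult_complex_linear[OF xc]]
  show ?thesis using u unfolding window_def[of R']
  proof (induction rule: complex_vector.span_induct_alt)
    case base
    show ?case by (simp add: l window_def complex_vector.span_zero)
  next
    case (step c v w)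
    then obtain k where k: "\<forall>j. \<bar>k $ j - m $ j\<bar> \<le> R'" "v = e k" by auto
    have "{i. \<forall>j. \<bar>i $ j - k $ j\<bar> \<le> R} \<subseteq> {i. \<forall>j. \<bar>i $ j - m $ j\<bar> \<le> R + R'}"
    proof (rule subsetI)
      fix i assume i: "i \<in> {i. \<forall>j. \<bar>i $ j - k $ j\<bar> \<le> R}"
      have "\<bar>i $ j - m $ j\<bar> \<le> R + R'" for j
      proof -
        have "\<bar>i $ j - k $ j\<bar> \<le> R" "\<bar>k $ j - m $ j\<bar> \<le> R'" using i k by auto
        thus ?thesis by linarith
      qed
      thus "i \<in> {i. \<forall>j. \<bar>i $ j - m $ j\<bar> \<le> R + R'}" by simp
    qed
    hence "window R k \<subseteq> window (R + R') m" unfolding window_def by (intro complex_vector.span_mono image_mono)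
    hence "L x v \<in> window (R + R') m" using x k by (auto simp: range_le_def)
    thus ?case using step by (simp add: l window_def complex_vector.span_add complex_vector.span_scale)
  qed
qed

lemma range_le_mult: "range_le R x \<Longrightarrow> range_le R' y \<Longrightarrow> range_le (R + R') (x \<otimes> y)"
  using range_le_window by (auto simp: range_le_def left_mult_mult)

lemma range_le_mon:
  assumes R: "\<And>j. \<bar>k $ j\<bar> \<le> R" and x: "x \<approx> mon k" shows "range_le R x"
proof -
  obtain c where c: "x = c \<odot> mon k" using x by (auto simp: sim_def)
  have "L (mon k) (e m) \<in> window R m" for m
  proof -
    obtain c where "L (mon k) (e m) = c *\<^sub>C e (k + m)"
      using gns_sim[OF mon_mult[of k m]] by (auto simp: e_def left_mult(2))
    moreover have "e (k + m) \<in> window R m"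
      unfolding window_def using R by (intro complex_vector.span_base imageI) simp
    ultimately show ?thesis unfolding window_def by (simp add: complex_vector.span_scale)
  qed
  hence "range_le R (mon k)" by (simp add: range_le_def)
  thus ?thesis unfolding c by (rule range_le_smult)
qed

lemma finite_range_common:
  assumes "finite_range_elt x" "finite_range_elt y"
  obtains R where "0 \<le> R" "range_le R x" "range_le R (adj A x)" "range_le R y" "range_le R (adj A y)"
proof -
  obtain R R' where "R \<ge> 0" "range_le R x" "range_le R (adj A x)" "range_le R' y" "range_le R' (adj A y)"
    using assms by (auto simp: finite_range_elt_def)
  thus ?thesis using range_le_mono by (intro that[of "max R R'"]) auto
qed

lemma finite_range_closed: "finite_range_elt x \<Longrightarrow> x \<in> carrier A"
  by (auto simp: finite_range_elt_def range_le_def)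

lemma finite_range_add: "finite_range_elt x \<Longrightarrow> finite_range_elt y \<Longrightarrow> finite_range_elt (x \<oplus> y)"
  by (rule finite_range_common[of x y]) (auto simp: finite_range_elt_def adj_add finite_range_closed intro!: range_le_add exI)

lemma finite_range_smult: "finite_range_elt x \<Longrightarrow> finite_range_elt (c \<odot> x)"
proof -
  assume x: "finite_range_elt x"
  then obtain R where "0 \<le> R" "range_le R x" "range_le R (adj A x)" by (auto simp: finite_range_elt_def)
  thus ?thesis using finite_range_closed[OF x] unfolding finite_range_elt_def
    by (intro exI[of _ R]) (simp add: adj_smult range_le_smult)
qed

lemma finite_range_adj: "finite_range_elt x \<Longrightarrow> finite_range_elt (adj A x)"
  using finite_range_closed[of x] by (auto simp: finite_range_elt_def adj_adj)

lemma finite_range_mult: "finite_range_elt x \<Longrightarrow> finite_range_elt y \<Longrightarrow> finite_range_elt (x \<otimes> y)"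
proof -
  assume xy: "finite_range_elt x" "finite_range_elt y"
  then obtain R where R: "0 \<le> R" "range_le R x" "range_le R (adj A x)" "range_le R y" "range_le R (adj A y)"
    by (rule finite_range_common)
  show ?thesis unfolding finite_range_elt_def
    using R(1) range_le_mult[OF R(2,4)] range_le_mult[OF R(5,3)] finite_range_closed[OF xy(1)] finite_range_closed[OF xy(2)]
    by (intro exI[of _ "R + R"]) (simp add: adj_mult)
qed

lemma finite_range_U: "finite_range_elt (U j)"
  unfolding finite_range_elt_def
proof (intro exI[of _ 1] conjI)
  have "range_le 1 (mon (axis j 1))"
    by (rule range_le_mon[OF _ sim_refl]) (simp_all add: axis_def)
  thus "range_le 1 (U j)" by (simp add: mon_axis)
  have "range_le 1 (adj A (mon (axis j 1)))"
    by (rule range_le_mon[OF _ adj_mon]) (simp add: axis_def)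
  thus "range_le 1 (adj A (U j))" by (simp add: mon_axis)
qed simp

text \<open>The norm limits of finite range elements form a closed subalgebra, stable under
  adjoints, that contains all \<open>U j\<close>; by generation it is the whole algebra.\<close>

lemma finite_range_dense:
  assumes x: "x \<in> carrier A" and r: "0 < r"
  shows "\<exists>y. finite_range_elt y \<and> nrm A (x \<ominus> y) < r"
proof -
  define S where "S = {x \<in> carrier A. \<forall>r>0. \<exists>y. finite_range_elt y \<and> nrm A (x \<ominus> y) < r}"
  have sub: "x \<in> S" if "finite_range_elt x" for x
    using that finite_range_closed[OF that] by (auto simp: S_def minus_eq r_neg intro!: exI[of _ x])
  have S_seq: "\<exists>s. (\<forall>n. finite_range_elt (s n)) \<and> converges s x" if x: "x \<in> S" for x
  proof -
    have "\<exists>y. finite_range_elt y \<and> nrm A (x \<ominus> y) < 1 / real (Suc n)" for n using x by (simp add: S_def)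
    then obtain s where s: "\<And>n. finite_range_elt (s n)" "\<And>n. nrm A (x \<ominus> s n) < 1 / real (Suc n)" by metis
    have "converges s x"
    proof (rule convergesI[OF _ _ _ inverse_Suc_tendsto_0])
      show "nrm A (s n \<ominus> x) \<le> 1 / real (Suc n)" for n
        using s(2)[of n] nrm_minus_commute[of x "s n"] finite_range_closed[OF s(1)] x by (simp add: S_def)
    qed (use s finite_range_closed x in \<open>auto simp: S_def\<close>)
    thus ?thesis using s by blast
  qed
  have seq_S: "x \<in> S" if s: "\<And>n. finite_range_elt (s n)" and c: "converges s x" for s x
  proof -
    have cl: "s n \<in> carrier A" "x \<in> carrier A" for n using c by (auto simp: converges_def)
    have "\<exists>y. finite_range_elt y \<and> nrm A (x \<ominus> y) < r" if r: "0 < r" for r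
    proof -
      have "(\<lambda>n. nrm A (s n \<ominus> x)) \<longlonglongrightarrow> 0" using c by (simp add: converges_def)
      hence "\<forall>\<^sub>F n in sequentially. nrm A (s n \<ominus> x) < r" using r by (rule order_tendstoD(2))
      then obtain n where "nrm A (s n \<ominus> x) < r" using eventually_happens'[OF sequentially_bot] by blast
      thus ?thesis using s[of n] nrm_minus_commute[OF cl] by auto
    qed
    thus ?thesis using cl by (simp add: S_def)
  qed
  have "closed_star_subalgebra A S"
    unfolding closed_star_subalgebra_def
  proof (intro conjI ballI allI impI)
    show "S \<subseteq> carrier A" by (auto simp: S_def)
    have "range_le 0 (mon 0)" by (rule range_le_mon[OF _ sim_refl]) simp_all
    hence "finite_range_elt \<one>" unfolding finite_range_elt_def mon_0 by (intro exI[of _ 0]) simp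
    thus "\<one> \<in> S" by (rule sub)
    fix x y assume "x \<in> S" "y \<in> S"
    then obtain s t where s: "\<And>n. finite_range_elt (s n)" "converges s x" "\<And>n. finite_range_elt (t n)" "converges t y"
      using S_seq by meson
    show "x \<oplus> y \<in> S" by (rule seq_S[OF finite_range_add[OF s(1,3)] converges_add[OF s(2,4)]])
    show "x \<otimes> y \<in> S" by (rule seq_S[OF finite_range_mult[OF s(1,3)] converges_mult[OF s(2,4)]])
  next
    fix c x assume "x \<in> S"
    then obtain s where s: "\<And>n. finite_range_elt (s n)" "converges s x" using S_seq by meson
    show "c \<odot> x \<in> S" by (rule seq_S[OF finite_range_smult[OF s(1)] converges_smult[OF s(2)]])
  next
    fix x assume "x \<in> S"
    then obtain s where s: "\<And>n. finite_range_elt (s n)" "converges s x" using S_seq by meson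
    show "adj A x \<in> S" by (rule seq_S[OF finite_range_adj[OF s(1)] converges_adj[OF s(2)]])
  next
    fix s :: "nat \<Rightarrow> 'a" and l assume s: "\<forall>n. s n \<in> S" and l: "l \<in> carrier A" "(\<lambda>n. nrm A (s n \<ominus> l)) \<longlonglongrightarrow> 0"
    have "\<exists>y. finite_range_elt y \<and> nrm A (l \<ominus> y) < r" if r: "0 < r" for r
    proof -
      have "\<forall>\<^sub>F n in sequentially. nrm A (s n \<ominus> l) < r / 2" using r by (intro order_tendstoD(2)[OF l(2)]) simp
      then obtain n where n: "nrm A (s n \<ominus> l) < r / 2" using eventually_happens'[OF sequentially_bot] by blast
      have sn: "s n \<in> carrier A" "s n \<in> S" using s by (auto simp: S_def)
      have "\<forall>r>0. \<exists>y. finite_range_elt y \<and> nrm A (s n \<ominus> y) < r" using sn(2) by (simp add: S_def)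
      then obtain y where y: "finite_range_elt y" "nrm A (s n \<ominus> y) < r / 2" using r half_gt_zero by blast
      have "nrm A (l \<ominus> y) \<le> nrm A (l \<ominus> s n) + nrm A (s n \<ominus> y)"
        using l sn finite_range_closed[OF y(1)] by (intro nrm_triangle) auto
      thus ?thesis using y n nrm_minus_commute[OF l(1) sn(1)] by (intro exI[of _ y]) simp
    qed
    thus "l \<in> S" using l by (simp add: S_def)
  qed
  moreover have "range U \<subseteq> S" using sub finite_range_U by blast
  ultimately have "S = carrier A" using torus by (simp add: nc_torus_def)
  hence "x \<in> S" using x by simp
  thus ?thesis using r unfolding S_def by blast
qed

text \<open>Because \<open>e 0\<close> is the image of the unit, a finite range element
  \<open>y\<close> satisfies \<open>\<Lambda> y = L y (e 0)\<close> and lies in the span of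
  \<open>e\<close>. Density of these elements in norm gives totality.\<close>

sublocale onb e
proof
  show "cinner (e m) (e n) = (if m = n then 1 else 0)" for m n by (rule e_ortho)
  have "\<Lambda> ` carrier A \<subseteq> closure (complex_vector.span (range e))"
  proof
    fix u assume "u \<in> \<Lambda> ` carrier A"
    then obtain x where x: "x \<in> carrier A" "u = \<Lambda> x" by blast
    have "\<exists>v\<in>complex_vector.span (range e). dist v u < r" if r: "0 < r" for r
    proof -
      obtain y where y: "finite_range_elt y" "nrm A (x \<ominus> y) < r" using finite_range_dense[OF x(1) r] by blast
      have yc: "y \<in> carrier A" by (rule finite_range_closed[OF y(1)])
      have "\<Lambda> y = L y (e 0)" using yc by (simp add: e_def mon_0 left_mult(2))
      also have "\<dots> \<in> complex_vector.span (range e)"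
        using y(1) complex_vector.span_mono[of "e ` _" "range e"]
        by (auto simp: finite_range_elt_def range_le_def window_def subset_iff)
      finally have "\<Lambda> y \<in> complex_vector.span (range e)" .
      moreover have "dist (\<Lambda> y) u \<le> nrm A (x \<ominus> y)"
        using norm_gns_le[of "x \<ominus> y"] x yc by (simp add: gns_diff dist_norm norm_minus_commute)
      ultimately show ?thesis using y(2) by (intro bexI[of _ "\<Lambda> y"]) auto
    qed
    thus "u \<in> closure (complex_vector.span (range e))" unfolding closure_approachable by blast
  qed
  hence "closure (\<Lambda> ` carrier A) \<subseteq> closure (complex_vector.span (range e))"
    by (rule closure_minimal) simp
  thus "closure (complex_vector.span (range e)) = UNIV" using gns_dense by auto
qed

end

section \<open>Transfer of the abstract bounds to the torus\<close>

lemma powr_half_card: "0 \<le> s \<Longrightarrow> 0 < n \<Longrightarrow> s powr (real n / 2) = sqrt s ^ n"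
proof (cases "s = 0")
  case False
  assume "0 \<le> s"
  hence s: "0 < s" using False by simp
  have "s powr (real n / 2) = (s powr (1 / 2)) powr real n" by (simp add: powr_powr)
  thus ?thesis using s by (simp add: powr_half_sqrt powr_realpow)
qed simp

lemma tendsto_ennrealI:
  assumes "\<And>\<eta>. 0 < \<eta> \<Longrightarrow> \<forall>\<^sub>F h in F. ennreal (c - \<eta>) \<le> f h"
    and "\<And>\<eta>. 0 < \<eta> \<Longrightarrow> \<forall>\<^sub>F h in F. f h \<le> ennreal (c + \<eta>)"
  shows "(f \<longlongrightarrow> ennreal c) F"
proof (rule order_tendstoI)
  have lim: "((\<lambda>\<eta>. ennreal (c + b * \<eta>)) \<longlongrightarrow> ennreal (c + b * 0)) (at_right 0)" for b
    by (intro tendsto_intros)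
  fix a
  show "\<forall>\<^sub>F h in F. a < f h" if "a < ennreal c"
  proof -
    have "\<forall>\<^sub>F \<eta> in at_right 0. a < ennreal (c + (-1) * \<eta>)"
      using lim[of "-1"] that by (intro order_tendstoD(1)) auto
    moreover have "\<forall>\<^sub>F \<eta> :: real in at_right 0. 0 < \<eta>" by (simp add: eventually_at_right_less)
    ultimately have "\<forall>\<^sub>F \<eta> in at_right 0. a < ennreal (c + (-1) * \<eta>) \<and> 0 < \<eta>" by eventually_elim simp
    then obtain \<eta> where "a < ennreal (c - \<eta>)" "0 < \<eta>"
      using eventually_happens'[OF trivial_limit_at_right_real] by fastforce
    thus ?thesis using assms(1)[of \<eta>] by (auto elim!: eventually_mono)
  qed
  show "\<forall>\<^sub>F h in F. f h < a" if "ennreal c < a"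
  proof -
    have "\<forall>\<^sub>F \<eta> in at_right 0. ennreal (c + 1 * \<eta>) < a"
      using lim[of 1] that by (intro order_tendstoD(2)) auto
    moreover have "\<forall>\<^sub>F \<eta> :: real in at_right 0. 0 < \<eta>" by (simp add: eventually_at_right_less)
    ultimately have "\<forall>\<^sub>F \<eta> in at_right 0. ennreal (c + 1 * \<eta>) < a \<and> 0 < \<eta>" by eventually_elim simp
    then obtain \<eta> where "ennreal (c + \<eta>) < a" "0 < \<eta>"
      using eventually_happens'[OF trivial_limit_at_right_real] by fastforce
    thus ?thesis using assms(2)[of \<eta>] by (auto elim!: eventually_mono)
  qed
qed

context torus_rep
begin

text \<open>Existence in the definite description comes from \<open>self_adjoint_mgraph\<close>,
  uniqueness from \<open>self_adjoint_eq_mgraph\<close>.\<close>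

lemma laplacian_eq: "torus_laplacian A U \<Lambda> = mgraph (\<lambda>n. - (norm (real_vec n))\<^sup>2)"
proof -
  have eq: "complex_of_int (- (\<Sum>j\<in>UNIV. (n $ j)\<^sup>2)) = complex_of_real (- (norm (real_vec n))\<^sup>2)" for n :: "int^'d::_"
    unfolding norm_real_vec by simp
  show ?thesis
    unfolding torus_laplacian_def eq mon_def[symmetric] e_def[symmetric]
  proof (rule the_equality)
    let ?w = "\<lambda>n. - (norm (real_vec n))\<^sup>2"
    show "self_adjoint (mgraph ?w) \<and> (\<forall>n. (e n, complex_of_real (?w n) *\<^sub>C e n) \<in> mgraph ?w)"
      using self_adjoint_mgraph mgraph_basis[of _ ?w] by blast
    show "D = mgraph ?w" if "self_adjoint D \<and> (\<forall>n. (e n, complex_of_real (?w n) *\<^sub>C e n) \<in> D)" for D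
      using that self_adjoint_eq_mgraph[of D ?w] by blast
  qed
qed

lemma schroedinger_eq: "0 < h \<Longrightarrow> schroedinger A U \<Lambda> h V = pgraph (kinetic h) (L V)"
proof -
  assume h: "0 < h"
  have 1: "(x, y) \<in> mgraph (\<lambda>n. - (norm (real_vec n))\<^sup>2) \<Longrightarrow> (x, complex_of_real (- (h\<^sup>2)) *\<^sub>C y) \<in> mgraph (kinetic h)" for x y
    by (simp add: mgraph_def cinner_scaleC_right cinner_minus_right kinetic_def power_mult_distrib)
  have 2: "(x, y) \<in> mgraph (kinetic h) \<Longrightarrow> (x, complex_of_real (- (1 / h\<^sup>2)) *\<^sub>C y) \<in> mgraph (\<lambda>n. - (norm (real_vec n))\<^sup>2)" for x y
    using h by (simp add: mgraph_def cinner_scaleC_right cinner_minus_right kinetic_def power_mult_distrib)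
  have 3: "complex_of_real (- (h\<^sup>2)) *\<^sub>C complex_of_real (- (1 / h\<^sup>2)) *\<^sub>C y = y" for y :: 'h
    using h by (simp add: scaleC_scaleC)
  show ?thesis
  proof (rule subset_antisym; rule subsetI)
    fix p assume "p \<in> schroedinger A U \<Lambda> h V"
    then obtain x y where "p = (x, complex_of_real (- (h\<^sup>2)) *\<^sub>C y + L V x)" "(x, y) \<in> mgraph (\<lambda>n. - (norm (real_vec n))\<^sup>2)"
      unfolding schroedinger_def laplacian_eq by blast
    thus "p \<in> pgraph (kinetic h) (L V)" using 1 unfolding pgraph_def by blast
  next
    fix p assume "p \<in> pgraph (kinetic h) (L V)"
    then obtain x y where "p = (x, y + L V x)" "(x, y) \<in> mgraph (kinetic h)" unfolding pgraph_def by blast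
    hence "p = (x, complex_of_real (- (h\<^sup>2)) *\<^sub>C (complex_of_real (- (1 / h\<^sup>2)) *\<^sub>C y) + L V x)"
      "(x, complex_of_real (- (1 / h\<^sup>2)) *\<^sub>C y) \<in> mgraph (\<lambda>n. - (norm (real_vec n))\<^sup>2)"
      using 2 3 by simp_all
    thus "p \<in> schroedinger A U \<Lambda> h V" unfolding schroedinger_def laplacian_eq by blast
  qed
qed

text \<open>The phases of right multiplication by \<open>mon k\<close>, which play the role of
  \<open>u\<close> in \<open>finite_range\<close>. Their values are left unspecified.\<close>

definition mult_phase :: "int^'d::_ \<Rightarrow> int^'d::_ \<Rightarrow> complex" where
  "mult_phase k n = (SOME c. cmod c = 1 \<and> mon n \<otimes> mon k = c \<odot> mon (n + k))"

lemma mult_phase: "cmod (mult_phase k n) = 1" "mon n \<otimes> mon k = mult_phase k n \<odot> mon (n + k)"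
proof -
  have "\<exists>c. cmod c = 1 \<and> mon n \<otimes> mon k = c \<odot> mon (n + k)" using mon_mult[of n k] by (simp add: sim_def)
  from someI_ex[OF this] show "cmod (mult_phase k n) = 1" "mon n \<otimes> mon k = mult_phase k n \<odot> mon (n + k)"
    unfolding mult_phase_def by auto
qed

lemma cinner_e_left_mult:
  "x \<in> carrier A \<Longrightarrow> z \<in> carrier A \<Longrightarrow> w \<in> carrier A \<Longrightarrow> cinner (\<Lambda> w) (L x (\<Lambda> z)) = \<tau> (adj A w \<otimes> (x \<otimes> z))"
  by (simp add: left_mult(2) gns_inner)

lemma finite_rangeI:
  assumes y: "y \<in> carrier A" "adj A y = y" "nrm A y \<le> M" and R: "0 \<le> R" "range_le R y"
  shows "finite_range e (L y) M R mult_phase"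
proof
  show "hermitian_bounded M (L y)" by (rule left_mult_hermitian[OF y])
  show "0 \<le> R" by (rule R(1))
  show "cmod (mult_phase k n) = 1" for k n by (rule mult_phase(1))
  show "cinner (e n) (L y (e m)) = 0" if "R < \<bar>n $ j - m $ j\<bar>" for n j m
  proof -
    have "L y (e m) \<in> complex_vector.span (e ` {k. \<forall>j. \<bar>k $ j - m $ j\<bar> \<le> R})"
      using R(2) by (simp add: range_le_def window_def)
    thus ?thesis
    proof (induction rule: complex_vector.span_induct_alt)
      case (step c v w)
      then obtain k where k: "\<forall>j. \<bar>k $ j - m $ j\<bar> \<le> R" "v = e k" by auto
      have "\<bar>k $ j - m $ j\<bar> \<le> R" using k(1) by blast
      hence "n \<noteq> k" using that by auto
      thus ?case using step k by (simp add: cinner_add_right cinner_scaleC_right ortho)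
    qed simp
  qed
  have f: "mult_phase k n *\<^sub>C e (n + k) = \<Lambda> (mon n \<otimes> mon k)" for k n
    by (simp add: mult_phase(2) gns_smult e_def)
  show "cinner (mult_phase k n *\<^sub>C e (n + k)) (L y (mult_phase k m *\<^sub>C e (m + k))) = cinner (e n) (L y (e m))" for k n m
  proof -
    \<comment> \<open>Right multiplication by \<open>mon k\<close> preserves these matrix elements
      because the trace moves \<open>mon k\<close> cyclically next to its adjoint, where the two
      cancel.\<close>
    have "cinner (\<Lambda> (mon n \<otimes> mon k)) (L y (\<Lambda> (mon m \<otimes> mon k)))
        = \<tau> (adj A (mon k) \<otimes> ((adj A (mon n) \<otimes> (y \<otimes> mon m)) \<otimes> mon k))"
      using y by (simp add: cinner_e_left_mult adj_mult m_assoc)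
    also have "\<dots> = \<tau> (((adj A (mon n) \<otimes> (y \<otimes> mon m)) \<otimes> mon k) \<otimes> adj A (mon k))"
      using y by (intro tr_commute) auto
    also have "\<dots> = \<tau> (adj A (mon n) \<otimes> (y \<otimes> mon m))"
      using y by (simp add: m_assoc mon_adj_mult)
    also have "\<dots> = cinner (\<Lambda> (mon n)) (L y (\<Lambda> (mon m)))"
      using y by (simp add: cinner_e_left_mult)
    finally show ?thesis unfolding f by (simp only: e_def)
  qed
qed

text \<open>By traciality the diagonal of the matrix of \<open>L y ^^ q\<close> is constant, which
  supplies the number \<open>t q\<close> in the abstract bounds.\<close>

lemma moment_eq:
  assumes y: "y \<in> carrier A" shows "Re (cinner (e n) ((L y ^^ q) (e n))) = Re (\<tau> (y [^] q))"
proof -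
  have "cinner (e n) ((L y ^^ q) (e n)) = \<tau> (adj A (mon n) \<otimes> (y [^] q \<otimes> mon n))"
    using y by (simp add: e_def left_mult_funpow gns_inner)
  also have "\<dots> = \<tau> ((y [^] q \<otimes> mon n) \<otimes> adj A (mon n))" using y by (intro tr_commute) auto
  also have "\<dots> = \<tau> (y [^] q)" using y by (simp add: m_assoc mon_adj_mult)
  finally show ?thesis by simp
qed

lemma hermitian_finite_range_dense:
  assumes x: "x \<in> carrier A" "adj A x = x" and r: "0 < r"
  shows "\<exists>y R. y \<in> carrier A \<and> adj A y = y \<and> nrm A (x \<ominus> y) < r \<and> 0 \<le> R \<and> range_le R y"
proof -
  obtain y where y: "finite_range_elt y" "nrm A (x \<ominus> y) < r" using finite_range_dense[OF x(1) r] by blast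
  have yc: "y \<in> carrier A" by (rule finite_range_closed[OF y(1)])
  obtain R where R: "0 \<le> R" "range_le R y" "range_le R (adj A y)" using y(1) by (auto simp: finite_range_elt_def)
  \<comment> \<open>Symmetrisation does not increase the distance to the self-adjoint
    \<open>x\<close>, as \<open>x - z\<close> is the mean of \<open>x - y\<close> and its
    adjoint.\<close>
  define z where "z = (1 / 2) \<odot> (y \<oplus> adj A y)"
  have z: "z \<in> carrier A" "adj A z = z"
    using yc by (simp_all add: z_def adj_smult adj_add adj_adj a_comm)
  have x2: "x = (1 / 2) \<odot> (x \<oplus> x)"
    using x smult_add_left[of x "1/2" "1/2"] by (simp add: smult_add_right)
  have "x \<ominus> z = (1 / 2) \<odot> ((x \<oplus> x) \<ominus> (y \<oplus> adj A y))"
    using x yc x2 by (simp add: z_def smult_diff)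
  also have "(x \<oplus> x) \<ominus> (y \<oplus> adj A y) = (x \<ominus> y) \<oplus> adj A (x \<ominus> y)"
    using x yc by (simp add: adj_diff) (simp add: minus_eq minus_add a_ac)
  finally have "nrm A (x \<ominus> z) \<le> (1 / 2) * (nrm A (x \<ominus> y) + nrm A (adj A (x \<ominus> y)))"
    using nrm_add[of "x \<ominus> y" "adj A (x \<ominus> y)"] x yc by (simp add: nrm_smult)
  hence "nrm A (x \<ominus> z) < r" using y(2) x yc by simp
  moreover have "range_le R z" unfolding z_def by (intro range_le_smult range_le_add R)
  ultimately show ?thesis using z R(1) by blast
qed

lemma left_mult_form_close:
  assumes "x \<in> carrier A" "y \<in> carrier A"
  shows "\<bar>Re (cinner u (L x u)) - Re (cinner u (L y u))\<bar> \<le> nrm A (x \<ominus> y) * (norm u)\<^sup>2"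
proof -
  have "L x u = L (x \<ominus> y) u + L y u"
    using assms left_mult_add[of "x \<ominus> y" y u] by (simp add: minus_add_cancel)
  hence "Re (cinner u (L x u)) - Re (cinner u (L y u)) = Re (cinner u (L (x \<ominus> y) u))"
    by (simp add: cinner_add_right)
  also have "\<bar>\<dots>\<bar> \<le> norm u * norm (L (x \<ominus> y) u)"
    using abs_Re_le_cmod cinner_Cauchy_Schwarz order_trans by blast
  also have "\<dots> \<le> norm u * (nrm A (x \<ominus> y) * norm u)"
    by (intro mult_left_mono left_mult(3)) (use assms in auto)
  finally show ?thesis by (simp add: power2_eq_square mult_ac)
qed

lemma counting_bounds:
  fixes l :: real
  assumes V: "V \<in> carrier A" "adj A V = V" and \<eta>: "0 < \<eta>"
  defines "X \<equiv> Re (\<tau> (power_elt A (neg_part A (V \<ominus> complex_of_real l \<odot> \<one>)) (CARD('d) / 2)))"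
  shows "\<forall>\<^sub>F h in at_right 0. ennreal (unit_ball_vol CARD('d) * X - \<eta>)
      \<le> ennreal (h ^ CARD('d)) * counting_function l (schroedinger A U \<Lambda> h V)"
    and "\<forall>\<^sub>F h in at_right 0. ennreal (h ^ CARD('d)) * counting_function l (schroedinger A U \<Lambda> h V)
      \<le> ennreal (unit_ball_vol CARD('d) * X + \<eta>)"
proof -
  define \<omega> where "\<omega> = unit_ball_vol (real CARD('d))"
  have \<omega>: "0 \<le> \<omega>" by (simp add: \<omega>_def)
  \<comment> \<open>The total error is \<open>4 * \<delta>\<close> times the ball volume, at most
    half of \<open>\<eta>\<close>: two units of \<open>\<delta>\<close> from comparing
    \<open>p y\<close> with the target through \<open>p V\<close>, and two from domination by
    \<open>p\<close> with the shift of \<open>l\<close>. The other half goes to the abstract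
    bounds.\<close>
  define \<delta> where "\<delta> = \<eta> / (8 * (\<omega> + 1))"
  have \<delta>: "0 < \<delta>" "8 * (\<omega> + 1) * \<delta> = \<eta>" using \<eta> \<omega> by (simp_all add: \<delta>_def)
  \<comment> \<open>\<open>M\<close> bounds the norm of every \<open>y\<close> within distance 1 of
    \<open>V\<close>. The summand \<open>2 * \<bar>l\<bar>\<close> leaves room for
    \<open>l + t\<close> with \<open>t\<close> in the interval bounding the spectrum of
    \<open>V - l\<close>.\<close>
  define M where "M = nrm A V + 1 + 2 * \<bar>l\<bar>"
  define b where "b t = sqrt (max 0 t) ^ CARD('d)" for t
  have M: "nrm A V + 1 \<le> M" by (simp add: M_def)
  have cb: "continuous_on T b" for T unfolding b_def[abs_def] by (intro continuous_intros)
  obtain p :: "real poly" where p: "\<And>v. v \<in> {-M..M} \<Longrightarrow> \<bar>poly p v - b (l - v)\<bar> < \<delta>"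
  proof -
    have "continuous_on {-M..M} (\<lambda>v. b (l - v))"
      by (rule continuous_on_compose2[OF cb[of UNIV]]) (auto intro!: continuous_intros)
    from weierstrass_poly[OF _ this \<delta>(1)] obtain q :: "real poly"
      where "\<forall>v\<in>{-M..M}. \<bar>poly q v - b (l - v)\<bar> < \<delta>" by auto
    thus ?thesis using that[of q] by blast
  qed
  \<comment> \<open>The target is built from \<open>V - l\<close>, while \<open>p\<close>
    approximates a function of \<open>v\<close>. The substitution \<open>v = l + t\<close> turns the
    power of the negative part of \<open>t\<close> into \<open>b (l - v)\<close>.\<close>
  have pV: "\<bar>Re (\<tau> (poly_elt A p V)) - X\<bar> \<le> \<delta>"
  proof -
    define x where "x = V \<ominus> complex_of_real l \<odot> \<one>"
    define M' where "M' = nrm A V + \<bar>l\<bar>"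
    have x: "x \<in> carrier A" "adj A x = x" using V by (simp_all add: x_def adj_diff adj_smult)
    have xM: "nrm A x \<le> M'"
      using nrm_diff[of V "complex_of_real l \<odot> \<one>"] V by (simp add: x_def M'_def nrm_smult)
    have "\<bar>poly (pcompose p [:l, 1:]) t - max 0 (- t) powr (real CARD('d) / 2)\<bar> \<le> \<delta>" if t: "t \<in> {-M'..M'}" for t
    proof -
      have "max 0 (- t) powr (real CARD('d) / 2) = b (l - (l + t))"
        by (simp add: powr_half_card b_def)
      moreover have "l + t \<in> {-M..M}" using t by (auto simp: M_def M'_def)
      ultimately show ?thesis using p[of "l + t"] by (simp add: poly_pcompose)
    qed
    note z = power_neg_part_approx[OF x xM _ this]
    have "poly_elt A [:l, 1:] x = V"
      using V by (simp add: poly_elt_pCons x x_def) (simp add: minus_eq a_ac r_neg r_neg1 r_neg2 cancel_simps)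
    hence "poly_elt A (pcompose p [:l, 1:]) x = poly_elt A p V" using x by (simp add: poly_elt_pcompose)
    hence zz: "power_elt A (neg_part A x) (CARD('d) / 2) \<in> carrier A"
      "nrm A (poly_elt A p V \<ominus> power_elt A (neg_part A x) (CARD('d) / 2)) \<le> \<delta>" using z by simp_all
    have "Re (\<tau> (poly_elt A p V)) - X = Re (\<tau> (poly_elt A p V \<ominus> power_elt A (neg_part A x) (CARD('d) / 2)))"
      using zz V by (simp add: tr_diff X_def x_def)
    also have "\<bar>\<dots>\<bar> \<le> nrm A (poly_elt A p V \<ominus> power_elt A (neg_part A x) (CARD('d) / 2))"
      using zz V by (intro order_trans[OF abs_Re_le_cmod tr_bound]) auto
    finally show ?thesis using zz(2) by simp
  qed
  \<comment> \<open>Replacing \<open>V\<close> by \<open>y\<close> amounts to shifting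
    \<open>l\<close> by at most \<open>\<epsilon>\<close>, and uniform continuity of
    \<open>b\<close> limits the effect to \<open>\<delta>\<close>. The bound
    \<open>\<epsilon> \<le> 1\<close> keeps the norm of \<open>y\<close> below
    \<open>M\<close>.\<close>
  obtain \<epsilon> where \<epsilon>: "0 < \<epsilon>" "\<epsilon> \<le> 1"
    "\<And>s s'. \<bar>s\<bar> \<le> M + \<bar>l\<bar> + 1 \<Longrightarrow> \<bar>s'\<bar> \<le> M + \<bar>l\<bar> + 1 \<Longrightarrow> \<bar>s' - s\<bar> \<le> \<epsilon> \<Longrightarrow> \<bar>b s' - b s\<bar> \<le> \<delta>"
  proof -
    have "uniformly_continuous_on {-(M + \<bar>l\<bar> + 1)..M + \<bar>l\<bar> + 1} b"
      by (intro compact_uniformly_continuous cb) simp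
    then obtain d where d: "0 < d" "\<And>s s'. s \<in> {-(M + \<bar>l\<bar> + 1)..M + \<bar>l\<bar> + 1} \<Longrightarrow> s' \<in> {-(M + \<bar>l\<bar> + 1)..M + \<bar>l\<bar> + 1} \<Longrightarrow>
        dist s' s < d \<Longrightarrow> dist (b s') (b s) < \<delta>"
      using \<delta>(1) unfolding uniformly_continuous_on_def by metis
    show ?thesis
    proof (rule that[of "min 1 (d / 2)"])
      fix s s' assume a: "\<bar>s\<bar> \<le> M + \<bar>l\<bar> + 1" "\<bar>s'\<bar> \<le> M + \<bar>l\<bar> + 1" "\<bar>s' - s\<bar> \<le> min 1 (d / 2)"
      have "dist (b s') (b s) < \<delta>"
        by (rule d(2)) (use a d(1) in \<open>auto simp: dist_real_def abs_le_iff\<close>)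
      thus "\<bar>b s' - b s\<bar> \<le> \<delta>" by (simp add: dist_real_def)
    qed (use d(1) in auto)
  qed
  \<comment> \<open>A whole sequence converging to \<open>V\<close> is taken because
    \<open>y\<close> must be close to \<open>V\<close> within \<open>\<epsilon>\<close> and at the
    same time make \<open>p y\<close> close to \<open>p V\<close> for the polynomial already
    fixed.\<close>
  have "\<exists>y R. y \<in> carrier A \<and> adj A y = y \<and> nrm A (V \<ominus> y) < \<epsilon> / real (Suc k) \<and> 0 \<le> R \<and> range_le R y" for k
    using hermitian_finite_range_dense[OF V, of "\<epsilon> / real (Suc k)"] \<epsilon> by simp
  then obtain ys Rs where ys: "\<And>k. ys k \<in> carrier A" "\<And>k. adj A (ys k) = ys k"
    "\<And>k. nrm A (V \<ominus> ys k) < \<epsilon> / real (Suc k)" "\<And>k. 0 \<le> Rs k" "\<And>k. range_le (Rs k) (ys k)" by metis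
  have lim0: "(\<lambda>n. \<epsilon> / real (Suc n)) \<longlonglongrightarrow> 0"
    using tendsto_mult[OF tendsto_const[of \<epsilon>] LIMSEQ_inverse_real_of_nat] by (simp add: divide_inverse)
  have "converges ys V"
  proof (rule convergesI[OF ys(1) V(1) _ lim0])
    show "nrm A (ys k \<ominus> V) \<le> \<epsilon> / real (Suc k)" for k
      using ys(3)[of k] nrm_minus_commute[OF V(1) ys(1)] by (simp add: less_imp_le)
  qed
  hence cp: "converges (\<lambda>k. poly_elt A p (ys k)) (poly_elt A p V)" by (rule converges_poly_elt)
  have "(\<lambda>k. nrm A (poly_elt A p (ys k) \<ominus> poly_elt A p V)) \<longlonglongrightarrow> 0" using cp by (simp add: converges_def)
  hence "\<forall>\<^sub>F k in sequentially. nrm A (poly_elt A p (ys k) \<ominus> poly_elt A p V) < \<delta>" using \<delta>(1) by (rule order_tendstoD(2))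
  then obtain k where k: "nrm A (poly_elt A p (ys k) \<ominus> poly_elt A p V) < \<delta>"
    using eventually_happens'[OF sequentially_bot] by blast
  define y where "y = ys k"
  define R where "R = Rs k"
  have y: "y \<in> carrier A" "adj A y = y" "0 \<le> R" "range_le R y" using ys by (simp_all add: y_def R_def)
  have Vy: "nrm A (V \<ominus> y) \<le> \<epsilon>"
  proof -
    have "\<epsilon> / real (Suc k) \<le> \<epsilon> / 1" using \<epsilon>(1) by (intro divide_left_mono) auto
    thus ?thesis using ys(3)[of k] by (simp add: y_def)
  qed
  have yM: "nrm A y \<le> M"
  proof -
    have "nrm A y \<le> nrm A (y \<ominus> V) + nrm A V"
      using nrm_add[of "y \<ominus> V" V] y V by (simp add: minus_add_cancel)
    thus ?thesis using Vy nrm_minus_commute[OF V(1) y(1)] \<epsilon>(2) M by simp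
  qed
  have py: "\<bar>Re (\<tau> (poly_elt A p y)) - X\<bar> \<le> 2 * \<delta>"
  proof -
    have "Re (\<tau> (poly_elt A p y)) - Re (\<tau> (poly_elt A p V)) = Re (\<tau> (poly_elt A p y \<ominus> poly_elt A p V))"
      using y V by (simp add: tr_diff)
    also have "\<bar>\<dots>\<bar> \<le> nrm A (poly_elt A p y \<ominus> poly_elt A p V)"
      using y V by (intro order_trans[OF abs_Re_le_cmod tr_bound]) auto
    finally show ?thesis using k pV by (simp add: y_def)
  qed
  interpret F: finite_range e "L y" M R mult_phase by (rule finite_rangeI[OF y(1,2) yM y(3,4)])
  define t where "t q = Re (\<tau> (y [^] q))" for q :: nat
  have t: "Re (cinner (e n) ((L y ^^ q) (e n))) = t q" for n q
    by (simp add: t_def moment_eq[OF y(1)])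
  have P: "(\<Sum>q\<le>degree p. coeff p q * t q) = Re (\<tau> (poly_elt A p y))"
    by (simp add: t_def tr_poly_elt[OF y(1)])
  have hV: "hermitian_bounded (nrm A V) (L V)" by (rule left_mult_hermitian[OF V order_refl])
  have close: "\<bar>Re (cinner u (L V u)) - Re (cinner u (L y u))\<bar> \<le> \<epsilon> * (norm u)\<^sup>2" for u
    using order_trans[OF left_mult_form_close[OF V(1) y(1)] mult_right_mono[OF Vy]] by simp
  have b1: "\<bar>b (l + c - v) - b (l - v)\<bar> \<le> \<delta>" if "\<bar>c\<bar> \<le> \<epsilon>" "\<bar>v\<bar> \<le> M" for c v
    by (rule \<epsilon>(3)) (use that \<epsilon>(2) in auto)
  have sch: "\<forall>\<^sub>F h in at_right 0. schroedinger A U \<Lambda> h V = pgraph (kinetic h) (L V)"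
    using eventually_at_right_less[of "0::real"] by eventually_elim (rule schroedinger_eq)
  have "\<omega> * (Re (\<tau> (poly_elt A p y)) - 2 * \<delta>) - \<eta> / 2 \<ge> \<omega> * X - \<eta>"
    and "\<omega> * (Re (\<tau> (poly_elt A p y)) + 2 * \<delta>) + \<eta> / 2 \<le> \<omega> * X + \<eta>"
  proof -
    have "\<omega> * (X - 4 * \<delta>) \<le> \<omega> * (Re (\<tau> (poly_elt A p y)) - 2 * \<delta>)"
      "\<omega> * (Re (\<tau> (poly_elt A p y)) + 2 * \<delta>) \<le> \<omega> * (X + 4 * \<delta>)"
      using py \<omega> by (auto intro!: mult_left_mono simp: abs_le_iff)
    moreover have "\<omega> * (4 * \<delta>) \<le> \<eta> / 2" using \<delta> \<omega> by (simp add: algebra_simps)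
    ultimately show "\<omega> * (Re (\<tau> (poly_elt A p y)) - 2 * \<delta>) - \<eta> / 2 \<ge> \<omega> * X - \<eta>"
      "\<omega> * (Re (\<tau> (poly_elt A p y)) + 2 * \<delta>) + \<eta> / 2 \<le> \<omega> * X + \<eta>"
      by (simp_all add: algebra_simps)
  qed
  note fin = this
  have "\<forall>\<^sub>F h in at_right 0. ennreal (\<omega> * (Re (\<tau> (poly_elt A p y)) - 2 * \<delta>) - \<eta> / 2)
      \<le> ennreal (h ^ CARD('d)) * counting_function l (pgraph (kinetic h) (L V))"
    unfolding \<omega>_def P[symmetric]
  proof (rule F.counting_lower[OF t _ _ hV])
    show "Re (cinner u (L V u)) \<le> Re (cinner u (L y u)) + \<epsilon> * (norm u)\<^sup>2" for u
      using close[of u] by linarith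
    fix v assume v: "\<bar>v\<bar> \<le> M"
    have "\<bar>b (l + - \<epsilon> - v) - b (l - v)\<bar> \<le> \<delta>" by (rule b1) (use v \<epsilon>(1) in auto)
    moreover have "\<bar>poly p v - b (l - v)\<bar> < \<delta>" by (rule p) (use v in \<open>auto simp: abs_le_iff\<close>)
    ultimately have "poly p v - 2 * \<delta> \<le> b (l - \<epsilon> - v)" by simp
    thus "poly p v - 2 * \<delta> \<le> sqrt (max 0 (l - \<epsilon> - v)) ^ CARD('d)" by (simp add: b_def)
  qed (use \<eta> \<delta> in auto)
  with sch show "\<forall>\<^sub>F h in at_right 0. ennreal (unit_ball_vol CARD('d) * X - \<eta>)
      \<le> ennreal (h ^ CARD('d)) * counting_function l (schroedinger A U \<Lambda> h V)"
    unfolding \<omega>_def[symmetric]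
  proof eventually_elim
    case (elim h)
    show ?case using order_trans[OF ennreal_leI[OF fin(1)] elim(2)] elim(1) by simp
  qed
  have "\<forall>\<^sub>F h in at_right 0. ennreal (h ^ CARD('d)) * counting_function l (pgraph (kinetic h) (L V))
      \<le> ennreal (\<omega> * (Re (\<tau> (poly_elt A p y)) + 2 * \<delta>) + \<eta> / 2)"
    unfolding \<omega>_def P[symmetric]
  proof (rule F.counting_upper[OF t _ _ hV])
    show "Re (cinner u (L y u)) - \<epsilon> * (norm u)\<^sup>2 \<le> Re (cinner u (L V u))" for u
      using close[of u] by linarith
    fix v assume v: "\<bar>v\<bar> \<le> M"
    have "\<bar>b (l + \<epsilon> - v) - b (l - v)\<bar> \<le> \<delta>" by (rule b1) (use v \<epsilon>(1) in auto)
    moreover have "\<bar>poly p v - b (l - v)\<bar> < \<delta>" by (rule p) (use v in \<open>auto simp: abs_le_iff\<close>)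
    ultimately have "b (l + \<epsilon> - v) \<le> poly p v + 2 * \<delta>" by linarith
    thus "sqrt (max 0 (l + \<epsilon> - v)) ^ CARD('d) \<le> poly p v + 2 * \<delta>" by (simp add: b_def)
  qed (use \<eta> \<delta> in auto)
  with sch show "\<forall>\<^sub>F h in at_right 0. ennreal (h ^ CARD('d)) * counting_function l (schroedinger A U \<Lambda> h V)
      \<le> ennreal (unit_ball_vol CARD('d) * X + \<eta>)"
    unfolding \<omega>_def[symmetric]
  proof eventually_elim
    case (elim h)
    show ?case using order_trans[OF elim(2) ennreal_leI[OF fin(2)]] elim(1) by simp
  qed
qed

end

theorem corollary5p9:
  fixes \<theta> :: "real^'d::_^'d::{finite,linorder}"
    and A :: "'a cstar" and U :: "'d \<Rightarrow> 'a"
    and \<tau> :: "'a \<Rightarrow> complex"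
    and \<Lambda> :: "'a \<Rightarrow> 'h::complex_hilbert_space"
    and V :: 'a and l :: real
  assumes "CARD('d) > 2"
    and "transpose \<theta> = - \<theta>"
    and "nc_torus \<theta> A U"
    and "torus_trace A U \<tau>"
    and "gns_space A \<tau> \<Lambda>"
    and "V \<in> carrier A" and "adj A V = V"
  shows "((\<lambda>h. ennreal (h ^ CARD('d)) * counting_function l (schroedinger A U \<Lambda> h V))
      \<longlongrightarrow> ennreal (surface_area (sphere (0 :: real^'d::_) 1) / CARD('d) *
            Re (\<tau> (power_elt A (neg_part A (V \<ominus>\<^bsub>A\<^esub> complex_of_real l \<odot>\<^bsub>A\<^esub> \<one>\<^bsub>A\<^esub>)) (CARD('d) / 2)))))
      (at_right 0)"
proof -
  interpret cstar_algebra A using assms(3) by (simp add: nc_torus_def)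
  interpret torus_rep A \<tau> \<Lambda> \<theta> U
    by unfold_locales (use assms in \<open>simp_all add: torus_trace_def\<close>)
  have "surface_area (sphere (0 :: real^'d::_) 1) / CARD('d) = unit_ball_vol CARD('d)"
    using surface_area_sphere[where 'e = "real^'d::_"] assms(1) by simp
  thus ?thesis
    using counting_bounds[OF assms(6,7)] by (simp only:) (intro tendsto_ennrealI)
qed

end
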